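(* Let $n\ge 1$, $d\ge 1$, $r\ge 0$ be integers and let $\mathcal{W}$ be a $d$-web of degree $r$ on $\mathbb{P}^2$. If the number of algebraic curves of degree at most $n$ invariant by $\mathcal{W}$ is finite, then the $n$-th extactic divisor $\mathcal{E}_n(\mathcal{W})$ of $\mathcal{W}$ has degree $$ \frac{n}{8}\cdot \left[ (n+1)(n+2)\bigl(4d + (n+3)(r-d)\bigr) + (n+3)(n^2 + 3n-2)(d-1)(d+2r) \right]. $$
   Context: We work over $\mathbb{C}$. A $d$-web $\mathcal{W}=[v]$ on a complex surface $X$ is given by (the class up to scalar of) a section $v\in H^0(X,\mathrm{Sym}^d TX\otimes\mathcal{M})$, with $\mathrm{Sym}^d$ denoting the $d$-th symmetric power and $\mathcal{M}$ a line bundle, having isolated zeros and discriminant not identically zero. The discriminant $\Delta(v)$ is the discriminant of $v$ seen pointwise as a binary form of degree $d$; it is a section of $\det(TX)^{\otimes d(d-1)}\otimes\mathcal{M}^{\otimes 2(d-1)}$. Outside $\{\Delta(v)=0\}$, $v$ is locally a product $v=v_1\cdots v_d$ of $d$ pairwise non-proportional vector fields. A curve $C$ is invariant by $\mathcal{W}$ if at a general point of each irreducible component of $C$ its tangent line is one of the directions of $\mathcal W$ there, i.e. one of the directions given by the linear factors of $v$. A $d$-web on $\mathbb{P}^2$ has degree $r$ if it is defined by a section $v$ of $\mathrm{Sym}^d T\mathbb{P}^2\otimes\mathcal{O}_{\mathbb{P}^2}(r-d)$. Let $W\subset H^0(X,\mathcal{N})$ be a vector subspace of dimension $k+1$, with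 $k\ge 1$ and $\mathcal{N}$ a line bundle, so that the linear system $|W|=\mathbb{P}W$ has dimension $k$. In a local trivialization of $\mathcal{N}$ let $s_0,\dots,s_k$ be functions expressing a basis of $W$. For a local holomorphic vector field $u$ put $$\sigma_W(u)=\det\bigl(u^{i}(s_j)\bigr)_{0\le i,j\le k},$$ where $u^i(s_j)$ is the $i$-th iterated derivative of $s_j$ along $u$. One has $\sigma_W(au)=a^{k(k+1)/2}\sigma_W(u)$ for every holomorphic function $a$. For a section $v\in H^0(X,\mathrm{Sym}^d TX\otimes\mathcal{M})$ with isolated zeros and discriminant $\Delta(v)$ not identically zero, defining the $d$-web $\mathcal{W}=[v]$, define $\sigma_W(v)=\prod_{i=1}^d\sigma_W(v_i)$ using local decompositions $v=v_1\cdots v_d$ outside $\{\Delta(v)=0\}$; this is independent of the decomposition and extends to a meromorphic section of $\mathcal{N}^{\otimes (k+1)d}\otimes\mathcal{M}^{\otimes k(k+1)/2}$ on $X$, with poles contained in $\{\Delta(v)=0\}$. The section $\Delta(v)^{k(k-1)/2}\cdot\sigma_W(v)$ is holomorphic, and the extactic divisor $\mathcal{E}(\mathcal{W},W)$ of $\mathcal{W}$ with respect to $|W|$ is its zero divisor (with multiplicities), when this section is not identically zero. The $n$-th extactic divisor $\mathcal{E}_n(\mathcal{W})$ of a web on $X=\mathbb{P}^2$ is the extactic divisor with respect to the complete linear system $W=H^0(\mathbb{P}^2,\mathcal{O}_{\mathbb{P}^2}(n))$, for which $k=n(n+3)/2$. *)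

theory Defs
  imports
    "HOL-Analysis.Analysis"
    "HOL-Computational_Algebra.Squarefree"
    "Jordan_Normal_Form.Determinant"
    "Subresultants.Resultant_Prelim"
begin

no_notation vec_index (infixl "$" 100)

section \<open>Holomorphic functions and vector fields on open subsets of \<open>\<complex>\<^sup>2\<close>\<close>

definition holo2 :: "(complex \<times> complex \<Rightarrow> complex) \<Rightarrow> (complex \<times> complex) set \<Rightarrow> bool" where
  "holo2 f U \<longleftrightarrow> open U \<and>
     (\<forall>z\<in>U. \<exists>a b. (f has_derivative (\<lambda>h. a * fst h + b * snd h)) (at z))"

definition pd1 :: "(complex \<times> complex \<Rightarrow> complex) \<Rightarrow> complex \<times> complex \<Rightarrow> complex" where
  "pd1 f z = deriv (\<lambda>t. f (t, snd z)) (fst z)"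

definition pd2 :: "(complex \<times> complex \<Rightarrow> complex) \<Rightarrow> complex \<times> complex \<Rightarrow> complex" where
  "pd2 f z = deriv (\<lambda>t. f (fst z, t)) (snd z)"

text \<open>A vector field \<open>u = p \<partial>\<^sub>x + q \<partial>\<^sub>y\<close> is given by the function \<open>z \<mapsto> (p z, q z)\<close>.\<close>

type_synonym vfield = "complex \<times> complex \<Rightarrow> complex \<times> complex"

definition holo_vfield :: "vfield \<Rightarrow> (complex \<times> complex) set \<Rightarrow> bool" where
  "holo_vfield u U \<longleftrightarrow> holo2 (fst \<circ> u) U \<and> holo2 (snd \<circ> u) U"

definition lie :: "vfield \<Rightarrow> (complex \<times> complex \<Rightarrow> complex) \<Rightarrow> complex \<times> complex \<Rightarrow> complex" where
  "lie u f z = fst (u z) * pd1 f z + snd (u z) * pd2 f z"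

text \<open>\<open>\<sigma>\<^sub>W(u)\<close>, for the list \<open>S = [s\<^sub>0, \<dots>, s\<^sub>k]\<close> of local expressions of a basis of \<open>W\<close>.\<close>

definition sigma :: "(complex \<times> complex \<Rightarrow> complex) list \<Rightarrow> vfield \<Rightarrow> complex \<times> complex \<Rightarrow> complex" where
  "sigma S u z = det (mat (length S) (length S) (\<lambda>(i, j). (lie u ^^ i) (S ! j) z))"

section \<open>Symmetric tensors as binary forms\<close>

text \<open>
  The element \<open>\<Sum>\<^sub>j a\<^sub>j \<partial>\<^sub>x\<^sup>j \<partial>\<^sub>y\<^sup>d\<^sup>-\<^sup>j\<close> of the \<open>d\<close>-th symmetric power of a tangent space is
  represented by its coefficients \<open>a\<^sub>0, \<dots>, a\<^sub>d\<close> (the values \<open>a j\<close> for \<open>j > d\<close> play no role), or,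
  equivalently, by the binary form \<open>bform d a\<close> that it defines on the cotangent space; products of
  symmetric tensors are products of binary forms, and a vector \<open>u\<close> is the linear form \<open>pairing u\<close>.
\<close>

definition bform :: "nat \<Rightarrow> (nat \<Rightarrow> complex) \<Rightarrow> complex \<times> complex \<Rightarrow> complex" where
  "bform d a \<xi> = (\<Sum>j\<le>d. a j * fst \<xi> ^ j * snd \<xi> ^ (d - j))"

definition pairing :: "complex \<times> complex \<Rightarrow> complex \<times> complex \<Rightarrow> complex" where
  "pairing u \<xi> = fst u * fst \<xi> + snd u * snd \<xi>"

definition is_factorization :: "nat \<Rightarrow> (nat \<Rightarrow> complex) \<Rightarrow> (complex \<times> complex) list \<Rightarrow> bool" where
  "is_factorization d a us \<longleftrightarrow>
     length us = d \<and> (\<forall>\<xi>. bform d a \<xi> = (\<Prod>u\<leftarrow>us. pairing u \<xi>))"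

text \<open>
  The discriminant of \<open>f = bform d a\<close>, normalised by
  \<open>Res(f\<^sub>\<xi>, f\<^sub>\<eta>) = (-1)\<^sup>d\<^sup>(\<^sup>d\<^sup>-\<^sup>1\<^sup>)\<^sup>/\<^sup>2 d\<^sup>d\<^sup>-\<^sup>2 disc f\<close>, the resultant being that of two binary forms of
  degree \<open>d - 1\<close> (so their leading coefficients may vanish). With this normalisation the
  discriminant is \<open>b\<^sup>2 - 4 a c\<close> for \<open>d = 2\<close> and \<open>1\<close> for \<open>d = 1\<close>.
\<close>

definition bdisc :: "nat \<Rightarrow> (nat \<Rightarrow> complex) \<Rightarrow> complex" where
  "bdisc d a =
     (let p = (\<Sum>j=1..d. monom (of_nat j * a j) (j - 1));
          q = (\<Sum>j<d. monom (of_nat (d - j) * a j) j)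
      in (- 1) ^ (d * (d - 1) div 2) * of_nat d powi (2 - int d)
           * det (sylvester_mat_sub (d - 1) (d - 1) p q))"

section \<open>The projective plane and its standard charts\<close>

definition proj_point :: "complex ^ 3 \<Rightarrow> (complex ^ 3) set" where
  "proj_point X = {c *s X | c. True}"

text \<open>
  \<open>lift i\<close> is the inverse of the chart on \<open>{X\<^sub>i \<noteq> 0}\<close>, with values in homogeneous coordinates
  normalised by \<open>X\<^sub>i = 1\<close>.
\<close>

definition lift :: "3 \<Rightarrow> complex \<times> complex \<Rightarrow> complex ^ 3" where
  "lift i z = (if i = 1 then vector [1, fst z, snd z]
               else if i = 2 then vector [fst z, 1, snd z]
               else vector [fst z, snd z, 1])"

definition coords :: "3 \<Rightarrow> complex ^ 3 \<Rightarrow> complex \<times> complex" where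
  "coords i X = (if i = 1 then (X $ 2 / X $ 1, X $ 3 / X $ 1)
                 else if i = 2 then (X $ 1 / X $ 2, X $ 3 / X $ 2)
                 else (X $ 1 / X $ 3, X $ 2 / X $ 3))"

definition trans_map :: "3 \<Rightarrow> 3 \<Rightarrow> complex \<times> complex \<Rightarrow> complex \<times> complex" where
  "trans_map i j z = coords j (lift i z)"

definition pullback :: "vfield \<Rightarrow> complex \<times> complex \<Rightarrow> complex \<times> complex \<Rightarrow> complex \<times> complex" where
  "pullback \<phi> z \<xi> =
     (pd1 (fst \<circ> \<phi>) z * fst \<xi> + pd1 (snd \<circ> \<phi>) z * snd \<xi>,
      pd2 (fst \<circ> \<phi>) z * fst \<xi> + pd2 (snd \<circ> \<phi>) z * snd \<xi>)"

section \<open>Webs on the projective plane\<close>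

text \<open>
  Sections of \<open>Sym\<^sup>d T\<P>\<^sup>2 \<otimes> \<O>(m)\<close>: \<open>v i z\<close> is the value at \<open>z\<close> in the chart \<open>i\<close>, where \<open>\<O>(m)\<close> is
  trivialised by \<open>X\<^sub>i\<^sup>m\<close>; thus the local expressions of a section of \<open>\<O>(m)\<close> satisfy
  \<open>s\<^sub>i = (X\<^sub>j / X\<^sub>i)\<^sup>m s\<^sub>j\<close>.
\<close>

type_synonym sym_tensor = "3 \<Rightarrow> complex \<times> complex \<Rightarrow> nat \<Rightarrow> complex"

definition sym_section :: "nat \<Rightarrow> int \<Rightarrow> sym_tensor \<Rightarrow> bool" where
  "sym_section d m v \<longleftrightarrow>
     (\<forall>i. \<forall>l\<le>d. holo2 (\<lambda>z. v i z l) UNIV) \<and>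
     (\<forall>i j z \<xi>. lift i z $ j \<noteq> 0 \<longrightarrow>
        bform d (v i z) (pullback (trans_map i j) z \<xi>) =
        (lift i z $ j) powi m * bform d (v j (trans_map i j z)) \<xi>)"

definition isolated_zeros :: "nat \<Rightarrow> sym_tensor \<Rightarrow> bool" where
  "isolated_zeros d v \<longleftrightarrow>
     (\<forall>i. \<forall>z\<in>{z. \<forall>l\<le>d. v i z l = 0}. z isolated_in {z. \<forall>l\<le>d. v i z l = 0})"

definition web :: "nat \<Rightarrow> nat \<Rightarrow> sym_tensor \<Rightarrow> bool" where
  "web d r v \<longleftrightarrow> sym_section d (int r - int d) v \<and> isolated_zeros d v \<and>
     (\<exists>i z. bdisc d (v i z) \<noteq> 0)"

section \<open>Algebraic curves\<close>

text \<open>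
  Polynomials in \<open>X\<^sub>1, X\<^sub>2, X\<^sub>3\<close> are elements of \<open>\<complex>[X\<^sub>1][X\<^sub>2][X\<^sub>3]\<close>. A (reduced) curve is identified
  with its set of points.
\<close>

type_synonym poly3 = "complex poly poly poly"

definition eval3 :: "poly3 \<Rightarrow> complex ^ 3 \<Rightarrow> complex" where
  "eval3 F X = poly (poly (poly F [:[:X $ 3:]:]) [:X $ 2:]) (X $ 1)"

definition homogeneous :: "nat \<Rightarrow> poly3 \<Rightarrow> bool" where
  "homogeneous m F \<longleftrightarrow>
     (\<forall>a b c. coeff (coeff (coeff F c) b) a \<noteq> 0 \<longrightarrow> a + b + c = m)"

definition zero_locus :: "poly3 \<Rightarrow> (complex ^ 3) set set" where
  "zero_locus F = proj_point ` {X. X \<noteq> 0 \<and> eval3 F X = 0}"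

definition curve_of_degree :: "nat \<Rightarrow> (complex ^ 3) set set \<Rightarrow> bool" where
  "curve_of_degree m C \<longleftrightarrow>
     m \<ge> 1 \<and> (\<exists>F. homogeneous m F \<and> squarefree F \<and> C = zero_locus F)"

definition curve_degree :: "(complex ^ 3) set set \<Rightarrow> nat" where
  "curve_degree C = (THE m. curve_of_degree m C)"

definition irreducible_equation :: "poly3 \<Rightarrow> (complex ^ 3) set set \<Rightarrow> bool" where
  "irreducible_equation F C \<longleftrightarrow>
     irreducible F \<and> (\<exists>m. homogeneous m F) \<and> C = zero_locus F"

definition irreducible_curve :: "(complex ^ 3) set set \<Rightarrow> bool" where
  "irreducible_curve C \<longleftrightarrow> (\<exists>F. irreducible_equation F C)"

section \<open>Invariant curves\<close>

definition web_direction :: "nat \<Rightarrow> (nat \<Rightarrow> complex) \<Rightarrow> complex \<times> complex \<Rightarrow> bool" where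
  "web_direction d a u \<longleftrightarrow> u \<noteq> 0 \<and> (\<exists>us. is_factorization d a us \<and> u \<in> set us)"

text \<open>The curve \<open>{f = 0}\<close> is smooth at \<open>z\<close>, with tangent line spanned by \<open>u\<close>.\<close>

definition tangent_to :: "(complex \<times> complex \<Rightarrow> complex) \<Rightarrow> complex \<times> complex \<Rightarrow> complex \<times> complex \<Rightarrow> bool" where
  "tangent_to f z u \<longleftrightarrow>
     (pd1 f z, pd2 f z) \<noteq> 0 \<and> u \<noteq> 0 \<and> fst u * pd1 f z + snd u * pd2 f z = 0"

text \<open>
  The irreducible components of \<open>C\<close> are the irreducible curves contained in \<open>C\<close>, and a property
  holds at a general point of an irreducible curve if it fails at finitely many points only.
\<close>

definition invariant_curve :: "nat \<Rightarrow> sym_tensor \<Rightarrow> (complex ^ 3) set set \<Rightarrow> bool" where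
  "invariant_curve d v C \<longleftrightarrow>
     (\<forall>F C'. irreducible_equation F C' \<and> C' \<subseteq> C \<longrightarrow>
       (\<forall>i. finite {z. eval3 F (lift i z) = 0 \<and>
          \<not> (\<exists>u. tangent_to (eval3 F \<circ> lift i) z u \<and> web_direction d (v i z) u)}))"

section \<open>Divisors on the projective plane\<close>

type_synonym divisor = "(complex ^ 3) set set \<Rightarrow> nat"

definition divisor_degree :: "divisor \<Rightarrow> nat" where
  "divisor_degree D = (\<Sum>C | irreducible_curve C \<and> D C \<noteq> 0. D C * curve_degree C)"

text \<open>
  \<open>E i\<close> is the expression of a section of a line bundle in the chart \<open>i\<close>. At every point of \<open>C\<close> the
  germ of the irreducible equation of \<open>C\<close> is reduced, so divisibility at all points of \<open>C\<close> amounts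
  to divisibility at a general one.
\<close>

definition vanishes_to_order ::
    "(3 \<Rightarrow> complex \<times> complex \<Rightarrow> complex) \<Rightarrow> (complex ^ 3) set set \<Rightarrow> nat \<Rightarrow> bool" where
  "vanishes_to_order E C m \<longleftrightarrow>
     (\<forall>F i z. irreducible_equation F C \<and> eval3 F (lift i z) = 0 \<longrightarrow>
       (\<exists>U h. z \<in> U \<and> holo2 h U \<and> (\<forall>w\<in>U. E i w = eval3 F (lift i w) ^ m * h w)))"

definition zero_divisor :: "(3 \<Rightarrow> complex \<times> complex \<Rightarrow> complex) \<Rightarrow> divisor" where
  "zero_divisor E C = (if irreducible_curve C then GREATEST m. vanishes_to_order E C m else 0)"

section \<open>Extactic divisors\<close>

text \<open>
  \<open>S i\<close> lists the expressions, in the chart \<open>i\<close>, of a basis of \<open>W\<close>. The extactic section is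
  \<open>\<Delta>(v)\<^sup>k\<^sup>(\<^sup>k\<^sup>-\<^sup>1\<^sup>)\<^sup>/\<^sup>2 \<cdot> \<sigma>\<^sub>W(v)\<close>, extended holomorphically across \<open>{\<Delta>(v) = 0}\<close>; it is represented by
  its expressions in the three charts.
\<close>

definition is_extactic_section ::
    "nat \<Rightarrow> sym_tensor \<Rightarrow> (3 \<Rightarrow> (complex \<times> complex \<Rightarrow> complex) list) \<Rightarrow>
     (3 \<Rightarrow> complex \<times> complex \<Rightarrow> complex) \<Rightarrow> bool" where
  "is_extactic_section d v S E \<longleftrightarrow>
     (\<forall>i. holo2 (E i) UNIV \<and>
       (\<forall>U vs. open U \<and> (\<forall>z\<in>U. bdisc d (v i z) \<noteq> 0) \<and> (\<forall>u\<in>set vs. holo_vfield u U) \<and>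
          (\<forall>z\<in>U. is_factorization d (v i z) (map (\<lambda>u. u z) vs)) \<longrightarrow>
          (let k = length (S i) - 1 in
           \<forall>z\<in>U. E i z = bdisc d (v i z) ^ (k * (k - 1) div 2) * (\<Prod>u\<leftarrow>vs. sigma (S i) u z))))"

definition extactic_section ::
    "nat \<Rightarrow> sym_tensor \<Rightarrow> (3 \<Rightarrow> (complex \<times> complex \<Rightarrow> complex) list) \<Rightarrow>
     3 \<Rightarrow> complex \<times> complex \<Rightarrow> complex" where
  "extactic_section d v S = (THE E. is_extactic_section d v S E)"

text \<open>
  The monomial basis of \<open>H\<^sup>0(\<P>\<^sup>2, \<O>(n))\<close>. Another basis multiplies \<open>\<sigma>\<^sub>W\<close> by a nonzero constant.
\<close>

definition monomials :: "nat \<Rightarrow> 3 \<Rightarrow> (complex \<times> complex \<Rightarrow> complex) list" where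
  "monomials n i =
     [\<lambda>z. (lift i z $ 1) ^ a * (lift i z $ 2) ^ b * (lift i z $ 3) ^ (n - a - b).
       a \<leftarrow> [0..<n + 1], b \<leftarrow> [0..<n + 1 - a]]"

abbreviation nth_extactic_section ::
    "nat \<Rightarrow> nat \<Rightarrow> sym_tensor \<Rightarrow> 3 \<Rightarrow> complex \<times> complex \<Rightarrow> complex" where
  "nth_extactic_section n d v \<equiv> extactic_section d v (monomials n)"

definition nth_extactic_divisor :: "nat \<Rightarrow> nat \<Rightarrow> sym_tensor \<Rightarrow> divisor" where
  "nth_extactic_divisor n d v = zero_divisor (nth_extactic_section n d v)"

end

theory Submission
  imports Defs "HOL-Complex_Analysis.Complex_Analysis"
    "HOL-Computational_Algebra.Fundamental_Theorem_Algebra" "HOL-Computational_Algebra.Field_as_Ring"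
begin

text \<open>
  Put \<open>k = n (n + 3) / 2\<close> and \<open>K = k (k - 1) / 2\<close>. The extactic section turns out to be a nonzero
  section of \<open>\<O>(D)\<close> with
  \<open>D = n (k + 1) d + (r - d) k (k + 1) / 2 + K (3 d (d - 1) + 2 (r - d) (d - 1))\<close>,
  hence a homogeneous polynomial of degree \<open>D\<close>, and the degree of its zero divisor is \<open>D\<close>, which is
  the asserted number. Four points carry the proof.

  \<^emph>\<open>The section is holomorphic across the discriminant.\<close> The web is a function \<open>f\<close> on the cotangent
  bundle, homogeneous of degree \<open>d\<close> on the fibres. Let \<open>u\<close> be a local field that is a factor of
  \<open>f\<close>. On the covectors annihilated by \<open>u\<close> the Hamiltonian derivation of \<open>f\<close> equals, up to a multiple of the
  identity, the derivation along \<open>c u\<close>, where \<open>c\<close> is the product of the other factors of \<open>f\<close>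
  (\<open>hamilton_on_root\<close>). So the determinant built from the \<open>s\<^sub>j\<close>, their differentials and the iterated
  Hamiltonian derivatives of these is a binary form \<open>G\<close> with holomorphic coefficients whose value on such a
  covector is \<open>c\<^sup>K \<sigma>\<^sub>W(u)\<close> (\<open>jet_det_on_root\<close>). The resultant of \<open>f\<close> and \<open>G\<close>, being the product of
  the values of \<open>G\<close> at the zeros of \<open>f\<close>, is \<open>\<Delta>\<^sup>K \<sigma>\<^sub>W(v)\<close> up to sign, because \<open>\<Delta>\<close> is up to sign the
  product of the cofactors \<open>c\<close>; and a resultant is a polynomial in the coefficients.

  \<^emph>\<open>The section belongs to \<open>\<O>(D)\<close>.\<close> Wronskians and discriminants transform by known powers
  (\<open>sigma_scale\<close>, \<open>sigma_mult\<close>, \<open>bdisc_trans\<close>), and \<open>extactic_trans\<close> adds them up. A holomorphic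
  section of \<open>\<O>(D)\<close> grows at most like the \<open>D\<close>-th power of the coordinates in one affine chart, so
  Liouville's theorem makes it a homogeneous polynomial (\<open>section_is_homogeneous\<close>).

  \<^emph>\<open>Degrees of divisors.\<close> For a homogeneous polynomial the order of vanishing along an irreducible
  curve is the multiplicity of the equation of the curve as a factor, by the Nullstellensatz for
  prime polynomials, and the degrees of the prime factors add up (\<open>divisor_degree_homogeneous\<close>).

  \<^emph>\<open>The section is not identically zero.\<close> If it were, then \<open>\<sigma>\<^sub>W(u) = 0\<close> on an open set for one of the
  local fields \<open>u\<close> of the web. A vanishing Wronskian gives a relation \<open>s\<^sub>q = \<Sum>\<^sub>j\<^sub><\<^sub>q \<theta>\<^sub>j s\<^sub>j\<close> between monomials
  whose coefficients \<open>\<theta>\<^sub>j\<close> are first integrals of \<open>u\<close> (\<open>wronskian_first_integrals\<close>). They are not all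
  constant, since the monomials are linearly independent; hence the leaf of \<open>u\<close> through a point is a
  level curve of one of them, all of them are constant on this leaf, and the relation with these
  constant values is the equation of an algebraic curve of degree at most \<open>n\<close> that contains the
  leaf. One of its irreducible components is then an invariant curve that meets the leaf. A point
  that avoids the finitely many invariant curves of degree at most \<open>n\<close>, together with the leaf near
  it, gives a contradiction (\<open>extactic_nonzero\<close>).
\<close>

section \<open>Holomorphic functions of two variables\<close>

text \<open>The complex differential of \<open>f\<close> at \<open>z\<close> is \<open>a dx + b dy\<close>. Stating it with explicit coefficients lets
  one read off \<open>pd1 f z\<close> and \<open>pd2 f z\<close>, which are defined by one-variable derivatives.\<close>

definition has_cd ::
    "(complex \<times> complex \<Rightarrow> complex) \<Rightarrow> complex \<Rightarrow> complex \<Rightarrow> complex \<times> complex \<Rightarrow> bool" where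
  "has_cd f a b z \<longleftrightarrow> (f has_derivative (\<lambda>h. a * fst h + b * snd h)) (at z)"

lemma has_cd_pd:
  assumes "has_cd f a b z" shows "pd1 f z = a" "pd2 f z = b"
proof -
  have "((\<lambda>t. (t, snd z)) has_derivative (\<lambda>h. (h, 0))) (at (fst z))"
    by (auto intro!: derivative_eq_intros)
  moreover have "(f has_derivative (\<lambda>h. a * fst h + b * snd h)) (at (fst z, snd z))"
    using assms by (simp add: has_cd_def)
  ultimately have "((\<lambda>t. f (t, snd z)) has_derivative (\<lambda>h. a * fst (h, 0::complex) + b * snd (h, 0::complex))) (at (fst z))"
    by (rule has_derivative_compose)
  then have "((\<lambda>t. f (t, snd z)) has_field_derivative a) (at (fst z))"
    by (simp add: has_field_derivative_def)
  then show "pd1 f z = a" unfolding pd1_def by (rule DERIV_imp_deriv)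
  have "((\<lambda>t. (fst z, t)) has_derivative (\<lambda>h. (0, h))) (at (snd z))"
    by (auto intro!: derivative_eq_intros)
  moreover have "(f has_derivative (\<lambda>h. a * fst h + b * snd h)) (at (fst z, snd z))"
    using assms by (simp add: has_cd_def)
  ultimately have "((\<lambda>t. f (fst z, t)) has_derivative (\<lambda>h. a * fst (0::complex, h) + b * snd (0::complex, h))) (at (snd z))"
    by (rule has_derivative_compose)
  then have "((\<lambda>t. f (fst z, t)) has_field_derivative b) (at (snd z))"
    by (simp add: has_field_derivative_def)
  then show "pd2 f z = b" unfolding pd2_def by (rule DERIV_imp_deriv)
qed

lemma holo2_has_cd: "holo2 f U \<Longrightarrow> z \<in> U \<Longrightarrow> has_cd f (pd1 f z) (pd2 f z) z"
proof -
  assume "holo2 f U" "z \<in> U"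
  then obtain a b where h: "has_cd f a b z" unfolding holo2_def has_cd_def by blast
  then show ?thesis using has_cd_pd[OF h] by simp
qed

lemma holo2I: "open U \<Longrightarrow> (\<And>z. z \<in> U \<Longrightarrow> has_cd f (a z) (b z) z) \<Longrightarrow> holo2 f U"
  unfolding holo2_def has_cd_def by blast

lemma holo2_open: "holo2 f U \<Longrightarrow> open U" unfolding holo2_def by blast

lemma holo2_subset: "holo2 f U \<Longrightarrow> open V \<Longrightarrow> V \<subseteq> U \<Longrightarrow> holo2 f V"
  unfolding holo2_def by blast

lemma has_cd_const: "has_cd (\<lambda>_. c) 0 0 z"
  unfolding has_cd_def by (auto intro!: derivative_eq_intros)

lemma has_cd_fst: "has_cd fst 1 0 z"
  unfolding has_cd_def by (auto intro!: derivative_eq_intros)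

lemma has_cd_snd: "has_cd snd 0 1 z"
  unfolding has_cd_def by (auto intro!: derivative_eq_intros)

lemma has_cd_add: "has_cd f a b z \<Longrightarrow> has_cd g c d z \<Longrightarrow> has_cd (\<lambda>z. f z + g z) (a + c) (b + d) z"
  unfolding has_cd_def by (auto intro!: derivative_eq_intros simp: algebra_simps)

lemma has_cd_diff: "has_cd f a b z \<Longrightarrow> has_cd g c d z \<Longrightarrow> has_cd (\<lambda>z. f z - g z) (a - c) (b - d) z"
  unfolding has_cd_def by (auto intro!: derivative_eq_intros simp: algebra_simps)

lemma has_cd_minus: "has_cd f a b z \<Longrightarrow> has_cd (\<lambda>z. - f z) (- a) (- b) z"
  unfolding has_cd_def by (auto intro!: derivative_eq_intros simp: algebra_simps)

lemma has_cd_mult: "has_cd f a b z \<Longrightarrow> has_cd g c d z \<Longrightarrow>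
    has_cd (\<lambda>z. f z * g z) (a * g z + f z * c) (b * g z + f z * d) z"
  unfolding has_cd_def by (auto intro!: derivative_eq_intros simp: algebra_simps)

lemma has_cd_field_compose:
  "has_cd f a b z \<Longrightarrow> (g has_field_derivative g') (at (f z)) \<Longrightarrow> has_cd (\<lambda>z. g (f z)) (g' * a) (g' * b) z"
  unfolding has_cd_def has_field_derivative_def
  by (drule (1) has_derivative_compose) (simp add: algebra_simps)

lemma has_cd_inverse: "has_cd f a b z \<Longrightarrow> f z \<noteq> 0 \<Longrightarrow>
    has_cd (\<lambda>z. inverse (f z)) (- (inverse (f z))\<^sup>2 * a) (- (inverse (f z))\<^sup>2 * b) z"
  by (rule has_cd_field_compose) (auto intro!: derivative_eq_intros simp: power2_eq_square)

lemma has_cd_compose: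
  assumes "has_cd (fst \<circ> \<phi>) a b z" "has_cd (snd \<circ> \<phi>) c d z" "has_cd f p q (\<phi> z)"
  shows "has_cd (\<lambda>z. f (\<phi> z)) (p * a + q * c) (p * b + q * d) z"
proof -
  have "((\<lambda>z. (fst (\<phi> z), snd (\<phi> z))) has_derivative (\<lambda>h. (a * fst h + b * snd h, c * fst h + d * snd h))) (at z)"
    using assms(1,2) unfolding has_cd_def comp_def by (rule has_derivative_Pair)
  then have "(\<phi> has_derivative (\<lambda>h. (a * fst h + b * snd h, c * fst h + d * snd h))) (at z)" by simp
  from has_derivative_compose[OF this assms(3)[unfolded has_cd_def]]
  show ?thesis unfolding has_cd_def by (simp add: algebra_simps)
qed

lemma has_cd_curve:
  assumes "(\<gamma>1 has_field_derivative a) (at t)" "(\<gamma>2 has_field_derivative b) (at t)"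
    "has_cd f p q (\<gamma>1 t, \<gamma>2 t)"
  shows "((\<lambda>t. f (\<gamma>1 t, \<gamma>2 t)) has_field_derivative (p * a + q * b)) (at t)"
proof -
  have "((\<lambda>t. (\<gamma>1 t, \<gamma>2 t)) has_derivative (\<lambda>h. (a * h, b * h))) (at t)"
    using assms(1,2) unfolding has_field_derivative_def by (rule has_derivative_Pair)
  from has_derivative_compose[OF this assms(3)[unfolded has_cd_def]]
  show ?thesis unfolding has_field_derivative_def
    by (rule has_derivative_eq_rhs) (auto simp: algebra_simps)
qed

lemma has_cd_cong_open:
  assumes "has_cd f a b z" "open U" "z \<in> U" "\<And>w. w \<in> U \<Longrightarrow> f w = g w"
  shows "has_cd g a b z"
  using assms unfolding has_cd_def by (meson has_derivative_transform_within_open)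

lemma holo2_cong:
  assumes "holo2 f U" "\<And>w. w \<in> U \<Longrightarrow> f w = g w" shows "holo2 g U"
  by (rule holo2I[OF holo2_open[OF assms(1)]],
      rule has_cd_cong_open[OF holo2_has_cd[OF assms(1)] holo2_open[OF assms(1)] _ assms(2)])

lemma pd_cong:
  assumes "holo2 f U" "z \<in> U" "\<And>w. w \<in> U \<Longrightarrow> f w = g w"
  shows "pd1 g z = pd1 f z" "pd2 g z = pd2 f z"
  using has_cd_pd[OF has_cd_cong_open[OF holo2_has_cd[OF assms(1,2)] holo2_open[OF assms(1)] assms(2,3)]]
  by auto

lemma holo2_const: "open U \<Longrightarrow> holo2 (\<lambda>_. c) U" by (rule holo2I[OF _ has_cd_const])
lemma holo2_fst: "open U \<Longrightarrow> holo2 fst U" by (rule holo2I[OF _ has_cd_fst])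
lemma holo2_snd: "open U \<Longrightarrow> holo2 snd U" by (rule holo2I[OF _ has_cd_snd])

lemma holo2_add: "holo2 f U \<Longrightarrow> holo2 g U \<Longrightarrow> holo2 (\<lambda>z. f z + g z) U"
  by (rule holo2I[OF holo2_open has_cd_add[OF holo2_has_cd holo2_has_cd]])
lemma holo2_diff: "holo2 f U \<Longrightarrow> holo2 g U \<Longrightarrow> holo2 (\<lambda>z. f z - g z) U"
  by (rule holo2I[OF holo2_open has_cd_diff[OF holo2_has_cd holo2_has_cd]])
lemma holo2_minus: "holo2 f U \<Longrightarrow> holo2 (\<lambda>z. - f z) U"
  by (rule holo2I[OF holo2_open has_cd_minus[OF holo2_has_cd]])
lemma holo2_mult: "holo2 f U \<Longrightarrow> holo2 g U \<Longrightarrow> holo2 (\<lambda>z. f z * g z) U"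
  by (rule holo2I[OF holo2_open has_cd_mult[OF holo2_has_cd holo2_has_cd]])
lemma holo2_inverse: "holo2 f U \<Longrightarrow> (\<And>z. z \<in> U \<Longrightarrow> f z \<noteq> 0) \<Longrightarrow> holo2 (\<lambda>z. inverse (f z)) U"
  by (rule holo2I[OF holo2_open has_cd_inverse[OF holo2_has_cd]])
lemma holo2_divide: "holo2 f U \<Longrightarrow> holo2 g U \<Longrightarrow> (\<And>z. z \<in> U \<Longrightarrow> g z \<noteq> 0) \<Longrightarrow> holo2 (\<lambda>z. f z / g z) U"
  unfolding divide_inverse by (intro holo2_mult holo2_inverse)

lemma holo2_sum: "open U \<Longrightarrow> (\<And>i. i \<in> I \<Longrightarrow> holo2 (f i) U) \<Longrightarrow> holo2 (\<lambda>z. \<Sum>i\<in>I. f i z) U"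
  by (induction I rule: infinite_finite_induct) (auto intro: holo2_const holo2_add)
lemma holo2_prod: "open U \<Longrightarrow> (\<And>i. i \<in> I \<Longrightarrow> holo2 (f i) U) \<Longrightarrow> holo2 (\<lambda>z. \<Prod>i\<in>I. f i z) U"
  by (induction I rule: infinite_finite_induct) (auto intro: holo2_const holo2_mult)
lemma holo2_power: "holo2 f U \<Longrightarrow> holo2 (\<lambda>z. f z ^ n) U"
  by (induction n) (auto intro: holo2_const holo2_mult holo2_open)
lemma holo2_powi: "holo2 f U \<Longrightarrow> (\<And>z. z \<in> U \<Longrightarrow> f z \<noteq> 0) \<Longrightarrow> holo2 (\<lambda>z. f z powi n) U"
  by (cases "n \<ge> 0") (simp_all add: power_int_def holo2_power holo2_inverse)

lemma holo2_compose:
  assumes "holo2 (fst \<circ> \<phi>) U" "holo2 (snd \<circ> \<phi>) U" "holo2 f V" "\<And>z. z \<in> U \<Longrightarrow> \<phi> z \<in> V"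
  shows "holo2 (\<lambda>z. f (\<phi> z)) U"
  by (rule holo2I[OF holo2_open[OF assms(1)] has_cd_compose[OF assms(1,2)[THEN holo2_has_cd] holo2_has_cd[OF assms(3,4)]]])

lemma holo2_det:
  assumes "open U" "\<And>i j. i < n \<Longrightarrow> j < n \<Longrightarrow> holo2 (f i j) U"
  shows "holo2 (\<lambda>z. det (mat n n (\<lambda>(i,j). f i j z))) U"
proof -
  have "holo2 (\<lambda>z. \<Sum>p | p permutes {0..<n}. signof p * (\<Prod>i = 0..<n. f i (p i) z)) U"
    using assms by (intro holo2_sum holo2_mult holo2_const holo2_prod) (auto simp: permutes_in_image)
  moreover have "det (mat n n (\<lambda>(i,j). f i j z)) =
     (\<Sum>p | p permutes {0..<n}. signof p * (\<Prod>i = 0..<n. f i (p i) z))" for z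
    by (subst det_def'[of _ n]) (auto simp: permutes_in_image intro!: sum.cong prod.cong)
  ultimately show ?thesis by simp
qed

lemma holo2_cont: "holo2 f U \<Longrightarrow> continuous_on U f"
  unfolding holo2_def by (meson continuous_at_imp_continuous_on has_derivative_continuous)

lemma holo2_slices:
  assumes "holo2 f U" "(x, y) \<in> U"
  shows "((\<lambda>t. f (t, y)) has_field_derivative pd1 f (x, y)) (at x)"
    "((\<lambda>t. f (x, t)) has_field_derivative pd2 f (x, y)) (at y)"
  using has_cd_curve[of "\<lambda>t. t" 1 x "\<lambda>t. y" 0 f] has_cd_curve[of "\<lambda>t. x" 0 y "\<lambda>t. t" 1 f]
    holo2_has_cd[OF assms] by auto

text \<open>Cauchy's inequality for the differences \<open>f (x, \<cdot>) - f (a, \<cdot>)\<close>, which are uniformly small on a disc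
  when \<open>x\<close> is close to \<open>a\<close>.\<close>

lemma continuous_slice_deriv:
  fixes f :: "complex \<times> complex \<Rightarrow> complex"
  assumes U: "open U" and c: "continuous_on U f"
    and d: "\<And>x y. (x, y) \<in> U \<Longrightarrow> (\<lambda>t. f (x, t)) field_differentiable at y"
  shows "continuous_on U (pd2 f)"
proof (rule continuous_at_imp_continuous_on, intro ballI)
  fix z0 assume z0: "z0 \<in> U"
  obtain a b where ab: "z0 = (a, b)" by force
  obtain A B where AB: "open A" "open B" "a \<in> A" "b \<in> B" "A \<times> B \<subseteq> U"
    using U z0 ab by (metis mem_Sigma_iff open_prod_elim prod.inject mem_Times_iff)
  obtain r1 r2 where r12: "r1 > 0" "cball a r1 \<subseteq> A" "r2 > 0" "cball b r2 \<subseteq> B"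
    using AB open_contains_cball by metis
  define r where "r = r2 / 2"
  have r: "r > 0" using r12 by (simp add: r_def)
  let ?K = "cball a r1 \<times> cball b r2"
  have K: "?K \<subseteq> U" using r12 AB by blast
  have uc: "uniformly_continuous_on ?K f"
    by (intro compact_uniformly_continuous compact_Times compact_cball continuous_on_subset[OF c K])
  have hol: "(\<lambda>t. f (x, t)) holomorphic_on cball b r2" if "x \<in> cball a r1" for x
    unfolding holomorphic_on_def
  proof (rule ballI, rule field_differentiable_at_within, rule d)
    fix y assume "y \<in> cball b r2"
    then show "(x, y) \<in> U" using K that by blast
  qed
  have contb: "isCont (deriv (\<lambda>t. f (a, t))) b"
  proof -
    have "(\<lambda>t. f (a, t)) holomorphic_on ball b r2"
      by (rule holomorphic_on_subset[OF hol ball_subset_cball]) (use r12 in simp)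
    then have "deriv (\<lambda>t. f (a, t)) holomorphic_on ball b r2" by (rule holomorphic_deriv) simp
    then have "continuous_on (ball b r2) (deriv (\<lambda>t. f (a, t)))" by (rule holomorphic_on_imp_continuous_on)
    then show ?thesis using r12 by (simp add: continuous_on_eq_continuous_at)
  qed
  show "isCont (pd2 f) z0"
    unfolding continuous_at_eps_delta
  proof (intro allI impI)
    fix e :: real assume e: "e > 0"
    obtain \<delta> where \<delta>: "\<delta> > 0" "\<And>p q. p \<in> ?K \<Longrightarrow> q \<in> ?K \<Longrightarrow> dist q p < \<delta> \<Longrightarrow> dist (f q) (f p) < e * r / 2"
      using uc e r unfolding uniformly_continuous_on_def by (metis half_gt_zero mult_pos_pos)
    obtain \<eta> where \<eta>: "\<eta> > 0" "\<And>y. dist y b < \<eta> \<Longrightarrow> dist (deriv (\<lambda>t. f (a, t)) y) (deriv (\<lambda>t. f (a, t)) b) < e / 2"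
      using contb e unfolding continuous_at_eps_delta by (metis half_gt_zero)
    show "\<exists>d>0. \<forall>z. dist z z0 < d \<longrightarrow> dist (pd2 f z) (pd2 f z0) < e"
    proof (intro exI conjI allI impI)
      show "min (min \<delta> \<eta>) (min r1 r) > 0" using \<delta> \<eta> r r12 by simp
      fix z assume z: "dist z z0 < min (min \<delta> \<eta>) (min r1 r)"
      obtain x y where xy: "z = (x, y)" by force
      have dx: "dist x a \<le> dist z z0" "dist y b \<le> dist z z0"
        using dist_fst_le[of z z0] dist_snd_le[of z z0] by (auto simp: xy ab)
      have xK: "x \<in> cball a r1" using dx z by (simp add: dist_commute)
      have sub: "cball y r \<subseteq> cball b r2"
      proof
        fix t assume "t \<in> cball y r"
        then show "t \<in> cball b r2" using dx z dist_triangle[of b t y] by (simp add: r_def dist_commute)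
      qed
      let ?g = "\<lambda>t. f (x, t) - f (a, t)"
      have holg: "?g holomorphic_on cball y r"
        by (intro holomorphic_on_diff holomorphic_on_subset[OF hol sub] xK) (use r12 in simp)
      have "cmod ((deriv ^^ 1) ?g y) \<le> fact 1 * (e * r / 2) / r ^ 1"
      proof (rule Cauchy_inequality[OF _ _ r])
        show "?g holomorphic_on ball y r" using holg holomorphic_on_subset ball_subset_cball by blast
        show "continuous_on (cball y r) ?g" using holg by (rule holomorphic_on_imp_continuous_on)
        fix t assume t: "cmod (y - t) = r"
        then have "t \<in> cball b r2" using sub by (auto simp: dist_norm)
        then have "dist (f (x, t)) (f (a, t)) < e * r / 2"
          using \<delta>(2)[of "(a,t)" "(x,t)"] xK r12 dx z by (auto simp: dist_Pair_Pair)
        then show "cmod (?g t) \<le> e * r / 2" by (simp add: dist_norm)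
      qed
      moreover have "deriv ?g y = deriv (\<lambda>t. f (x, t)) y - deriv (\<lambda>t. f (a, t)) y"
      proof (rule deriv_diff)
        have "y \<in> cball b r2" by (rule subsetD[OF sub]) (use r in simp)
        then show "(\<lambda>t. f (x, t)) field_differentiable at y" "(\<lambda>t. f (a, t)) field_differentiable at y"
          using d[of x y] d[of a y] K xK r12 by (auto simp: subset_iff)
      qed
      ultimately have 1: "dist (deriv (\<lambda>t. f (x, t)) y) (deriv (\<lambda>t. f (a, t)) y) \<le> e / 2"
        using r by (simp add: dist_norm)
      have 2: "dist (deriv (\<lambda>t. f (a, t)) y) (deriv (\<lambda>t. f (a, t)) b) < e / 2"
        using \<eta>(2)[of y] dx z by simp
      show "dist (pd2 f z) (pd2 f z0) < e"
        using 1 2 dist_triangle[of "pd2 f z" "pd2 f z0" "deriv (\<lambda>t. f (a, t)) y"]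
        unfolding pd2_def xy ab by simp
    qed
  qed
qed

text \<open>Osgood's lemma: a continuous function that is holomorphic in each variable is holomorphic. One
  partial derivative is continuous by the preceding lemma, which is enough for differentiability.\<close>

lemma holo2_from_slices:
  fixes f :: "complex \<times> complex \<Rightarrow> complex"
  assumes U: "open U" and c: "continuous_on U f"
    and d1: "\<And>x y. (x, y) \<in> U \<Longrightarrow> (\<lambda>t. f (t, y)) field_differentiable at x"
    and d2: "\<And>x y. (x, y) \<in> U \<Longrightarrow> (\<lambda>t. f (x, t)) field_differentiable at y"
  shows "holo2 f U"
proof (rule holo2I[OF U])
  fix z0 assume z0: "z0 \<in> U"
  obtain a b where ab: "z0 = (a, b)" by force
  obtain A B where AB: "open A" "open B" "a \<in> A" "b \<in> B" "A \<times> B \<subseteq> U"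
    using U z0 ab by (metis mem_Sigma_iff open_prod_elim prod.inject mem_Times_iff)
  obtain r2 where r2: "r2 > 0" "ball b r2 \<subseteq> B" using AB open_contains_ball by metis
  have c2: "continuous_on U (pd2 f)" by (rule continuous_slice_deriv[OF U c d2])
  let ?X = "A" and ?Y = "ball b r2"
  have op: "open (?X \<times> ?Y)" using AB by (intro open_Times) auto
  have sub: "?X \<times> ?Y \<subseteq> U" using AB r2 by blast
  have inn: "(a,b) \<in> ?X \<times> ?Y" using AB r2 by auto
  have "((\<lambda>(x, y). f (x, y)) has_derivative
        (\<lambda>(tx, ty). pd1 f (a,b) * tx + blinfun_apply (blinfun_mult_right (pd2 f (a,b))) ty))
        (at (a, b) within ?X \<times> ?Y)"
  proof (rule has_derivative_partialsI)
    show "((\<lambda>x. f (x, b)) has_derivative (*) (pd1 f (a, b))) (at a within ?X)"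
    proof -
      have "((\<lambda>x. f (x, b)) has_field_derivative pd1 f (a, b)) (at a)"
        using d1[of a b] z0 ab by (simp add: pd1_def DERIV_deriv_iff_field_differentiable)
      then show ?thesis
        unfolding has_field_derivative_def by (rule has_derivative_at_withinI)
    qed
    show "((\<lambda>y. f (x, y)) has_derivative blinfun_apply (blinfun_mult_right (pd2 f (x, y)))) (at y within ?Y)"
      if "x \<in> ?X" "y \<in> ?Y" for x y
    proof -
      have "(x, y) \<in> U" using that sub by blast
      then have "((\<lambda>y. f (x, y)) has_field_derivative pd2 f (x, y)) (at y)"
        using d2[of x y] by (simp add: pd2_def DERIV_deriv_iff_field_differentiable)
      then show ?thesis
        unfolding has_field_derivative_def blinfun_mult_right.rep_eq by (rule has_derivative_at_withinI)
    qed
    have "continuous_on U (\<lambda>p. blinfun_mult_right (pd2 f p))"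
      by (rule bounded_linear.continuous_on[OF bounded_linear_blinfun_mult_right c2])
    then have "continuous (at (a,b) within ?X \<times> ?Y) (\<lambda>p. blinfun_mult_right (pd2 f p))"
      using inn sub by (meson continuous_on_eq_continuous_within continuous_on_subset)
    then show "continuous (at (a,b) within ?X \<times> ?Y) (\<lambda>(x, y). blinfun_mult_right (pd2 f (x, y)))"
      by (simp add: case_prod_unfold)
  qed (use r2 in auto)
  then have "(f has_derivative (\<lambda>h. pd1 f (a,b) * fst h + pd2 f (a,b) * snd h)) (at (a,b))"
    using at_within_open[OF inn op] by (simp add: case_prod_unfold blinfun_mult_right.rep_eq)
  then show "has_cd f (pd1 f z0) (pd2 f z0) z0" by (simp add: has_cd_def ab)
qed

lemma pd_swap: "pd1 (f \<circ> prod.swap) z = pd2 f (prod.swap z)" "pd2 (f \<circ> prod.swap) z = pd1 f (prod.swap z)"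
  by (simp_all add: pd1_def pd2_def)

lemma open_swap: "open U \<Longrightarrow> open (prod.swap -` U :: ('a::topological_space \<times> 'b::topological_space) set)"
  by (rule open_vimage) (auto intro!: continuous_intros simp: prod.swap_def)

lemma holo2_swap: "holo2 f U \<Longrightarrow> holo2 (f \<circ> prod.swap) (prod.swap -` U)"
  unfolding comp_def
  by (rule holo2_compose[of prod.swap]) (auto simp: comp_def intro: holo2_cong[OF holo2_fst] holo2_cong[OF holo2_snd] open_swap holo2_open)

lemma continuous_pd2: "holo2 f U \<Longrightarrow> continuous_on U (pd2 f)"
  using continuous_slice_deriv[OF holo2_open holo2_cont] holo2_slices(2) field_differentiable_def by blast

lemma continuous_pd1: "holo2 f U \<Longrightarrow> continuous_on U (pd1 f)"
proof -
  assume h: "holo2 f U"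
  have "continuous_on (prod.swap -` U) (pd2 (f \<circ> prod.swap))" by (rule continuous_pd2[OF holo2_swap[OF h]])
  then have "continuous_on U (pd2 (f \<circ> prod.swap) \<circ> prod.swap)"
    by (intro continuous_on_compose) (auto simp: prod.swap_def intro!: continuous_intros elim: continuous_on_subset)
  then show ?thesis by (simp add: comp_def pd_swap[unfolded comp_def])
qed

text \<open>By Cauchy's formula \<open>pd1 f (a, y)\<close> is an integral over a circle around \<open>a\<close> of the values of \<open>f\<close>, so
  differentiation under the integral sign makes it holomorphic in \<open>y\<close>; in the first variable it is
  the derivative of a holomorphic function.\<close>

lemma holo2_pd1: assumes h: "holo2 f U" shows "holo2 (pd1 f) U"
proof (rule holo2_from_slices[OF holo2_open[OF h] continuous_pd1[OF h]])
  fix a b assume ab: "(a, b) \<in> U"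
  obtain A B where AB: "open A" "open B" "a \<in> A" "b \<in> B" "A \<times> B \<subseteq> U"
    using holo2_open[OF h] ab by (metis mem_Sigma_iff open_prod_elim)
  have hol: "(\<lambda>t. f (t, y)) holomorphic_on A" if "y \<in> B" for y
    unfolding holomorphic_on_def field_differentiable_def
  proof (intro ballI exI, rule has_field_derivative_at_within, rule holo2_slices(1)[OF h])
    fix x assume "x \<in> A"
    then show "(x, y) \<in> U" using AB that by blast
  qed
  have "deriv (\<lambda>t. f (t, b)) holomorphic_on A" by (rule holomorphic_deriv[OF hol AB(1)]) fact
  then show "(\<lambda>t. pd1 f (t, b)) field_differentiable at a"
    using AB unfolding pd1_def by (simp add: holomorphic_on_imp_differentiable_at)
  obtain r1 where r1: "r1 > 0" "cball a r1 \<subseteq> A" using AB open_contains_cball by metis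
  obtain r2 where r2: "r2 > 0" "ball b r2 \<subseteq> B" using AB open_contains_ball by metis
  let ?c = "\<lambda>s::real. circlepath a r1 s"
  let ?k = "\<lambda>s::real. vector_derivative (circlepath a r1) (at s) / (?c s - a)\<^sup>2"
  have cA: "?c s \<in> A" for s
    by (rule subsetD[OF r1(2)]) (use r1 in \<open>auto simp: circlepath dist_norm norm_mult\<close>)
  have cne: "?c s \<noteq> a" for s using r1 by (simp add: circlepath)
  have cc: "continuous_on UNIV ?c" unfolding circlepath by (intro continuous_intros)
  have cU: "(?c s, y) \<in> U" if "y \<in> ball b r2" for s y using cA AB r2 that by blast
  have kc: "continuous_on {0..1} ?k"
    using cne unfolding vector_derivative_circlepath unfolding circlepath
    by (intro continuous_intros) auto
  have hI: "(\<lambda>y. integral (cbox 0 1) (\<lambda>s. f (?c s, y) * ?k s)) holomorphic_on ball b r2"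
  proof (rule leibniz_rule_holomorphic[where fx = "\<lambda>y s. pd2 f (?c s, y) * ?k s"])
    fix y s assume ys: "y \<in> ball b r2" "s \<in> cbox 0 (1::real)"
    then have "(?c s, y) \<in> U" using cA AB r2 by blast
    then show "((\<lambda>y. f (?c s, y) * ?k s) has_field_derivative pd2 f (?c s, y) * ?k s) (at y within ball b r2)"
      by (rule has_field_derivative_at_within[OF DERIV_cmult_right[OF holo2_slices(2)[OF h]]])
  next
    fix y assume y: "y \<in> ball b r2"
    show "(\<lambda>s. f (?c s, y) * ?k s) integrable_on cbox 0 1"
    proof (intro integrable_continuous continuous_on_mult)
      show "continuous_on (cbox 0 1) ?k" using kc by simp
      show "continuous_on (cbox 0 1) (\<lambda>s. f (?c s, y))"
        by (rule continuous_on_compose2[OF holo2_cont[OF h]])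
           (use cU y in \<open>auto intro!: continuous_intros continuous_on_compose2[OF cc]\<close>)
    qed
  next
    have "continuous_on (ball b r2 \<times> cbox 0 1) (\<lambda>p. pd2 f (?c (snd p), fst p) * ?k (snd p))"
    proof (intro continuous_on_mult)
      show "continuous_on (ball b r2 \<times> cbox 0 1) (\<lambda>p. pd2 f (?c (snd p), fst p))"
        by (rule continuous_on_compose2[OF continuous_pd2[OF h]])
           (use cU in \<open>auto intro!: continuous_intros continuous_on_compose2[OF cc]\<close>)
      show "continuous_on (ball b r2 \<times> cbox 0 1) (\<lambda>p. ?k (snd p))"
        by (rule continuous_on_compose2[OF kc]) (auto intro!: continuous_intros)
    qed
    then show "continuous_on (ball b r2 \<times> cbox 0 1) (\<lambda>(y, s). pd2 f (?c s, y) * ?k s)"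
      by (simp add: case_prod_unfold)
  qed auto
  have eqI: "pd1 f (a, y) = integral (cbox 0 1) (\<lambda>s. f (?c s, y) * ?k s) / (2 * of_real pi * \<i>)"
    if "y \<in> ball b r2" for y
  proof -
    have yB: "y \<in> B" using that r2 by auto
    have hc: "(\<lambda>t. f (t, y)) holomorphic_on cball a r1" by (rule holomorphic_on_subset[OF hol[OF yB] r1(2)])
    have "contour_integral (circlepath a r1) (\<lambda>u. f (u, y) / (u - a)\<^sup>2) = 2 * of_real pi * \<i> * deriv (\<lambda>t. f (t, y)) a"
      using Cauchy_contour_integral_circlepath_2[OF holomorphic_on_imp_continuous_on[OF hc]
            holomorphic_on_subset[OF hc ball_subset_cball], of a] r1 by simp
    then have "2 * of_real pi * \<i> * pd1 f (a, y) = contour_integral (circlepath a r1) (\<lambda>u. f (u, y) / (u - a)\<^sup>2)"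
      by (simp add: pd1_def)
    also have "\<dots> = integral (cbox 0 1) (\<lambda>s. f (?c s, y) * ?k s)"
      by (simp add: contour_integral_integral field_simps)
    finally show ?thesis by (simp add: field_simps)
  qed
  have "(\<lambda>y. integral (cbox 0 1) (\<lambda>s. f (?c s, y) * ?k s) / (2 * of_real pi * \<i>)) holomorphic_on ball b r2"
    by (intro holomorphic_on_divide hI holomorphic_on_const) simp
  then have "(\<lambda>y. pd1 f (a, y)) holomorphic_on ball b r2"
    by (rule holomorphic_transform) (simp only: eqI)
  then show "(\<lambda>y. pd1 f (a, y)) field_differentiable at b"
    using r2 by (simp add: holomorphic_on_imp_differentiable_at)
qed

lemma holo2_pd2: assumes h: "holo2 f U" shows "holo2 (pd2 f) U"
proof -
  have "holo2 (pd1 (f \<circ> prod.swap) \<circ> prod.swap) (prod.swap -` prod.swap -` U)"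
    by (rule holo2_swap[OF holo2_pd1[OF holo2_swap[OF h]]])
  then show ?thesis by (simp add: comp_def pd_swap[unfolded comp_def] vimage_def)
qed

section \<open>Identity theorem\<close>

lemma holo2_line:
  assumes "holo2 f UNIV"
  shows "(\<lambda>t. f (a + t * p, b + t * q)) holomorphic_on S"
proof -
  have "((\<lambda>t. f (a + t * p, b + t * q)) has_field_derivative
      (pd1 f (a + t * p, b + t * q) * p + pd2 f (a + t * p, b + t * q) * q)) (at t)" for t
    by (rule has_cd_curve[OF _ _ holo2_has_cd[OF assms]]) (auto intro!: derivative_eq_intros)
  then show ?thesis
    unfolding holomorphic_on_def field_differentiable_def by (meson has_field_derivative_at_within)
qed

text \<open>The one-variable identity theorem on the complex line joining the given point to a point of \<open>W\<close>.\<close>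

lemma holo2_entire_identity:
  assumes f: "holo2 f UNIV" and W: "open W" "w \<in> W" and 0: "\<And>z. z \<in> W \<Longrightarrow> f z = 0"
  shows "f z = 0"
proof -
  obtain a b where w: "w = (a, b)" by force
  obtain x y where z: "z = (x, y)" by force
  let ?\<gamma> = "\<lambda>t::complex. (a + t * (x - a), b + t * (y - b))"
  have c: "continuous_on UNIV ?\<gamma>" by (intro continuous_intros)
  have op: "open (?\<gamma> -` W)" using W(1) c by (rule open_vimage)
  have "f (?\<gamma> 1) = 0"
  proof (rule analytic_continuation_open[of "?\<gamma> -` W" UNIV "\<lambda>t. f (?\<gamma> t)" "\<lambda>_. 0"])
    have "0 \<in> ?\<gamma> -` W" using W w by simp
    then show "?\<gamma> -` W \<noteq> {}" by blast
  qed (use op 0 holo2_line[OF f] in auto)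
  then show ?thesis by (simp add: z)
qed

lemma holo2_entire_nonzero_dense:
  assumes "holo2 f UNIV" "f z0 \<noteq> 0" "open W" "W \<noteq> {}"
  obtains w where "w \<in> W" "f w \<noteq> 0"
  using holo2_entire_identity[OF assms(1,3), of _ z0] assms(2,4) by blast

lemma eq_of_eq_dense:
  fixes f g :: "complex \<times> complex \<Rightarrow> complex"
  assumes "holo2 f UNIV" "holo2 g UNIV" "holo2 h UNIV" "h z0 \<noteq> 0" "\<And>z. h z \<noteq> 0 \<Longrightarrow> f z = g z"
  shows "f z = g z"
proof -
  have 1: "holo2 (\<lambda>z. h z * (f z - g z)) UNIV" by (intro holo2_mult holo2_diff assms)
  have op: "open {z. h z \<noteq> 0}"
    by (rule open_Collect_neq[OF holo2_cont[OF assms(3)] continuous_on_const])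
  have "(\<lambda>z. f z - g z) z = 0"
    by (rule holo2_entire_identity[of _ "{z. h z \<noteq> 0}" z0]) (use assms op in \<open>auto intro: holo2_diff\<close>)
  then show ?thesis by simp
qed

section \<open>Vector fields as derivations\<close>

lemma holo2_lie: "holo_vfield u U \<Longrightarrow> holo2 f U \<Longrightarrow> holo2 (lie u f) U"
  unfolding holo_vfield_def comp_def
  by (rule holo2_cong[of "\<lambda>z. fst (u z) * pd1 f z + snd (u z) * pd2 f z"])
     (auto intro!: holo2_add holo2_mult holo2_pd1 holo2_pd2 simp: lie_def)

lemma holo2_lie_funpow: "holo_vfield u U \<Longrightarrow> holo2 f U \<Longrightarrow> holo2 ((lie u ^^ i) f) U"
  by (induction i) (auto intro: holo2_lie)

lemma lie_cong:
  assumes "holo2 f U" "z \<in> U" "\<And>w. w \<in> U \<Longrightarrow> f w = g w"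
  shows "lie u g z = lie u f z"
  unfolding lie_def using pd_cong[OF assms] by simp

lemma lie_has_cd: "has_cd f a b z \<Longrightarrow> lie u f z = fst (u z) * a + snd (u z) * b"
  using has_cd_pd[of f a b z] by (simp add: lie_def)

lemma lie_add: "holo2 f U \<Longrightarrow> holo2 g U \<Longrightarrow> z \<in> U \<Longrightarrow> lie u (\<lambda>z. f z + g z) z = lie u f z + lie u g z"
  by (subst lie_has_cd[OF has_cd_add[OF holo2_has_cd holo2_has_cd]]) (auto simp: lie_def algebra_simps)

lemma lie_mult: "holo2 f U \<Longrightarrow> holo2 g U \<Longrightarrow> z \<in> U \<Longrightarrow>
    lie u (\<lambda>z. f z * g z) z = lie u f z * g z + f z * lie u g z"
  by (subst lie_has_cd[OF has_cd_mult[OF holo2_has_cd holo2_has_cd]]) (auto simp: lie_def algebra_simps)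

lemma lie_sum: 
  assumes "finite I" "\<And>i. i \<in> I \<Longrightarrow> holo2 (f i) U" "z \<in> U" "open U"
  shows "lie u (\<lambda>z. \<Sum>i\<in>I. f i z) z = (\<Sum>i\<in>I. lie u (f i) z)"
  using assms(1,2)
proof (induction I rule: finite_induct)
  case empty then show ?case using lie_has_cd[OF has_cd_const, of u 0 z] by simp
next
  case (insert i I)
  then show ?case using lie_add[of "f i" U "\<lambda>z. \<Sum>i\<in>I. f i z" z u] assms(3,4) by (simp add: holo2_sum)
qed

section \<open>Implicit functions\<close>

text \<open>The inverse function theorem for \<open>(z, t) \<mapsto> (z, F (z, t))\<close>. The derivative of \<open>F\<close> is
  given by its coefficients \<open>A, B, C\<close>, so that the implicit function is visibly complex differentiable.\<close>

lemma implicit_holo2: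
  fixes F A B C :: "(complex \<times> complex) \<times> complex \<Rightarrow> complex"
  assumes U: "open U" "(z0, t0) \<in> U"
    and d: "\<And>p. p \<in> U \<Longrightarrow> (F has_derivative (\<lambda>h. A p * fst (fst h) + B p * snd (fst h) + C p * snd h)) (at p)"
    and c: "continuous_on U A" "continuous_on U B" "continuous_on U C"
    and 0: "F (z0, t0) = 0" "C (z0, t0) \<noteq> 0"
  obtains W g where "open W" "z0 \<in> W" "holo2 g W" "g z0 = t0"
    "\<And>z. z \<in> W \<Longrightarrow> (z, g z) \<in> U \<and> F (z, g z) = 0"
proof -
  define D where "D p h = (fst h, A p * fst (fst h) + B p * snd (fst h) + C p * snd h)"
    for p and h :: "(complex \<times> complex) \<times> complex"
  have bl: "bounded_linear (D p)" for p
    unfolding D_def by (intro bounded_linear_Pair bounded_linear_add bounded_linear_const_mult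
        bounded_linear_fst_comp bounded_linear_snd_comp bounded_linear_fst bounded_linear_snd)
  define f' where "f' p = Blinfun (D p)" for p
  have f': "blinfun_apply (f' p) = D p" for p unfolding f'_def by (rule bounded_linear_Blinfun_apply[OF bl])
  define \<Phi> where "\<Phi> p = (fst p, F p)" for p
  have d\<Phi>: "(\<Phi> has_derivative blinfun_apply (f' p)) (at p)" if "p \<in> U" for p
    unfolding f' \<Phi>_def D_def by (intro has_derivative_Pair d that has_derivative_fst has_derivative_ident)
  have cf': "continuous_on U f'"
    by (rule continuous_on_blinfun_componentwise, unfold f' D_def) (intro continuous_intros c)
  define E where "E h = (fst h, (snd h - A (z0,t0) * fst (fst h) - B (z0,t0) * snd (fst h)) * inverse (C (z0,t0)))"
    for h :: "(complex \<times> complex) \<times> complex"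
  have blE: "bounded_linear E"
    unfolding E_def by (intro bounded_linear_Pair bounded_linear_sub bounded_linear_const_mult bounded_linear_mult_const
        bounded_linear_fst_comp bounded_linear_snd_comp bounded_linear_fst bounded_linear_snd)
  have inv: "Blinfun E o\<^sub>L f' (z0, t0) = id_blinfun"
    by (rule blinfun_eqI) (use 0 in \<open>simp add: f' bounded_linear_Blinfun_apply[OF blE] D_def E_def field_simps\<close>)
  show ?thesis
  proof (rule inverse_function_theorem[OF U(1) d\<Phi> cf' U(2) inv])
    fix U' V g g'
    assume g: "open U'" "U' \<subseteq> U" "(z0, t0) \<in> U'" "open V" "\<Phi> (z0, t0) \<in> V" "homeomorphism U' V \<Phi> g"
      "\<And>y. y \<in> V \<Longrightarrow> (g has_derivative g' y) (at y)"
      "\<And>y. y \<in> V \<Longrightarrow> g' y = inv_into UNIV (blinfun_apply (f' (g y)))"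
      "\<And>y. y \<in> V \<Longrightarrow> bij (blinfun_apply (f' (g y)))"
    define W where "W = {z. (z, 0::complex) \<in> V}"
    define \<gamma> where "\<gamma> z = snd (g (z, 0))" for z
    have W: "open W" 
      using open_vimage[OF g(4), of "\<lambda>z. (z, 0)"] unfolding W_def vimage_def by (simp add: continuous_intros)
    have gz: "g (z, 0) = (z, \<gamma> z)" "(z, \<gamma> z) \<in> U" "F (z, \<gamma> z) = 0" if "z \<in> W" for z
    proof -
      have 1: "\<Phi> (g (z, 0)) = (z, 0)" "g (z, 0) \<in> U'"
        using g(6) that by (auto simp: homeomorphism_def W_def)
      then show e: "g (z, 0) = (z, \<gamma> z)" by (simp add: \<Phi>_def \<gamma>_def prod_eq_iff)
      then show "(z, \<gamma> z) \<in> U" "F (z, \<gamma> z) = 0" using 1 g(2) by (auto simp: \<Phi>_def)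
    qed
    have "holo2 \<gamma> W"
    proof (rule holo2I[OF W])
      fix z assume z: "z \<in> W"
      let ?p = "(z, \<gamma> z)"
      have zV: "(z, 0) \<in> V" using z by (simp add: W_def)
      have bij: "bij (D ?p)" using g(9)[OF zV] gz(1)[OF z] by (simp add: f')
      have C: "C ?p \<noteq> 0"
      proof
        assume "C ?p = 0"
        then have "D ?p (0, 1) = D ?p (0, 0)" by (simp add: D_def)
        then show False using bij by (metis bij_is_inj injD prod.inject zero_neq_one)
      qed
      have g'z: "g' (z, 0) (h, 0) = (h, - (A ?p * fst h + B ?p * snd h) / C ?p)" for h
      proof -
        have "D ?p (h, - (A ?p * fst h + B ?p * snd h) / C ?p) = (h, 0)" using C by (simp add: D_def)
        then show ?thesis using g(8)[OF zV] gz(1)[OF z] bij by (simp add: f' inv_f_eq bij_is_inj)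
      qed
      have "((\<lambda>z. (z, 0)) has_derivative (\<lambda>h. (h, 0::complex))) (at z)"
        by (auto intro!: derivative_eq_intros)
      from has_derivative_compose[OF this g(7)[OF zV]]
      have "((\<lambda>z. snd (g (z, 0))) has_derivative (\<lambda>h. snd (g' (z, 0) (h, 0)))) (at z)"
        by (rule has_derivative_snd)
      then show "has_cd \<gamma> (- A ?p / C ?p) (- B ?p / C ?p) z"
        unfolding has_cd_def \<gamma>_def by (rule has_derivative_eq_rhs) (simp add: fun_eq_iff g'z[unfolded \<gamma>_def] diff_divide_distrib)
    qed
    moreover have z0W: "z0 \<in> W" using g(5) 0 by (simp add: W_def \<Phi>_def)
    moreover have "\<gamma> z0 = t0"
    proof -
      have "g (\<Phi> (z0, t0)) = (z0, t0)" using g(3,6) by (auto simp: homeomorphism_def)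
      then show ?thesis using 0 by (simp add: \<Phi>_def \<gamma>_def)
    qed
    ultimately show thesis using that[OF W z0W, of \<gamma>] gz by blast
  qed
qed

text \<open>The regular level curves of a holomorphic function are parametrised by one of the two coordinates.\<close>

lemma level_curve:
  assumes \<theta>: "holo2 \<theta> V" and z0: "z0 \<in> V" and nz: "pd1 \<theta> z0 \<noteq> 0 \<or> pd2 \<theta> z0 \<noteq> 0"
  obtains T \<gamma>1 \<gamma>2 \<gamma>1' \<gamma>2' where "open T" "0 \<in> T" "connected T"
    "\<And>t. t \<in> T \<Longrightarrow> (\<gamma>1 has_field_derivative \<gamma>1' t) (at t)"
    "\<And>t. t \<in> T \<Longrightarrow> (\<gamma>2 has_field_derivative \<gamma>2' t) (at t)"
    "\<And>t. t \<in> T \<Longrightarrow> (\<gamma>1 t, \<gamma>2 t) \<in> V \<and> \<theta> (\<gamma>1 t, \<gamma>2 t) = \<theta> z0 \<and> (\<gamma>1' t, \<gamma>2' t) \<noteq> 0"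
    "(\<gamma>1 0, \<gamma>2 0) = z0" "inj_on (\<lambda>t. (\<gamma>1 t, \<gamma>2 t)) T"
proof -
  obtain a b where z0': "z0 = (a, b)" by force
  note V = holo2_open[OF \<theta>]
  \<comment> \<open>\<open>\<delta>1 = 1\<close> parametrises by the first coordinate and solves for the second; \<open>\<delta>2 = 1\<close> exchanges the
     two. The parameter of the curve is the first component of a point of \<open>\<complex>\<^sup>2\<close>, to match the implicit function theorem.\<close>
  define \<delta>1 where "\<delta>1 = (if pd2 \<theta> z0 \<noteq> 0 then 1 else 0 :: complex)"
  define \<delta>2 where "\<delta>2 = 1 - \<delta>1"
  define m where "m p = (a + \<delta>1 * fst (fst p) + \<delta>2 * snd p, b + \<delta>2 * fst (fst p) + \<delta>1 * snd p)"
    for p :: "(complex \<times> complex) \<times> complex"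
  define F where "F p = \<theta> (m p) - \<theta> z0" for p
  have cm: "continuous_on S m" for S unfolding m_def by (intro continuous_intros)
  have op: "open (m -` V)" using V cm by (rule open_vimage)
  have in0: "(0, 0) \<in> m -` V" using z0 z0' by (simp add: m_def)
  have dm: "(m has_derivative (\<lambda>h. (\<delta>1 * fst (fst h) + \<delta>2 * snd h, \<delta>2 * fst (fst h) + \<delta>1 * snd h))) (at p)" for p
    unfolding m_def by (auto intro!: derivative_eq_intros)
  define A where "A p = pd1 \<theta> (m p) * \<delta>1 + pd2 \<theta> (m p) * \<delta>2" for p
  define C where "C p = pd1 \<theta> (m p) * \<delta>2 + pd2 \<theta> (m p) * \<delta>1" for p
  have dF: "(F has_derivative (\<lambda>h. A p * fst (fst h) + 0 * snd (fst h) + C p * snd h)) (at p)" if "p \<in> m -` V" for p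
  proof -
    have "has_cd \<theta> (pd1 \<theta> (m p)) (pd2 \<theta> (m p)) (m p)" using holo2_has_cd[OF \<theta>] that by simp
    from has_derivative_compose[OF dm this[unfolded has_cd_def]]
    have "(F has_derivative (\<lambda>h. pd1 \<theta> (m p) * fst (\<delta>1 * fst (fst h) + \<delta>2 * snd h, \<delta>2 * fst (fst h) + \<delta>1 * snd h)
         + pd2 \<theta> (m p) * snd (\<delta>1 * fst (fst h) + \<delta>2 * snd h, \<delta>2 * fst (fst h) + \<delta>1 * snd h) - 0)) (at p)"
      unfolding F_def by (rule has_derivative_diff) (rule has_derivative_const)
    then show ?thesis by (rule has_derivative_eq_rhs) (auto simp: A_def C_def algebra_simps)
  qed
  have cc: "continuous_on (m -` V) (\<lambda>p. pd1 \<theta> (m p))" "continuous_on (m -` V) (\<lambda>p. pd2 \<theta> (m p))"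
    by (rule continuous_on_compose2[OF continuous_pd1[OF \<theta>] cm] continuous_on_compose2[OF continuous_pd2[OF \<theta>] cm]; auto)+
  have C0: "C (0, 0) \<noteq> 0" using nz by (auto simp: C_def m_def z0' \<delta>1_def \<delta>2_def)
  have F0: "F (0, 0) = 0" by (simp add: F_def m_def z0')
  obtain W g where g: "open W" "0 \<in> W" "holo2 g W" "g 0 = 0" "\<And>z. z \<in> W \<Longrightarrow> (z, g z) \<in> m -` V \<and> F (z, g z) = 0"
    by (rule implicit_holo2[OF op in0 dF _ _ _ F0 C0])
       (use cc in \<open>auto simp: A_def C_def intro!: continuous_intros\<close>)
  obtain r where r: "r > 0" "ball 0 r \<subseteq> W" using g(1,2) open_contains_ball by blast
  define T where "T = ball (0::complex) r"
  have TW: "(t, 0) \<in> W" if "t \<in> T" for t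
    using that r by (auto simp: T_def norm_Pair subset_iff)
  define k where "k t = g (t, 0)" for t
  have k: "(k has_field_derivative pd1 g (t, 0)) (at t)" if "t \<in> T" for t
    unfolding k_def by (rule holo2_slices(1)[OF g(3) TW[OF that]])
  show thesis
  proof (rule that[of T "\<lambda>t. a + \<delta>1 * t + \<delta>2 * k t" "\<lambda>t. \<delta>1 + \<delta>2 * pd1 g (t, 0)"
        "\<lambda>t. b + \<delta>2 * t + \<delta>1 * k t" "\<lambda>t. \<delta>2 + \<delta>1 * pd1 g (t, 0)"])
    show "open T" "0 \<in> T" "connected T" using r by (auto simp: T_def)
    show "((\<lambda>t. a + \<delta>1 * t + \<delta>2 * k t) has_field_derivative \<delta>1 + \<delta>2 * pd1 g (t, 0)) (at t)"
      "((\<lambda>t. b + \<delta>2 * t + \<delta>1 * k t) has_field_derivative \<delta>2 + \<delta>1 * pd1 g (t, 0)) (at t)" if "t \<in> T" for t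
      by (auto intro!: derivative_eq_intros k[OF that])
    show "(a + \<delta>1 * t + \<delta>2 * k t, b + \<delta>2 * t + \<delta>1 * k t) \<in> V \<and>
         \<theta> (a + \<delta>1 * t + \<delta>2 * k t, b + \<delta>2 * t + \<delta>1 * k t) = \<theta> z0 \<and>
         (\<delta>1 + \<delta>2 * pd1 g (t, 0), \<delta>2 + \<delta>1 * pd1 g (t, 0)) \<noteq> 0" if "t \<in> T" for t
      using g(5)[OF TW[OF that]] by (auto simp: m_def F_def k_def \<delta>1_def \<delta>2_def zero_prod_def)
    show "(a + \<delta>1 * 0 + \<delta>2 * k 0, b + \<delta>2 * 0 + \<delta>1 * k 0) = z0"
      using g(4) by (simp add: k_def z0' zero_prod_def)
    show "inj_on (\<lambda>t. (a + \<delta>1 * t + \<delta>2 * k t, b + \<delta>2 * t + \<delta>1 * k t)) T"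
      by (auto simp: inj_on_def \<delta>1_def \<delta>2_def split: if_splits)
  qed
qed

section \<open>Binary forms\<close>

text \<open>A generator of the line of covectors that annihilate \<open>u\<close>, that is, the zero of the linear form \<open>pairing u\<close>.\<close>

definition perp :: "complex \<times> complex \<Rightarrow> complex \<times> complex" where
  "perp u = (- snd u, fst u)"

text \<open>The linear form \<open>pairing u\<close>, dehomogenised by setting the second coordinate equal to \<open>1\<close>.\<close>

definition lin :: "complex \<times> complex \<Rightarrow> complex poly" where
  "lin u = [:snd u, fst u:]"

definition form_poly :: "nat \<Rightarrow> (nat \<Rightarrow> complex) \<Rightarrow> complex poly" where
  "form_poly d a = (\<Sum>j\<le>d. monom (a j) j)"

lemma pairing_perp: "pairing u (perp w) = snd u * fst w - fst u * snd w"
  by (simp add: pairing_def perp_def)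

lemma pairing_perp_self [simp]: "pairing u (perp u) = 0"
  by (simp add: pairing_perp)

lemma coeff_form_poly: "coeff (form_poly d a) j = (if j \<le> d then a j else 0)"
  by (simp add: form_poly_def coeff_sum)

lemma degree_form_poly: "degree (form_poly d a) \<le> d"
  by (rule degree_le) (simp add: coeff_form_poly)

lemma bform_form_poly: "bform d (coeff (form_poly d a)) = bform d a"
  by (auto simp: bform_def coeff_form_poly fun_eq_iff intro!: sum.cong)

lemma bform_cong: "(\<And>j. j \<le> d \<Longrightarrow> a j = b j) \<Longrightarrow> bform d a = bform d b"
  by (auto simp: bform_def fun_eq_iff)

lemma poly_sum_le: "degree f \<le> d \<Longrightarrow> poly f x = (\<Sum>j\<le>d. coeff f j * x ^ j)" for x :: complex
  unfolding poly_altdef by (rule sum.mono_neutral_left) (auto simp: coeff_eq_0)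

lemma bform_affine:
  assumes "degree f \<le> d" "\<eta> \<noteq> 0"
  shows "bform d (coeff f) (\<xi>, \<eta>) = \<eta> ^ d * poly f (\<xi> / \<eta>)"
proof -
  have "coeff f j * \<xi> ^ j * \<eta> ^ (d - j) = \<eta> ^ d * (coeff f j * (\<xi> / \<eta>) ^ j)" if "j \<le> d" for j
    using that assms(2) by (simp add: power_divide power_diff)
  then show ?thesis unfolding poly_sum_le[OF assms(1)] bform_def sum_distrib_left by (auto intro: sum.cong)
qed

lemma bform_infinity: "bform d a (\<xi>, 0) = a d * \<xi> ^ d"
proof -
  have "bform d a (\<xi>, 0) = (\<Sum>j\<le>d. if j = d then a d * \<xi> ^ d else 0)"
    unfolding bform_def by (rule sum.cong) auto
  then show ?thesis by simp
qed

lemma coeff_mult_top: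
  fixes f g :: "complex poly"
  assumes "degree f \<le> m" "degree g \<le> n"
  shows "coeff (f * g) (m + n) = coeff f m * coeff g n"
proof -
  have "coeff (f * g) (m + n) = (\<Sum>i\<le>m + n. if i = m then coeff f m * coeff g n else 0)"
    unfolding coeff_mult
  proof (rule sum.cong)
    fix i assume "i \<in> {..m + n}"
    then show "coeff f i * coeff g (m + n - i) = (if i = m then coeff f m * coeff g n else 0)"
      using assms by (cases i m rule: linorder_cases) (auto simp: coeff_eq_0)
  qed simp
  then show ?thesis by simp
qed

text \<open>Products of binary forms are computed on dehomogenisations; the only points where these do not
  determine the form are those on \<open>\<eta> = 0\<close>, and there the form is given by its top coefficient.\<close>

lemma bform_mult:
  assumes "degree f \<le> m" "degree g \<le> n"
  shows "bform (m + n) (coeff (f * g)) \<omega> = bform m (coeff f) \<omega> * bform n (coeff g) \<omega>"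
proof -
  obtain \<xi> \<eta> where \<omega>: "\<omega> = (\<xi>, \<eta>)" by force
  have deg: "degree (f * g) \<le> m + n" using degree_mult_le[of f g] assms by linarith
  show ?thesis
  proof (cases "\<eta> = 0")
    case True then show ?thesis
      by (simp add: \<omega> bform_infinity coeff_mult_top[OF assms] power_add)
  next
    case False then show ?thesis
      by (simp add: \<omega> bform_affine[OF deg] bform_affine[OF assms(1)] bform_affine[OF assms(2)] power_add)
  qed
qed

lemma degree_prod_lin: "degree (\<Prod>i<d. lin (u i)) \<le> d"
proof -
  have "degree (\<Prod>i<d. lin (u i)) \<le> (\<Sum>i<d. degree (lin (u i)))" using degree_prod_sum_le[of "{..<d}"] by (simp add: comp_def)
  also have "\<dots> \<le> (\<Sum>i<d. 1)" by (intro sum_mono) (simp add: lin_def)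
  finally show ?thesis by simp
qed

lemma bform_lin: "bform 1 (coeff (lin u)) \<omega> = pairing u \<omega>"
  by (simp add: bform_def lin_def pairing_def)

lemma bform_prod_lin: "bform d (coeff (\<Prod>i<d. lin (u i))) \<omega> = (\<Prod>i<d. pairing (u i) \<omega>)"
proof (induction d)
  case 0 show ?case by (simp add: bform_def)
next
  case (Suc d)
  have "bform (d + 1) (coeff ((\<Prod>i<d. lin (u i)) * lin (u d))) \<omega> =
      bform d (coeff (\<Prod>i<d. lin (u i))) \<omega> * bform 1 (coeff (lin (u d))) \<omega>"
    by (rule bform_mult[OF degree_prod_lin]) (simp add: lin_def)
  then show ?case using Suc by (simp add: bform_lin[unfolded One_nat_def])
qed

lemma bform_inject:
  assumes "\<And>\<omega>. bform d a \<omega> = bform d b \<omega>" "j \<le> d" shows "a j = b j"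
proof -
  have "poly (form_poly d a) t = poly (form_poly d b) t" for t
    using assms(1)[of "(t, 1)"] bform_affine[OF degree_form_poly, of 1 d _ t] by (simp add: bform_form_poly)
  then have "form_poly d a = form_poly d b" by (simp add: poly_eq_poly_eq_iff[symmetric] fun_eq_iff)
  then show ?thesis using coeff_form_poly[of d a j] coeff_form_poly[of d b j] assms(2) by simp
qed

lemma is_factorization_iff:
  "is_factorization d a us \<longleftrightarrow> length us = d \<and> (\<forall>\<xi>. bform d a \<xi> = (\<Prod>i<d. pairing (us ! i) \<xi>))"
  unfolding is_factorization_def by (auto simp: prod.list_conv_set_nth atLeast0LessThan)

lemma is_factorization_coeff:
  assumes "is_factorization d a us" "j \<le> d" shows "a j = coeff (\<Prod>i<d. lin (us ! i)) j"
  by (rule bform_inject[OF _ assms(2)]) (use assms(1) in \<open>simp add: is_factorization_iff bform_prod_lin del: split_paired_All\<close>)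

lemma factorization_exists:
  assumes "d \<ge> 1" obtains us where "is_factorization d a us"
proof (cases "form_poly d a = 0")
  case True
  have "bform d a \<xi> = 0" for \<xi>
    by (subst bform_form_poly[symmetric]) (simp add: True bform_def)
  then have "is_factorization d a (replicate d 0)"
    using assms by (simp add: is_factorization_iff pairing_def)
  then show ?thesis by (rule that)
next
  case False
  let ?f = "form_poly d a"
  obtain A where A: "size A = degree ?f" "?f = Polynomial.smult (lead_coeff ?f) (\<Prod>x\<in>#A. [:- x, 1:])"
    using alg_closed_imp_factorization[OF False] by blast
  obtain xs where xs: "mset xs = A" using ex_mset by blast
  let ?us = "map (\<lambda>r. (1, - r)) xs @ replicate (d - degree ?f) (0 :: complex, 1 :: complex)"
  have len: "length ?us = d" using degree_form_poly[of d a] A(1) xs by (metis add_diff_inverse_nat length_append length_map length_replicate not_less size_mset)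
  have pl: "(\<Prod>u\<leftarrow>?us. lin u) = (\<Prod>x\<in>#A. [:- x, 1:])"
    by (simp add: xs[symmetric] lin_def comp_def prod_list_replicate one_pCons[symmetric] flip: prod_mset_prod_list)
  define L where "L = ?us"
  have "length L = d" using len by (simp add: L_def)
  then have "L \<noteq> []" using assms by auto
  then obtain u us where "L = u # us" by (auto simp: neq_Nil_conv)
  then have u: "?us = u # us" by (simp add: L_def)
  define vs where "vs = (lead_coeff ?f * fst u, lead_coeff ?f * snd u) # us"
  have lv: "length vs = d" using len u by (simp add: vs_def)
  have "(\<Prod>v\<leftarrow>vs. lin v) = Polynomial.smult (lead_coeff ?f) (\<Prod>u\<leftarrow>?us. lin u)"
    unfolding u vs_def by (simp add: lin_def smult_add_right)
  then have f: "?f = (\<Prod>i<d. lin (vs ! i))"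
    using A(2) pl lv by (simp add: prod.list_conv_set_nth atLeast0LessThan)
  have "bform d a \<xi> = (\<Prod>i<d. pairing (vs ! i) \<xi>)" for \<xi>
  proof -
    have "bform d (coeff ?f) \<xi> = (\<Prod>i<d. pairing (vs ! i) \<xi>)" by (subst f) (rule bform_prod_lin)
    then show ?thesis by (simp only: bform_form_poly)
  qed
  then show ?thesis by (intro that[of vs]) (use lv in \<open>simp add: is_factorization_iff del: split_paired_All\<close>)
qed

text \<open>A binary form of degree \<open>d\<close> that vanishes at \<open>d + 1\<close> distinct points of the projective line is zero. At most
  one of these points is at infinity, and a zero there lowers the degree of the dehomogenisation.\<close>

lemma bform_many_zeros:
  assumes z: "\<And>i. i \<le> d \<Longrightarrow> bform d y (\<tau> i) = 0"
    and ind: "\<And>i j. i \<le> d \<Longrightarrow> j \<le> d \<Longrightarrow> i \<noteq> j \<Longrightarrow> fst (\<tau> i) * snd (\<tau> j) \<noteq> snd (\<tau> i) * fst (\<tau> j)"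
  shows "bform d y \<omega> = 0"
proof (cases "d = 0")
  case True then show ?thesis using z[of 0] by (simp add: bform_def)
next
  case d: False
  let ?f = "form_poly d y"
  have "?f = 0"
  proof (rule ccontr)
    assume f: "?f \<noteq> 0"
    let ?S = "{i. i \<le> d \<and> snd (\<tau> i) \<noteq> 0}"
    let ?r = "\<lambda>i. fst (\<tau> i) / snd (\<tau> i)"
    have inj: "inj_on ?r ?S"
    proof (rule inj_onI)
      fix i j assume "i \<in> ?S" "j \<in> ?S" "?r i = ?r j"
      then show "i = j" using ind[of i j] by (auto simp: field_simps)
    qed
    have sub: "?r ` ?S \<subseteq> {x. poly ?f x = 0}"
    proof clarify
      fix i assume i: "i \<le> d" "snd (\<tau> i) \<noteq> 0"
      then show "poly ?f (?r i) = 0"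
        using z[OF i(1)] bform_affine[OF degree_form_poly i(2), of d y "fst (\<tau> i)"] by (simp add: bform_form_poly)
    qed
    have "card ?S = card (?r ` ?S)" using inj by (simp add: card_image)
    also have "\<dots> \<le> card {x. poly ?f x = 0}" by (intro card_mono poly_roots_finite f sub)
    also have "\<dots> \<le> degree ?f" by (rule card_poly_roots_bound[OF f])
    finally have le: "card ?S \<le> degree ?f" .
    show False
    proof (cases "\<exists>i\<le>d. snd (\<tau> i) = 0")
      case True
      then obtain i0 where i0: "i0 \<le> d" "snd (\<tau> i0) = 0" by blast
      have other: "snd (\<tau> i) \<noteq> 0" if "i \<le> d" "i \<noteq> i0" for i using ind[of i i0] i0 that by auto
      obtain j where j: "j \<le> d" "j \<noteq> i0" using d by (metis le0 le_refl neq0_conv)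
      have "fst (\<tau> i0) \<noteq> 0" using ind[of i0 j] i0 j by auto
      then have "y d = 0" using z[OF i0(1)] i0(2) bform_infinity[of d y "fst (\<tau> i0)"] by (metis mult_eq_0_iff power_not_zero prod.collapse)
      then have "coeff ?f d = 0" by (simp add: coeff_form_poly)
      then have "degree ?f < d" using degree_form_poly[of d y] f d
        by (metis le_neq_implies_less leading_coeff_0_iff)
      moreover have "?S = {..d} - {i0}" using other i0 by auto
      ultimately show False using le i0 by simp
    next
      case False
      then have "?S = {..d}" by auto
      then show False using le degree_form_poly[of d y] by simp
    qed
  qed
  then show ?thesis by (subst bform_form_poly[symmetric]) (simp add: bform_def)
qed

section \<open>Resultants of binary forms\<close>

lemma det_scale_cols:
  "det (mat n n (\<lambda>(i,j). w i j * c j)) = (\<Prod>j<n. c j) * det (mat n n (\<lambda>(i,j). w i j))"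
  for w :: "nat \<Rightarrow> nat \<Rightarrow> 'a :: comm_ring_1"
proof -
  have "(\<Prod>i = 0..<n. w i (p i) * c (p i)) = (\<Prod>j<n. c j) * (\<Prod>i = 0..<n. w i (p i))" if "p permutes {0..<n}" for p
  proof -
    have "(\<Prod>i = 0..<n. c (p i)) = (\<Prod>j = 0..<n. c j)" using prod.permute[OF that, of c] by (simp add: comp_def)
    then show ?thesis by (simp add: prod.distrib atLeast0LessThan mult.commute)
  qed
  then show ?thesis
    by (subst (1 2) det_def'[of _ n]) (auto simp: permutes_in_image sum_distrib_left intro!: sum.cong)
qed

lemma isCont_det:
  fixes f :: "nat \<Rightarrow> nat \<Rightarrow> complex \<Rightarrow> complex"
  assumes "\<And>i j. i < n \<Longrightarrow> j < n \<Longrightarrow> isCont (f i j) t"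
  shows "isCont (\<lambda>t. det (mat n n (\<lambda>(i,j). f i j t))) t"
proof -
  have "isCont (\<lambda>t. \<Sum>p | p permutes {0..<n}. signof p * (\<Prod>i = 0..<n. f i (p i) t)) t"
    using assms by (intro continuous_intros) (auto simp: permutes_in_image)
  moreover have "det (mat n n (\<lambda>(i,j). f i j z)) =
     (\<Sum>p | p permutes {0..<n}. signof p * (\<Prod>i = 0..<n. f i (p i) z))" for z
    by (subst det_def'[of _ n]) (auto simp: permutes_in_image intro!: sum.cong prod.cong)
  ultimately show ?thesis by simp
qed

text \<open>A vector in the kernel of the transposed matrix is a polynomial of degree below \<open>n\<close> with \<open>n\<close> zeros.\<close>

lemma vandermonde_nonzero:
  fixes x :: "nat \<Rightarrow> complex"
  assumes inj: "inj_on x {..<n}"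
  shows "det (mat n n (\<lambda>(i,c). x c ^ (n - 1 - i))) \<noteq> 0"
proof
  let ?V = "mat n n (\<lambda>(i,c). x c ^ (n - 1 - i))"
  assume "det ?V = 0"
  then have "det (transpose_mat ?V) = 0" by (subst det_transpose[of _ n]) auto
  then obtain v where v: "v \<in> carrier_vec n" "v \<noteq> 0\<^sub>v n" "transpose_mat ?V *\<^sub>v v = 0\<^sub>v n"
    using det_0_iff_vec_prod_zero[of "transpose_mat ?V" n] by auto
  define p where "p = (\<Sum>i<n. monom (vec_index v i) (n - 1 - i))"
  have cp: "coeff p (n - 1 - i) = vec_index v i" if "i < n" for i
  proof -
    have "coeff p (n - 1 - i) = (\<Sum>k<n. if k = i then vec_index v i else 0)"
      unfolding p_def coeff_sum by (rule sum.cong) (use that in auto)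
    then show ?thesis using that by simp
  qed
  have deg: "degree p < n" if "n > 0"
  proof -
    have "degree p \<le> n - 1" unfolding p_def by (rule degree_sum_le) (auto intro: order_trans[OF degree_monom_le])
    then show ?thesis using that by simp
  qed
  have roots: "poly p (x c) = 0" if "c < n" for c
  proof -
    have "vec_index (transpose_mat ?V *\<^sub>v v) c = 0" using v(3) that by simp
    then have "(\<Sum>i = 0..<n. x c ^ (n - 1 - i) * vec_index v i) = 0"
      using that v(1) by (simp add: scalar_prod_def)
    then show ?thesis unfolding p_def by (simp add: poly_sum poly_monom atLeast0LessThan mult.commute)
  qed
  have "p = 0"
  proof (rule ccontr)
    assume p: "p \<noteq> 0"
    have "n = card (x ` {..<n})" using inj by (simp add: card_image)
    also have "\<dots> \<le> card {z. poly p z = 0}" by (rule card_mono[OF poly_roots_finite[OF p]]) (use roots in auto)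
    also have "\<dots> \<le> degree p" by (rule card_poly_roots_bound[OF p])
    finally have "n = 0" using deg by linarith
    then show False using p by (simp add: p_def)
  qed
  then have "v = 0\<^sub>v n" using cp v(1) by (intro eq_vecI) auto
  then show False using v(2) by simp
qed

lemma sylvester_mult_vandermonde:
  fixes f g :: "complex poly"
  assumes "degree f \<le> d" "degree g \<le> e"
  shows "sylvester_mat_sub d e f g * mat (d + e) (d + e) (\<lambda>(i,c). x c ^ (d + e - 1 - i)) =
    mat (d + e) (d + e) (\<lambda>(i,c). (if i < e then poly f (x c) else poly g (x c)) *
      x c ^ (if i < e then e - 1 - i else d + e - 1 - i))" (is "?S * ?V = ?R")
proof (rule eq_matI)
  fix i c assume "i < dim_row ?R" "c < dim_col ?R"
  then have ic: "i < d + e" "c < d + e" by auto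
  have "(?S * ?V) $$ (i, c) = (\<Sum>j = 0..<d + e. ?S $$ (i, j) * x c ^ (d + e - 1 - j))"
    using ic by (simp add: scalar_prod_def)
  also have "\<dots> = ?R $$ (i, c)"
  proof (cases "i < e")
    case True
    have "(\<Sum>j = 0..<d + e. ?S $$ (i, j) * x c ^ (d + e - 1 - j)) =
        (\<Sum>j \<in> {i..i + d}. coeff f (d + i - j) * x c ^ (d + e - 1 - j))"
      using True ic by (intro sum.mono_neutral_cong_right) (auto simp: sylvester_mat_sub_index)
    also have "\<dots> = (\<Sum>l\<le>d. coeff f l * x c ^ l * x c ^ (e - 1 - i))"
    proof (rule sum.reindex_bij_witness[of _ "\<lambda>l. d + i - l" "\<lambda>j. d + i - j"])
      fix j assume "j \<in> {i..i + d}"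
      then have "d + e - 1 - j = (d + i - j) + (e - 1 - i)" using True by auto
      then show "coeff f (d + i - j) * x c ^ (d + i - j) * x c ^ (e - 1 - i) = coeff f (d + i - j) * x c ^ (d + e - 1 - j)"
        by (simp add: power_add)
    qed auto
    also have "\<dots> = poly f (x c) * x c ^ (e - 1 - i)"
      by (simp add: poly_sum_le[OF assms(1)] sum_distrib_right)
    finally show ?thesis using True ic by simp
  next
    case False
    have "(\<Sum>j = 0..<d + e. ?S $$ (i, j) * x c ^ (d + e - 1 - j)) =
        (\<Sum>j \<in> {i - e..i}. coeff g (i - j) * x c ^ (d + e - 1 - j))"
      using False ic by (intro sum.mono_neutral_cong_right) (auto simp: sylvester_mat_sub_index)
    also have "\<dots> = (\<Sum>l\<le>e. coeff g l * x c ^ l * x c ^ (d + e - 1 - i))"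
    proof (rule sum.reindex_bij_witness[of _ "\<lambda>l. i - l" "\<lambda>j. i - j"])
      fix j assume "j \<in> {i - e..i}"
      then have "d + e - 1 - j = (i - j) + (d + e - 1 - i)" using False ic by auto
      then show "coeff g (i - j) * x c ^ (i - j) * x c ^ (d + e - 1 - i) = coeff g (i - j) * x c ^ (d + e - 1 - j)"
        by (simp add: power_add)
    qed (use False in auto)
    also have "\<dots> = poly g (x c) * x c ^ (d + e - 1 - i)"
      by (simp add: poly_sum_le[OF assms(2)] sum_distrib_right)
    finally show ?thesis using False ic by simp
  qed
  finally show "(?S * ?V) $$ (i, c) = ?R $$ (i, c)" .
qed auto

text \<open>Multiply the Sylvester matrix by the Vandermonde matrix at the \<open>d\<close> zeros of the product and at \<open>e\<close> auxiliary
  points: the product is block triangular. The Vandermonde factors are eliminated by comparison with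
  the case \<open>g = 1\<close>, in which the Sylvester matrix is triangular.\<close>

lemma resultant_distinct_roots:
  fixes g :: "complex poly"
  assumes g: "degree g \<le> e" and nz: "\<And>i. i < d \<Longrightarrow> fst (u i) \<noteq> 0"
    and ind: "\<And>i j. i < d \<Longrightarrow> j < d \<Longrightarrow> i \<noteq> j \<Longrightarrow> fst (u i) * snd (u j) \<noteq> snd (u i) * fst (u j)"
  shows "det (sylvester_mat_sub d e (\<Prod>i<d. lin (u i)) g) = (\<Prod>i<d. bform e (coeff g) (perp (u i)))"
proof -
  let ?f = "\<Prod>i<d. lin (u i)" and ?N = "d + e"
  define r where "r i = - snd (u i) / fst (u i)" for i
  have rinj: "inj_on r {..<d}"
    using ind nz by (auto simp: inj_on_def r_def field_simps)
  have "infinite (UNIV - r ` {..<d})" by (simp add: infinite_UNIV_char_0)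
  then obtain \<tau> :: "nat \<Rightarrow> complex" where \<tau>: "inj \<tau>" "range \<tau> \<subseteq> UNIV - r ` {..<d}"
    using infinite_countable_subset by blast
  define x where "x c = (if c < e then \<tau> c else r (c - e))" for c
  have xinj: "inj_on x {..<?N}"
  proof (rule inj_onI)
    fix a b assume "a \<in> {..<?N}" "b \<in> {..<?N}" "x a = x b"
    moreover have "\<tau> a \<noteq> r i" if "i < d" for a i using \<tau>(2) that by auto
    then have "\<tau> a \<noteq> r i" "r i \<noteq> \<tau> a" if "i < d" for a i using that by metis+
    ultimately show "a = b" using \<tau>(1) rinj
      by (auto simp: x_def inj_on_def split: if_splits) (metis add_diff_inverse_nat less_diff_conv2 lessThan_iff not_less add.commute)
  qed
  let ?V = "mat ?N ?N (\<lambda>(i,c). x c ^ (?N - 1 - i))"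
  let ?A = "mat e e (\<lambda>(i,c). poly ?f (\<tau> c) * \<tau> c ^ (e - 1 - i))"
  let ?W = "mat d d (\<lambda>(i,c). r c ^ (d - 1 - i))"
  have froot: "poly ?f (r c) = 0" if "c < d" for c
    unfolding poly_prod by (rule prod_zero, simp, rule bexI[of _ c]) (use that nz[OF that] in \<open>auto simp: lin_def r_def\<close>)
  have key: "det (sylvester_mat_sub d e ?f h) * det ?V = det ?A * ((\<Prod>c<d. poly h (r c)) * det ?W)"
    if h: "degree h \<le> e" for h
  proof -
    have "det (sylvester_mat_sub d e ?f h) * det ?V = det (sylvester_mat_sub d e ?f h * ?V)"
      by (rule det_mult[symmetric, of _ ?N]) auto
    also have "sylvester_mat_sub d e ?f h * ?V = four_block_mat ?A (0\<^sub>m e d)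
        (mat d e (\<lambda>(i,c). poly h (\<tau> c) * \<tau> c ^ (d - 1 - i))) (mat d d (\<lambda>(i,c). r c ^ (d - 1 - i) * poly h (r c)))"
      unfolding sylvester_mult_vandermonde[OF degree_prod_lin h]
      by (rule eq_matI) (auto simp: x_def froot mult.commute intro!: arg_cong2[of _ _ _ _ "(*)"] arg_cong[of _ _ "\<lambda>k. _ ^ k"])
    also have "det \<dots> = det ?A * det (mat d d (\<lambda>(i,c). r c ^ (d - 1 - i) * poly h (r c)))"
      by (rule det_four_block_mat_upper_right_zero[of _ e _ d]) auto
    also have "det (mat d d (\<lambda>(i,c). r c ^ (d - 1 - i) * poly h (r c))) = (\<Prod>c<d. poly h (r c)) * det ?W"
      by (rule det_scale_cols)
    finally show ?thesis .
  qed
  have V: "det ?V \<noteq> 0" by (rule vandermonde_nonzero[OF xinj])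
  have ld: "coeff ?f d = (\<Prod>i<d. fst (u i))"
    using bform_prod_lin[of d u "(1, 0)"] by (simp add: bform_infinity pairing_def)
  have one: "det (sylvester_mat_sub d e ?f 1) = coeff ?f d ^ e"
  proof -
    have "det (sylvester_mat_sub d e ?f 1) = prod_list (diag_mat (sylvester_mat_sub d e ?f 1))"
      by (rule det_upper_triangular[of _ ?N]) (auto intro!: upper_triangularI simp: sylvester_mat_sub_index)
    also have "\<dots> = (\<Prod>i = 0..<?N. if i < e then coeff ?f d else 1)"
      unfolding diag_mat_def by (simp add: prod.list_conv_set_nth)
        (auto intro!: prod.cong simp: sylvester_mat_sub_index)
    also have "\<dots> = (\<Prod>i\<in>{0..<e}. coeff ?f d)"
      by (rule prod.mono_neutral_cong_right) auto
    finally show ?thesis by simp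
  qed
  have "coeff ?f d ^ e * det ?V = det ?A * det ?W" using key[of 1] one by simp
  then have "det (sylvester_mat_sub d e ?f g) * det ?V = (coeff ?f d ^ e * (\<Prod>c<d. poly g (r c))) * det ?V"
    using key[OF g] by (simp add: algebra_simps)
  then have "det (sylvester_mat_sub d e ?f g) = coeff ?f d ^ e * (\<Prod>c<d. poly g (r c))" using V by simp
  also have "\<dots> = (\<Prod>i<d. fst (u i) ^ e * poly g (r i))" by (simp add: ld prod.distrib prod_power_distrib)
  also have "\<dots> = (\<Prod>i<d. bform e (coeff g) (perp (u i)))"
    by (rule prod.cong) (use nz in \<open>auto simp: perp_def bform_affine[OF g] r_def\<close>)
  finally show ?thesis .
qed

lemma isCont_if: "(P \<Longrightarrow> isCont f t) \<Longrightarrow> (\<not> P \<Longrightarrow> isCont g t) \<Longrightarrow> isCont (\<lambda>t. if P then f t else g t) t"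
  by (cases P) simp_all

lemma isCont_coeff_prod_lin:
  fixes d :: nat
  assumes "\<And>i. i < d \<Longrightarrow> isCont (\<lambda>t. fst (u i t)) t" "\<And>i. i < d \<Longrightarrow> isCont (\<lambda>t. snd (u i t)) t"
  shows "isCont (\<lambda>t. coeff (\<Prod>i<d. lin (u i t)) k) t"
  using assms
proof (induction d arbitrary: k)
  case 0 then show ?case by simp
next
  case (Suc d)
  have "coeff (\<Prod>i<Suc d. lin (u i t)) k = snd (u d t) * coeff (\<Prod>i<d. lin (u i t)) k +
     (if k = 0 then 0 else fst (u d t) * coeff (\<Prod>i<d. lin (u i t)) (k - 1))" for t
    by (simp add: lin_def mult.commute[of _ "pCons _ _"] coeff_pCons split: nat.split)
  then show ?case using Suc by (cases "k = 0") (auto intro!: continuous_intros)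
qed

lemma eventually_at_0_notin_finite: "finite S \<Longrightarrow> \<forall>\<^sub>F t in at 0. t \<notin> (S :: complex set)"
proof -
  assume "finite S"
  then have "open (- (S - {0}))" by (intro open_Compl finite_imp_closed) auto
  then have "\<forall>\<^sub>F t in nhds 0. t \<in> - (S - {0})" by (rule eventually_nhds_in_open) simp
  then show ?thesis unfolding eventually_at_filter by eventually_elim auto
qed

lemma eventually_poly_nonzero: "p \<noteq> 0 \<Longrightarrow> \<forall>\<^sub>F t in at 0. poly p t \<noteq> (0::complex)"
  using eventually_at_0_notin_finite[OF poly_roots_finite[of p]] by simp

lemma eq_by_perturbation:
  fixes A B :: "complex \<Rightarrow> complex"
  assumes "isCont A 0" "isCont B 0" "\<forall>\<^sub>F t in at 0. A t = B t"
  shows "A 0 = B 0"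
proof -
  have "(A \<longlongrightarrow> B 0) (at 0)" using assms(2,3) by (subst tendsto_cong[OF assms(3)]) (simp add: isCont_def)
  then show ?thesis using assms(1) by (metis LIM_unique isCont_def)
qed

text \<open>The resultant with respect to formal degrees, as the product of the values of one form at the zeros
  of the other, now without restriction on the zeros: both sides are continuous in the \<open>u i\<close>, and a
  small generic perturbation reaches the case of distinct finite zeros.\<close>

lemma resultant_eq_prod:
  fixes g :: "complex poly"
  assumes g: "degree g \<le> e"
  shows "det (sylvester_mat_sub d e (\<Prod>i<d. lin (u i)) g) = (\<Prod>i<d. bform e (coeff g) (perp (u i)))"
proof -
  \<comment> \<open>The \<open>u i\<close> move in the pairwise independent directions \<open>(1, i)\<close>, which makes them independent of
     one another for small \<open>t \<noteq> 0\<close>.\<close>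
  define w where "w i t = (fst (u i) + t, snd (u i) + of_nat i * t)" for i and t :: complex
  define A where "A t = det (sylvester_mat_sub d e (\<Prod>i<d. lin (w i t)) g)" for t
  define B where "B t = (\<Prod>i<d. bform e (coeff g) (perp (w i t)))" for t
  have cA: "isCont A 0"
    unfolding A_def sylvester_mat_sub_def
    by (rule isCont_det) (auto simp: w_def intro!: isCont_if isCont_coeff_prod_lin continuous_intros)
  have cB: "isCont B 0"
    unfolding B_def w_def bform_def perp_def by (auto intro!: continuous_intros)
  have ev1: "\<forall>\<^sub>F t in at 0. \<forall>i\<in>{..<d}. poly [:fst (u i), 1:] t \<noteq> 0"
    by (intro eventually_ball_finite ballI eventually_poly_nonzero) auto
  let ?q = "\<lambda>i j. [:fst (u i), 1:] * [:snd (u j), of_nat j:] - [:snd (u i), of_nat i:] * [:fst (u j), 1:]"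
  have q: "?q i j \<noteq> 0" if "i \<noteq> j" for i j
  proof
    assume "?q i j = 0"
    then have "coeff (?q i j) 2 = 0" by simp
    then show False using that by (simp add: numeral_2_eq_2)
  qed
  have ev2: "\<forall>\<^sub>F t in at 0. \<forall>p\<in>{p \<in> {..<d} \<times> {..<d}. fst p \<noteq> snd p}. poly (?q (fst p) (snd p)) t \<noteq> 0"
    by (intro eventually_ball_finite ballI eventually_poly_nonzero q) auto
  have "\<forall>\<^sub>F t in at 0. A t = B t"
    using ev1 ev2
  proof eventually_elim
    case (elim t)
    show ?case unfolding A_def B_def
    proof (rule resultant_distinct_roots[OF g])
      fix i assume "i < d" then show "fst (w i t) \<noteq> 0" using elim(1) by (auto simp: w_def)
    next
      fix i j assume "i < d" "j < d" "i \<noteq> j"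
      then have "poly (?q i j) t \<noteq> 0" using elim(2) by force
      then show "fst (w i t) * snd (w j t) \<noteq> snd (w i t) * fst (w j t)" by (simp add: w_def algebra_simps)
    qed
  qed
  then have "A 0 = B 0" by (rule eq_by_perturbation[OF cA cB])
  then show ?thesis by (simp add: A_def B_def w_def)
qed

section \<open>The discriminant\<close>

text \<open>The value of the product of the forms \<open>pairing (u j)\<close>, \<open>j \<noteq> i\<close>, at the zero of \<open>pairing (u i)\<close>;
  the differential of the whole product at that zero is this number times \<open>pairing (u i)\<close>.\<close>

definition cofac :: "nat \<Rightarrow> (nat \<Rightarrow> complex \<times> complex) \<Rightarrow> nat \<Rightarrow> complex" where
  "cofac d u i = (\<Prod>j\<in>{..<d} - {i}. pairing (u j) (perp (u i)))"

lemma has_cd_bform: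
  assumes "d \<ge> 1"
  shows "has_cd (bform d a) (bform (d - 1) (\<lambda>j. of_nat (j + 1) * a (j + 1)) \<omega>) (bform (d - 1) (\<lambda>j. of_nat (d - j) * a j) \<omega>) \<omega>"
proof -
  obtain \<xi> \<eta> where \<omega>: "\<omega> = (\<xi>, \<eta>)" by force
  obtain d' where d: "d = Suc d'" using assms by (cases d) auto
  have "((\<lambda>\<omega>. \<Sum>j\<le>d. a j * fst \<omega> ^ j * snd \<omega> ^ (d - j)) has_derivative
      (\<lambda>h. \<Sum>j\<le>d. a j * (of_nat j * \<xi> ^ (j - 1) * fst h) * \<eta> ^ (d - j) + a j * \<xi> ^ j * (of_nat (d - j) * \<eta> ^ (d - j - 1) * snd h))) (at \<omega>)"
    unfolding \<omega> by (intro has_derivative_sum) (auto intro!: derivative_eq_intros simp: algebra_simps fun_eq_iff)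
  moreover have "(\<Sum>j\<le>d. a j * (of_nat j * \<xi> ^ (j - 1) * h1) * \<eta> ^ (d - j) + a j * \<xi> ^ j * (of_nat (d - j) * \<eta> ^ (d - j - 1) * h2)) =
      bform (d - 1) (\<lambda>j. of_nat (j + 1) * a (j + 1)) \<omega> * h1 + bform (d - 1) (\<lambda>j. of_nat (d - j) * a j) \<omega> * h2" for h1 h2
  proof -
    have "(\<Sum>j\<le>d. a j * (of_nat j * \<xi> ^ (j - 1) * h1) * \<eta> ^ (d - j)) = (\<Sum>j\<le>d'. a (Suc j) * (of_nat (Suc j) * \<xi> ^ j * h1) * \<eta> ^ (d' - j))"
      unfolding d by (subst sum.atMost_Suc_shift) simp
    moreover have "(\<Sum>j\<le>d. a j * \<xi> ^ j * (of_nat (d - j) * \<eta> ^ (d - j - 1) * h2)) = (\<Sum>j\<le>d'. a j * \<xi> ^ j * (of_nat (d - j) * \<eta> ^ (d - j - 1) * h2))"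
      unfolding d by simp
    ultimately show ?thesis
      unfolding sum.distrib bform_def \<omega> sum_distrib_right by (simp add: d algebra_simps)
  qed
  ultimately show ?thesis unfolding has_cd_def bform_def[of d, abs_def] by simp
qed

lemma has_cd_pairing: "has_cd (pairing u) (fst u) (snd u) \<omega>"
  unfolding has_cd_def pairing_def[abs_def] by (auto intro!: derivative_eq_intros)

lemma differentiable_prod_pairing: "\<exists>a b. has_cd (\<lambda>\<omega>. \<Prod>i\<in>I. pairing (u i) \<omega>) a b \<omega>"
proof (induction I rule: infinite_finite_induct)
  case (insert i I)
  then obtain a b where ab: "has_cd (\<lambda>\<omega>. \<Prod>i\<in>I. pairing (u i) \<omega>) a b \<omega>" by blast
  show ?case using has_cd_mult[OF has_cd_pairing[of "u i"] ab] insert by auto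
qed (auto intro: has_cd_const)

lemma has_cd_prod_pairing_root:
  assumes "i < d"
  shows "has_cd (\<lambda>\<omega>. \<Prod>i<d. pairing (u i) \<omega>) (fst (u i) * cofac d u i) (snd (u i) * cofac d u i) (perp (u i))"
proof -
  obtain a b where ab: "has_cd (\<lambda>\<omega>. \<Prod>j\<in>{..<d} - {i}. pairing (u j) \<omega>) a b (perp (u i))"
    using differentiable_prod_pairing by blast
  have "has_cd (\<lambda>\<omega>. pairing (u i) \<omega> * (\<Prod>j\<in>{..<d} - {i}. pairing (u j) \<omega>)) (fst (u i) * cofac d u i) (snd (u i) * cofac d u i) (perp (u i))"
    using has_cd_mult[OF has_cd_pairing[of "u i"] ab] by (simp add: cofac_def)
  moreover have "(\<lambda>\<omega>. \<Prod>i<d. pairing (u i) \<omega>) = (\<lambda>\<omega>. pairing (u i) \<omega> * (\<Prod>j\<in>{..<d} - {i}. pairing (u j) \<omega>))"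
    using assms by (intro ext prod.remove) auto
  ultimately show ?thesis by simp
qed

lemma bform_scale: "bform d a (t * fst \<omega>, t * snd \<omega>) = t ^ d * bform d a \<omega>"
proof -
  have "a j * (t * fst \<omega>) ^ j * (t * snd \<omega>) ^ (d - j) = t ^ d * (a j * fst \<omega> ^ j * snd \<omega> ^ (d - j))" if "j \<le> d" for j
  proof -
    have "t ^ d = t ^ j * t ^ (d - j)" using that by (simp flip: power_add)
    then show ?thesis by (simp add: power_mult_distrib mult_ac)
  qed
  then show ?thesis unfolding bform_def sum_distrib_left by (auto intro: sum.cong)
qed

lemma bform_euler:
  assumes "has_cd (bform d a) p q \<omega>"
  shows "p * fst \<omega> + q * snd \<omega> = of_nat d * bform d a \<omega>"
proof -
  have "((\<lambda>t. bform d a (t * fst \<omega>, t * snd \<omega>)) has_field_derivative (p * fst \<omega> + q * snd \<omega>)) (at 1)"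
    by (rule has_cd_curve) (use assms in \<open>auto intro!: derivative_eq_intros\<close>)
  moreover have "((\<lambda>t. t ^ d * bform d a \<omega>) has_field_derivative of_nat d * bform d a \<omega>) (at 1)"
    by (auto intro!: derivative_eq_intros)
  ultimately show ?thesis unfolding bform_scale by (rule DERIV_unique)
qed

text \<open>At a zero of \<open>f\<^sub>\<xi>\<close>, Euler's relation turns the value of \<open>f\<^sub>\<eta>\<close> into the value of \<open>f\<close>. So the resultant of
  \<open>f\<^sub>\<xi>\<close> and \<open>f\<^sub>\<eta>\<close> becomes that of \<open>f\<^sub>\<xi>\<close> and \<open>f\<close>, which exchanging the two products evaluates
  as a product of values of \<open>f\<^sub>\<xi>\<close> at the zeros of \<open>f\<close>. Euler's relation introduces the first coordinates of the
  zeros of \<open>f\<^sub>\<xi>\<close>, whence the assumption that the leading coefficient of \<open>f\<close> is nonzero.\<close>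

lemma disc_resultant:
  assumes d: "d \<ge> 2" and nz: "\<And>i. i < d \<Longrightarrow> fst (u i) \<noteq> 0"
    and a: "\<And>j. j \<le> d \<Longrightarrow> a j = coeff (\<Prod>i<d. lin (u i)) j"
  shows "det (sylvester_mat_sub (d - 1) (d - 1) (form_poly (d - 1) (\<lambda>j. of_nat (j + 1) * a (j + 1)))
      (form_poly (d - 1) (\<lambda>j. of_nat (d - j) * a j))) = of_nat d ^ (d - 2) * (\<Prod>i<d. cofac d u i)"
proof -
  let ?p = "\<lambda>j. of_nat (j + 1) * a (j + 1)" and ?q = "\<lambda>j. of_nat (d - j) * a j"
  let ?P = "bform (d - 1) ?p" and ?Q = "bform (d - 1) ?q"
  let ?Res = "det (sylvester_mat_sub (d - 1) (d - 1) (form_poly (d - 1) ?p) (form_poly (d - 1) ?q))"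
  have F: "bform d a = (\<lambda>\<omega>. \<Prod>i<d. pairing (u i) \<omega>)"
    using bform_cong[of d a "coeff (\<Prod>i<d. lin (u i))"] a by (simp add: bform_prod_lin fun_eq_iff)
  have cd: "has_cd (bform d a) (?P \<omega>) (?Q \<omega>) \<omega>" for \<omega> using has_cd_bform[of d a \<omega>] d by simp
  obtain ws where ws: "is_factorization (d - 1) ?p ws" by (rule factorization_exists[of "d - 1" ?p]) (use d in auto)
  have wlen: "length ws = d - 1" and wP: "?P \<omega> = (\<Prod>l<d - 1. pairing (ws ! l) \<omega>)" for \<omega>
    using ws by (auto simp: is_factorization_iff simp del: split_paired_All)
  have fp: "form_poly (d - 1) ?p = (\<Prod>l<d - 1. lin (ws ! l))"
    by (rule poly_eqI) (use is_factorization_coeff[OF ws] degree_prod_lin[of "\<lambda>l. ws ! l" "d - 1"] in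
        \<open>auto simp: coeff_form_poly coeff_eq_0\<close>)
  have Res: "?Res = (\<Prod>l<d - 1. ?Q (perp (ws ! l)))"
    unfolding fp by (subst resultant_eq_prod[OF degree_form_poly]) (simp add: bform_form_poly)
  have ad: "a d = (\<Prod>i<d. fst (u i))"
    using F bform_infinity[of d a 1] by (simp add: pairing_def)
  have lead: "(\<Prod>l<d - 1. fst (ws ! l)) = of_nat d * a d"
    using wP[of "(1, 0)"] bform_infinity[of "d - 1" ?p 1] d by (simp add: pairing_def)
  have Euler: "fst (ws ! l) * ?Q (perp (ws ! l)) = of_nat d * bform d a (perp (ws ! l))" if "l < d - 1" for l
  proof -
    have "?P (perp (ws ! l)) = 0" unfolding wP by (rule prod_zero, simp, rule bexI[of _ l]) (use that in auto)
    then show ?thesis using bform_euler[OF cd[of "perp (ws ! l)"]] by (simp add: perp_def mult.commute)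
  qed
  have Pu: "?P (perp (u i)) = fst (u i) * cofac d u i" if "i < d" for i
    using has_cd_pd(1)[OF has_cd_prod_pairing_root[OF that, of u]] has_cd_pd(1)[OF cd[of "perp (u i)"]] F by simp
  have sw: "pairing v (perp w) = - pairing w (perp v)" for v w by (simp add: pairing_perp)
  have "of_nat d * a d * ?Res = (\<Prod>l<d - 1. fst (ws ! l) * ?Q (perp (ws ! l)))"
    unfolding Res lead[symmetric] by (simp add: prod.distrib)
  also have "\<dots> = (\<Prod>l<d - 1. of_nat d * (\<Prod>i<d. pairing (u i) (perp (ws ! l))))"
    using Euler F by simp
  also have "\<dots> = of_nat d ^ (d - 1) * (\<Prod>i<d. \<Prod>l<d - 1. pairing (u i) (perp (ws ! l)))"
  proof -
    have "(\<Prod>l<d - 1. \<Prod>i<d. pairing (u i) (perp (ws ! l))) = (\<Prod>i<d. \<Prod>l<d - 1. pairing (u i) (perp (ws ! l)))"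
      by (rule prod.swap)
    then show ?thesis by (simp only: prod.distrib prod_constant card_lessThan)
  qed
  also have "(\<Prod>i<d. \<Prod>l<d - 1. pairing (u i) (perp (ws ! l))) = (\<Prod>i<d. (- 1) ^ (d - 1) * ?P (perp (u i)))"
  proof (rule prod.cong)
    fix i
    have "(\<Prod>l<d - 1. pairing (u i) (perp (ws ! l))) = (\<Prod>l<d - 1. - 1 * pairing (ws ! l) (perp (u i)))"
      by (rule prod.cong[OF refl]) (simp add: pairing_perp)
    then show "(\<Prod>l<d - 1. pairing (u i) (perp (ws ! l))) = (- 1) ^ (d - 1) * ?P (perp (u i))"
      unfolding wP prod.distrib by simp
  qed simp
  also have "\<dots> = (\<Prod>i<d. (- 1) ^ (d - 1) * (fst (u i) * cofac d u i))" using Pu by simp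
  also have "\<dots> = ((- 1) ^ (d - 1)) ^ d * (a d * (\<Prod>i<d. cofac d u i))" by (simp add: prod.distrib ad)
  also have "((- 1) ^ (d - 1)) ^ d = (1::complex)"
    by (simp flip: power_mult)
  finally have "of_nat d * a d * ?Res = of_nat d ^ (d - 1) * (a d * (\<Prod>i<d. cofac d u i))" by simp
  moreover have "(of_nat d :: complex) ^ (d - 1) = of_nat d * of_nat d ^ (d - 2)"
  proof -
    have "d - 1 = Suc (d - 2)" using d by simp
    then show ?thesis by (simp only: power_Suc)
  qed
  moreover have "a d \<noteq> 0" using ad nz by simp
  ultimately show ?thesis using d by simp
qed

lemma bdisc_conv:
  assumes "d \<ge> 1"
  shows "bdisc d a = (- 1) ^ (d * (d - 1) div 2) * of_nat d powi (2 - int d) *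
    det (sylvester_mat_sub (d - 1) (d - 1) (form_poly (d - 1) (\<lambda>j. of_nat (j + 1) * a (j + 1)))
      (form_poly (d - 1) (\<lambda>j. of_nat (d - j) * a j)))"
proof -
  have 1: "(\<Sum>j=1..d. monom (of_nat j * a j) (j - 1)) = form_poly (d - 1) (\<lambda>j. of_nat (j + 1) * a (j + 1))"
    unfolding form_poly_def
    by (rule sum.reindex_bij_witness[of _ "\<lambda>j. j + 1" "\<lambda>j. j - 1"]) (use assms in auto)
  have 2: "{..<d} = {..d - 1}" using assms by auto
  show ?thesis unfolding bdisc_def Let_def 1 form_poly_def 2 by simp
qed

text \<open>The discriminant is, up to sign, the product over ordered pairs of factors of their determinants.
  Continuity removes the assumption of the preceding lemma on the leading coefficient.\<close>

theorem bdisc_eq_prod: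
  assumes d: "d \<ge> 1" and fac: "is_factorization d a us"
  shows "bdisc d a = (- 1) ^ (d * (d - 1) div 2) * (\<Prod>i<d. cofac d (\<lambda>i. us ! i) i)"
proof (cases "d = 1")
  case True
  have "det (sylvester_mat_sub 0 0 p q) = 1" for p q :: "complex poly"
    by (subst det_def'[of _ 0]) (auto simp: sylvester_mat_sub_def sign_def)
  then show ?thesis using True by (simp add: bdisc_conv cofac_def lessThan_Suc)
next
  case False
  then have d2: "d \<ge> 2" using d by simp
  define w where "w i t = (fst (us ! i) + t, snd (us ! i))" for i and t :: complex
  define a' where "a' t = coeff (\<Prod>i<d. lin (w i t))" for t
  define A where "A t = det (sylvester_mat_sub (d - 1) (d - 1) (form_poly (d - 1) (\<lambda>j. of_nat (j + 1) * a' t (j + 1)))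
      (form_poly (d - 1) (\<lambda>j. of_nat (d - j) * a' t j)))" for t
  define B where "B t = of_nat d ^ (d - 2) * (\<Prod>i<d. cofac d (\<lambda>i. w i t) i)" for t
  have ca': "isCont (\<lambda>t. a' t j) 0" for j
    unfolding a'_def by (rule isCont_coeff_prod_lin) (auto simp: w_def intro!: continuous_intros)
  have cA: "isCont A 0"
    unfolding A_def sylvester_mat_sub_def
    unfolding coeff_form_poly by (rule isCont_det) (auto intro!: isCont_if ca' continuous_intros)
  have cB: "isCont B 0"
    unfolding B_def cofac_def w_def pairing_def perp_def by (auto intro!: continuous_intros)
  have "\<forall>\<^sub>F t in at 0. \<forall>i\<in>{..<d}. poly [:fst (us ! i), 1:] t \<noteq> 0"
    by (intro eventually_ball_finite ballI eventually_poly_nonzero) auto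
  then have "\<forall>\<^sub>F t in at 0. A t = B t"
  proof eventually_elim
    case (elim t)
    show ?case unfolding A_def B_def
      by (rule disc_resultant[OF d2]) (use elim in \<open>auto simp: w_def a'_def\<close>)
  qed
  then have "A 0 = B 0" by (rule eq_by_perturbation[OF cA cB])
  moreover have "a' 0 j = a j" if "j \<le> d" for j
    using is_factorization_coeff[OF fac that] by (simp add: a'_def w_def)
  then have "A 0 = det (sylvester_mat_sub (d - 1) (d - 1) (form_poly (d - 1) (\<lambda>j. of_nat (j + 1) * a (j + 1)))
      (form_poly (d - 1) (\<lambda>j. of_nat (d - j) * a j)))"
    unfolding A_def form_poly_def using d by (intro arg_cong[of _ _ det] arg_cong2[of _ _ _ _ "sylvester_mat_sub _ _"] sum.cong) auto
  ultimately have R: "det (sylvester_mat_sub (d - 1) (d - 1) (form_poly (d - 1) (\<lambda>j. of_nat (j + 1) * a (j + 1)))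
      (form_poly (d - 1) (\<lambda>j. of_nat (d - j) * a j))) = of_nat d ^ (d - 2) * (\<Prod>i<d. cofac d (\<lambda>i. us ! i) i)"
    by (simp add: B_def w_def)
  have "(of_nat d :: complex) powi (2 - int d) * of_nat d ^ (d - 2) = 1"
  proof -
    have e: "2 - int d = - int (d - 2)" using d2 by simp
    show ?thesis unfolding e power_int_minus power_int_of_nat using d2 by simp
  qed
  then show ?thesis unfolding bdisc_conv[OF d] R by (simp add: mult.assoc[symmetric])
qed

section \<open>Wronskian determinants\<close>

text \<open>The transition from \<open>R'\<close> to \<open>R\<close> is a lower triangular matrix with diagonal entries \<open>T i i\<close>.\<close>

lemma det_lower_combination:
  fixes R R' T :: "nat \<Rightarrow> nat \<Rightarrow> complex"
  assumes "\<And>i j. i < N \<Longrightarrow> j < N \<Longrightarrow> R i j = (\<Sum>l\<le>i. T i l * R' l j)"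
  shows "det (mat N N (\<lambda>(i,j). R i j)) = (\<Prod>i<N. T i i) * det (mat N N (\<lambda>(i,j). R' i j))"
proof -
  let ?L = "mat N N (\<lambda>(i,l). if l \<le> i then T i l else 0)"
  have "mat N N (\<lambda>(i,j). R i j) = ?L * mat N N (\<lambda>(i,j). R' i j)"
  proof (rule eq_matI)
    fix i j assume "i < dim_row (?L * mat N N (\<lambda>(i,j). R' i j))" "j < dim_col (?L * mat N N (\<lambda>(i,j). R' i j))"
    then have ij: "i < N" "j < N" by auto
    have "(?L * mat N N (\<lambda>(i,j). R' i j)) $$ (i, j) = (\<Sum>l = 0..<N. (if l \<le> i then T i l else 0) * R' l j)"
      using ij by (simp add: scalar_prod_def)
    also have "\<dots> = (\<Sum>l\<le>i. T i l * R' l j)"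
      using ij by (intro sum.mono_neutral_cong_right) auto
    finally show "mat N N (\<lambda>(i,j). R i j) $$ (i, j) = (?L * mat N N (\<lambda>(i,j). R' i j)) $$ (i, j)"
      using assms ij by simp
  qed auto
  then have "det (mat N N (\<lambda>(i,j). R i j)) = det ?L * det (mat N N (\<lambda>(i,j). R' i j))"
    by (simp add: det_mult[of _ N])
  also have "det ?L = prod_list (diag_mat ?L)" by (rule det_lower_triangular[of N]) auto
  also have "\<dots> = (\<Prod>i<N. T i i)"
    unfolding diag_mat_def by (simp add: prod.list_conv_set_nth atLeast0LessThan)
  finally show ?thesis .
qed

text \<open>The coefficients of \<open>H i = \<Sum>\<^sub>l row_coeff i l \<cdot> u\<^sup>l(H 0)\<close> for functions with
  \<open>H (i + 1) = a i \<cdot> u(H i) + b i \<cdot> H i\<close>. They do not depend on \<open>H 0\<close>, so the rows of a matrix whose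
  columns all satisfy this recursion are lower triangular combinations of the rows of a Wronskian matrix.\<close>

primrec row_coeff :: "vfield \<Rightarrow> (nat \<Rightarrow> complex \<times> complex \<Rightarrow> complex) \<Rightarrow> (nat \<Rightarrow> complex \<times> complex \<Rightarrow> complex) \<Rightarrow>
    nat \<Rightarrow> nat \<Rightarrow> complex \<times> complex \<Rightarrow> complex" where
  "row_coeff u a b 0 = (\<lambda>l z. if l = 0 then 1 else 0)"
| "row_coeff u a b (Suc i) = (\<lambda>l z. a i z * (lie u (row_coeff u a b i l) z + (if l = 0 then 0 else row_coeff u a b i (l - 1) z)) + b i z * row_coeff u a b i l z)"

context
  fixes u :: vfield and U :: "(complex \<times> complex) set" and a b :: "nat \<Rightarrow> complex \<times> complex \<Rightarrow> complex"
  assumes u: "holo_vfield u U" and a: "\<And>i. holo2 (a i) U" and b: "\<And>i. holo2 (b i) U"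
begin

lemma holo2_row_coeff: "holo2 (row_coeff u a b i l) U"
proof (induction i arbitrary: l)
  case 0 show ?case using holo2_open[OF a] by (auto intro: holo2_const)
next
  case (Suc i) then show ?case
    using holo2_open[OF a] by (cases "l = 0") (auto intro!: holo2_add holo2_mult holo2_lie u a b holo2_const)
qed

lemma row_coeff_above_diagonal: "l > i \<Longrightarrow> z \<in> U \<Longrightarrow> row_coeff u a b i l z = 0"
proof (induction i arbitrary: l z)
  case 0 then show ?case by simp
next
  case (Suc i)
  have "lie u (row_coeff u a b i l) z = lie u (\<lambda>_. 0) z"
    using Suc holo2_open[OF a] by (intro lie_cong[of _ U]) (auto intro: holo2_const)
  also have "\<dots> = 0" using lie_has_cd[OF has_cd_const] by simp
  finally show ?case using Suc by simp
qed

lemma row_coeff_diagonal: "z \<in> U \<Longrightarrow> row_coeff u a b i i z = (\<Prod>l<i. a l z)"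
proof (induction i)
  case 0 then show ?case by simp
next
  case (Suc i)
  have "lie u (row_coeff u a b i (Suc i)) z = lie u (\<lambda>_. 0) z"
    using Suc row_coeff_above_diagonal[of i "Suc i"] holo2_open[OF a] by (intro lie_cong[of _ U]) (auto intro: holo2_const)
  also have "\<dots> = 0" using lie_has_cd[OF has_cd_const] by simp
  finally show ?case using Suc row_coeff_above_diagonal[of i "Suc i" z] by simp
qed

lemma row_recursion_expand:
  assumes H: "\<And>i. holo2 (H i) U"
    and rec: "\<And>i z. z \<in> U \<Longrightarrow> H (Suc i) z = a i z * lie u (H i) z + b i z * H i z"
    and z: "z \<in> U"
  shows "H i z = (\<Sum>l\<le>i. row_coeff u a b i l z * (lie u ^^ l) (H 0) z)"
  using z
proof (induction i arbitrary: z)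
  case 0 then show ?case by simp
next
  case (Suc i)
  let ?X = "\<lambda>l. (lie u ^^ l) (H 0)" and ?T = "row_coeff u a b i"
  have X: "holo2 (?X l) U" for l by (rule holo2_lie_funpow[OF u H])
  have "lie u (H i) z = lie u (\<lambda>z. \<Sum>l\<le>i. ?T l z * ?X l z) z"
  proof (rule lie_cong[where U = U])
    show "holo2 (\<lambda>z. \<Sum>l\<le>i. ?T l z * ?X l z) U"
      by (intro holo2_sum holo2_mult holo2_row_coeff X holo2_open[OF a])
  qed (use Suc in auto)
  also have "\<dots> = (\<Sum>l\<le>i. lie u (\<lambda>z. ?T l z * ?X l z) z)"
    by (rule lie_sum[where U = U]) (use Suc in \<open>auto intro!: holo2_mult holo2_row_coeff X holo2_open[OF a]\<close>)
  also have "\<dots> = (\<Sum>l\<le>i. lie u (?T l) z * ?X l z + ?T l z * ?X (Suc l) z)"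
    by (intro sum.cong refl) (simp add: lie_mult[OF holo2_row_coeff X Suc.prems])
  finally have 1: "lie u (H i) z = (\<Sum>l\<le>i. lie u (?T l) z * ?X l z) + (\<Sum>l\<le>i. ?T l z * ?X (Suc l) z)"
    by (simp add: sum.distrib)
  have lz: "lie u (?T (Suc i)) z = 0"
  proof -
    have "lie u (?T (Suc i)) z = lie u (\<lambda>_. 0) z"
      using row_coeff_above_diagonal[of i "Suc i"] holo2_open[OF a] Suc.prems by (intro lie_cong[of _ U]) (auto intro: holo2_const)
    then show ?thesis using lie_has_cd[OF has_cd_const] by simp
  qed
  have "(\<Sum>l\<le>Suc i. row_coeff u a b (Suc i) l z * ?X l z) =
     a i z * (\<Sum>l\<le>Suc i. lie u (?T l) z * ?X l z) + a i z * (\<Sum>l\<le>Suc i. (if l = 0 then 0 else ?T (l - 1) z) * ?X l z)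
      + b i z * (\<Sum>l\<le>Suc i. ?T l z * ?X l z)"
    by (simp only: sum_distrib_left sum.distrib[symmetric] row_coeff.simps)
       (intro sum.cong refl, simp add: algebra_simps)
  also have "(\<Sum>l\<le>Suc i. lie u (?T l) z * ?X l z) = (\<Sum>l\<le>i. lie u (?T l) z * ?X l z)"
    using lz by simp
  also have "(\<Sum>l\<le>Suc i. (if l = 0 then 0 else ?T (l - 1) z) * ?X l z) = (\<Sum>l\<le>i. ?T l z * ?X (Suc l) z)"
    by (subst sum.atMost_Suc_shift) simp
  also have "(\<Sum>l\<le>Suc i. ?T l z * ?X l z) = (\<Sum>l\<le>i. ?T l z * ?X l z)"
    using row_coeff_above_diagonal[of i "Suc i" z] Suc.prems by simp
  also have "(\<Sum>l\<le>i. ?T l z * ?X l z) = H i z" using Suc by simp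
  finally show ?case using rec[OF Suc.prems, of i] 1 by (simp add: algebra_simps)
qed

lemma det_row_recursion:
  assumes H: "\<And>i j. j < N \<Longrightarrow> holo2 (H i j) U"
    and rec: "\<And>i j z. j < N \<Longrightarrow> z \<in> U \<Longrightarrow> H (Suc i) j z = a i z * lie u (H i j) z + b i z * H i j z"
    and z: "z \<in> U"
  shows "det (mat N N (\<lambda>(i,j). H i j z)) =
    (\<Prod>i<N. \<Prod>l<i. a l z) * det (mat N N (\<lambda>(i,j). (lie u ^^ i) (H 0 j) z))"
proof -
  have "det (mat N N (\<lambda>(i,j). H i j z)) =
     (\<Prod>i<N. row_coeff u a b i i z) * det (mat N N (\<lambda>(i,j). (lie u ^^ i) (H 0 j) z))"
    by (rule det_lower_combination[where T = "\<lambda>i l. row_coeff u a b i l z"]) (rule row_recursion_expand[OF H rec z])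
  then show ?thesis using z by (simp add: row_coeff_diagonal)
qed

end

lemma lie_funpow_cong:
  assumes "holo_vfield u U" "holo2 f U" "z \<in> U" "\<And>w. w \<in> U \<Longrightarrow> f w = g w"
  shows "(lie u ^^ i) g z = (lie u ^^ i) f z"
  using assms(3)
proof (induction i arbitrary: z)
  case 0 then show ?case using assms(4) by simp
next
  case (Suc i)
  have "lie u ((lie u ^^ i) g) z = lie u ((lie u ^^ i) f) z"
    by (rule lie_cong[OF holo2_lie_funpow[OF assms(1,2)]]) (use Suc in auto)
  then show ?case by simp
qed

lemma prod_power_index: "(\<Prod>i<N. (x::complex) ^ i) = x ^ (N * (N - 1) div 2)"
proof -
  have "2 * (\<Sum>i<N. i) = N * (N - 1)"
  proof (induction N)
    case (Suc N) then show ?case by (cases N) auto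
  qed simp
  then have "(\<Sum>i<N. i) = N * (N - 1) div 2" by simp
  then show ?thesis by (simp flip: power_sum)
qed

lemma sigma_scale:
  assumes u: "holo_vfield u U" and a: "holo2 a U" and S: "\<And>s. s \<in> set S \<Longrightarrow> holo2 s U" and z: "z \<in> U"
  shows "sigma S (\<lambda>z. (a z * fst (u z), a z * snd (u z))) z = a z ^ (length S * (length S - 1) div 2) * sigma S u z"
proof -
  let ?u = "\<lambda>z. (a z * fst (u z), a z * snd (u z))"
  have u': "holo_vfield ?u U" using u a unfolding holo_vfield_def comp_def by (auto intro: holo2_mult)
  have "det (mat (length S) (length S) (\<lambda>(i,j). (lie ?u ^^ i) (S ! j) z)) =
     (\<Prod>i<length S. \<Prod>l<i. a z) * det (mat (length S) (length S) (\<lambda>(i,j). (lie u ^^ i) ((lie ?u ^^ 0) (S ! j)) z))"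
  proof (rule det_row_recursion[OF u, where a = "\<lambda>_. a" and b = "\<lambda>_ _. 0"])
    show "(lie ?u ^^ Suc i) (S ! j) z = a z * lie u ((lie ?u ^^ i) (S ! j)) z + 0 * (lie ?u ^^ i) (S ! j) z" for i j z
      by (simp add: lie_def algebra_simps)
  qed (use S z a in \<open>auto intro!: holo2_lie_funpow[OF u'] holo2_const holo2_open[OF a]\<close>)
  then show ?thesis by (simp add: sigma_def prod_power_index)
qed

text \<open>The rows \<open>\<phi>\<^sup>-\<^sup>1 u\<^sup>i(\<phi> s)\<close> satisfy the recursion with \<open>a = 1\<close> and \<open>b = u(\<phi>) / \<phi>\<close>, so their determinant is
  that of the rows \<open>u\<^sup>i(s)\<close>.\<close>

lemma sigma_mult:
  assumes u: "holo_vfield u U" and \<phi>: "holo2 \<phi> U" "\<And>z. z \<in> U \<Longrightarrow> \<phi> z \<noteq> 0"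
    and S: "length S = length S'" "\<And>s. s \<in> set S \<Longrightarrow> holo2 s U" "\<And>j z. j < length S \<Longrightarrow> z \<in> U \<Longrightarrow> (S' ! j) z = \<phi> z * (S ! j) z"
    and z: "z \<in> U"
  shows "sigma S' u z = \<phi> z ^ length S * sigma S u z"
proof -
  define H where "H i j z = inverse (\<phi> z) * (lie u ^^ i) (S' ! j) z" for i j z
  note U = holo2_open[OF \<phi>(1)]
  have S': "holo2 (S' ! j) U" if "j < length S" for j
    by (rule holo2_cong[of "\<lambda>z. \<phi> z * (S ! j) z"]) (use that S \<phi> in \<open>auto intro: holo2_mult\<close>)
  have H: "holo2 (H i j) U" if "j < length S" for i j
    unfolding H_def by (intro holo2_mult holo2_inverse \<phi> holo2_lie_funpow[OF u S'[OF that]])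
  let ?b = "\<lambda>z. inverse (\<phi> z) * lie u \<phi> z"
  have b: "holo2 ?b U" by (intro holo2_mult holo2_inverse \<phi> holo2_lie u)
  have "det (mat (length S) (length S) (\<lambda>(i,j). H i j z)) =
     (\<Prod>i<length S. \<Prod>l<i. 1) * det (mat (length S) (length S) (\<lambda>(i,j). (lie u ^^ i) (H 0 j) z))"
  proof (rule det_row_recursion[OF u, where a = "\<lambda>_ _. 1" and b = "\<lambda>_. ?b"])
    fix i j z assume j: "j < length S" and z: "z \<in> U"
    have "(lie u ^^ Suc i) (S' ! j) z = lie u (\<lambda>z. \<phi> z * H i j z) z"
      unfolding funpow.simps comp_def by (rule lie_cong[of _ U]) (use \<phi> j z in \<open>auto simp: H_def[symmetric] H intro!: holo2_mult\<close>, simp add: H_def)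
    also have "\<dots> = lie u \<phi> z * H i j z + \<phi> z * lie u (H i j) z" by (rule lie_mult[OF \<phi>(1) H[OF j] z])
    finally have e: "(lie u ^^ Suc i) (S' ! j) z = lie u \<phi> z * H i j z + \<phi> z * lie u (H i j) z" .
    have i: "inverse (\<phi> z) * \<phi> z = 1" using \<phi>(2)[OF z] by simp
    have "inverse (\<phi> z) * (lie u \<phi> z * H i j z + \<phi> z * lie u (H i j) z) =
        (inverse (\<phi> z) * \<phi> z) * lie u (H i j) z + ?b z * H i j z"
      by (simp only: distrib_left mult.assoc add.commute)
    then show "H (Suc i) j z = 1 * lie u (H i j) z + ?b z * H i j z"
      unfolding H_def[of "Suc i"] e i .
  qed (use H b z U in \<open>auto intro: holo2_const\<close>)
  also have "mat (length S) (length S) (\<lambda>(i,j). (lie u ^^ i) (H 0 j) z) =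
      mat (length S) (length S) (\<lambda>(i,j). (lie u ^^ i) (S ! j) z)"
  proof (rule cong_mat)
    fix i j assume ij: "i < length S" "j < length S"
    show "(case (i, j) of (i, j) \<Rightarrow> (lie u ^^ i) (H 0 j) z) = (case (i, j) of (i, j) \<Rightarrow> (lie u ^^ i) (S ! j) z)"
      using lie_funpow_cong[OF u _ z, of "S ! j" "H 0 j" i] S \<phi> ij by (simp add: H_def)
  qed auto
  finally have 1: "det (mat (length S) (length S) (\<lambda>(i,j). H i j z)) = sigma S u z" by (simp add: sigma_def)
  have "det (mat (length S) (length S) (\<lambda>(i,j). (lie u ^^ i) (S' ! j) z)) =
     det (\<phi> z \<cdot>\<^sub>m mat (length S) (length S) (\<lambda>(i,j). H i j z))"
    by (intro arg_cong[of _ _ det] eq_matI) (use \<phi>(2)[OF z] in \<open>auto simp: H_def\<close>)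
  also have "\<dots> = \<phi> z ^ length S * sigma S u z" using 1 by simp
  finally show ?thesis using S(1) by (simp add: sigma_def)
qed

section \<open>The Hamiltonian derivation\<close>

text \<open>A function on the cotangent bundle of the plane, with base point \<open>z\<close> and covector \<open>\<omega>\<close>, that is
  homogeneous of degree \<open>m\<close> in \<open>\<omega>\<close> and has holomorphic coefficients.\<close>

definition holo_form :: "nat \<Rightarrow> (complex \<times> complex \<Rightarrow> complex \<times> complex \<Rightarrow> complex) \<Rightarrow> bool" where
  "holo_form m g \<longleftrightarrow> (\<exists>b. (\<forall>l. holo2 (b l) UNIV) \<and> (\<forall>z \<omega>. g z \<omega> = bform m (\<lambda>l. b l z) \<omega>))"

lemma holo_formI: "(\<And>l. holo2 (b l) UNIV) \<Longrightarrow> (\<And>z \<omega>. g z \<omega> = bform m (\<lambda>l. b l z) \<omega>) \<Longrightarrow> holo_form m g"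
  unfolding holo_form_def by blast

lemma holo_form_zero: "holo_form m (\<lambda>_ _. 0)"
  by (rule holo_formI[of "\<lambda>_ _. 0"]) (auto simp: bform_def intro: holo2_const)

lemma holo_form_base: "holo2 f UNIV \<Longrightarrow> holo_form 0 (\<lambda>z _. f z)"
  by (rule holo_formI[of "\<lambda>_. f"]) (auto simp: bform_def)

lemma holo_form_add:
  assumes "holo_form m g" "holo_form m h" shows "holo_form m (\<lambda>z \<omega>. g z \<omega> + h z \<omega>)"
proof -
  obtain b c where "\<And>l. holo2 (b l) UNIV" "\<And>z \<omega>. g z \<omega> = bform m (\<lambda>l. b l z) \<omega>"
    "\<And>l. holo2 (c l) UNIV" "\<And>z \<omega>. h z \<omega> = bform m (\<lambda>l. c l z) \<omega>"
    using assms unfolding holo_form_def by blast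
  then show ?thesis by (intro holo_formI[of "\<lambda>l z. b l z + c l z"])
    (auto intro: holo2_add simp: bform_def sum.distrib algebra_simps)
qed

lemma holo_form_mult:
  assumes "holo_form m g" "holo_form n h" shows "holo_form (m + n) (\<lambda>z \<omega>. g z \<omega> * h z \<omega>)"
proof -
  obtain b c where b: "\<And>l. holo2 (b l) UNIV" "\<And>z \<omega>. g z \<omega> = bform m (\<lambda>l. b l z) \<omega>"
    and c: "\<And>l. holo2 (c l) UNIV" "\<And>z \<omega>. h z \<omega> = bform n (\<lambda>l. c l z) \<omega>"
    using assms unfolding holo_form_def by blast
  let ?e = "\<lambda>l z. coeff (form_poly m (\<lambda>l. b l z) * form_poly n (\<lambda>l. c l z)) l"
  have "holo2 (?e l) UNIV" for l
    unfolding coeff_mult coeff_form_poly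
  proof (intro holo2_sum holo2_mult)
    show "holo2 (\<lambda>z. if i \<le> m then b i z else 0) UNIV" for i using b by (cases "i \<le> m") (auto intro: holo2_const)
    show "holo2 (\<lambda>z. if i \<le> n then c i z else 0) UNIV" for i using c by (cases "i \<le> n") (auto intro: holo2_const)
  qed simp
  then show ?thesis
    by (rule holo_formI[of ?e]) (simp only: bform_mult[OF degree_form_poly degree_form_poly] bform_form_poly b(2) c(2))
qed

lemma holo_form_scale: "holo_form m g \<Longrightarrow> holo_form m (\<lambda>z \<omega>. c * g z \<omega>)"
  using holo_form_mult[OF holo_form_base[OF holo2_const[of UNIV c]], of m g] by simp

lemma holo_form_diff: "holo_form m g \<Longrightarrow> holo_form m h \<Longrightarrow> holo_form m (\<lambda>z \<omega>. g z \<omega> - h z \<omega>)"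
  using holo_form_add[of m g "\<lambda>z \<omega>. -1 * h z \<omega>"] holo_form_scale[of m h "-1"] by simp

lemma holo_form_sum: "(\<And>i. i \<in> I \<Longrightarrow> holo_form m (g i)) \<Longrightarrow> holo_form m (\<lambda>z \<omega>. \<Sum>i\<in>I. g i z \<omega>)"
  by (induction I rule: infinite_finite_induct) (auto intro: holo_form_zero holo_form_add)

lemma holo_form_one: "holo_form 0 (\<lambda>_ _. 1)" using holo_form_base[OF holo2_const[of UNIV 1]] by simp

lemma holo_form_prod: "finite I \<Longrightarrow> (\<And>i. i \<in> I \<Longrightarrow> holo_form (m i) (g i)) \<Longrightarrow> holo_form (\<Sum>i\<in>I. m i) (\<lambda>z \<omega>. \<Prod>i\<in>I. g i z \<omega>)"
  by (induction I rule: finite_induct) (auto intro: holo_form_one holo_form_mult)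

lemma holo_form_det:
  assumes "\<And>i j. i < N \<Longrightarrow> j < N \<Longrightarrow> holo_form (m i) (g i j)"
  shows "holo_form (\<Sum>i<N. m i) (\<lambda>z \<omega>. det (mat N N (\<lambda>(i,j). g i j z \<omega>)))"
proof -
  have 1: "det (mat N N (\<lambda>(i,j). g i j z \<omega>)) = (\<Sum>p | p permutes {0..<N}. signof p * (\<Prod>i\<in>{..<N}. g i (p i) z \<omega>))" for z \<omega>
    by (subst det_def'[of _ N]) (auto simp: permutes_in_image atLeast0LessThan intro!: sum.cong prod.cong)
  show ?thesis unfolding 1 using assms
    by (intro holo_form_sum holo_form_scale holo_form_prod) (auto simp: permutes_in_image)
qed

lemma has_cd_sum:
  assumes "finite I" "\<And>i. i \<in> I \<Longrightarrow> has_cd (f i) (a i) (b i) z"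
  shows "has_cd (\<lambda>z. \<Sum>i\<in>I. f i z) (\<Sum>i\<in>I. a i) (\<Sum>i\<in>I. b i) z"
  using assms by (induction I rule: finite_induct) (auto intro: has_cd_const has_cd_add)

lemma has_cd_scale: "has_cd f a b z \<Longrightarrow> has_cd (\<lambda>z. f z * c) (a * c) (b * c) z"
  using has_cd_mult[OF _ has_cd_const[of c z], of f a b] by simp

lemma holo_form_pd_base:
  assumes "holo_form m g"
  shows "holo_form m (\<lambda>z \<omega>. pd1 (\<lambda>z. g z \<omega>) z)" "holo_form m (\<lambda>z \<omega>. pd2 (\<lambda>z. g z \<omega>) z)"
proof -
  obtain b where b: "\<And>l. holo2 (b l) UNIV" "\<And>z \<omega>. g z \<omega> = bform m (\<lambda>l. b l z) \<omega>"
    using assms unfolding holo_form_def by blast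
  have cd: "has_cd (\<lambda>z. g z \<omega>) (\<Sum>l\<le>m. pd1 (b l) z * (fst \<omega> ^ l * snd \<omega> ^ (m - l))) (\<Sum>l\<le>m. pd2 (b l) z * (fst \<omega> ^ l * snd \<omega> ^ (m - l))) z" for z \<omega>
    unfolding b(2) bform_def mult.assoc by (intro has_cd_sum has_cd_scale holo2_has_cd[OF b(1)]) auto
  show "holo_form m (\<lambda>z \<omega>. pd1 (\<lambda>z. g z \<omega>) z)"
    by (rule holo_formI[of "\<lambda>l. pd1 (b l)"]) (auto intro: holo2_pd1 b simp: has_cd_pd[OF cd] bform_def mult_ac)
  show "holo_form m (\<lambda>z \<omega>. pd2 (\<lambda>z. g z \<omega>) z)"
    by (rule holo_formI[of "\<lambda>l. pd2 (b l)"]) (auto intro: holo2_pd2 b simp: has_cd_pd[OF cd] bform_def mult_ac)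
qed

lemma holo_form_has_cd_fibre:
  assumes "holo_form m g" shows "has_cd (g z) (pd1 (g z) \<omega>) (pd2 (g z) \<omega>) \<omega>"
proof -
  obtain b where b: "\<And>z \<omega>. g z \<omega> = bform m (\<lambda>l. b l z) \<omega>"
    using assms unfolding holo_form_def by blast
  then have g: "g z = bform m (\<lambda>l. b l z)" by (intro ext)
  show ?thesis
  proof (cases "m = 0")
    case True
    then have "g z = (\<lambda>_. b 0 z)" using g by (auto simp: bform_def)
    then show ?thesis using has_cd_pd[OF has_cd_const[of "b 0 z" \<omega>]] has_cd_const[of "b 0 z" \<omega>] by simp
  next
    case False
    then show ?thesis using has_cd_pd[OF has_cd_bform[of m "\<lambda>l. b l z" \<omega>]] has_cd_bform[of m "\<lambda>l. b l z" \<omega>] g by simp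
  qed
qed

lemma holo_form_pd_fibre:
  assumes "holo_form m g"
  shows "holo_form (m - 1) (\<lambda>z \<omega>. pd1 (g z) \<omega>)" "holo_form (m - 1) (\<lambda>z \<omega>. pd2 (g z) \<omega>)"
    "m = 0 \<Longrightarrow> pd1 (g z) \<omega> = 0" "m = 0 \<Longrightarrow> pd2 (g z) \<omega> = 0"
proof -
  obtain b where b: "\<And>l. holo2 (b l) UNIV" "\<And>z \<omega>. g z \<omega> = bform m (\<lambda>l. b l z) \<omega>"
    using assms unfolding holo_form_def by blast
  then have g: "g z = bform m (\<lambda>l. b l z)" for z by (intro ext)
  have z0: "pd1 (g z) \<omega> = 0" "pd2 (g z) \<omega> = 0" if "m = 0" for z \<omega>
  proof -
    have "g z = (\<lambda>_. b 0 z)" using that g by (auto simp: bform_def)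
    then show "pd1 (g z) \<omega> = 0" "pd2 (g z) \<omega> = 0" using has_cd_pd[OF has_cd_const[of "b 0 z" \<omega>]] by auto
  qed
  then show "m = 0 \<Longrightarrow> pd1 (g z) \<omega> = 0" "m = 0 \<Longrightarrow> pd2 (g z) \<omega> = 0" by auto
  show "holo_form (m - 1) (\<lambda>z \<omega>. pd1 (g z) \<omega>)"
  proof (cases "m = 0")
    case True then show ?thesis using z0 holo_form_zero by simp
  next
    case False
    then have "pd1 (g z) \<omega> = bform (m - 1) (\<lambda>j. of_nat (j + 1) * b (j + 1) z) \<omega>" for z \<omega>
      unfolding g by (intro has_cd_pd[OF has_cd_bform]) simp
    then show ?thesis by (intro holo_formI[of "\<lambda>j z. of_nat (j + 1) * b (j + 1) z"]) (auto intro!: holo2_mult holo2_const b)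
  qed
  show "holo_form (m - 1) (\<lambda>z \<omega>. pd2 (g z) \<omega>)"
  proof (cases "m = 0")
    case True then show ?thesis using z0 holo_form_zero by simp
  next
    case False
    then have "pd2 (g z) \<omega> = bform (m - 1) (\<lambda>j. of_nat (m - j) * b j z) \<omega>" for z \<omega>
      unfolding g by (intro has_cd_pd[OF has_cd_bform]) simp
    then show ?thesis by (intro holo_formI[of "\<lambda>j z. of_nat (m - j) * b j z"]) (auto intro!: holo2_mult holo2_const b)
  qed
qed

lemma holo_form_total:
  assumes g: "holo_form m g" and \<omega>: "has_cd (fst \<circ> \<omega>) a1 a2 z" "has_cd (snd \<circ> \<omega>) c1 c2 z"
  shows "has_cd (\<lambda>w. g w (\<omega> w))
    (pd1 (\<lambda>w. g w (\<omega> z)) z + pd1 (g z) (\<omega> z) * a1 + pd2 (g z) (\<omega> z) * c1)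
    (pd2 (\<lambda>w. g w (\<omega> z)) z + pd1 (g z) (\<omega> z) * a2 + pd2 (g z) (\<omega> z) * c2) z"
proof -
  obtain b where b: "\<And>l. holo2 (b l) UNIV" "\<And>z \<omega>. g z \<omega> = bform m (\<lambda>l. b l z) \<omega>"
    using g unfolding holo_form_def by blast
  let ?M = "\<lambda>l w. fst w ^ l * snd w ^ (m - l) :: complex"
  have "\<exists>q r. has_cd (\<lambda>w. ?M l (\<omega> w)) q r z" for l
  proof -
    have "has_cd (\<lambda>w. (fst \<circ> \<omega>) w ^ l) (of_nat l * (fst \<circ> \<omega>) z ^ (l - 1) * a1) (of_nat l * (fst \<circ> \<omega>) z ^ (l - 1) * a2) z"
      by (rule has_cd_field_compose[OF \<omega>(1)]) (auto intro!: derivative_eq_intros)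
    moreover have "has_cd (\<lambda>w. (snd \<circ> \<omega>) w ^ (m - l)) (of_nat (m - l) * (snd \<circ> \<omega>) z ^ (m - l - 1) * c1) (of_nat (m - l) * (snd \<circ> \<omega>) z ^ (m - l - 1) * c2) z"
      by (rule has_cd_field_compose[OF \<omega>(2)]) (auto intro!: derivative_eq_intros)
    ultimately show ?thesis using has_cd_mult by (fastforce simp: comp_def)
  qed
  then obtain q r where qr: "\<And>l. has_cd (\<lambda>w. ?M l (\<omega> w)) (q l) (r l) z" by metis
  have 1: "has_cd (\<lambda>w. g w (\<omega> w)) (\<Sum>l\<le>m. pd1 (b l) z * ?M l (\<omega> z) + b l z * q l) (\<Sum>l\<le>m. pd2 (b l) z * ?M l (\<omega> z) + b l z * r l) z"
    unfolding b(2) bform_def mult.assoc by (intro has_cd_sum has_cd_mult holo2_has_cd[OF b(1)] qr) auto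
  have 2: "has_cd (\<lambda>w. g w (\<omega> z)) (\<Sum>l\<le>m. pd1 (b l) z * ?M l (\<omega> z)) (\<Sum>l\<le>m. pd2 (b l) z * ?M l (\<omega> z)) z"
    unfolding b(2) bform_def mult.assoc by (intro has_cd_sum has_cd_scale holo2_has_cd[OF b(1)]) auto
  have 3: "has_cd (\<lambda>w. g z (\<omega> w)) (\<Sum>l\<le>m. 0 * ?M l (\<omega> z) + b l z * q l) (\<Sum>l\<le>m. 0 * ?M l (\<omega> z) + b l z * r l) z"
    unfolding b(2) bform_def mult.assoc by (intro has_cd_sum has_cd_mult has_cd_const qr) auto
  have 4: "has_cd (\<lambda>w. g z (\<omega> w)) (pd1 (g z) (\<omega> z) * a1 + pd2 (g z) (\<omega> z) * c1) (pd1 (g z) (\<omega> z) * a2 + pd2 (g z) (\<omega> z) * c2) z"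
    by (rule has_cd_compose[OF \<omega> holo_form_has_cd_fibre[OF g]])
  show ?thesis
    using 1 has_cd_pd[OF 2] has_cd_pd[OF 3] has_cd_pd[OF 4] by (simp add: sum.distrib add.assoc)
qed

text \<open>The Poisson bracket of \<open>f\<close> and \<open>g\<close>, which is the derivative of \<open>g\<close> along the Hamiltonian field of \<open>f\<close>.\<close>

definition hamilton :: "(complex \<times> complex \<Rightarrow> complex \<times> complex \<Rightarrow> complex) \<Rightarrow>
    (complex \<times> complex \<Rightarrow> complex \<times> complex \<Rightarrow> complex) \<Rightarrow> complex \<times> complex \<Rightarrow> complex \<times> complex \<Rightarrow> complex" where
  "hamilton f g z \<omega> = pd1 (f z) \<omega> * pd1 (\<lambda>z. g z \<omega>) z + pd2 (f z) \<omega> * pd2 (\<lambda>z. g z \<omega>) z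
     - (pd1 (\<lambda>z. f z \<omega>) z * pd1 (g z) \<omega> + pd2 (\<lambda>z. f z \<omega>) z * pd2 (g z) \<omega>)"

lemma holo_form_hamilton:
  assumes f: "holo_form d f" and g: "holo_form m g" and d: "d \<ge> 1"
  shows "holo_form (m + (d - 1)) (hamilton f g)"
proof -
  have 1: "holo_form (m + (d - 1)) (\<lambda>z \<omega>. pd1 (f z) \<omega> * pd1 (\<lambda>z. g z \<omega>) z + pd2 (f z) \<omega> * pd2 (\<lambda>z. g z \<omega>) z)"
    by (subst add.commute, intro holo_form_add holo_form_mult holo_form_pd_fibre[OF f] holo_form_pd_base[OF g])
  have 2: "holo_form (m + (d - 1)) (\<lambda>z \<omega>. pd1 (\<lambda>z. f z \<omega>) z * pd1 (g z) \<omega> + pd2 (\<lambda>z. f z \<omega>) z * pd2 (g z) \<omega>)"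
  proof (cases "m = 0")
    case True then show ?thesis using holo_form_pd_fibre(3,4)[OF g] holo_form_zero by simp
  next
    case False
    have "holo_form (d + (m - 1)) (\<lambda>z \<omega>. pd1 (\<lambda>z. f z \<omega>) z * pd1 (g z) \<omega> + pd2 (\<lambda>z. f z \<omega>) z * pd2 (g z) \<omega>)"
      by (intro holo_form_add holo_form_mult holo_form_pd_fibre[OF g] holo_form_pd_base[OF f])
    moreover have "d + (m - 1) = m + (d - 1)" using False d by simp
    ultimately show ?thesis by simp
  qed
  show ?thesis unfolding hamilton_def[abs_def] by (rule holo_form_diff[OF 1 2])
qed

lemma holo_form_hamilton_funpow:
  assumes "holo_form d f" "holo_form m g" "d \<ge> 1"
  shows "holo_form (m + i * (d - 1)) ((hamilton f ^^ i) g)"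
proof (induction i)
  case 0 then show ?case using assms by simp
next
  case (Suc i)
  have "m + i * (d - 1) + (d - 1) = m + Suc i * (d - 1)" by simp
  then show ?case using holo_form_hamilton[OF assms(1) Suc assms(3)] by (simp only: funpow.simps comp_def)
qed

lemma holo_form_euler:
  assumes "holo_form m g" shows "pd1 (g z) \<omega> * fst \<omega> + pd2 (g z) \<omega> * snd \<omega> = of_nat m * g z \<omega>"
proof -
  obtain b where b: "\<And>z \<omega>. g z \<omega> = bform m (\<lambda>l. b l z) \<omega>" using assms unfolding holo_form_def by blast
  then have g: "g z = bform m (\<lambda>l. b l z)" by (intro ext)
  show ?thesis using bform_euler[OF holo_form_has_cd_fibre[OF assms, of z \<omega>, unfolded g]] g by simp
qed

lemma holo_form_restrict:
  assumes g: "holo_form m g" and u: "holo_vfield u U" and U: "open U"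
  shows "holo2 (\<lambda>z. g z (perp (u z))) U"
proof -
  obtain b where b: "\<And>l. holo2 (b l) UNIV" "\<And>z \<omega>. g z \<omega> = bform m (\<lambda>l. b l z) \<omega>"
    using g unfolding holo_form_def by blast
  show ?thesis unfolding b(2) bform_def perp_def
    using u unfolding holo_vfield_def comp_def
    by (auto intro!: holo2_sum U holo2_mult holo2_power holo2_minus holo2_subset[OF b(1)])
qed

text \<open>The hypotheses say that \<open>f\<close> vanishes on the covectors annihilated by \<open>u\<close> and that its fibre
  derivative there is \<open>c u\<close>. The Hamiltonian field of \<open>f\<close> is then tangent to the hypersurface of all such covectors and
  projects to \<open>c u\<close>. On the section \<open>perp u\<close> of this hypersurface it differs from the lift of \<open>c u\<close> by a
  radial vector of the fibre, which acts on a form of degree \<open>m\<close> as \<open>m\<close> times a function, by Euler's relation.\<close>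

lemma hamilton_on_root:
  assumes f: "holo_form d f" and g: "holo_form m g" and u: "holo_vfield u U"
    and root: "\<And>z. z \<in> U \<Longrightarrow> f z (perp (u z)) = 0"
    and c1: "\<And>z. z \<in> U \<Longrightarrow> pd1 (f z) (perp (u z)) = c z * fst (u z)"
    and c2: "\<And>z. z \<in> U \<Longrightarrow> pd2 (f z) (perp (u z)) = c z * snd (u z)"
    and z: "z \<in> U"
  shows "hamilton f g z (perp (u z)) = c z * lie u (\<lambda>z. g z (perp (u z))) z
     + of_nat m * (c z * (pd2 (\<lambda>z. - snd (u z)) z - pd1 (\<lambda>z. fst (u z)) z)) * g z (perp (u z))"
proof -
  let ?\<omega> = "\<lambda>z. perp (u z)"
  let ?\<xi> = "\<lambda>z. - snd (u z)" and ?\<eta> = "\<lambda>z. fst (u z)"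
  have U: "open U" using u unfolding holo_vfield_def by (auto intro: holo2_open)
  have w1: "has_cd (fst \<circ> ?\<omega>) (pd1 ?\<xi> z) (pd2 ?\<xi> z) z" and w2: "has_cd (snd \<circ> ?\<omega>) (pd1 ?\<eta> z) (pd2 ?\<eta> z) z"
    using u z unfolding holo_vfield_def comp_def perp_def by (auto intro!: holo2_has_cd[of _ U] holo2_minus)
  note tf = holo_form_total[OF f w1 w2] and tg = holo_form_total[OF g w1 w2]
  have z0: "has_cd (\<lambda>w. f w (?\<omega> w)) 0 0 z"
    by (rule has_cd_cong_open[OF has_cd_const U z]) (simp add: root)
  define fx where "fx = pd1 (\<lambda>w. f w (?\<omega> z)) z"
  define fy where "fy = pd2 (\<lambda>w. f w (?\<omega> z)) z"
  define gx where "gx = pd1 (\<lambda>w. g w (?\<omega> z)) z"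
  define gy where "gy = pd2 (\<lambda>w. g w (?\<omega> z)) z"
  define g1 where "g1 = pd1 (g z) (?\<omega> z)"
  define g2 where "g2 = pd2 (g z) (?\<omega> z)"
  define p where "p = fst (u z)"
  define q where "q = snd (u z)"
  define \<xi>x where "\<xi>x = pd1 ?\<xi> z" define \<xi>y where "\<xi>y = pd2 ?\<xi> z"
  define \<eta>x where "\<eta>x = pd1 ?\<eta> z" define \<eta>y where "\<eta>y = pd2 ?\<eta> z"
  have e1: "fx + c z * p * \<xi>x + c z * q * \<eta>x = 0" and e2: "fy + c z * p * \<xi>y + c z * q * \<eta>y = 0"
    using has_cd_pd[OF tf] has_cd_pd[OF z0] c1[OF z] c2[OF z]
    by (simp_all add: fx_def fy_def p_def q_def \<xi>x_def \<xi>y_def \<eta>x_def \<eta>y_def)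
  have eu: "g1 * (- q) + g2 * p = of_nat m * g z (?\<omega> z)"
    using holo_form_euler[OF g, of z "?\<omega> z"] by (simp add: g1_def g2_def p_def q_def perp_def)
  have L: "lie u (\<lambda>z. g z (?\<omega> z)) z = p * (gx + g1 * \<xi>x + g2 * \<eta>x) + q * (gy + g1 * \<xi>y + g2 * \<eta>y)"
    unfolding lie_has_cd[OF tg] by (simp add: gx_def gy_def g1_def g2_def p_def q_def \<xi>x_def \<xi>y_def \<eta>x_def \<eta>y_def)
  have Hm: "hamilton f g z (?\<omega> z) = c z * p * gx + c z * q * gy - (fx * g1 + fy * g2)"
    unfolding hamilton_def c1[OF z] c2[OF z] by (simp add: fx_def fy_def gx_def gy_def g1_def g2_def p_def q_def)
  have fx: "fx = - (c z * p * \<xi>x + c z * q * \<eta>x)" and fy: "fy = - (c z * p * \<xi>y + c z * q * \<eta>y)"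
    using e1 e2 by (auto simp: add_eq_0_iff2 algebra_simps)
  have "hamilton f g z (?\<omega> z) = c z * lie u (\<lambda>z. g z (?\<omega> z)) z + (c z * (\<xi>y - \<eta>x)) * (g1 * (- q) + g2 * p)"
    unfolding Hm L fx fy by (simp add: algebra_simps)
  then show ?thesis unfolding eu by (simp add: \<xi>y_def \<eta>x_def mult_ac)
qed

section \<open>Holomorphy of the extactic section\<close>

text \<open>Row \<open>1\<close> is the differential of \<open>s\<close> as a linear form in \<open>\<omega>\<close>, with value \<open>u(s)\<close> at \<open>perp u\<close>, and the
  Hamiltonian derivation is applied from there on only. Starting it at row \<open>0\<close> would cost one more factor \<open>c\<close> in
  each row and replace the exponent \<open>k (k - 1) / 2\<close> of the discriminant by \<open>k (k + 1) / 2\<close>.\<close>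

definition jet_row :: "(complex \<times> complex \<Rightarrow> complex \<times> complex \<Rightarrow> complex) \<Rightarrow> nat \<Rightarrow> (complex \<times> complex \<Rightarrow> complex) \<Rightarrow>
    complex \<times> complex \<Rightarrow> complex \<times> complex \<Rightarrow> complex" where
  "jet_row f i s = (case i of 0 \<Rightarrow> (\<lambda>z _. s z)
     | Suc i \<Rightarrow> (hamilton f ^^ i) (\<lambda>z \<omega>. snd \<omega> * pd1 s z - fst \<omega> * pd2 s z))"

definition jet_degree :: "nat \<Rightarrow> nat \<Rightarrow> nat" where
  "jet_degree d i = (case i of 0 \<Rightarrow> 0 | Suc i \<Rightarrow> 1 + i * (d - 1))"

lemma holo_form_jet_row:
  assumes f: "holo_form d f" and d: "d \<ge> 1" and s: "holo2 s UNIV"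
  shows "holo_form (jet_degree d i) (jet_row f i s)"
proof (cases i)
  case 0 then show ?thesis using holo_form_base[OF s] by (simp add: jet_row_def jet_degree_def)
next
  case (Suc i')
  have "holo_form 1 (\<lambda>z \<omega>. snd \<omega> * pd1 s z - fst \<omega> * pd2 s z)"
    by (rule holo_formI[of "\<lambda>l. if l = 0 then pd1 s else (\<lambda>z. - pd2 s z)"])
       (auto simp: bform_def intro: holo2_pd1 holo2_pd2 holo2_minus s)
  from holo_form_hamilton_funpow[OF f this d, of i'] show ?thesis using Suc by (simp add: jet_row_def jet_degree_def)
qed

lemma jet_det_on_root:
  assumes f: "holo_form d f" and d: "d \<ge> 1" and u: "holo_vfield u U" and c: "holo2 c U"
    and root: "\<And>z. z \<in> U \<Longrightarrow> f z (perp (u z)) = 0"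
    and c1: "\<And>z. z \<in> U \<Longrightarrow> pd1 (f z) (perp (u z)) = c z * fst (u z)"
    and c2: "\<And>z. z \<in> U \<Longrightarrow> pd2 (f z) (perp (u z)) = c z * snd (u z)"
    and z: "z \<in> U" and S: "\<And>s. s \<in> set S \<Longrightarrow> holo2 s UNIV" and k: "length S = Suc k"
  shows "det (mat (Suc k) (Suc k) (\<lambda>(i,j). jet_row f i (S ! j) z (perp (u z)))) = c z ^ (k * (k - 1) div 2) * sigma S u z"
proof -
  let ?\<kappa> = "\<lambda>z. c z * (pd2 (\<lambda>z. - snd (u z)) z - pd1 (\<lambda>z. fst (u z)) z)"
  let ?b = "\<lambda>i z. of_nat (1 + i * (d - 1)) * ?\<kappa> z"
  define H where "H i j z = jet_row f (Suc i) (S ! j) z (perp (u z))" for i j z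
  have U: "open U" using c by (rule holo2_open)
  have b: "holo2 (?b i) U" for i
    using u unfolding holo_vfield_def comp_def by (intro holo2_mult holo2_diff holo2_const holo2_pd1 holo2_pd2 holo2_minus c U) auto
  have jf: "holo_form (1 + i * (d - 1)) (jet_row f (Suc i) (S ! j))" if "j < Suc k" for i j
    using holo_form_jet_row[OF f d S, of "S ! j" "Suc i"] that k by (simp add: jet_degree_def)
  have H: "holo2 (H i j) U" if "j < Suc k" for i j
    unfolding H_def by (rule holo_form_restrict[OF jf[OF that] u U])
  have rec: "H (Suc i) j z = c z * lie u (H i j) z + ?b i z * H i j z" if "j < Suc k" "z \<in> U" for i j z
    using hamilton_on_root[OF f jf[OF that(1), of i] u root c1 c2 that(2)] by (simp add: H_def[abs_def] jet_row_def)
  have H0: "H 0 j = lie u (S ! j)" for j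
    by (rule ext) (simp add: H_def jet_row_def lie_def perp_def)
  \<comment> \<open>Row \<open>0\<close> of the determinant is that of the Wronskian; the recursion starts with row \<open>1\<close>, applied
     to the functions \<open>u(s\<^sub>j)\<close>, so its coefficients are shifted by one in both indices.\<close>
  define T where "T i l = (case i of 0 \<Rightarrow> 1 | Suc i \<Rightarrow> (case l of 0 \<Rightarrow> 0 | Suc l \<Rightarrow> row_coeff u (\<lambda>_. c) ?b i l z))" for i l
  have "det (mat (Suc k) (Suc k) (\<lambda>(i,j). jet_row f i (S ! j) z (perp (u z)))) =
    (\<Prod>i<Suc k. T i i) * det (mat (Suc k) (Suc k) (\<lambda>(i,j). (lie u ^^ i) (S ! j) z))"
  proof (rule det_lower_combination[where T = T])
    fix i j assume ij: "i < Suc k" "j < Suc k"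
    show "jet_row f i (S ! j) z (perp (u z)) = (\<Sum>l\<le>i. T i l * (lie u ^^ l) (S ! j) z)"
    proof (cases i)
      case 0 then show ?thesis by (simp add: T_def jet_row_def)
    next
      case (Suc i')
      have "jet_row f i (S ! j) z (perp (u z)) = (\<Sum>l\<le>i'. row_coeff u (\<lambda>_. c) ?b i' l z * (lie u ^^ l) (H 0 j) z)"
        using row_recursion_expand[of u U "\<lambda>_. c" ?b "\<lambda>i. H i j" z i', OF u c b H[OF ij(2)] rec[OF ij(2)] z] Suc by (simp add: H_def)
      also have "\<dots> = (\<Sum>l\<le>i. T i l * (lie u ^^ l) (S ! j) z)"
        unfolding Suc H0 by (subst sum.atMost_Suc_shift) (simp add: T_def funpow_swap1)
      finally show ?thesis .
    qed
  qed
  also have "(\<Prod>i<Suc k. T i i) = (\<Prod>i<k. c z ^ i)"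
  proof -
    have "T (Suc i) (Suc i) = c z ^ i" for i
      using row_coeff_diagonal[of u U "\<lambda>_. c" ?b z i, OF u c b z] by (simp add: T_def)
    then show ?thesis by (subst prod.lessThan_Suc_shift) (simp add: T_def[of 0])
  qed
  finally show ?thesis by (simp add: prod_power_index sigma_def k)
qed

text \<open>The resultant of the web and of the form given by the determinant of the jet rows is polynomial in holomorphic
  coefficients, hence holomorphic everywhere. Where the web decomposes, it is the product over the factors of the
  values of that determinant, and these values bring in the cofactors whose product is the discriminant.\<close>

theorem extactic_section_holomorphic:
  assumes d: "d \<ge> 1" and a: "\<And>l. l \<le> d \<Longrightarrow> holo2 (\<lambda>z. a z l) UNIV"
    and S: "\<And>s. s \<in> set S \<Longrightarrow> holo2 s UNIV" and k: "length S = Suc k"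
  obtains E where "holo2 E UNIV"
    "\<And>U vs z. open U \<Longrightarrow> (\<And>u. u \<in> set vs \<Longrightarrow> holo_vfield u U) \<Longrightarrow>
      (\<And>z. z \<in> U \<Longrightarrow> is_factorization d (a z) (map (\<lambda>u. u z) vs)) \<Longrightarrow> z \<in> U \<Longrightarrow>
      E z = bdisc d (a z) ^ (k * (k - 1) div 2) * (\<Prod>u\<leftarrow>vs. sigma S u z)"
proof -
  let ?K = "k * (k - 1) div 2" and ?e = "\<Sum>i<Suc k. jet_degree d i"
  let ?s = "(- 1) ^ (d * (d - 1) div 2) :: complex"
  define f where "f z = bform d (a z)" for z
  have f: "holo_form d f"
  proof (rule holo_formI[of "\<lambda>l z. if l \<le> d then a z l else 0"])
    show "holo2 (\<lambda>z. if l \<le> d then a z l else 0) UNIV" for l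
      using a by (cases "l \<le> d") (simp_all add: holo2_const)
    show "f z \<omega> = bform d (\<lambda>l. if l \<le> d then a z l else 0) \<omega>" for z \<omega>
      unfolding f_def by (rule fun_cong[OF bform_cong]) simp
  qed
  have "holo_form ?e (\<lambda>z \<omega>. det (mat (Suc k) (Suc k) (\<lambda>(i,j). jet_row f i (S ! j) z \<omega>)))"
    by (rule holo_form_det, rule holo_form_jet_row[OF f d S]) (use k in auto)
  then obtain b where b: "\<And>l. holo2 (b l) UNIV"
    "\<And>z \<omega>. det (mat (Suc k) (Suc k) (\<lambda>(i,j). jet_row f i (S ! j) z \<omega>)) = bform ?e (\<lambda>l. b l z) \<omega>"
    unfolding holo_form_def by blast
  define E where "E z = ?s ^ ?K * det (sylvester_mat_sub d ?e (form_poly d (a z)) (form_poly ?e (\<lambda>l. b l z)))" for z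
  show thesis
  proof (rule that)
    have h1: "holo2 (\<lambda>z. coeff (form_poly d (a z)) l) UNIV" for l
      using a by (cases "l \<le> d") (auto simp: coeff_form_poly intro: holo2_const)
    have h2: "holo2 (\<lambda>z. coeff (form_poly ?e (\<lambda>l. b l z)) l) UNIV" for l
      using b by (cases "l \<le> ?e") (auto simp: coeff_form_poly intro: holo2_const)
    have hif: "holo2 (\<lambda>z. if P then g z else h z) UNIV" if "holo2 g UNIV" "holo2 h UNIV" for P g h
      using that by (cases P) auto
    show "holo2 E UNIV"
      unfolding E_def sylvester_mat_sub_def
      by (intro holo2_mult holo2_const holo2_det hif h1 h2) auto
  next
    fix U vs z0
    assume U: "open U" and vs: "\<And>u. u \<in> set vs \<Longrightarrow> holo_vfield u U"
      and fac: "\<And>z. z \<in> U \<Longrightarrow> is_factorization d (a z) (map (\<lambda>u. u z) vs)" and z0: "z0 \<in> U"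
    have len: "length vs = d" using fac[OF z0] by (simp add: is_factorization_iff)
    have F: "f z = (\<lambda>\<omega>. \<Prod>i<d. pairing ((vs ! i) z) \<omega>)" if "z \<in> U" for z
    proof
      fix \<omega> show "f z \<omega> = (\<Prod>i<d. pairing ((vs ! i) z) \<omega>)"
        using fac[OF that] len by (simp add: is_factorization_iff f_def del: split_paired_All)
    qed
    define c where "c i z = cofac d (\<lambda>j. (vs ! j) z) i" for i z
    have vsi: "holo_vfield (vs ! i) U" if "i < d" for i using vs len that by simp
    have c: "holo2 (c i) U" if "i < d" for i
      unfolding c_def cofac_def pairing_perp
      using vsi that by (intro holo2_prod U holo2_diff holo2_mult) (auto simp: holo_vfield_def comp_def)
    have key: "bform ?e (\<lambda>l. b l z0) (perp ((vs ! i) z0)) = c i z0 ^ ?K * sigma S (vs ! i) z0" if i: "i < d" for i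
      unfolding b(2)[symmetric]
    proof (rule jet_det_on_root[OF f d vsi[OF i] c[OF i] _ _ _ z0 S k])
      fix z assume z: "z \<in> U"
      show "f z (perp ((vs ! i) z)) = 0" unfolding F[OF z] by (rule prod_zero, simp, rule bexI[of _ i]) (use i in auto)
      have "has_cd (f z) (fst ((vs ! i) z) * c i z) (snd ((vs ! i) z) * c i z) (perp ((vs ! i) z))"
        unfolding F[OF z] c_def using has_cd_prod_pairing_root[OF i, of "\<lambda>j. (vs ! j) z"] by simp
      from has_cd_pd[OF this] show "pd1 (f z) (perp ((vs ! i) z)) = c i z * fst ((vs ! i) z)"
        "pd2 (f z) (perp ((vs ! i) z)) = c i z * snd ((vs ! i) z)" by (simp_all add: mult.commute)
    qed
    have fp: "form_poly d (a z0) = (\<Prod>i<d. lin ((vs ! i) z0))"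
    proof (rule poly_eqI)
      fix n show "coeff (form_poly d (a z0)) n = coeff (\<Prod>i<d. lin ((vs ! i) z0)) n"
        using is_factorization_coeff[OF fac[OF z0], of n] degree_prod_lin[of "\<lambda>i. (vs ! i) z0" d] len
        by (simp add: coeff_form_poly coeff_eq_0)
    qed
    have "det (sylvester_mat_sub d ?e (form_poly d (a z0)) (form_poly ?e (\<lambda>l. b l z0))) =
        (\<Prod>i<d. c i z0 ^ ?K * sigma S (vs ! i) z0)"
      unfolding fp resultant_eq_prod[OF degree_form_poly] bform_form_poly using key by simp
    moreover have "bdisc d (a z0) = ?s * (\<Prod>i<d. c i z0)"
    proof -
      have "(\<Prod>i<d. cofac d (\<lambda>i. map (\<lambda>u. u z0) vs ! i) i) = (\<Prod>i<d. c i z0)"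
        unfolding c_def cofac_def by (intro prod.cong refl) (use len in auto)
      then show ?thesis using bdisc_eq_prod[OF d fac[OF z0]] by simp
    qed
    ultimately show "E z0 = bdisc d (a z0) ^ ?K * (\<Prod>u\<leftarrow>vs. sigma S u z0)"
      using len by (simp add: E_def prod.distrib prod.list_conv_set_nth atLeast0LessThan power_mult_distrib prod_power_distrib)
  qed
qed

section \<open>Local decompositions of a web\<close>

lemma open_nonzero_set:
  fixes f :: "complex \<times> complex \<Rightarrow> complex"
  assumes "open U" "continuous_on U f" shows "open {z \<in> U. f z \<noteq> 0}"
proof -
  have "open (U \<inter> f -` (- {0}))" by (rule continuous_open_preimage[OF assms(2,1)]) auto
  moreover have "U \<inter> f -` (- {0}) = {z \<in> U. f z \<noteq> 0}" by auto
  ultimately show ?thesis by simp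
qed

lemma holo2_bdisc:
  assumes d: "d \<ge> 1" and a: "\<And>l. l \<le> d \<Longrightarrow> holo2 (\<lambda>z. a z l) U" and U: "open U"
  shows "holo2 (\<lambda>z. bdisc d (a z)) U"
proof -
  have hif: "holo2 (\<lambda>z. if P then g z else 0) U" if "P \<Longrightarrow> holo2 g U" for P g
    using that U by (cases P) (auto intro: holo2_const)
  have h1: "holo2 (\<lambda>z. coeff (form_poly (d - 1) (\<lambda>j. of_nat (j + 1) * a z (j + 1))) l) U" for l
    unfolding coeff_form_poly by (intro hif holo2_mult holo2_const U a) (use d in auto)
  have h2: "holo2 (\<lambda>z. coeff (form_poly (d - 1) (\<lambda>j. of_nat (d - j) * a z j)) l) U" for l
    unfolding coeff_form_poly by (intro hif holo2_mult holo2_const U a) (use d in auto)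
  have hif2: "holo2 (\<lambda>z. if P then g z else h z) U" if "holo2 g U" "holo2 h U" for P g h
    using that by (cases P) auto
  show ?thesis unfolding bdisc_conv[OF d] sylvester_mat_sub_def
    by (intro holo2_mult holo2_const holo2_det hif2 h1 h2 U)
qed

lemma implicit_root:
  fixes a :: "nat \<Rightarrow> complex \<times> complex \<Rightarrow> complex" and M M' :: "nat \<Rightarrow> complex \<Rightarrow> complex"
  assumes a: "\<And>j. j \<le> d \<Longrightarrow> holo2 (a j) UNIV"
    and M: "\<And>j t. (M j has_field_derivative M' j t) (at t)" and M': "\<And>j. continuous_on UNIV (M' j)"
    and 0: "(\<Sum>j\<le>d. a j z0 * M j t0) = 0" "(\<Sum>j\<le>d. a j z0 * M' j t0) \<noteq> 0"
  obtains W g where "open W" "z0 \<in> W" "holo2 g W" "g z0 = t0" "\<And>z. z \<in> W \<Longrightarrow> (\<Sum>j\<le>d. a j z * M j (g z)) = 0"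
proof -
  let ?F = "\<lambda>p. \<Sum>j\<le>d. a j (fst p) * M j (snd p)"
  have cM: "continuous_on UNIV (M j)" for j
    using M DERIV_continuous_on by blast
  have ca: "continuous_on UNIV (\<lambda>p. a j (fst p))" "continuous_on UNIV (\<lambda>p. pd1 (a j) (fst p))"
    "continuous_on UNIV (\<lambda>p. pd2 (a j) (fst p))" if "j \<le> d" for j
    by (rule continuous_on_compose2[OF holo2_cont[OF a[OF that]]] continuous_on_compose2[OF continuous_pd1[OF a[OF that]]]
        continuous_on_compose2[OF continuous_pd2[OF a[OF that]]]; auto intro!: continuous_intros)+
  have cs: "continuous_on UNIV (\<lambda>p. M j (snd p))" "continuous_on UNIV (\<lambda>p. M' j (snd p))" for j
    by (rule continuous_on_compose2[OF cM] continuous_on_compose2[OF M']; auto intro!: continuous_intros)+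
  have d: "(?F has_derivative (\<lambda>h. (\<Sum>j\<le>d. pd1 (a j) (fst p) * M j (snd p)) * fst (fst h)
      + (\<Sum>j\<le>d. pd2 (a j) (fst p) * M j (snd p)) * snd (fst h) + (\<Sum>j\<le>d. a j (fst p) * M' j (snd p)) * snd h)) (at p)" for p
  proof -
    have "((\<lambda>p. a j (fst p) * M j (snd p)) has_derivative
       (\<lambda>h. a j (fst p) * (M' j (snd p) * snd h) + (pd1 (a j) (fst p) * fst (fst h) + pd2 (a j) (fst p) * snd (fst h)) * M j (snd p))) (at p)"
      if "j \<le> d" for j
    proof (rule has_derivative_mult)
      show "((\<lambda>p. a j (fst p)) has_derivative (\<lambda>h. pd1 (a j) (fst p) * fst (fst h) + pd2 (a j) (fst p) * snd (fst h))) (at p)"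
        by (rule has_derivative_compose[OF has_derivative_fst[OF has_derivative_ident]
              holo2_has_cd[OF a[OF that] UNIV_I, unfolded has_cd_def]])
      show "((\<lambda>p. M j (snd p)) has_derivative (\<lambda>h. M' j (snd p) * snd h)) (at p)"
        by (rule has_derivative_compose[OF has_derivative_snd[OF has_derivative_ident] M[unfolded has_field_derivative_def]])
    qed
    then have "(?F has_derivative (\<lambda>h. \<Sum>j\<le>d. a j (fst p) * (M' j (snd p) * snd h) + (pd1 (a j) (fst p) * fst (fst h) + pd2 (a j) (fst p) * snd (fst h)) * M j (snd p))) (at p)"
      by (intro has_derivative_sum) auto
    then show ?thesis
      by (rule has_derivative_eq_rhs) (simp add: fun_eq_iff sum_distrib_left sum_distrib_right sum.distrib algebra_simps del: split_paired_All)
  qed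
  obtain W g where "open W" "z0 \<in> W" "holo2 g W" "g z0 = t0" "\<And>z. z \<in> W \<Longrightarrow> (z, g z) \<in> UNIV \<and> ?F (z, g z) = 0"
  proof (rule implicit_holo2[OF open_UNIV UNIV_I d])
    show "continuous_on UNIV (\<lambda>p. \<Sum>j\<le>d. pd1 (a j) (fst p) * M j (snd p))"
      "continuous_on UNIV (\<lambda>p. \<Sum>j\<le>d. pd2 (a j) (fst p) * M j (snd p))"
      "continuous_on UNIV (\<lambda>p. \<Sum>j\<le>d. a j (fst p) * M' j (snd p))"
      by (intro continuous_on_sum continuous_on_mult ca cs; simp)+
  qed (use 0 in auto)
  then show thesis using that by simp
qed

text \<open>A zero of the form with nonzero differential continues holomorphically to nearby points.\<close>

lemma root_field:
  assumes d: "d \<ge> 1" and a: "\<And>l. l \<le> d \<Longrightarrow> holo2 (\<lambda>z. a z l) UNIV"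
    and root: "bform d (a z0) (perp u0) = 0"
    and cd: "has_cd (bform d (a z0)) p q (perp u0)" and pq: "p \<noteq> 0 \<or> q \<noteq> 0"
  obtains W u where "open W" "z0 \<in> W" "holo_vfield u W" "u z0 = u0" "\<And>z. z \<in> W \<Longrightarrow> bform d (a z) (perp (u z)) = 0"
proof -
  \<comment> \<open>The covector moves along a coordinate axis on which the differential does not vanish.\<close>
  define e1 where "e1 = (if p \<noteq> 0 then 1 else 0 :: complex)"
  define e2 where "e2 = 1 - e1"
  let ?x = "\<lambda>t. - snd u0 + e1 * t" and ?y = "\<lambda>t. fst u0 + e2 * t"
  let ?M = "\<lambda>j t. ?x t ^ j * ?y t ^ (d - j)"
  let ?M' = "\<lambda>j t. of_nat j * ?x t ^ (j - 1) * e1 * ?y t ^ (d - j) + ?x t ^ j * (of_nat (d - j) * ?y t ^ (d - j - 1) * e2)"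
  have M: "(?M j has_field_derivative ?M' j t) (at t)" for j t
    by (rule derivative_eq_intros refl | simp)+
  have F: "(\<Sum>j\<le>d. a z j * ?M j t) = bform d (a z) (?x t, ?y t)" for z t
    by (simp add: bform_def mult.assoc)
  have "((\<lambda>t. \<Sum>j\<le>d. a z0 j * ?M j t) has_field_derivative (\<Sum>j\<le>d. a z0 j * ?M' j 0)) (at 0)"
    by (intro DERIV_sum DERIV_cmult M)
  moreover have "((\<lambda>t. bform d (a z0) (?x t, ?y t)) has_field_derivative (p * e1 + q * e2)) (at 0)"
    by (rule has_cd_curve) (use cd in \<open>auto intro!: derivative_eq_intros simp: perp_def\<close>)
  ultimately have C: "(\<Sum>j\<le>d. a z0 j * ?M' j 0) = p * e1 + q * e2" unfolding F by (rule DERIV_unique)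
  have C0: "(\<Sum>j\<le>d. a z0 j * ?M' j 0) \<noteq> 0" unfolding C using pq by (auto simp: e1_def e2_def)
  have r0: "(\<Sum>j\<le>d. a z0 j * ?M j 0) = 0" unfolding F using root by (simp add: perp_def)
  obtain W g where g: "open W" "z0 \<in> W" "holo2 g W" "g z0 = 0" "\<And>z. z \<in> W \<Longrightarrow> (\<Sum>j\<le>d. a z j * ?M j (g z)) = 0"
    by (rule implicit_root[of d "\<lambda>j z. a z j" ?M ?M' z0 0, OF a M _ r0 C0]) (auto intro!: continuous_intros)
  let ?u = "\<lambda>z. (fst u0 + e2 * g z, snd u0 - e1 * g z)"
  show thesis
  proof (rule that[OF g(1,2), of ?u])
    show "holo_vfield ?u W" unfolding holo_vfield_def comp_def
      by (auto intro!: holo2_add holo2_diff holo2_mult holo2_const g)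
    show "?u z0 = u0" using g(4) by simp
    show "bform d (a z) (perp (?u z)) = 0" if "z \<in> W" for z
      using g(5)[OF that] unfolding F by (simp add: perp_def)
  qed
qed

text \<open>Off the discriminant the zeros of the form at \<open>z0\<close> are simple and extend to fields \<open>w i\<close>. The form and
  the product of the \<open>w i\<close> have the same \<open>d\<close> zeros, so they differ by a factor \<open>c\<close>, which is
  absorbed into the first field.\<close>

theorem local_factorization:
  assumes d: "d \<ge> 1" and a: "\<And>l. l \<le> d \<Longrightarrow> holo2 (\<lambda>z. a z l) UNIV" and disc: "bdisc d (a z0) \<noteq> 0"
    and Om: "open Om" "z0 \<in> Om"
  obtains U vs where "open U" "z0 \<in> U" "U \<subseteq> Om" "\<And>u. u \<in> set vs \<Longrightarrow> holo_vfield u U"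
    "\<And>z. z \<in> U \<Longrightarrow> is_factorization d (a z) (map (\<lambda>u. u z) vs)" "\<And>z. z \<in> U \<Longrightarrow> bdisc d (a z) \<noteq> 0"
proof (cases "d = 1")
  case True
  have hd: "holo2 (\<lambda>z. bdisc d (a z)) Om" by (rule holo2_subset[OF holo2_bdisc[OF d a]]) (use Om in auto)
  let ?U = "{z \<in> Om. bdisc d (a z) \<noteq> 0}"
  let ?v = "\<lambda>z. (a z 1, a z 0)"
  have U: "open ?U" by (rule open_nonzero_set[OF Om(1) holo2_cont[OF hd]])
  show ?thesis
  proof (rule that[of ?U "[?v]"])
    show "holo_vfield u ?U" if "u \<in> set [?v]" for u
    proof -
      have "holo2 (\<lambda>z. a z l) ?U" if "l \<le> d" for l by (rule holo2_subset[OF a[OF that] U]) simp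
      from this[of 0] this[of 1] show ?thesis using that True by (simp add: holo_vfield_def comp_def)
    qed
    show "is_factorization d (a z) (map (\<lambda>u. u z) [?v])" for z
      unfolding is_factorization_def by (auto simp: True bform_def pairing_def)
  qed (use U Om disc in auto)
next
  case False
  obtain us where us: "is_factorization d (a z0) us" by (rule factorization_exists[OF d])
  have len: "length us = d" and F0: "bform d (a z0) = (\<lambda>\<xi>. \<Prod>i<d. pairing (us ! i) \<xi>)"
    using us by (auto simp: is_factorization_iff fun_eq_iff simp del: split_paired_All)
  have cof: "cofac d (\<lambda>i. us ! i) i \<noteq> 0" if "i < d" for i
  proof -
    have "(\<Prod>i<d. cofac d (\<lambda>i. us ! i) i) \<noteq> 0" using disc bdisc_eq_prod[OF d us] by auto
    then show ?thesis using that by simp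
  qed
  have ind: "pairing (us ! j) (perp (us ! i)) \<noteq> 0" if "i < d" "j < d" "i \<noteq> j" for i j
    using cof[OF that(1)] that by (auto simp: cofac_def)
  have nz: "us ! i \<noteq> 0" if "i < d" for i
  proof -
    obtain j where "j < d" "j \<noteq> i" using False d by (metis One_nat_def le_neq_implies_less less_Suc_eq less_one nat_neq_iff not_less_eq zero_less_one)
    then show ?thesis using ind[OF that, of j] by (auto simp: pairing_perp)
  qed
  have "\<exists>W u. open W \<and> z0 \<in> W \<and> holo_vfield u W \<and> u z0 = us ! i \<and> (\<forall>z\<in>W. bform d (a z) (perp (u z)) = 0)"
    if i: "i < d" for i
  proof -
    have r: "bform d (a z0) (perp (us ! i)) = 0" unfolding F0 by (rule prod_zero, simp, rule bexI[of _ i]) (use i in auto)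
    have cd: "has_cd (bform d (a z0)) (fst (us ! i) * cofac d ((!) us) i) (snd (us ! i) * cofac d ((!) us) i) (perp (us ! i))"
      unfolding F0 by (rule has_cd_prod_pairing_root[OF i])
    have "fst (us ! i) * cofac d ((!) us) i \<noteq> 0 \<or> snd (us ! i) * cofac d ((!) us) i \<noteq> 0"
      using nz[OF i] cof[OF i] by (auto simp: prod_eq_iff)
    from root_field[OF d a r cd this] show ?thesis by metis
  qed
  then obtain W w where W: "\<And>i. i < d \<Longrightarrow> open (W i)" "\<And>i. i < d \<Longrightarrow> z0 \<in> W i" and w: "\<And>i. i < d \<Longrightarrow> holo_vfield (w i) (W i)"
    "\<And>i. i < d \<Longrightarrow> w i z0 = us ! i" and wr: "\<And>i z. i < d \<Longrightarrow> z \<in> W i \<Longrightarrow> bform d (a z) (perp (w i z)) = 0"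
    by metis
  \<comment> \<open>A covector at which the form does not vanish: it serves to compute \<open>c\<close>, and provides the last of
     the \<open>d + 1\<close> zeros needed to see that the form and \<open>c\<close> times the product of the \<open>w i\<close> agree.\<close>
  obtain \<omega>0 where \<omega>0: "bform d (a z0) \<omega>0 \<noteq> 0"
  proof (rule ccontr)
    assume "\<not> thesis"
    then have "bform d (a z0) = (\<lambda>_. 0)" using that by blast
    then have "has_cd (\<lambda>\<omega>. \<Prod>i<d. pairing (us ! i) \<omega>) 0 0 (perp (us ! 0))" using F0 has_cd_const[of 0] by simp
    from has_cd_pd[OF this] has_cd_pd[OF has_cd_prod_pairing_root[of 0 d "(!) us"]]
    have "fst (us ! 0) * cofac d ((!) us) 0 = 0" "snd (us ! 0) * cofac d ((!) us) 0 = 0" using d by auto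
    then show False using cof[of 0] nz[of 0] d by (auto simp: prod_eq_iff)
  qed
  define W' where "W' = Om \<inter> (\<Inter>i<d. W i)"
  have W': "open W'" "z0 \<in> W'" unfolding W'_def using W Om by (auto intro!: open_INT)
  have wW: "holo2 (\<lambda>z. fst (w i z)) W'" "holo2 (\<lambda>z. snd (w i z)) W'" if "i < d" for i
  proof -
    have "W' \<subseteq> W i" using that by (auto simp: W'_def)
    then show "holo2 (\<lambda>z. fst (w i z)) W'" "holo2 (\<lambda>z. snd (w i z)) W'"
      using w(1)[OF that] holo2_subset[OF _ W'(1)] unfolding holo_vfield_def comp_def by blast+
  qed
  have aW: "holo2 (\<lambda>z. a z l) W'" if "l \<le> d" for l by (rule holo2_subset[OF a[OF that] W'(1)]) simp
  define P where "P z = (\<Prod>i<d. pairing (w i z) \<omega>0)" for z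
  have P: "holo2 P W'"
    unfolding P_def pairing_def by (intro holo2_prod holo2_add holo2_mult holo2_const W' wW) auto
  define \<Theta> where "\<Theta> z = bdisc d (a z) * (P z * (\<Prod>i<d. \<Prod>j\<in>{..<d} - {i}. pairing (w j z) (perp (w i z))))" for z
  have \<Theta>: "holo2 \<Theta> W'"
    unfolding \<Theta>_def pairing_perp by (intro holo2_mult holo2_prod P holo2_bdisc d aW W' holo2_diff wW) auto
  define U where "U = {z \<in> W'. \<Theta> z \<noteq> 0}"
  have U: "open U" unfolding U_def by (rule open_nonzero_set[OF W'(1) holo2_cont[OF \<Theta>]])
  have "\<Theta> z0 \<noteq> 0"
    using disc \<omega>0 w(2) ind F0 by (auto simp: \<Theta>_def P_def)
  then have z0U: "z0 \<in> U" using W' by (simp add: U_def)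
  define c where "c z = bform d (a z) \<omega>0 / P z" for z
  have Pnz: "P z \<noteq> 0" if "z \<in> U" for z using that by (auto simp: U_def \<Theta>_def)
  have c: "holo2 c U"
    unfolding c_def bform_def
    by (intro holo2_divide holo2_sum holo2_mult holo2_const U holo2_subset[OF a U] holo2_subset[OF P U] Pnz) (auto simp: U_def)
  have fac: "bform d (a z) \<omega> = c z * (\<Prod>i<d. pairing (w i z) \<omega>)" if z: "z \<in> U" for z \<omega>
  proof -
    let ?Q = "\<Prod>i<d. lin (w i z)"
    let ?y = "\<lambda>l. a z l - c z * coeff ?Q l"
    have y: "bform d ?y \<omega> = bform d (a z) \<omega> - c z * (\<Prod>i<d. pairing (w i z) \<omega>)" for \<omega>
      unfolding bform_prod_lin[symmetric] by (simp add: bform_def sum_subtractf sum_distrib_left algebra_simps)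
    have nzp: "pairing (w j z) (perp (w i z)) \<noteq> 0" if "i < d" "j < d" "i \<noteq> j" for i j
      using z that by (auto simp: U_def \<Theta>_def)
    have nz0: "pairing (w i z) \<omega>0 \<noteq> 0" if "i < d" for i using Pnz[OF z] that by (auto simp: P_def)
    have "bform d ?y \<omega> = 0"
    proof (rule bform_many_zeros[of d ?y "\<lambda>i. if i < d then perp (w i z) else \<omega>0"])
      fix i assume i: "i \<le> d"
      show "bform d ?y (if i < d then perp (w i z) else \<omega>0) = 0"
      proof (cases "i < d")
        case True
        have "(\<Prod>k<d. pairing (w k z) (perp (w i z))) = 0" by (rule prod_zero, simp, rule bexI[of _ i]) (use True in auto)
        then show ?thesis using True wr[OF True, of z] z by (simp add: y U_def W'_def)
      next
        case False
        have "bform d ?y \<omega>0 = 0" unfolding y using Pnz[OF z] by (simp add: c_def P_def)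
        then show ?thesis using False by simp
      qed
    next
      fix i j assume ij: "i \<le> d" "j \<le> d" "i \<noteq> j"
      have 1: "fst (perp (w i z)) * snd \<omega>0 \<noteq> snd (perp (w i z)) * fst \<omega>0" if "i < d" for i
      proof
        assume "fst (perp (w i z)) * snd \<omega>0 = snd (perp (w i z)) * fst \<omega>0"
        moreover have "fst (perp (w i z)) * snd \<omega>0 - snd (perp (w i z)) * fst \<omega>0 = - pairing (w i z) \<omega>0"
          by (simp add: pairing_def perp_def algebra_simps)
        ultimately show False using nz0[OF that] by simp
      qed
      have 2: "fst \<omega>0 * snd (perp (w i z)) \<noteq> snd \<omega>0 * fst (perp (w i z))" if "i < d" for i
        using 1[OF that] by (metis mult.commute)
      have 3: "fst (perp (w i z)) * snd (perp (w j z)) \<noteq> snd (perp (w i z)) * fst (perp (w j z))" if "i < d" "j < d"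
        using nzp[OF that ij(3)] by (auto simp: pairing_def perp_def algebra_simps)
      show "fst (if i < d then perp (w i z) else \<omega>0) * snd (if j < d then perp (w j z) else \<omega>0) \<noteq>
        snd (if i < d then perp (w i z) else \<omega>0) * fst (if j < d then perp (w j z) else \<omega>0)"
        using ij 1 2 3 by auto
    qed
    then show ?thesis using y[of \<omega>] by simp
  qed
  define v where "v i z = (if i = 0 then (c z * fst (w 0 z), c z * snd (w 0 z)) else w i z)" for i :: nat and z
  show ?thesis
  proof (rule that[of U "map v [0..<d]"])
    show "U \<subseteq> Om" by (auto simp: U_def W'_def)
    show "bdisc d (a z) \<noteq> 0" if "z \<in> U" for z using that by (auto simp: U_def \<Theta>_def)
    show "holo_vfield u U" if "u \<in> set (map v [0..<d])" for u
    proof -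
      obtain i where i: "i < d" "u = v i" using \<open>u \<in> set (map v [0..<d])\<close> by auto
      have "holo2 (\<lambda>z. fst (w k z)) U" "holo2 (\<lambda>z. snd (w k z)) U" if "k < d" for k
      proof -
        have "U \<subseteq> W'" by (auto simp: U_def)
        then show "holo2 (\<lambda>z. fst (w k z)) U" "holo2 (\<lambda>z. snd (w k z)) U"
          using holo2_subset[OF wW(1)[OF that] U] holo2_subset[OF wW(2)[OF that] U] by blast+
      qed
      then show ?thesis using i c by (cases "i = 0") (auto simp: holo_vfield_def comp_def v_def intro: holo2_mult)
    qed
    show "is_factorization d (a z) (map (\<lambda>u. u z) (map v [0..<d]))" if z: "z \<in> U" for z
      unfolding is_factorization_iff
    proof (intro conjI allI)
      fix \<xi>
      obtain d' where d': "d = Suc d'" using d by (cases d) auto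
      have "(\<Prod>i<d. pairing (v i z) \<xi>) = c z * (\<Prod>i<d. pairing (w i z) \<xi>)"
        unfolding d' prod.lessThan_Suc_shift by (simp add: v_def pairing_def algebra_simps)
      then show "bform d (a z) \<xi> = (\<Prod>i<d. pairing (map (\<lambda>u. u z) (map v [0..<d]) ! i) \<xi>)"
        using fac[OF z] by simp
    qed simp
  qed (use U z0U in auto)
qed

section \<open>Change of charts\<close>

lemma lift_simps [simp]:
  "lift 1 z $ 1 = 1" "lift 1 z $ 2 = fst z" "lift 1 z $ 3 = snd z"
  "lift 2 z $ 1 = fst z" "lift 2 z $ 2 = 1" "lift 2 z $ 3 = snd z"
  "lift 3 z $ 1 = fst z" "lift 3 z $ 2 = snd z" "lift 3 z $ 3 = 1"
  by (simp_all add: lift_def)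

lemma lift_self [simp]: "lift i z $ i = 1"
  using exhaust_3[of i] by auto

lemma holo2_lift: "open U \<Longrightarrow> holo2 (\<lambda>z. lift i z $ j) U"
  using exhaust_3[of i] exhaust_3[of j] by (auto intro: holo2_const holo2_fst holo2_snd simp: holo2_fst[unfolded fst_def])

lemma coords_lift [simp]: "coords i (lift i z) = z"
  using exhaust_3[of i] by (auto simp: coords_def)

lemma lift_coords: "X $ i \<noteq> 0 \<Longrightarrow> lift i (coords i X) $ j = X $ j / X $ i"
  using exhaust_3[of i] exhaust_3[of j] by (auto simp: coords_def)

lemma lift_trans: "lift i z $ j \<noteq> 0 \<Longrightarrow> lift j (trans_map i j z) $ m = lift i z $ m / lift i z $ j"
  unfolding trans_map_def by (rule lift_coords)

lemma coords_scale: "c \<noteq> 0 \<Longrightarrow> (\<And>m. Y $ m = X $ m / c) \<Longrightarrow> coords i Y = coords i X"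
  by (simp add: coords_def)

lemma trans_map_inverse: "lift i z $ j \<noteq> 0 \<Longrightarrow> trans_map j i (trans_map i j z) = z"
  using coords_scale[of "lift i z $ j" "lift j (trans_map i j z)" "lift i z" i] lift_trans[of i z j]
  by (simp add: trans_map_def[of j i])

text \<open>The Jacobian determinant of a change of charts is \<open>\<plusminus> L\<^sup>-\<^sup>3\<close>, where \<open>L\<close> is the ratio of the two coordinates;
  this expresses that the determinant of the tangent bundle is \<open>\<O>(3)\<close>. The sign depends on the pair of charts and
  disappears in the square, which is enough for discriminants.\<close>

lemma trans_jacobian:
  assumes ij: "i \<noteq> j" and L: "lift i z $ j \<noteq> 0"
  shows "\<exists>a b c e. has_cd (fst \<circ> trans_map i j) a b z \<and> has_cd (snd \<circ> trans_map i j) c e z \<and>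
    (a * e - b * c) ^ 2 = inverse (lift i z $ j) ^ 6"
proof -
  have x: "has_cd (\<lambda>z. inverse (fst z)) (- (inverse (fst z))\<^sup>2) 0 z" if "fst z \<noteq> 0"
    using has_cd_inverse[OF has_cd_fst that] by simp
  have y: "has_cd (\<lambda>z. inverse (snd z)) 0 (- (inverse (snd z))\<^sup>2) z" if "snd z \<noteq> 0"
    using has_cd_inverse[OF has_cd_snd that] by simp
  have yx: "has_cd (\<lambda>z. snd z * inverse (fst z)) (snd z * - (inverse (fst z))\<^sup>2) (inverse (fst z)) z" if "fst z \<noteq> 0"
    using has_cd_mult[OF has_cd_snd x[OF that]] by simp
  have xy: "has_cd (\<lambda>z. fst z * inverse (snd z)) (inverse (snd z)) (fst z * - (inverse (snd z))\<^sup>2) z" if "snd z \<noteq> 0"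
    using has_cd_mult[OF has_cd_fst y[OF that]] by simp
  have p6: "(X * X\<^sup>2)\<^sup>2 = X ^ 6" for X :: complex
    by (simp add: power2_eq_square eval_nat_numeral)
  consider "i = 3" "j = 1" | "i = 3" "j = 2" | "i = 1" "j = 3" | "i = 2" "j = 3" | "i = 1" "j = 2" | "i = 2" "j = 1"
    using ij exhaust_3[of i] exhaust_3[of j] by auto
  then show ?thesis
  proof cases
    case 1
    have "fst \<circ> trans_map i j = (\<lambda>z. snd z * inverse (fst z))" "snd \<circ> trans_map i j = (\<lambda>z. inverse (fst z))"
      by (simp_all add: fun_eq_iff trans_map_def coords_def 1 divide_inverse del: split_paired_All)
    then show ?thesis using x yx L p6[of "inverse (fst z)"] 1
      by (intro exI[of _ "snd z * - (inverse (fst z))\<^sup>2"] exI[of _ "inverse (fst z)"] exI[of _ "- (inverse (fst z))\<^sup>2"] exI[of _ 0]) simp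
  next
    case 2
    have "fst \<circ> trans_map i j = (\<lambda>z. fst z * inverse (snd z))" "snd \<circ> trans_map i j = (\<lambda>z. inverse (snd z))"
      by (simp_all add: fun_eq_iff trans_map_def coords_def 2 divide_inverse del: split_paired_All)
    then show ?thesis using y xy L p6[of "inverse (snd z)"] 2
      by (intro exI[of _ "inverse (snd z)"] exI[of _ "fst z * - (inverse (snd z))\<^sup>2"] exI[of _ 0] exI[of _ "- (inverse (snd z))\<^sup>2"]) simp
  next
    case 3
    have "fst \<circ> trans_map i j = (\<lambda>z. inverse (snd z))" "snd \<circ> trans_map i j = (\<lambda>z. fst z * inverse (snd z))"
      by (simp_all add: fun_eq_iff trans_map_def coords_def 3 divide_inverse del: split_paired_All)
    then show ?thesis using y xy L p6[of "inverse (snd z)"] 3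
      by (intro exI[of _ 0] exI[of _ "- (inverse (snd z))\<^sup>2"] exI[of _ "inverse (snd z)"] exI[of _ "fst z * - (inverse (snd z))\<^sup>2"]) (simp add: mult.commute)
  next
    case 4
    have "fst \<circ> trans_map i j = (\<lambda>z. fst z * inverse (snd z))" "snd \<circ> trans_map i j = (\<lambda>z. inverse (snd z))"
      by (simp_all add: fun_eq_iff trans_map_def coords_def 4 divide_inverse del: split_paired_All)
    then show ?thesis using y xy L p6[of "inverse (snd z)"] 4
      by (intro exI[of _ "inverse (snd z)"] exI[of _ "fst z * - (inverse (snd z))\<^sup>2"] exI[of _ 0] exI[of _ "- (inverse (snd z))\<^sup>2"]) simp
  next
    case 5
    have "fst \<circ> trans_map i j = (\<lambda>z. inverse (fst z))" "snd \<circ> trans_map i j = (\<lambda>z. snd z * inverse (fst z))"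
      by (simp_all add: fun_eq_iff trans_map_def coords_def 5 divide_inverse del: split_paired_All)
    then show ?thesis using x yx L p6[of "inverse (fst z)"] 5
      by (intro exI[of _ "- (inverse (fst z))\<^sup>2"] exI[of _ 0] exI[of _ "snd z * - (inverse (fst z))\<^sup>2"] exI[of _ "inverse (fst z)"]) (simp add: mult.commute)
  next
    case 6
    have "fst \<circ> trans_map i j = (\<lambda>z. inverse (fst z))" "snd \<circ> trans_map i j = (\<lambda>z. snd z * inverse (fst z))"
      by (simp_all add: fun_eq_iff trans_map_def coords_def 6 divide_inverse del: split_paired_All)
    then show ?thesis using x yx L p6[of "inverse (fst z)"] 6
      by (intro exI[of _ "- (inverse (fst z))\<^sup>2"] exI[of _ 0] exI[of _ "snd z * - (inverse (fst z))\<^sup>2"] exI[of _ "inverse (fst z)"]) (simp add: mult.commute)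
  qed
qed

definition chart_dom :: "3 \<Rightarrow> 3 \<Rightarrow> (complex \<times> complex) set" where
  "chart_dom i j = {z. lift i z $ j \<noteq> 0}"

lemma open_chart_dom: "open (chart_dom i j)"
  unfolding chart_dom_def by (rule open_Collect_neq[OF holo2_cont[OF holo2_lift[OF open_UNIV]] continuous_on_const])

lemma holo2_trans:
  assumes "i \<noteq> j"
  shows "holo2 (fst \<circ> trans_map i j) (chart_dom i j)" "holo2 (snd \<circ> trans_map i j) (chart_dom i j)"
proof -
  have "\<exists>a b. has_cd (fst \<circ> trans_map i j) a b z" "\<exists>a b. has_cd (snd \<circ> trans_map i j) a b z"
    if "z \<in> chart_dom i j" for z
    using trans_jacobian[OF assms, of z] that unfolding chart_dom_def by blast+
  then show "holo2 (fst \<circ> trans_map i j) (chart_dom i j)" "holo2 (snd \<circ> trans_map i j) (chart_dom i j)"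
    unfolding holo2_def has_cd_def[symmetric] using open_chart_dom by blast+
qed

lemma trans_chart_dom: "z \<in> chart_dom i j \<Longrightarrow> trans_map i j z \<in> chart_dom j i"
  by (simp add: chart_dom_def lift_trans)

lemma lift_trans_inverse: "z \<in> chart_dom i j \<Longrightarrow> lift j (trans_map i j z) $ i = inverse (lift i z $ j)"
  by (simp add: chart_dom_def lift_trans divide_inverse)

definition tangent_map :: "3 \<Rightarrow> 3 \<Rightarrow> complex \<times> complex \<Rightarrow> complex \<times> complex \<Rightarrow> complex \<times> complex" where
  "tangent_map i j z u = (pd1 (fst \<circ> trans_map i j) z * fst u + pd2 (fst \<circ> trans_map i j) z * snd u,
     pd1 (snd \<circ> trans_map i j) z * fst u + pd2 (snd \<circ> trans_map i j) z * snd u)"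

lemma pairing_pullback: "pairing u (pullback (trans_map i j) z \<xi>) = pairing (tangent_map i j z u) \<xi>"
  by (simp add: pairing_def pullback_def tangent_map_def algebra_simps)

definition jac :: "3 \<Rightarrow> 3 \<Rightarrow> complex \<times> complex \<Rightarrow> complex" where
  "jac i j z = pd1 (fst \<circ> trans_map i j) z * pd2 (snd \<circ> trans_map i j) z
     - pd2 (fst \<circ> trans_map i j) z * pd1 (snd \<circ> trans_map i j) z"

lemma jac_square: "i \<noteq> j \<Longrightarrow> z \<in> chart_dom i j \<Longrightarrow> jac i j z ^ 2 = inverse (lift i z $ j) ^ 6"
proof -
  assume "i \<noteq> j" "z \<in> chart_dom i j"
  then obtain a b c e where h: "has_cd (fst \<circ> trans_map i j) a b z" "has_cd (snd \<circ> trans_map i j) c e z"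
    "(a * e - b * c) ^ 2 = inverse (lift i z $ j) ^ 6"
    using trans_jacobian[of i j z] unfolding chart_dom_def by blast
  then show ?thesis unfolding jac_def has_cd_pd[OF h(1)] has_cd_pd[OF h(2)] by simp
qed

lemma pairing_tangent_map: "pairing (tangent_map i j z u) (perp (tangent_map i j z w)) = jac i j z * pairing u (perp w)"
  by (simp add: pairing_perp tangent_map_def jac_def algebra_simps)

definition push :: "3 \<Rightarrow> 3 \<Rightarrow> vfield \<Rightarrow> vfield" where
  "push i j u w = tangent_map i j (trans_map j i w) (u (trans_map j i w))"

lemma push_trans: "z \<in> chart_dom i j \<Longrightarrow> push i j u (trans_map i j z) = tangent_map i j z (u z)"
  by (simp add: push_def trans_map_inverse chart_dom_def)

definition chart_image :: "3 \<Rightarrow> 3 \<Rightarrow> (complex \<times> complex) set \<Rightarrow> (complex \<times> complex) set" where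
  "chart_image i j U = chart_dom j i \<inter> trans_map j i -` U"

lemma continuous_trans: assumes "i \<noteq> j" shows "continuous_on (chart_dom i j) (trans_map i j)"
proof -
  have "continuous_on (chart_dom i j) (\<lambda>z. ((fst \<circ> trans_map i j) z, (snd \<circ> trans_map i j) z))"
    by (intro continuous_on_Pair holo2_cont holo2_trans assms)
  then show ?thesis by simp
qed

lemma open_chart_image: "i \<noteq> j \<Longrightarrow> open U \<Longrightarrow> open (chart_image i j U)"
  unfolding chart_image_def using continuous_open_preimage[OF continuous_trans[of j i] open_chart_dom] by auto

lemma chart_image_mem: "z \<in> chart_dom i j \<Longrightarrow> z \<in> U \<Longrightarrow> trans_map i j z \<in> chart_image i j U"
  using trans_chart_dom[of z i j] trans_map_inverse[of i z j] by (simp add: chart_image_def) (simp add: chart_dom_def)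

lemma holo2_comp_trans:
  assumes ij: "i \<noteq> j" and f: "holo2 f U" and U: "U \<subseteq> chart_dom i j"
  shows "holo2 (\<lambda>w. f (trans_map j i w)) (chart_image i j U)"
proof (rule holo2_compose[OF _ _ f])
  have o: "open (chart_image i j U)" by (rule open_chart_image[OF ij holo2_open[OF f]])
  show "holo2 (fst \<circ> trans_map j i) (chart_image i j U)" "holo2 (snd \<circ> trans_map j i) (chart_image i j U)"
    by (rule holo2_subset[OF holo2_trans(1) o] holo2_subset[OF holo2_trans(2) o]; use ij in \<open>auto simp: chart_image_def\<close>)+
qed (auto simp: chart_image_def)

lemma holo_vfield_push:
  assumes ij: "i \<noteq> j" and u: "holo_vfield u U" and U: "U \<subseteq> chart_dom i j"
  shows "holo_vfield (push i j u) (chart_image i j U)"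
proof -
  have o: "open U" using u by (auto simp: holo_vfield_def intro: holo2_open)
  have t: "holo2 (fst \<circ> trans_map i j) U" "holo2 (snd \<circ> trans_map i j) U"
    using holo2_subset[OF holo2_trans(1)[OF ij] o U] holo2_subset[OF holo2_trans(2)[OF ij] o U] by auto
  have "holo2 (\<lambda>z. fst (tangent_map i j z (u z))) U" "holo2 (\<lambda>z. snd (tangent_map i j z (u z))) U"
    using u unfolding tangent_map_def holo_vfield_def comp_def
    by (auto intro!: holo2_add holo2_mult holo2_pd1 holo2_pd2 t[unfolded comp_def])
  from this[THEN holo2_comp_trans[OF ij _ U]] show ?thesis
    unfolding holo_vfield_def comp_def push_def by (rule conjI)
qed

lemma lie_push:
  assumes ij: "i \<noteq> j" and h: "holo2 h V" "trans_map i j z \<in> V" and z: "z \<in> chart_dom i j"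
  shows "lie u (\<lambda>z. h (trans_map i j z)) z = lie (push i j u) h (trans_map i j z)"
proof -
  have "has_cd (\<lambda>z. h (trans_map i j z))
     (pd1 h (trans_map i j z) * pd1 (fst \<circ> trans_map i j) z + pd2 h (trans_map i j z) * pd1 (snd \<circ> trans_map i j) z)
     (pd1 h (trans_map i j z) * pd2 (fst \<circ> trans_map i j) z + pd2 h (trans_map i j z) * pd2 (snd \<circ> trans_map i j) z) z"
    using has_cd_compose[OF holo2_has_cd[OF holo2_trans(1)[OF ij] z] holo2_has_cd[OF holo2_trans(2)[OF ij] z] holo2_has_cd[OF h]] .
  then have "lie u (\<lambda>z. h (trans_map i j z)) z = fst (u z) * (pd1 h (trans_map i j z) * pd1 (fst \<circ> trans_map i j) z + pd2 h (trans_map i j z) * pd1 (snd \<circ> trans_map i j) z)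
     + snd (u z) * (pd1 h (trans_map i j z) * pd2 (fst \<circ> trans_map i j) z + pd2 h (trans_map i j z) * pd2 (snd \<circ> trans_map i j) z)"
    by (rule lie_has_cd)
  then show ?thesis by (simp add: lie_def push_trans[OF z] tangent_map_def algebra_simps)
qed

lemma lie_funpow_push:
  assumes ij: "i \<noteq> j" and h: "holo2 h UNIV" and u: "holo_vfield u U" and U: "U \<subseteq> chart_dom i j" and z: "z \<in> U"
  shows "(lie u ^^ l) (\<lambda>z. h (trans_map i j z)) z = (lie (push i j u) ^^ l) h (trans_map i j z)"
  using z
proof (induction l arbitrary: z)
  case (Suc l)
  have o: "open U" using u by (auto simp: holo_vfield_def intro: holo2_open)
  have hl: "holo2 ((lie (push i j u) ^^ l) h) (chart_image i j U)"
    by (rule holo2_lie_funpow[OF holo_vfield_push[OF ij u U] holo2_subset[OF h open_chart_image[OF ij o]]]) simp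
  have hz: "holo2 (\<lambda>z. h (trans_map i j z)) U"
    by (rule holo2_compose[OF holo2_subset[OF holo2_trans(1)[OF ij] o U] holo2_subset[OF holo2_trans(2)[OF ij] o U] h]) simp
  have "lie u ((lie u ^^ l) (\<lambda>z. h (trans_map i j z))) z = lie u (\<lambda>z. (lie (push i j u) ^^ l) h (trans_map i j z)) z"
    by (rule lie_cong[symmetric, OF holo2_lie_funpow[OF u hz] Suc.prems]) (rule Suc.IH)
  also have "\<dots> = lie (push i j u) ((lie (push i j u) ^^ l) h) (trans_map i j z)"
    by (rule lie_push[OF ij hl chart_image_mem]) (use Suc.prems U in blast)+
  finally show ?case by simp
qed simp

lemma length_monomials: "length (monomials n i) = Suc (n * (n + 3) div 2)"
proof -
  have "length (monomials n i) = (\<Sum>a<n + 1. n + 1 - a)"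
    by (simp add: monomials_def length_concat comp_def sum_list_sum_nth atLeast0LessThan)
  also have "2 * \<dots> = (n + 1) * (n + 2)"
  proof (induction n)
    case (Suc n)
    have "(\<Sum>a<Suc n + 1. Suc n + 1 - a) = (n + 2) + (\<Sum>a<n + 1. n + 1 - a)"
      by (simp only: add_Suc sum.lessThan_Suc_shift) simp
    then show ?case using Suc by simp
  qed simp
  finally have "2 * length (monomials n i) = 2 * Suc (n * (n + 3) div 2)" by (simp add: algebra_simps)
  then show ?thesis by simp
qed

lemma holo2_monomials: "s \<in> set (monomials n i) \<Longrightarrow> open U \<Longrightarrow> holo2 s U"
  unfolding monomials_def by (auto intro!: holo2_mult holo2_power holo2_lift)

lemma monomials_eq_map: "monomials n i = map (\<lambda>m z. m (lift i z))
   [\<lambda>X :: complex ^ 3. (X $ 1) ^ a * (X $ 2) ^ b * (X $ 3) ^ (n - a - b). a \<leftarrow> [0..<n + 1], b \<leftarrow> [0..<n + 1 - a]]"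
  unfolding monomials_def by (simp add: map_concat comp_def)

lemma monomials_trans:
  assumes z: "z \<in> chart_dom i j" and l: "l < length (monomials n i)"
  shows "(monomials n i ! l) z = (lift i z $ j) ^ n * (monomials n j ! l) (trans_map i j z)"
proof -
  let ?M = "[\<lambda>X :: complex ^ 3. (X $ 1) ^ a * (X $ 2) ^ b * (X $ 3) ^ (n - a - b). a \<leftarrow> [0..<n + 1], b \<leftarrow> [0..<n + 1 - a]]"
  have l': "l < length ?M" using l unfolding monomials_eq_map by simp
  have L: "lift i z $ j \<noteq> 0" using z by (simp add: chart_dom_def)
  obtain a b where ab: "a < n + 1" "b < n + 1 - a" "?M ! l = (\<lambda>X. (X $ 1) ^ a * (X $ 2) ^ b * (X $ 3) ^ (n - a - b))"
  proof -
    have "\<forall>x\<in>set ?M. \<exists>a b. a < n + 1 \<and> b < n + 1 - a \<and> x = (\<lambda>X. (X $ 1) ^ a * (X $ 2) ^ b * (X $ 3) ^ (n - a - b))"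
      by (simp del: upt_Suc)
         (intro ballI, rule exI, rule conjI[rotated], rule exI, rule conjI[rotated], rule refl, auto)
    then show thesis using that nth_mem[OF l'] by blast
  qed
  let ?x = "\<lambda>m. lift i z $ m" and ?L = "lift i z $ j"
  have "?L ^ n = ?L ^ a * ?L ^ b * ?L ^ (n - a - b)" using ab by (simp flip: power_add)
  then have "?x 1 ^ a * ?x 2 ^ b * ?x 3 ^ (n - a - b) = ?L ^ n * ((?x 1 / ?L) ^ a * (?x 2 / ?L) ^ b * (?x 3 / ?L) ^ (n - a - b))"
    using L by (simp add: power_divide)
  moreover have "(monomials n i ! l) z = (?M ! l) (lift i z)" "(monomials n j ! l) (trans_map i j z) = (?M ! l) (lift j (trans_map i j z))"
    by (simp_all only: monomials_eq_map nth_map[OF l'])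
  ultimately show ?thesis unfolding ab(3) lift_trans[OF L] by simp
qed

text \<open>Monomials change by \<open>L\<^sup>n\<close>, which \<open>sigma_mult\<close> raises to the number of monomials; iterated derivatives
  commute with the change of coordinates.\<close>

lemma sigma_trans:
  assumes ij: "i \<noteq> j" and u: "holo_vfield u U" and U: "U \<subseteq> chart_dom i j" and z: "z \<in> U"
  shows "sigma (monomials n i) u z = (lift i z $ j) ^ (n * length (monomials n i)) * sigma (monomials n j) (push i j u) (trans_map i j z)"
proof -
  have o: "open U" using u by (auto simp: holo_vfield_def intro: holo2_open)
  let ?S = "map (\<lambda>h z. h (trans_map i j z)) (monomials n j)"
  have hz: "holo2 (\<lambda>z. h (trans_map i j z)) U" if "h \<in> set (monomials n j)" for h
    by (rule holo2_compose[OF holo2_subset[OF holo2_trans(1)[OF ij] o U] holo2_subset[OF holo2_trans(2)[OF ij] o U] holo2_monomials[OF that open_UNIV]]) simp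
  have "sigma (monomials n i) u z = ((lift i z $ j) ^ n) ^ length ?S * sigma ?S u z"
  proof (rule sigma_mult[OF u])
    show "holo2 (\<lambda>z. (lift i z $ j) ^ n) U" by (intro holo2_power holo2_lift o)
    show "(monomials n i ! l) z = (lift i z $ j) ^ n * (?S ! l) z" if "l < length ?S" "z \<in> U" for l z
      using monomials_trans[of z i j l n] that U by (auto simp: length_monomials)
  qed (use hz U z in \<open>auto simp: chart_dom_def length_monomials\<close>)
  also have "sigma ?S u z = sigma (monomials n j) (push i j u) (trans_map i j z)"
    unfolding sigma_def length_map
    by (intro arg_cong[of _ _ det] cong_mat refl)
       (auto intro!: lie_funpow_push[OF ij holo2_monomials[OF nth_mem] u U z])
  finally show ?thesis by (simp only: length_map length_monomials power_mult)
qed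

lemma bdisc_scale:
  assumes d: "d \<ge> 1"
  shows "bdisc d (\<lambda>l. c * a l) = c ^ (2 * (d - 1)) * bdisc d a"
proof -
  let ?p = "\<lambda>a. form_poly (d - 1) (\<lambda>j. of_nat (j + 1) * a (j + 1))" and ?q = "\<lambda>a. form_poly (d - 1) (\<lambda>j. of_nat (d - j) * a j)"
  have "sylvester_mat_sub (d - 1) (d - 1) (?p (\<lambda>l. c * a l)) (?q (\<lambda>l. c * a l)) =
     c \<cdot>\<^sub>m sylvester_mat_sub (d - 1) (d - 1) (?p a) (?q a)"
    by (rule eq_matI) (auto simp: sylvester_mat_sub_index coeff_form_poly)
  then show ?thesis unfolding bdisc_conv[OF d] by (simp add: mult_2)
qed

text \<open>Each of the \<open>d (d - 1)\<close> ordered pairs of factors contributes the Jacobian determinant once.\<close>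

lemma bdisc_transform:
  assumes d: "d \<ge> 1" and ij: "i \<noteq> j" and z: "z \<in> chart_dom i j"
    and eq: "\<And>\<xi>. bform d a (pullback (trans_map i j) z \<xi>) = bform d b \<xi>"
  shows "bdisc d b = inverse (lift i z $ j) ^ (3 * (d * (d - 1))) * bdisc d a"
proof -
  obtain us where us: "is_factorization d a us" by (rule factorization_exists[OF d])
  let ?us = "map (tangent_map i j z) us"
  have fb: "is_factorization d b ?us"
    unfolding is_factorization_def
  proof (intro conjI allI)
    show "length ?us = d" using us by (simp add: is_factorization_def)
    show "bform d b \<xi> = (\<Prod>u\<leftarrow>?us. pairing u \<xi>)" for \<xi>
      using us eq[of \<xi>] by (simp add: is_factorization_def comp_def pairing_pullback del: split_paired_All)
  qed
  have len: "length us = d" using us by (simp add: is_factorization_def)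
  have "cofac d (\<lambda>k. ?us ! k) k = jac i j z ^ (d - 1) * cofac d (\<lambda>k. us ! k) k" if "k < d" for k
  proof -
    have "cofac d (\<lambda>k. ?us ! k) k = (\<Prod>l\<in>{..<d} - {k}. jac i j z * pairing (us ! l) (perp (us ! k)))"
      unfolding cofac_def by (rule prod.cong) (use that len in \<open>auto simp: pairing_tangent_map\<close>)
    then show ?thesis using that by (simp add: prod.distrib cofac_def)
  qed
  then have "bdisc d b = jac i j z ^ (d * (d - 1)) * bdisc d a"
    unfolding bdisc_eq_prod[OF d fb] bdisc_eq_prod[OF d us] by (simp add: prod.distrib power_mult[symmetric] mult.commute)
  also have "jac i j z ^ (d * (d - 1)) = (jac i j z ^ 2) ^ (d * (d - 1) div 2)"
  proof -
    have "even (d * (d - 1))" by (cases d) auto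
    then have "2 * (d * (d - 1) div 2) = d * (d - 1)" by simp
    then show ?thesis by (simp only: power_mult[symmetric])
  qed
  also have "\<dots> = inverse (lift i z $ j) ^ (6 * (d * (d - 1) div 2))"
    unfolding jac_square[OF ij z] by (simp only: power_mult)
  also have "6 * (d * (d - 1) div 2) = 3 * (d * (d - 1))"
  proof -
    have "even (d * (d - 1))" by (cases d) auto
    then have "2 * (d * (d - 1) div 2) = d * (d - 1)" by simp
    then show ?thesis by linarith
  qed
  finally show ?thesis .
qed

section \<open>The extactic section in the charts\<close>

lemma eq_on_open_of_eq_dense:
  fixes f g :: "complex \<times> complex \<Rightarrow> complex"
  assumes Om: "open Om" and f: "continuous_on Om f" and g: "continuous_on Om g" and h: "holo2 h UNIV" "h z0 \<noteq> 0"
    and eq: "\<And>z. z \<in> Om \<Longrightarrow> h z \<noteq> 0 \<Longrightarrow> f z = g z" and z: "z \<in> Om"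
  shows "f z = g z"
proof (rule ccontr)
  assume ne: "f z \<noteq> g z"
  have "open {w \<in> Om. f w - g w \<noteq> 0}"
    by (rule open_nonzero_set[OF Om continuous_on_diff[OF f g]])
  then obtain w where "w \<in> {w \<in> Om. f w - g w \<noteq> 0}" "h w \<noteq> 0"
  proof (rule holo2_entire_nonzero_dense[OF h])
    have "z \<in> {w \<in> Om. f w - g w \<noteq> 0}" using z ne by simp
    then show "{w \<in> Om. f w - g w \<noteq> 0} \<noteq> {}" by blast
  qed
  then show False using eq[of w] by auto
qed

context
  fixes d :: nat and m :: int and v :: sym_tensor
  assumes d: "d \<ge> 1" and v: "sym_section d m v" and disc: "\<exists>i z. bdisc d (v i z) \<noteq> 0"
begin

lemma holo2_v: "l \<le> d \<Longrightarrow> holo2 (\<lambda>z. v i z l) UNIV"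
  using v unfolding sym_section_def by blast

lemma v_trans: "z \<in> chart_dom i j \<Longrightarrow>
    bform d (v i z) (pullback (trans_map i j) z \<xi>) = (lift i z $ j) powi m * bform d (v j (trans_map i j z)) \<xi>"
  using v unfolding sym_section_def chart_dom_def by blast

text \<open>The discriminant is a section of \<open>\<O>(3 d (d - 1) + 2 m (d - 1))\<close>.\<close>

lemma bdisc_trans:
  assumes ij: "i \<noteq> j" and z: "z \<in> chart_dom i j"
  shows "bdisc d (v i z) = (lift i z $ j) powi (3 * (int d * (int d - 1)) + 2 * m * (int d - 1)) * bdisc d (v j (trans_map i j z))"
proof -
  let ?L = "lift i z $ j"
  have L: "?L \<noteq> 0" using z by (simp add: chart_dom_def)
  have "bform d (v i z) (pullback (trans_map i j) z \<xi>) = bform d (\<lambda>l. ?L powi m * v j (trans_map i j z) l) \<xi>" for \<xi>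
    unfolding v_trans[OF z] by (simp add: bform_def sum_distrib_left mult.assoc)
  from bdisc_transform[OF d ij z this]
  have e: "(?L powi m) ^ (2 * (d - 1)) * bdisc d (v j (trans_map i j z)) = inverse ?L ^ (3 * (d * (d - 1))) * bdisc d (v i z)"
    by (simp add: bdisc_scale[OF d])
  have "bdisc d (v i z) = ?L ^ (3 * (d * (d - 1))) * (inverse ?L ^ (3 * (d * (d - 1))) * bdisc d (v i z))"
    using L by (simp add: power_inverse)
  also have "\<dots> = (?L ^ (3 * (d * (d - 1))) * (?L powi m) ^ (2 * (d - 1))) * bdisc d (v j (trans_map i j z))"
    unfolding e[symmetric] by simp
  also have "?L ^ (3 * (d * (d - 1))) * (?L powi m) ^ (2 * (d - 1)) = ?L powi int (3 * (d * (d - 1))) * ?L powi (m * int (2 * (d - 1)))"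
    by (simp only: power_int_of_nat power_int_mult)
  also have "\<dots> = ?L powi (int (3 * (d * (d - 1))) + m * int (2 * (d - 1)))"
    by (simp only: power_int_add[OF disjI1[OF L]])
  also have "int (3 * (d * (d - 1))) + m * int (2 * (d - 1)) = 3 * (int d * (int d - 1)) + 2 * m * (int d - 1)"
    using d by (simp add: of_nat_diff algebra_simps)
  finally show ?thesis .
qed

lemma v_local:
  assumes "bdisc d (v i z) \<noteq> 0" "open Om" "z \<in> Om"
  shows "\<exists>U vs. open U \<and> z \<in> U \<and> U \<subseteq> Om \<and> (\<forall>u\<in>set vs. holo_vfield u U) \<and>
    (\<forall>z\<in>U. is_factorization d (v i z) (map (\<lambda>u. u z) vs)) \<and> (\<forall>z\<in>U. bdisc d (v i z) \<noteq> 0)"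
proof (rule local_factorization[of d "v i" z Om])
  show "holo2 (\<lambda>z. v i z l) UNIV" if "l \<le> d" for l by (rule holo2_v[OF that])
qed (use d assms in blast)+

lemma bdisc_nonzero: "\<exists>z. bdisc d (v i z) \<noteq> 0"
proof -
  obtain j z0 where j: "bdisc d (v j z0) \<noteq> 0" using disc by blast
  show ?thesis
  proof (cases "i = j")
    case True then show ?thesis using j by blast
  next
    case False
    have "holo2 (\<lambda>z. lift j z $ i) UNIV" by (rule holo2_lift) simp
    moreover have "\<exists>w. lift j w $ i \<noteq> 0"
    proof -
      have "lift j (1, 1) $ i \<noteq> 0" using exhaust_3[of i] exhaust_3[of j] by auto
      then show ?thesis by blast
    qed
    ultimately have "chart_dom j i \<noteq> {}" by (auto simp: chart_dom_def)
    then obtain z where z: "z \<in> chart_dom j i" "bdisc d (v j z) \<noteq> 0"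
      using holo2_entire_nonzero_dense[OF holo2_bdisc[OF d holo2_v open_UNIV] j open_chart_dom] by metis
    then show ?thesis using bdisc_trans[of j i z] False by (metis mult_zero_right)
  qed
qed

lemma is_extactic_sectionD:
  assumes "is_extactic_section d v (monomials n) E" "open U" "\<And>z. z \<in> U \<Longrightarrow> bdisc d (v i z) \<noteq> 0"
    "\<And>u. u \<in> set vs \<Longrightarrow> holo_vfield u U"
    "\<And>z. z \<in> U \<Longrightarrow> is_factorization d (v i z) (map (\<lambda>u. u z) vs)" "z \<in> U"
  shows "E i z = bdisc d (v i z) ^ ((n * (n + 3) div 2) * (n * (n + 3) div 2 - 1) div 2) * (\<Prod>u\<leftarrow>vs. sigma (monomials n i) u z)"
proof -
  let ?K = "n * (n + 3) div 2"
  have "\<forall>U vs. open U \<and> (\<forall>z\<in>U. bdisc d (v i z) \<noteq> 0) \<and> (\<forall>u\<in>set vs. holo_vfield u U) \<and>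
      (\<forall>z\<in>U. is_factorization d (v i z) (map (\<lambda>u. u z) vs)) \<longrightarrow>
      (\<forall>z\<in>U. E i z = bdisc d (v i z) ^ (?K * (?K - 1) div 2) * (\<Prod>u\<leftarrow>vs. sigma (monomials n i) u z))"
    using assms(1) unfolding is_extactic_section_def Let_def length_monomials diff_Suc_1 by blast
  then show ?thesis using assms(2-) by blast
qed

text \<open>Existence comes from the resultant; uniqueness holds because the defining formula determines the
  section off the discriminant, where local decompositions exist, and hence everywhere.\<close>

lemma extactic_section_exists: "is_extactic_section d v (monomials n) (nth_extactic_section n d v)"
proof -
  let ?K = "n * (n + 3) div 2"
  have "\<exists>E. holo2 E UNIV \<and> (\<forall>U vs. open U \<and> (\<forall>u\<in>set vs. holo_vfield u U) \<and>
      (\<forall>z\<in>U. is_factorization d (v i z) (map (\<lambda>u. u z) vs)) \<longrightarrow>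
      (\<forall>z\<in>U. E z = bdisc d (v i z) ^ (?K * (?K - 1) div 2) * (\<Prod>u\<leftarrow>vs. sigma (monomials n i) u z)))" for i
  proof (rule extactic_section_holomorphic[OF d, of "v i" "monomials n i" ?K])
    show "holo2 (\<lambda>z. v i z l) UNIV" if "l \<le> d" for l by (rule holo2_v[OF that])
    show "holo2 s UNIV" if "s \<in> set (monomials n i)" for s by (rule holo2_monomials[OF that]) simp
    show "length (monomials n i) = Suc ?K" by (rule length_monomials)
    fix E assume E: "holo2 E UNIV" "\<And>U vs z. open U \<Longrightarrow> (\<And>u. u \<in> set vs \<Longrightarrow> holo_vfield u U) \<Longrightarrow>
      (\<And>z. z \<in> U \<Longrightarrow> is_factorization d (v i z) (map (\<lambda>u. u z) vs)) \<Longrightarrow> z \<in> U \<Longrightarrow>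
      E z = bdisc d (v i z) ^ (?K * (?K - 1) div 2) * (\<Prod>u\<leftarrow>vs. sigma (monomials n i) u z)"
    show ?thesis
      by (intro exI[of _ E] conjI allI impI ballI E(1)) (rule E(2); blast)
  qed
  then obtain E where E: "\<And>i. holo2 (E i) UNIV" "\<And>i U vs z. open U \<Longrightarrow> (\<And>u. u \<in> set vs \<Longrightarrow> holo_vfield u U) \<Longrightarrow>
      (\<And>z. z \<in> U \<Longrightarrow> is_factorization d (v i z) (map (\<lambda>u. u z) vs)) \<Longrightarrow> z \<in> U \<Longrightarrow>
      E i z = bdisc d (v i z) ^ (?K * (?K - 1) div 2) * (\<Prod>u\<leftarrow>vs. sigma (monomials n i) u z)"
    by metis
  have ex: "is_extactic_section d v (monomials n) E"
    unfolding is_extactic_section_def Let_def length_monomials using E by auto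
  have "E' = E" if E': "is_extactic_section d v (monomials n) E'" for E'
  proof (intro ext)
    fix i z
    obtain z0 where z0: "bdisc d (v i z0) \<noteq> 0" using bdisc_nonzero by blast
    show "E' i z = E i z"
    proof (rule eq_of_eq_dense[OF _ E(1) holo2_bdisc[OF d holo2_v open_UNIV] z0])
      show "holo2 (E' i) UNIV" using E' by (simp add: is_extactic_section_def)
      fix z assume dz: "bdisc d (v i z) \<noteq> 0"
      obtain U vs where U0: "open U" "z \<in> U" "\<forall>u\<in>set vs. holo_vfield u U"
        "\<forall>z\<in>U. is_factorization d (v i z) (map (\<lambda>u. u z) vs)" "\<forall>z\<in>U. bdisc d (v i z) \<noteq> 0"
        using v_local[OF dz open_UNIV UNIV_I] by blast
      have U: "open U" "z \<in> U" "\<And>u. u \<in> set vs \<Longrightarrow> holo_vfield u U"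
        "\<And>z. z \<in> U \<Longrightarrow> is_factorization d (v i z) (map (\<lambda>u. u z) vs)" "\<And>z. z \<in> U \<Longrightarrow> bdisc d (v i z) \<noteq> 0"
        using U0 by blast+
      have "E' i z = bdisc d (v i z) ^ (?K * (?K - 1) div 2) * (\<Prod>u\<leftarrow>vs. sigma (monomials n i) u z)"
        by (rule is_extactic_sectionD[OF E' U(1,5,3,4,2)])
      then show "E' i z = E i z" using E(2)[OF U(1,3,4,2)] by simp
    qed
  qed
  then show ?thesis unfolding extactic_section_def using ex by (metis theI)
qed

lemma extactic_formula:
  fixes n
  defines "k \<equiv> n * (n + 3) div 2"
  assumes "open U" "\<And>u. u \<in> set vs \<Longrightarrow> holo_vfield u U"
    "\<And>z. z \<in> U \<Longrightarrow> is_factorization d (v i z) (map (\<lambda>u. u z) vs)" "\<And>z. z \<in> U \<Longrightarrow> bdisc d (v i z) \<noteq> 0" "z \<in> U"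
  shows "nth_extactic_section n d v i z = bdisc d (v i z) ^ (k * (k - 1) div 2) * (\<Prod>u\<leftarrow>vs. sigma (monomials n i) u z)"
  unfolding k_def by (rule is_extactic_sectionD[OF extactic_section_exists assms(2,5,3,4,6)])

lemma holo2_extactic: "holo2 (nth_extactic_section n d v i) UNIV"
  using extactic_section_exists[of n] unfolding is_extactic_section_def by simp

text \<open>The three summands come from the monomials (each of the \<open>d\<close> factors of the web contributes
  \<open>n (k + 1)\<close>), from the twist \<open>\<O>(m)\<close> of the web, and from the power of the discriminant.\<close>

definition ext_degree :: "nat \<Rightarrow> int" where
  "ext_degree n = (let k = n * (n + 3) div 2 in
     int (n * Suc k * d) + m * int (Suc k * k div 2)
      + (3 * (int d * (int d - 1)) + 2 * m * (int d - 1)) * int (k * (k - 1) div 2))"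

text \<open>Both sides are continuous, so it suffices to compare them where the web decomposes. The fields of a
  decomposition in one chart, transported to the other chart, form a decomposition there after one of them
  is multiplied by \<open>L\<^sup>-\<^sup>m\<close>.\<close>

theorem extactic_trans:
  assumes ij: "i \<noteq> j" and z: "z \<in> chart_dom i j"
  shows "nth_extactic_section n d v i z =
    (lift i z $ j) powi ext_degree n * nth_extactic_section n d v j (trans_map i j z)"
proof -
  obtain z0 where z0: "bdisc d (v i z0) \<noteq> 0" using bdisc_nonzero by blast
  let ?E = "nth_extactic_section n d v"
  have c1: "continuous_on (chart_dom i j) (?E i)"
    using holo2_cont[OF holo2_extactic] continuous_on_subset by blast
  have c2: "continuous_on (chart_dom i j) (\<lambda>z. (lift i z $ j) powi ext_degree n * ?E j (trans_map i j z))"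
    by (rule holo2_cont, intro holo2_mult holo2_powi holo2_lift open_chart_dom
        holo2_compose[OF holo2_trans(1)[OF ij] holo2_trans(2)[OF ij] holo2_extactic]) (auto simp: chart_dom_def)
  show ?thesis
  proof (rule eq_on_open_of_eq_dense[OF open_chart_dom c1 c2 holo2_bdisc[OF d holo2_v open_UNIV] z0 _ z])
    fix z assume z: "z \<in> chart_dom i j" and dz: "bdisc d (v i z) \<noteq> 0"
    define k where "k = n * (n + 3) div 2"
    obtain U vs where U: "open U" "z \<in> U" "U \<subseteq> chart_dom i j" "\<And>u. u \<in> set vs \<Longrightarrow> holo_vfield u U"
        and fac: "\<And>z. z \<in> U \<Longrightarrow> is_factorization d (v i z) (map (\<lambda>u. u z) vs)" and dU: "\<And>z. z \<in> U \<Longrightarrow> bdisc d (v i z) \<noteq> 0"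
      using v_local[OF dz open_chart_dom z] by meson
    have len: "length vs = d" using fac[OF U(2)] by (simp add: is_factorization_def)
    obtain u0 rest where vs: "vs = u0 # rest" using len d by (cases vs) auto
    let ?w = "trans_map i j z" and ?U = "chart_image i j U" and ?L = "lift i z $ j"
    have L: "?L \<noteq> 0" using z by (simp add: chart_dom_def)
    define lam where "lam w = (lift j w $ i) powi m" for w
    let ?u0 = "\<lambda>w. (lam w * fst (push i j u0 w), lam w * snd (push i j u0 w))"
    let ?vs = "?u0 # map (push i j) rest"
    have oU: "open ?U" by (rule open_chart_image[OF ij U(1)])
    have wU: "?w \<in> ?U" by (rule chart_image_mem[OF z U(2)])
    have hlam: "holo2 lam ?U" unfolding lam_def by (intro holo2_powi holo2_lift oU) (auto simp: chart_image_def chart_dom_def)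
    have push: "holo_vfield (push i j u) ?U" if "u \<in> set vs" for u by (rule holo_vfield_push[OF ij U(4)[OF that] U(3)])
    have v0: "holo_vfield ?u0 ?U"
      using push[of u0] hlam vs unfolding holo_vfield_def comp_def by (auto intro: holo2_mult)
    have rel: "\<exists>z\<in>U. z \<in> chart_dom i j \<and> w = trans_map i j z" if "w \<in> ?U" for w
      using that U(3) by (intro bexI[of _ "trans_map j i w"]) (auto simp: chart_image_def trans_map_inverse chart_dom_def)
    have fac': "is_factorization d (v j w) (map (\<lambda>u. u w) ?vs)" if w: "w \<in> ?U" for w
    proof -
      obtain z where z: "z \<in> U" "z \<in> chart_dom i j" "w = trans_map i j z" using rel[OF w] by blast
      have L: "lift i z $ j \<noteq> 0" using z(2) by (simp add: chart_dom_def)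
      have "bform d (v j w) \<xi> = (\<Prod>u\<leftarrow>map (\<lambda>u. u w) ?vs. pairing u \<xi>)" for \<xi>
      proof -
        have "(lift i z $ j) powi m * bform d (v j w) \<xi> = bform d (v i z) (pullback (trans_map i j) z \<xi>)"
          using v_trans[OF z(2)] z(3) by simp
        also have "\<dots> = (\<Prod>u\<leftarrow>vs. pairing (push i j u w) \<xi>)"
          using fac[OF z(1)] by (simp add: is_factorization_def comp_def pairing_pullback z(3) push_trans[OF z(2)] del: split_paired_All)
        finally have e: "(lift i z $ j) powi m * bform d (v j w) \<xi> = (\<Prod>u\<leftarrow>vs. pairing (push i j u w) \<xi>)" .
        have "(\<Prod>u\<leftarrow>map (\<lambda>u. u w) ?vs. pairing u \<xi>) = lam w * (\<Prod>u\<leftarrow>vs. pairing (push i j u w) \<xi>)"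
          by (simp add: vs comp_def pairing_def algebra_simps)
        also have "\<dots> = lam w * (lift i z $ j) powi m * bform d (v j w) \<xi>" unfolding e[symmetric] by simp
        also have "lam w * (lift i z $ j) powi m = 1"
          using L by (simp add: lam_def z(3) lift_trans_inverse[OF z(2)] power_int_inverse)
        finally show ?thesis by simp
      qed
      then show ?thesis using len by (simp add: is_factorization_def vs del: split_paired_All)
    qed
    have dU': "bdisc d (v j w) \<noteq> 0" if w: "w \<in> ?U" for w
    proof -
      obtain z where z: "z \<in> U" "z \<in> chart_dom i j" "w = trans_map i j z" using rel[OF w] by blast
      then show ?thesis using bdisc_trans[OF ij z(2)] dU[OF z(1)] by auto
    qed
    let ?N = "length (monomials n j)"
    have s0: "sigma (monomials n j) ?u0 ?w = lam ?w ^ (Suc k * k div 2) * sigma (monomials n j) (push i j u0) ?w"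
      using sigma_scale[OF push hlam holo2_monomials[OF _ oU] wU, of u0 "monomials n j"] vs by (simp add: length_monomials k_def)
    have st: "sigma (monomials n i) u z = ?L ^ (n * Suc k) * sigma (monomials n j) (push i j u) ?w" if "u \<in> set vs" for u
      using sigma_trans[OF ij U(4)[OF that] U(3) U(2), of n] by (simp add: length_monomials k_def)
    have prodst: "(\<Prod>u\<leftarrow>us. sigma (monomials n i) u z) = ?L ^ (n * Suc k * length us) * (\<Prod>u\<leftarrow>us. sigma (monomials n j) (push i j u) ?w)"
      if "set us \<subseteq> set vs" for us
      using that by (induction us) (auto simp: st power_add algebra_simps)
    let ?P = "\<Prod>u\<leftarrow>vs. sigma (monomials n j) (push i j u) ?w"
    have Ei: "?E i z = bdisc d (v i z) ^ (k * (k - 1) div 2) * (?L ^ (n * Suc k * d) * ?P)"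
      using extactic_formula[OF U(1,4) fac dU U(2), of n] prodst[of vs] len by (simp add: k_def)
    have Ej: "?E j ?w = bdisc d (v j ?w) ^ (k * (k - 1) div 2) * (lam ?w ^ (Suc k * k div 2) * ?P)"
    proof -
      have "?E j ?w = bdisc d (v j ?w) ^ (k * (k - 1) div 2) * (\<Prod>u\<leftarrow>?vs. sigma (monomials n j) u ?w)"
        unfolding k_def by (rule extactic_formula[OF oU _ fac' dU' wU]) (use v0 push vs in auto)
      then show ?thesis using s0 by (simp add: vs comp_def)
    qed
    have lamL: "lam ?w * ?L powi m = 1"
      using L by (simp add: lam_def lift_trans_inverse[OF z] power_int_inverse)
    have "?P = (lam ?w * ?L powi m) ^ (Suc k * k div 2) * ?P" using lamL by simp
    also have "\<dots> = (?L powi m) ^ (Suc k * k div 2) * (lam ?w ^ (Suc k * k div 2) * ?P)" by (simp add: power_mult_distrib)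
    finally have P: "?P = (?L powi m) ^ (Suc k * k div 2) * (lam ?w ^ (Suc k * k div 2) * ?P)" .
    let ?D = "3 * (int d * (int d - 1)) + 2 * m * (int d - 1)"
    have "?E i z = (?L powi ?D * bdisc d (v j ?w)) ^ (k * (k - 1) div 2) * (?L ^ (n * Suc k * d) *
       ((?L powi m) ^ (Suc k * k div 2) * (lam ?w ^ (Suc k * k div 2) * ?P)))"
      unfolding Ei bdisc_trans[OF ij z] by (subst P) (rule refl)
    also have "\<dots> = (?L ^ (n * Suc k * d) * (?L powi m) ^ (Suc k * k div 2) * (?L powi ?D) ^ (k * (k - 1) div 2)) * ?E j ?w"
      unfolding Ej power_mult_distrib by (simp only: mult_ac)
    also have "?L ^ (n * Suc k * d) * (?L powi m) ^ (Suc k * k div 2) * (?L powi ?D) ^ (k * (k - 1) div 2) = ?L powi ext_degree n"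
      unfolding ext_degree_def Let_def k_def[symmetric]
      by (simp only: power_int_of_nat[symmetric] power_int_mult[symmetric])
         (simp only: power_int_add[OF disjI1[OF L], symmetric])
    finally show "?E i z = ?L powi ext_degree n * ?E j ?w" .
  qed
qed

end

section \<open>Evaluation of polynomials\<close>

text \<open>Polynomials in two variables follow the nesting of \<open>eval3\<close>: the outer variable is the second coordinate.\<close>

definition eval2 :: "complex poly poly \<Rightarrow> complex \<times> complex \<Rightarrow> complex" where
  "eval2 p z = poly (poly p [:snd z:]) (fst z)"

lemma eval2_simps [simp]:
  "eval2 (p + q) z = eval2 p z + eval2 q z" "eval2 (p - q) z = eval2 p z - eval2 q z"
  "eval2 (p * q) z = eval2 p z * eval2 q z" "eval2 0 z = 0" "eval2 1 z = 1" "eval2 (- p) z = - eval2 p z"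
  "eval2 (p ^ k) z = eval2 p z ^ k" "eval2 [:f:] z = poly f (fst z)"
  by (simp_all add: eval2_def)

lemma eval2_sum: "eval2 (\<Sum>i\<in>I. f i) z = (\<Sum>i\<in>I. eval2 (f i) z)"
  by (simp add: eval2_def poly_sum)

lemma eval2_monom: "eval2 (monom (monom k a) b) z = k * fst z ^ a * snd z ^ b"
  by (simp add: eval2_def poly_monom)

lemma eval3_eval2: "eval3 F X = eval2 (poly F [:[:X $ 3:]:]) (X $ 1, X $ 2)"
  by (simp add: eval3_def eval2_def)

lemma eval3_simps [simp]:
  "eval3 (p + q) X = eval3 p X + eval3 q X" "eval3 (p - q) X = eval3 p X - eval3 q X"
  "eval3 (p * q) X = eval3 p X * eval3 q X" "eval3 0 X = 0" "eval3 1 X = 1"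
  "eval3 (p ^ k) X = eval3 p X ^ k"
  by (simp_all add: eval3_def)

lemma eval3_sum: "eval3 (\<Sum>i\<in>I. f i) X = (\<Sum>i\<in>I. eval3 (f i) X)"
  by (simp add: eval3_def poly_sum)

definition mon3 :: "complex \<Rightarrow> nat \<Rightarrow> nat \<Rightarrow> nat \<Rightarrow> poly3" where
  "mon3 k a b c = monom (monom (monom k a) b) c"

lemma eval3_mon3: "eval3 (mon3 k a b c) X = k * X $ 1 ^ a * X $ 2 ^ b * X $ 3 ^ c"
  by (simp add: eval3_def mon3_def poly_monom)

lemma poly_zero_if_roots:
  fixes p :: "'a :: idom poly" and e :: "complex \<Rightarrow> 'a"
  assumes "inj e" "\<And>t. poly p (e t) = 0" shows "p = 0"
proof (rule ccontr)
  assume "p \<noteq> 0"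
  then have "finite {x. poly p x = 0}" by (rule poly_roots_finite)
  then have "finite (range e)" by (rule finite_subset[rotated]) (use assms(2) in auto)
  then have "finite (UNIV :: complex set)" using assms(1) by (simp add: finite_image_iff)
  then show False by (simp add: infinite_UNIV_char_0)
qed

lemma eval2_zero: assumes "\<And>z. eval2 p z = 0" shows "p = 0"
proof (rule poly_zero_if_roots[of "\<lambda>t. [:t:]"])
  show "inj (\<lambda>t::complex. [:t:])" by (simp add: inj_on_def)
  show "poly p [:t:] = 0" for t
    by (rule poly_zero_if_roots[of "\<lambda>t. t"]) (use assms[of "(_, t)"] in \<open>auto simp: eval2_def\<close>)
qed

lemma eval3_zero: assumes "\<And>X. eval3 F X = 0" shows "F = 0"
proof (rule poly_zero_if_roots[of "\<lambda>t. [:[:t:]:]"])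
  show "inj (\<lambda>t::complex. [:[:t:]:])" by (simp add: inj_on_def)
  show "poly F [:[:t:]:] = 0" for t
  proof (rule eval2_zero)
    fix z :: "complex \<times> complex"
    show "eval2 (poly F [:[:t:]:]) z = 0"
      using assms[of "vector [fst z, snd z, t]"] by (simp add: eval3_eval2)
  qed
qed

section \<open>A Nullstellensatz for prime polynomials\<close>

text \<open>Pseudo-division by an element of least degree in the ideal generated by \<open>F\<close> and \<open>G\<close>: a
  multiple of \<open>F\<close>, and one of \<open>G\<close>, by nonzero constants is divisible by it, and primality of \<open>F\<close> forces its degree to be zero.\<close>

lemma prime_poly_bezout:
  fixes F G :: "'a :: idom poly"
  assumes F: "prime_elem F" "degree F > 0" and G: "\<not> F dvd G"
  obtains A B r where "r \<noteq> 0" "A * F + B * G = [:r:]"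
proof -
  define I where "I = {h. \<exists>A B. h = A * F + B * G}"
  have FI: "F \<in> I" unfolding I_def by (rule CollectI, rule exI[of _ 1], rule exI[of _ 0]) simp
  have GI: "G \<in> I" unfolding I_def by (rule CollectI, rule exI[of _ 0], rule exI[of _ 1]) simp
  have "F \<in> I - {0}" using FI F by auto
  then obtain h where h: "h \<in> I - {0}" and min: "\<And>g. g \<in> I - {0} \<Longrightarrow> degree h \<le> degree g"
    using ex_has_least_nat[of "\<lambda>h. h \<in> I - {0}" F degree] by blast
  obtain A B where AB: "h = A * F + B * G" using h unfolding I_def by blast
  have div: "\<exists>c q. c \<noteq> 0 \<and> Polynomial.smult c f = h * q" if f: "f \<in> I" for f
  proof -
    obtain q r where qr: "pseudo_divmod f h = (q, r)" by force
    let ?c = "lead_coeff h ^ (Suc (degree f) - degree h)"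
    from pseudo_divmod[OF _ qr] h have e: "Polynomial.smult ?c f = h * q + r" and d: "r = 0 \<or> degree r < degree h" by auto
    obtain A' B' where f': "f = A' * F + B' * G" using f unfolding I_def by blast
    have "r = Polynomial.smult ?c f - h * q" using e by simp
    also have "\<dots> = (Polynomial.smult ?c A' - q * A) * F + (Polynomial.smult ?c B' - q * B) * G"
      unfolding f' AB by (simp add: algebra_simps smult_add_right)
    finally have "r \<in> I" unfolding I_def by blast
    then have "r = 0" using d min[of r] by (cases "r = 0") auto
    moreover have "?c \<noteq> 0" using h by simp
    ultimately show ?thesis using e by (intro exI[of _ ?c] exI[of _ q]) auto
  qed
  obtain c q where c: "c \<noteq> 0" "Polynomial.smult c F = h * q" using div[OF FI] by blast
  obtain c' q' where c': "c' \<noteq> 0" "Polynomial.smult c' G = h * q'" using div[OF GI] by blast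
  have "F dvd h * q" unfolding c(2)[symmetric] by (simp add: dvd_smult)
  then have "F dvd h \<or> F dvd q" using F by (simp add: prime_elem_dvd_mult_iff)
  then have "degree h = 0"
  proof
    assume "F dvd h"
    then have "F dvd [:c':] * G" using c'(2) by (simp add: dvd_mult2)
    then have "F dvd [:c':]" using prime_elem_dvd_multD[OF F(1)] G by blast
    then have "degree F \<le> degree [:c':]" using c' by (intro dvd_imp_degree_le) auto
    then show ?thesis using F by simp
  next
    assume "F dvd q"
    then obtain t where "q = F * t" by blast
    then have "F * [:c:] = F * (h * t)" using c(2) by (simp add: algebra_simps)
    moreover have "F \<noteq> 0" using F by auto
    ultimately have "[:c:] = h * t" using mult_left_cancel[of F] by blast
    then have "h * t \<noteq> 0" "degree (h * t) = 0" using c(1) by (metis pCons_eq_0_iff, metis degree_pCons_0)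
    then show ?thesis by (metis add_is_0 degree_mult_eq mult_eq_0_iff)
  qed
  then obtain r where "h = [:r:]" by (metis degree_eq_zeroE)
  then show thesis using that[of r A B] h AB by auto
qed

lemma poly_of_evaluation:
  fixes ev :: "'a :: idom \<Rightarrow> complex" and emb :: "complex \<Rightarrow> 'a"
  assumes add: "\<And>a b. ev (a + b) = ev a + ev b" and mult: "\<And>a b. ev (a * b) = ev a * ev b"
    and 0: "ev 0 = 0" and 1: "ev 1 = 1" and emb: "\<And>t. ev (emb t) = t"
  shows "ev (poly F (emb t)) = poly (map_poly ev F) t"
proof (induction F)
  case 0 then show ?case by (simp add: \<open>ev 0 = 0\<close>)
next
  case (pCons a F) then show ?case by (simp add: add mult emb 0 map_poly_pCons)
qed

text \<open>From coefficients in \<open>'a\<close> to polynomials over \<open>'a\<close>. The points \<open>i\<close> enter through the evaluations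
  \<open>ev i\<close>. If \<open>F\<close> did not divide \<open>G\<close>, some \<open>A F + B G\<close> would be a nonzero \<open>r\<close> free of the
  new variable; at a point where neither \<open>r\<close> nor the leading coefficient of \<open>F\<close> vanishes, \<open>F\<close> has a zero in the new
  variable, where \<open>G\<close> and hence \<open>r\<close> vanish. A prime \<open>F\<close> without the new variable is the inductive case.\<close>

lemma nullstellensatz_step:
  fixes ev :: "'i \<Rightarrow> 'a :: idom \<Rightarrow> complex" and emb :: "complex \<Rightarrow> 'a"
  assumes add: "\<And>i a b. ev i (a + b) = ev i a + ev i b" and mult: "\<And>i a b. ev i (a * b) = ev i a * ev i b"
    and 0: "\<And>i. ev i 0 = 0" and 1: "\<And>i. ev i 1 = 1" and emb: "\<And>i t. ev i (emb t) = t"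
    and inj: "\<And>r. (\<And>i. ev i r = 0) \<Longrightarrow> r = 0"
    and NS: "\<And>p q. prime_elem p \<Longrightarrow> (\<And>i. ev i p = 0 \<Longrightarrow> ev i q = 0) \<Longrightarrow> p dvd q"
    and F: "prime_elem F" and van: "\<And>i t. ev i (poly F (emb t)) = 0 \<Longrightarrow> ev i (poly G (emb t)) = 0"
  shows "F dvd G"
proof -
  note pe = poly_of_evaluation[of "ev i" emb for i, OF add mult 0 1 emb]
  show ?thesis
  proof (cases "degree F = 0")
    case True
    then obtain f where f: "F = [:f:]" by (metis degree_eq_zeroE)
    have pf: "prime_elem f" using F f by (simp add: prime_elem_const_poly_iff)
    have "f dvd coeff G k" for k
    proof (rule NS[OF pf])
      fix i assume i: "ev i f = 0"
      have "poly (map_poly (ev i) G) t = 0" for t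
        using van[of i t] i f pe[of i G t] by simp
      then have "map_poly (ev i) G = 0" by (simp add: poly_all_0_iff_0[symmetric])
      then have "coeff (map_poly (ev i) G) k = 0" by simp
      then show "ev i (coeff G k) = 0" by (simp add: coeff_map_poly 0)
    qed
    then show ?thesis unfolding f by (simp add: const_poly_dvd_iff)
  next
    case False
    show ?thesis
    proof (rule ccontr)
      assume nd: "\<not> F dvd G"
      obtain A B r where r: "r \<noteq> 0" "A * F + B * G = [:r:]" by (rule prime_poly_bezout[OF F _ nd]) (use False in auto)
      have "r * lead_coeff F \<noteq> 0" using r False by auto
      then obtain i where i: "ev i (r * lead_coeff F) \<noteq> 0" using inj by blast
      have lc: "ev i (lead_coeff F) \<noteq> 0" and ri: "ev i r \<noteq> 0" using i by (auto simp: mult)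
      have "degree (map_poly (ev i) F) = degree F" using lc by (intro map_poly_degree_eq) simp
      then have "\<not> constant (poly (map_poly (ev i) F))" using False by (simp add: constant_degree)
      then obtain t where t: "poly (map_poly (ev i) F) t = 0" using fundamental_theorem_of_algebra by blast
      then have z: "ev i (poly F (emb t)) = 0" by (simp add: pe)
      have "ev i r = ev i (poly (A * F + B * G) (emb t))" unfolding r(2) by simp
      also have "\<dots> = 0" using z van[OF z] by (simp add: add mult)
      finally show False using ri by simp
    qed
  qed
qed

lemma nullstellensatz1:
  assumes p: "prime_elem (p :: complex poly)" and van: "\<And>x. poly p x = 0 \<Longrightarrow> poly q x = 0"
  shows "p dvd q"
proof (rule nullstellensatz_step[of "\<lambda>_::unit. \<lambda>x. x" "\<lambda>t. t"])
  fix a b :: complex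
  assume "prime_elem a" then have False by (simp add: prime_elem_def dvd_field_iff)
  then show "a dvd b" by simp
qed (use assms in auto)

lemma nullstellensatz2:
  assumes p: "prime_elem (p :: complex poly poly)" and van: "\<And>z. eval2 p z = 0 \<Longrightarrow> eval2 q z = 0"
  shows "p dvd q"
proof (rule nullstellensatz_step[of "\<lambda>x r. poly r x" "\<lambda>t. [:t:]"])
  show "r = 0" if "\<And>i. poly r i = 0" for r :: "complex poly" using that by (simp add: poly_all_0_iff_0[symmetric])
  show "poly (poly q [:t:]) i = 0" if "poly (poly p [:t:]) i = 0" for i t
    using van[of "(i, t)"] that by (simp add: eval2_def)
  show "p dvd q" if "prime_elem p" "\<And>i. poly p i = 0 \<Longrightarrow> poly q i = 0" for p q :: "complex poly"
    by (rule nullstellensatz1) (use that in auto)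
qed (use p in auto)

lemma nullstellensatz3:
  assumes p: "prime_elem (F :: poly3)" and van: "\<And>X. eval3 F X = 0 \<Longrightarrow> eval3 G X = 0"
  shows "F dvd G"
proof (rule nullstellensatz_step[of "\<lambda>z r. eval2 r z" "\<lambda>t. [:[:t:]:]"])
  show "r = 0" if "\<And>i. eval2 r i = 0" for r using eval2_zero that by blast
  show "eval2 (poly G [:[:t:]:]) i = 0" if "eval2 (poly F [:[:t:]:]) i = 0" for i t
    using van[of "vector [fst i, snd i, t]"] that by (simp add: eval3_eval2)
  show "p dvd q" if "prime_elem p" "\<And>i. eval2 p i = 0 \<Longrightarrow> eval2 q i = 0" for p q
    by (rule nullstellensatz2) (use that in auto)
qed (use p in auto)

text \<open>Eliminating the second coordinate leaves finitely many values of the first, and over each of them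
  one of the two polynomials is not identically zero.\<close>

lemma prime_common_zeros_finite:
  assumes p: "prime_elem (p :: complex poly poly)" and q: "\<not> p dvd q"
  shows "finite {z. eval2 p z = 0 \<and> eval2 q z = 0}"
proof -
  let ?pe = "\<lambda>x f. map_poly (\<lambda>r. poly r x) f"
  have ev: "eval2 f (x, y) = poly (?pe x f) y" for f x y
    using poly_of_evaluation[of "\<lambda>r. poly r x" "\<lambda>t. [:t:]" f y] by (simp add: eval2_def)
  have dvdI: "[:[:- x, 1:]:] dvd f" if "?pe x f = 0" for x :: complex and f
  proof -
    have "poly (coeff f k) x = 0" for k
    proof -
      have "coeff (?pe x f) k = 0" using that by simp
      then show ?thesis by (simp add: coeff_map_poly)
    qed
    then have "\<forall>n. [:- x, 1:] dvd coeff f n" using poly_eq_0_iff_dvd by blast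
    then show ?thesis using const_poly_dvd_iff by blast
  qed
  have lin: "prime_elem [:[:- x, 1:]:]" for x :: complex
  proof -
    have "prime_elem [:- x, 1:]" by (rule prime_elem_linear_field_poly) simp
    then show ?thesis by (simp add: prime_elem_const_poly_iff)
  qed
  have both: "?pe x p \<noteq> 0 \<or> ?pe x q \<noteq> 0" for x
  proof (rule ccontr)
    assume "\<not> ?thesis"
    then have d: "[:[:- x, 1:]:] dvd p" "[:[:- x, 1:]:] dvd q" using dvdI by auto
    have "p dvd [:[:- x, 1:]:]"
      using d(1) p lin[of x] by (meson prime_elem_imp_irreducible irreducibleD' prime_elem_not_unit)
    then show False using d(2) q dvd_trans by blast
  qed
  have fib: "finite {y. eval2 p (x, y) = 0 \<and> eval2 q (x, y) = 0}" for x
  proof (cases "?pe x p = 0")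
    case True
    then have "finite {y. poly (?pe x q) y = 0}" using both[of x] by (intro poly_roots_finite) auto
    then show ?thesis by (rule finite_subset[rotated]) (auto simp: ev)
  next
    case False
    then have "finite {y. poly (?pe x p) y = 0}" by (intro poly_roots_finite) auto
    then show ?thesis by (rule finite_subset[rotated]) (auto simp: ev)
  qed
  have "\<exists>X. finite X \<and> (\<forall>z. eval2 p z = 0 \<and> eval2 q z = 0 \<longrightarrow> fst z \<in> X)"
  proof (cases "degree p = 0")
    case True
    then obtain f where f: "p = [:f:]" by (metis degree_eq_zeroE)
    have "f \<noteq> 0" using p f by auto
    then have "finite {x. poly f x = 0}" by (rule poly_roots_finite)
    then show ?thesis by (intro exI[of _ "{x. poly f x = 0}"]) (auto simp: f)
  next
    case False
    obtain A B r where r: "r \<noteq> 0" "A * p + B * q = [:r:]" by (rule prime_poly_bezout[OF p _ q]) (use False in auto)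
    have "poly r (fst z) = 0" if "eval2 p z = 0" "eval2 q z = 0" for z
    proof -
      have "poly r (fst z) = eval2 (A * p + B * q) z" unfolding r(2) by simp
      then show ?thesis using that by simp
    qed
    then show ?thesis using poly_roots_finite[OF r(1)] by (intro exI[of _ "{x. poly r x = 0}"]) auto
  qed
  then obtain X where X: "finite X" "\<And>z. eval2 p z = 0 \<Longrightarrow> eval2 q z = 0 \<Longrightarrow> fst z \<in> X" by blast
  have "{z. eval2 p z = 0 \<and> eval2 q z = 0} \<subseteq> (\<Union>x\<in>X. Pair x ` {y. eval2 p (x, y) = 0 \<and> eval2 q (x, y) = 0})"
  proof
    fix z assume z: "z \<in> {z. eval2 p z = 0 \<and> eval2 q z = 0}"
    then have "fst z \<in> X" using X by blast
    then show "z \<in> (\<Union>x\<in>X. Pair x ` {y. eval2 p (x, y) = 0 \<and> eval2 q (x, y) = 0})"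
      using z by (intro UN_I[of "fst z"]) (auto simp: image_iff intro!: exI[of _ "snd z"])
  qed
  then show ?thesis by (rule finite_subset) (intro finite_UN_I X finite_imageI fib)
qed

section \<open>Homogeneous polynomials\<close>

abbreviation cf :: "poly3 \<Rightarrow> nat \<Rightarrow> nat \<Rightarrow> nat \<Rightarrow> complex" where
  "cf F a b c \<equiv> coeff (coeff (coeff F c) b) a"

lemma poly_as_monoms: "(\<Sum>a\<le>degree p. monom (coeff p a) a) = p"
  by (rule poly_as_sum_of_monoms)

lemma cf_mon3: "cf (mon3 k a b c) a' b' c' = (if a' = a \<and> b' = b \<and> c' = c then k else 0)"
  by (auto simp: mon3_def)

definition part3 :: "nat \<Rightarrow> poly3 \<Rightarrow> poly3" where
  "part3 j F = (\<Sum>c\<le>degree F. \<Sum>b\<le>degree (coeff F c). \<Sum>a\<le>degree (coeff (coeff F c) b).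
     if a + b + c = j then mon3 (cf F a b c) a b c else 0)"

lemma poly3_as_monoms:
  "F = (\<Sum>c\<le>degree F. \<Sum>b\<le>degree (coeff F c). \<Sum>a\<le>degree (coeff (coeff F c) b). mon3 (cf F a b c) a b c)"
proof -
  have "F = (\<Sum>c\<le>degree F. monom (coeff F c) c)" by (simp add: poly_as_monoms)
  also have "\<dots> = (\<Sum>c\<le>degree F. monom (\<Sum>b\<le>degree (coeff F c). monom (coeff (coeff F c) b) b) c)"
    by (simp add: poly_as_monoms)
  also have "\<dots> = (\<Sum>c\<le>degree F. monom (\<Sum>b\<le>degree (coeff F c). monom (\<Sum>a\<le>degree (coeff (coeff F c) b). monom (cf F a b c) a) b) c)"
    by (simp add: poly_as_monoms)
  finally show ?thesis by (simp add: mon3_def monom_sum)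
qed

lemma eval3_expand:
  "eval3 F X = (\<Sum>c\<le>degree F. \<Sum>b\<le>degree (coeff F c). \<Sum>a\<le>degree (coeff (coeff F c) b). cf F a b c * X $ 1 ^ a * X $ 2 ^ b * X $ 3 ^ c)"
  by (subst poly3_as_monoms[of F]) (simp only: eval3_sum eval3_mon3)

lemma eval3_homogeneous_scale:
  assumes "homogeneous m F" shows "eval3 F (t *s X) = t ^ m * eval3 F X"
proof -
  have "cf F a b c * (t * X $ 1) ^ a * (t * X $ 2) ^ b * (t * X $ 3) ^ c = t ^ m * (cf F a b c * X $ 1 ^ a * X $ 2 ^ b * X $ 3 ^ c)" for a b c
  proof (cases "cf F a b c = 0")
    case False
    then have "m = a + b + c" using assms unfolding homogeneous_def by blast
    then show ?thesis by (simp add: power_mult_distrib power_add mult_ac)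
  qed simp
  then show ?thesis unfolding eval3_expand sum_distrib_left vector_smult_component
    by (intro sum.cong refl)
qed

lemma homogeneous_add: "homogeneous m F \<Longrightarrow> homogeneous m G \<Longrightarrow> homogeneous m (F + G)"
  unfolding homogeneous_def by (metis add_0 coeff_add)

lemma homogeneous_zero: "homogeneous m 0" by (simp add: homogeneous_def)

lemma homogeneous_sum: "(\<And>i. i \<in> I \<Longrightarrow> homogeneous m (f i)) \<Longrightarrow> homogeneous m (\<Sum>i\<in>I. f i)"
  by (induction I rule: infinite_finite_induct) (auto intro: homogeneous_zero homogeneous_add)

lemma homogeneous_mon3: "a + b + c = m \<Longrightarrow> homogeneous m (mon3 k a b c)"
  unfolding homogeneous_def cf_mon3 by auto

lemma homogeneous_part3: "homogeneous j (part3 j F)"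
  unfolding part3_def by (intro homogeneous_sum) (auto intro: homogeneous_mon3 homogeneous_zero)

lemma homogeneous_unique:
  assumes "homogeneous m F" "homogeneous m' F" "F \<noteq> 0" shows "m = m'"
proof -
  obtain c where "coeff F c \<noteq> 0" using assms(3) by (metis leading_coeff_0_iff)
  then obtain b where "coeff (coeff F c) b \<noteq> 0" by (metis leading_coeff_0_iff)
  then obtain a where "cf F a b c \<noteq> 0" by (metis leading_coeff_0_iff)
  then show ?thesis using assms unfolding homogeneous_def by metis
qed

lemma sum_part3: "\<exists>J. F = (\<Sum>j\<le>J. part3 j F)"
proof -
  have fin: "finite (\<Union>c\<in>{..degree F}. \<Union>b\<in>{..degree (coeff F c)}. (\<lambda>a. a + b + c) ` {..degree (coeff (coeff F c) b)})"
    (is "finite ?S") by auto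
  define J where "J = Max (insert 0 ?S)"
  have J: "a + b + c \<le> J" if "c \<le> degree F" "b \<le> degree (coeff F c)" "a \<le> degree (coeff (coeff F c) b)" for a b c
    unfolding J_def using fin that by (intro Max_ge) auto
  have "(\<Sum>j\<le>J. part3 j F) = (\<Sum>c\<le>degree F. \<Sum>b\<le>degree (coeff F c). \<Sum>a\<le>degree (coeff (coeff F c) b).
     \<Sum>j\<le>J. if a + b + c = j then mon3 (cf F a b c) a b c else 0)"
    unfolding part3_def
    by (rule trans[OF sum.swap], rule sum.cong, rule refl, rule trans[OF sum.swap], rule sum.cong, rule refl, rule sum.swap)
  also have "\<dots> = (\<Sum>c\<le>degree F. \<Sum>b\<le>degree (coeff F c). \<Sum>a\<le>degree (coeff (coeff F c) b). mon3 (cf F a b c) a b c)"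
    by (intro sum.cong refl) (use J in \<open>simp add: sum.delta\<close>)
  also have "\<dots> = F" by (rule poly3_as_monoms[symmetric])
  finally show ?thesis by metis
qed

text \<open>Homogeneity of the associated function implies homogeneity of the polynomial, since a function
  determines the polynomial and therefore its homogeneous parts. This reduces closure properties to values.\<close>

lemma homogeneousI_eval:
  assumes "\<And>t X. eval3 F (t *s X) = t ^ m * eval3 F X" shows "homogeneous m F"
proof -
  obtain J where J: "F = (\<Sum>j\<le>J. part3 j F)" using sum_part3 by blast
  have z: "part3 j F = 0" if "j \<noteq> m" "j \<le> J" for j
  proof (rule eval3_zero)
    fix X
    define p where "p = (\<Sum>j\<le>J. monom (eval3 (part3 j F) X) j) - monom (eval3 F X) m"
    have "poly p t = 0" for t
    proof -
      have "eval3 F (t *s X) = (\<Sum>j\<le>J. t ^ j * eval3 (part3 j F) X)"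
        by (subst J) (simp add: eval3_sum eval3_homogeneous_scale[OF homogeneous_part3])
      then show ?thesis using assms[of t X] by (simp add: p_def poly_sum poly_monom mult.commute)
    qed
    then have "p = 0" by (simp add: poly_all_0_iff_0[symmetric])
    then have "coeff p j = 0" by simp
    then show "eval3 (part3 j F) X = 0" using that by (simp add: p_def coeff_sum)
  qed
  have "F = (\<Sum>j\<le>J. if j = m then part3 m F else 0)"
    by (subst J) (rule sum.cong, use z in auto)
  then have "F = part3 m F \<or> F = 0" by (auto split: if_splits)
  then show ?thesis using homogeneous_part3[of m F] homogeneous_zero[of m] by metis
qed

lemma homogeneous_mult:
  assumes "homogeneous m F" "homogeneous k G" shows "homogeneous (m + k) (F * G)"
  by (rule homogeneousI_eval) (simp add: eval3_homogeneous_scale[OF assms(1)] eval3_homogeneous_scale[OF assms(2)] power_add)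

lemma homogeneous_one: "homogeneous 0 1"
  by (rule homogeneousI_eval) simp

lemma homogeneous_power: "homogeneous m F \<Longrightarrow> homogeneous (k * m) (F ^ k)"
  by (induction k) (auto intro: homogeneous_one homogeneous_mult)

lemma homogeneous_prod: "finite I \<Longrightarrow> (\<And>i. i \<in> I \<Longrightarrow> homogeneous (m i) (f i)) \<Longrightarrow> homogeneous (\<Sum>i\<in>I. m i) (\<Prod>i\<in>I. f i)"
  by (induction I rule: finite_induct) (auto intro: homogeneous_one homogeneous_mult)

lemma poly_factor_monom:
  fixes p q :: "complex poly"
  assumes "p * q = monom c m" "c \<noteq> 0" shows "\<exists>a l. p = monom a l"
  using assms(1)
proof (induction m arbitrary: p q)
  case 0
  then have "p * q = [:c:]" by (simp add: monom_0)
  moreover have "p \<noteq> 0" "q \<noteq> 0" using 0 assms(2) by auto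
  ultimately have "degree p = 0" by (metis add_is_0 degree_mult_eq degree_pCons_0)
  then show ?case by (metis degree_eq_zeroE monom_0)
next
  case (Suc m)
  have "poly (p * q) 0 = 0" using Suc.prems by (simp add: poly_monom)
  then have "poly p 0 = 0 \<or> poly q 0 = 0" by simp
  then show ?case
  proof
    assume "poly p 0 = 0"
    then obtain p' where p': "p = [:0, 1:] * p'" using poly_eq_0_iff_dvd[of p 0] by (auto elim: dvdE)
    have "[:0, 1:] * (p' * q) = [:0, 1:] * monom c m" using Suc.prems p' by (simp add: monom_Suc)
    then have "p' * q = monom c m" by simp
    then obtain a l where "p' = monom a l" using Suc.IH by blast
    then have "p = monom a (Suc l)" using p' by (simp add: monom_Suc)
    then show ?thesis by blast
  next
    assume "poly q 0 = 0"
    then obtain q' where q': "q = [:0, 1:] * q'" using poly_eq_0_iff_dvd[of q 0] by (auto elim: dvdE)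
    have "[:0, 1:] * (p * q') = [:0, 1:] * monom c m" using Suc.prems q' by (simp add: monom_Suc)
    then have "p * q' = monom c m" by simp
    then show ?thesis using Suc.IH by blast
  qed
qed

text \<open>Along a line \<open>t \<mapsto> t X\<close> the factor becomes a polynomial in \<open>t\<close> that divides a monomial, hence is a
  monomial itself whenever \<open>F X \<noteq> 0\<close>. So two different homogeneous parts of the factor have
  product zero.\<close>

lemma homogeneous_factor:
  assumes F: "homogeneous m F" "F \<noteq> 0" and A: "A dvd F"
  obtains k where "homogeneous k A"
proof -
  obtain B where B: "F = A * B" using A by blast
  obtain J where J: "A = (\<Sum>j\<le>J. part3 j A)" using sum_part3 by blast
  obtain J' where J': "B = (\<Sum>j\<le>J'. part3 j B)" using sum_part3 by blast
  have expand: "eval3 A (t *s X) = (\<Sum>j\<le>J. t ^ j * eval3 (part3 j A) X)" "eval3 B (t *s X) = (\<Sum>j\<le>J'. t ^ j * eval3 (part3 j B) X)" for t X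
    by (subst J, simp add: eval3_sum eval3_homogeneous_scale[OF homogeneous_part3])
       (subst J', simp add: eval3_sum eval3_homogeneous_scale[OF homogeneous_part3])
  have prod0: "part3 i A = 0 \<or> part3 j A = 0" if ij: "i \<noteq> j" "i \<le> J" "j \<le> J" for i j
  proof -
    have "part3 i A * part3 j A * F = 0"
    proof (rule eval3_zero)
      fix X
      show "eval3 (part3 i A * part3 j A * F) X = 0"
      proof (cases "eval3 F X = 0")
        case False
        define p where "p = (\<Sum>j\<le>J. monom (eval3 (part3 j A) X) j)"
        define q where "q = (\<Sum>j\<le>J'. monom (eval3 (part3 j B) X) j)"
        have pe: "poly p t = eval3 A (t *s X)" "poly q t = eval3 B (t *s X)" for t
          by (simp_all add: p_def q_def expand poly_sum poly_monom mult.commute)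
        have "poly (p * q) t = poly (monom (eval3 F X) m) t" for t
        proof -
          have "poly (p * q) t = eval3 F (t *s X)" unfolding B by (simp add: pe)
          then show ?thesis using eval3_homogeneous_scale[OF F(1), of t X] by (simp add: poly_monom mult.commute)
        qed
        then have "p * q = monom (eval3 F X) m" by (simp add: poly_eq_poly_eq_iff[symmetric] fun_eq_iff)
        then obtain a l where p: "p = monom a l" using poly_factor_monom False by blast
        have cp: "coeff p k = eval3 (part3 k A) X" if "k \<le> J" for k
          using that by (simp add: p_def coeff_sum)
        have "coeff p i = 0 \<or> coeff p j = 0" using p ij(1) by simp
        then show ?thesis using cp ij by auto
      qed simp
    qed
    then show ?thesis using F(2) by simp
  qed
  have "A \<noteq> 0" using F B by auto
  then obtain j where j: "j \<le> J" "part3 j A \<noteq> 0" using J by (metis (no_types, lifting) atMost_iff sum.neutral)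
  have "A = (\<Sum>i\<le>J. if i = j then part3 j A else 0)"
    by (subst J) (rule sum.cong, use prod0 j in auto)
  then have "A = part3 j A" using j(1) by simp
  then show thesis using that[of j] homogeneous_part3[of j A] by simp
qed

section \<open>Curves\<close>

lemma holo2_eval3_lift: "open U \<Longrightarrow> holo2 (\<lambda>z. eval3 F (lift i z)) U"
  unfolding eval3_expand by (intro holo2_sum holo2_mult holo2_power holo2_lift holo2_const) auto

lemma proj_point_eq: assumes "X \<noteq> 0" "proj_point X = proj_point Y" obtains c where "c \<noteq> 0" "X = c *s Y"
proof -
  have "X \<in> proj_point X" unfolding proj_point_def by (rule CollectI, rule exI[of _ 1]) simp
  then obtain c where "X = c *s Y" using assms(2) unfolding proj_point_def by auto
  then show thesis using that[of c] assms(1) by (cases "c = 0") auto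
qed

lemma proj_point_in_zero_locus:
  assumes "homogeneous m F" "X \<noteq> 0"
  shows "proj_point X \<in> zero_locus F \<longleftrightarrow> eval3 F X = 0"
proof
  assume "proj_point X \<in> zero_locus F"
  then obtain Y where Y: "proj_point X = proj_point Y" "eval3 F Y = 0" unfolding zero_locus_def by auto
  obtain c where "X = c *s Y" using proj_point_eq[OF assms(2) Y(1)] by blast
  then show "eval3 F X = 0" using Y(2) by (simp add: eval3_homogeneous_scale[OF assms(1)])
qed (use assms in \<open>auto simp: zero_locus_def\<close>)

lemma zero_locus_subset_iff:
  assumes "homogeneous m F" "homogeneous k G"
  shows "zero_locus F \<subseteq> zero_locus G \<longleftrightarrow> (\<forall>X. X \<noteq> 0 \<longrightarrow> eval3 F X = 0 \<longrightarrow> eval3 G X = 0)"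
proof
  assume sub: "zero_locus F \<subseteq> zero_locus G"
  show "\<forall>X. X \<noteq> 0 \<longrightarrow> eval3 F X = 0 \<longrightarrow> eval3 G X = 0"
    using sub proj_point_in_zero_locus[OF assms(1)] proj_point_in_zero_locus[OF assms(2)] by blast
next
  assume h: "\<forall>X. X \<noteq> 0 \<longrightarrow> eval3 F X = 0 \<longrightarrow> eval3 G X = 0"
  then show "zero_locus F \<subseteq> zero_locus G" unfolding zero_locus_def by auto
qed

text \<open>Vanishing at the origin is the only condition missing from the affine statement; it is supplied by
  multiplying \<open>Q\<close> by a coordinate. A prime cannot divide two different coordinates.\<close>

lemma nullstellensatz_projective:
  assumes P: "prime_elem P" and van: "\<And>X. X \<noteq> 0 \<Longrightarrow> eval3 P X = 0 \<Longrightarrow> eval3 Q X = 0"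
  shows "P dvd Q"
proof (rule ccontr)
  assume nd: "\<not> P dvd Q"
  \<comment> \<open>\<open>mon3 1 1 0 0\<close> and \<open>mon3 1 0 1 0\<close> are the coordinates \<open>X\<^sub>1\<close> and \<open>X\<^sub>2\<close>.\<close>
  have 1: "P dvd mon3 1 1 0 0"
  proof -
    have "P dvd mon3 1 1 0 0 * Q"
    proof (rule nullstellensatz3[OF P])
      fix X assume "eval3 P X = 0"
      then show "eval3 (mon3 1 1 0 0 * Q) X = 0" using van[of X] by (cases "X = 0") (auto simp: eval3_mon3)
    qed
    then show ?thesis using P nd by (simp add: prime_elem_dvd_mult_iff)
  qed
  have 2: "P dvd mon3 1 0 1 0"
  proof -
    have "P dvd mon3 1 0 1 0 * Q"
    proof (rule nullstellensatz3[OF P])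
      fix X assume "eval3 P X = 0"
      then show "eval3 (mon3 1 0 1 0 * Q) X = 0" using van[of X] by (cases "X = 0") (auto simp: eval3_mon3)
    qed
    then show ?thesis using P nd by (simp add: prime_elem_dvd_mult_iff)
  qed
  have "degree P \<le> degree (mon3 1 1 0 0)" by (rule dvd_imp_degree_le[OF 1]) (simp add: mon3_def)
  then have "degree P = 0" by (simp add: mon3_def monom_0)
  then obtain p where p: "P = [:p:]" by (metis degree_eq_zeroE)
  have p1: "p dvd monom (monom 1 1) 0" and p2: "p dvd monom (monom 1 0) 1"
    using 1 2 unfolding p mon3_def monom_0 by (auto simp: const_poly_dvd)
  have "degree p \<le> degree (monom (monom 1 1) 0 :: complex poly poly)" by (rule dvd_imp_degree_le[OF p1]) simp
  then have "degree p = 0" by (simp add: monom_0)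
  then obtain f where f: "p = [:f:]" by (metis degree_eq_zeroE)
  have "f dvd coeff (monom (monom 1 0) 1) 1" using p2 unfolding f const_poly_dvd_iff by blast
  then have "f dvd 1" by (simp add: one_pCons monom_0)
  then have "P dvd 1" by (simp add: p f one_pCons const_poly_dvd)
  then show False using P by (simp add: prime_elem_def)
qed

lemma eval3_dvd: "P dvd Q \<Longrightarrow> eval3 P X = 0 \<Longrightarrow> eval3 Q X = 0"
  by (auto elim!: dvdE)

lemma irreducible_prime3: "irreducible (P :: poly3) \<Longrightarrow> prime_elem P"
  by (rule irreducible_imp_prime_elem)

lemma irreducible_equation_unique:
  assumes "irreducible_equation P C" "irreducible_equation Q C" shows "P dvd Q"
proof -
  obtain m k where m: "homogeneous m P" "homogeneous k Q" "irreducible P" "zero_locus P = zero_locus Q"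
    using assms unfolding irreducible_equation_def by blast
  have "\<forall>X. X \<noteq> 0 \<longrightarrow> eval3 P X = 0 \<longrightarrow> eval3 Q X = 0"
    using zero_locus_subset_iff[OF m(1,2)] m(4) by simp
  then show ?thesis using nullstellensatz_projective[OF irreducible_prime3[OF m(3)]] by blast
qed

lemma eval3_lift_coords:
  fixes X :: "complex ^ 3"
  assumes "homogeneous m F" "X $ i \<noteq> 0"
  shows "eval3 F (lift i (coords i X)) = inverse (X $ i) ^ m * eval3 F X"
proof -
  have "lift i (coords i X) = inverse (X $ i) *s X"
    unfolding Finite_Cartesian_Product.vec_eq_iff vector_smult_component lift_coords[OF assms(2)]
    by (simp add: divide_inverse mult.commute)
  then show ?thesis by (simp add: eval3_homogeneous_scale[OF assms(1)])
qed

lemma eval3_lift_nonzero: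
  assumes F: "homogeneous m F" "F \<noteq> 0" shows "\<exists>z. eval3 F (lift i z) \<noteq> 0"
proof -
  define V where "V = (if i = 1 then mon3 1 1 0 0 else if i = 2 then mon3 1 0 1 0 else mon3 1 0 0 1)"
  have Ve: "eval3 V X = X $ i" for X
    using exhaust_3[of i] by (auto simp: V_def eval3_mon3)
  have "V \<noteq> 0" by (simp add: V_def mon3_def)
  then have "F * V \<noteq> 0" using F by simp
  then obtain X where "eval3 (F * V) X \<noteq> 0" using eval3_zero by blast
  then have X: "eval3 F X \<noteq> 0" "X $ i \<noteq> 0" by (auto simp: Ve)
  then have "eval3 F (lift i (coords i X)) \<noteq> 0" by (simp add: eval3_lift_coords[OF F(1)])
  then show ?thesis by blast
qed

lemma unit_homogeneous: assumes "homogeneous k H" "H dvd 1" shows "k = 0"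
proof -
  obtain G where G: "1 = H * G" using assms(2) by blast
  obtain l where l: "homogeneous l G" by (rule homogeneous_factor[OF homogeneous_one, of G]) (use G in \<open>auto intro: dvd_triv_right\<close>, metis dvd_triv_right)
  have "homogeneous (k + l) 1" using homogeneous_mult[OF assms(1) l] G by simp
  then have "k + l = 0" by (rule homogeneous_unique[OF _ homogeneous_one]) simp
  then show ?thesis by simp
qed

lemma irreducible_degree_pos: assumes P: "irreducible P" "homogeneous m P" shows "m \<ge> 1"
proof (rule ccontr)
  assume "\<not> m \<ge> 1"
  then have m: "m = 0" by simp
  have P0: "P \<noteq> 0" using P by auto
  have "P = mon3 (cf P 0 0 0) 0 0 0"
  proof (intro poly_eqI)
    fix c b a show "cf P a b c = cf (mon3 (cf P 0 0 0) 0 0 0) a b c"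
      using P(2) m unfolding homogeneous_def cf_mon3 by auto
  qed
  then obtain k where k: "P = [:[:[:k:]:]:]" by (simp add: mon3_def monom_0)
  then have "k \<noteq> 0" using P0 by auto
  then have "P * [:[:[:inverse k:]:]:] = 1" by (simp add: k one_pCons)
  then have "P dvd 1" by (metis dvdI)
  then show False using P by (simp add: irreducible_def)
qed

text \<open>A squarefree equation of the same curve is divisible by \<open>P\<close>. Any prime factor of the cofactor
  vanishes only on the curve, hence is associated to \<open>P\<close>, so that \<open>P\<^sup>2\<close> would divide the equation.\<close>

lemma curve_degree_irreducible:
  assumes P: "irreducible P" "homogeneous m P"
  shows "curve_degree (zero_locus P) = m" "curve_of_degree m (zero_locus P)"
proof -
  have P0: "P \<noteq> 0" using P by auto
  have pP: "prime_elem P" by (rule irreducible_prime3[OF P(1)])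
  have sq: "squarefree P"
  proof (rule squarefreeI)
    fix x assume "x\<^sup>2 dvd P"
    then obtain y where "P = x * (x * y)" unfolding dvd_def power2_eq_square mult.assoc by blast
    then have "x dvd 1 \<or> x * y dvd 1" using P(1) by (auto dest: irreducibleD)
    then show "x dvd 1" using dvd_mult_left by blast
  qed
  show c: "curve_of_degree m (zero_locus P)"
    unfolding curve_of_degree_def using irreducible_degree_pos[OF P] P(2) sq by blast
  have "k = m" if "curve_of_degree k (zero_locus P)" for k
  proof -
    have "\<exists>G. homogeneous k G \<and> squarefree G \<and> zero_locus P = zero_locus G"
      using that by (simp add: curve_of_degree_def)
    then obtain G where G: "homogeneous k G" "squarefree G" "zero_locus P = zero_locus G" by blast
    have G0: "G \<noteq> 0" using G(2) by auto
    have "P dvd G" by (rule nullstellensatz_projective[OF pP]) (use zero_locus_subset_iff[OF P(2) G(1)] G(3) in blast)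
    then obtain H where H: "G = P * H" by blast
    obtain l where l: "homogeneous l H" by (rule homogeneous_factor[OF G(1) G0, of H]) (use H in auto)
    have "H dvd 1"
    proof (rule ccontr)
      assume nu: "\<not> H dvd 1"
      have H0: "H \<noteq> 0" using G0 H by auto
      obtain Q where Q: "Q dvd H" "prime Q" using prime_divisor_exists[OF H0 nu] by blast
      obtain q where q: "homogeneous q Q" by (rule homogeneous_factor[OF l H0 Q(1)])
      have "zero_locus Q \<subseteq> zero_locus G"
        unfolding zero_locus_subset_iff[OF q G(1)] using Q(1) H by (auto elim!: dvdE)
      then have "Q dvd P" using Q(2) zero_locus_subset_iff[OF q P(2)] G(3)
        by (intro nullstellensatz_projective) auto
      then have "P dvd Q" using P(1) Q(2) by (meson irreducibleD' not_prime_unit)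
      then have "P dvd H" using Q(1) dvd_trans by blast
      then have "P\<^sup>2 dvd G" unfolding H power2_eq_square by (rule mult_dvd_mono[OF dvd_refl])
      then have "P dvd 1" using G(2) by (auto simp: squarefree_def)
      then show False using P(1) by (simp add: irreducible_def)
    qed
    then have "l = 0" by (rule unit_homogeneous[OF l])
    then have "homogeneous m G" using homogeneous_mult[OF P(2) l] H by simp
    then show ?thesis using homogeneous_unique[OF G(1) _ G0] by blast
  qed
  then show "curve_degree (zero_locus P) = m" unfolding curve_degree_def using c by (intro the_equality)
qed

section \<open>The degree of the divisor of a homogeneous polynomial\<close>

text \<open>If \<open>F = P\<^sup>\<mu> G\<close> vanished to a higher order than \<open>\<mu>\<close>, cancelling \<open>P\<^sup>\<mu>\<close> off the curve would make \<open>G\<close>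
  vanish on the curve, so that \<open>P\<close> divides \<open>G\<close>.\<close>

lemma zero_divisor_multiplicity:
  assumes P: "irreducible P" "homogeneous p P" and F: "homogeneous m F" "F \<noteq> 0"
    and E: "\<And>i z. E i z = eval3 F (lift i z)"
  shows "zero_divisor E (zero_locus P) = multiplicity P F"
proof -
  have pP: "prime_elem P" by (rule irreducible_prime3[OF P(1)])
  have ie: "irreducible_equation P (zero_locus P)" using P unfolding irreducible_equation_def by blast
  have Pu: "\<not> is_unit P" using pP by (simp add: prime_elem_def)
  define \<mu> where "\<mu> = multiplicity P F"
  have \<mu>dvd: "P ^ \<mu> dvd F" unfolding \<mu>_def by (rule multiplicity_dvd)
  have van: "vanishes_to_order E (zero_locus P) \<mu>"
    unfolding vanishes_to_order_def
  proof (intro allI impI)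
    fix Q i z assume Q: "irreducible_equation Q (zero_locus P) \<and> eval3 Q (lift i z) = 0"
    have "Q dvd P" using irreducible_equation_unique[of Q _ P] Q ie by blast
    then have "Q ^ \<mu> dvd P ^ \<mu>" by (rule dvd_power_same)
    also have "P ^ \<mu> dvd F" by (rule \<mu>dvd)
    finally obtain G where G: "F = Q ^ \<mu> * G" by blast
    show "\<exists>U h. z \<in> U \<and> holo2 h U \<and> (\<forall>w\<in>U. E i w = eval3 Q (lift i w) ^ \<mu> * h w)"
      by (intro exI[of _ UNIV] exI[of _ "\<lambda>w. eval3 G (lift i w)"]) (auto simp: holo2_eval3_lift E G)
  qed
  have max: "y \<le> \<mu>" if y: "vanishes_to_order E (zero_locus P) y" for y
  proof (rule ccontr)
    assume "\<not> y \<le> \<mu>"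
    then have ly: "\<mu> < y" by simp
    obtain G where G: "F = P ^ \<mu> * G" using \<mu>dvd by blast
    have nd: "\<not> P dvd G"
    proof
      assume "P dvd G"
      then have "P ^ Suc \<mu> dvd F" unfolding G by (simp add: mult_dvd_mono mult.commute[of P])
      then have "Suc \<mu> \<le> multiplicity P F" by (rule multiplicity_geI[OF F(2) Pu])
      then show False by (simp add: \<mu>_def)
    qed
    obtain g where g: "homogeneous g G" by (rule homogeneous_factor[OF F, of G]) (use G in auto)
    have P0: "P \<noteq> 0" using P by auto
    have van0: "eval3 G (lift i z) = 0" if z: "eval3 P (lift i z) = 0" for i z
    proof -
      obtain U h where U: "z \<in> U" "holo2 h U" "\<And>w. w \<in> U \<Longrightarrow> E i w = eval3 P (lift i w) ^ y * h w"
        using y[unfolded vanishes_to_order_def, rule_format, of P i z] ie z by blast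
      obtain z1 where z1: "eval3 P (lift i z1) \<noteq> 0" using eval3_lift_nonzero[OF P(2) P0] by blast
      have "eval3 G (lift i z) = eval3 P (lift i z) ^ (y - \<mu>) * h z"
      proof (rule eq_on_open_of_eq_dense[OF holo2_open[OF U(2)] _ _ holo2_eval3_lift[OF open_UNIV] z1 _ U(1)])
        show "continuous_on U (\<lambda>z. eval3 G (lift i z))" by (rule holo2_cont[OF holo2_eval3_lift[OF holo2_open[OF U(2)]]])
        show "continuous_on U (\<lambda>z. eval3 P (lift i z) ^ (y - \<mu>) * h z)"
          by (rule holo2_cont) (intro holo2_mult holo2_power holo2_eval3_lift holo2_open[OF U(2)] U(2))
        fix w assume w: "w \<in> U" "eval3 P (lift i w) \<noteq> 0"
        have "eval3 P (lift i w) ^ \<mu> * eval3 G (lift i w) = E i w" by (simp add: E G)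
        also have "\<dots> = eval3 P (lift i w) ^ (\<mu> + (y - \<mu>)) * h w" using U(3)[OF w(1)] ly by simp
        finally show "eval3 G (lift i w) = eval3 P (lift i w) ^ (y - \<mu>) * h w" using w(2) by (simp add: power_add)
      qed
      then show ?thesis using z ly by simp
    qed
    have "P dvd G"
    proof (rule nullstellensatz_projective[OF pP])
      fix X assume X: "X \<noteq> 0" "eval3 P X = 0"
      then obtain i where i: "X $ i \<noteq> 0" by (auto simp: Finite_Cartesian_Product.vec_eq_iff)
      have "eval3 P (lift i (coords i X)) = 0" using X by (simp add: eval3_lift_coords[OF P(2) i])
      then have "eval3 G (lift i (coords i X)) = 0" by (rule van0)
      then show "eval3 G X = 0" using i by (simp add: eval3_lift_coords[OF g i])
    qed
    then show False using nd by blast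
  qed
  have "irreducible_curve (zero_locus P)" using ie unfolding irreducible_curve_def by blast
  then show ?thesis unfolding zero_divisor_def using Greatest_equality[of "vanishes_to_order E (zero_locus P)", OF van max] by (simp add: \<mu>_def)
qed

text \<open>The curves in the divisor correspond to the prime factors of \<open>F\<close>, so its degree is the degree of
  the product of the prime factors with multiplicities, which is \<open>F\<close> up to a constant.\<close>

theorem divisor_degree_homogeneous:
  assumes F: "homogeneous m F" "F \<noteq> 0" and E: "\<And>i z. E i z = eval3 F (lift i z)"
  shows "divisor_degree (zero_divisor E) = m"
proof -
  let ?PF = "prime_factors F"
  have fin: "finite ?PF" by simp
  have pf: "irreducible P" "P dvd F" "multiplicity P F > 0" if "P \<in> ?PF" for P
  proof -
    have p: "prime P" "P dvd F" using that by auto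
    show "irreducible P" using p(1) by (simp add: prime_elem_imp_irreducible prime_imp_prime_elem)
    show "P dvd F" by fact
    show "multiplicity P F > 0" using that by (simp add: prime_factors_multiplicity)
  qed
  have "\<exists>k. homogeneous k P" if "P \<in> ?PF" for P
    by (rule homogeneous_factor[OF F pf(2)[OF that]]) blast
  then obtain hd where hd: "\<And>P. P \<in> ?PF \<Longrightarrow> homogeneous (hd P) P" by metis
  have inj: "inj_on zero_locus ?PF"
  proof (rule inj_onI)
    fix P Q assume PQ: "P \<in> ?PF" "Q \<in> ?PF" "zero_locus P = zero_locus Q"
    have "irreducible_equation P (zero_locus P)" "irreducible_equation Q (zero_locus P)"
      unfolding irreducible_equation_def using PQ pf(1) hd by auto
    then have "P dvd Q" by (rule irreducible_equation_unique)
    then show "P = Q" using PQ by (auto intro: primes_dvd_imp_eq)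
  qed
  have mult: "zero_divisor E (zero_locus P) = multiplicity P F" if "P \<in> ?PF" for P
    by (rule zero_divisor_multiplicity[OF pf(1)[OF that] hd[OF that] F E])
  have set: "{C. irreducible_curve C \<and> zero_divisor E C \<noteq> 0} = zero_locus ` ?PF"
  proof (intro equalityI subsetI)
    fix C assume C: "C \<in> {C. irreducible_curve C \<and> zero_divisor E C \<noteq> 0}"
    then obtain P k where P: "irreducible P" "homogeneous k P" "C = zero_locus P"
      unfolding irreducible_curve_def irreducible_equation_def by blast
    have mn: "multiplicity P F \<noteq> 0" using C zero_divisor_multiplicity[OF P(1,2) F E] P(3) by simp
    have PF: "P dvd F"
    proof (rule ccontr)
      assume "\<not> P dvd F"
      then show False using not_dvd_imp_multiplicity_0[of P F] mn by simp
    qed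
    have np: "prime (normalize P)" using irreducible_prime3[OF P(1)] by simp
    have nF: "normalize P \<in> ?PF" using PF np F(2) by (simp add: in_prime_factors_iff)
    have "irreducible_equation P C" using P unfolding irreducible_equation_def by blast
    moreover have "zero_locus (normalize P) = C"
    proof -
      have "zero_locus (normalize P) \<subseteq> zero_locus P" "zero_locus P \<subseteq> zero_locus (normalize P)"
        unfolding zero_locus_subset_iff[OF hd[OF nF] P(2)] zero_locus_subset_iff[OF P(2) hd[OF nF]]
        using eval3_dvd[of "normalize P" P] eval3_dvd[of P "normalize P"] by auto
      then show ?thesis using P(3) by blast
    qed
    ultimately show "C \<in> zero_locus ` ?PF" using nF by blast
  next
    fix C assume "C \<in> zero_locus ` ?PF"
    then obtain P where P: "P \<in> ?PF" "C = zero_locus P" by blast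
    then have "irreducible_curve C" unfolding irreducible_curve_def irreducible_equation_def using pf(1) hd by blast
    then show "C \<in> {C. irreducible_curve C \<and> zero_divisor E C \<noteq> 0}" using mult[OF P(1)] pf(3)[OF P(1)] P(2) by simp
  qed
  have "divisor_degree (zero_divisor E) = (\<Sum>C\<in>zero_locus ` ?PF. zero_divisor E C * curve_degree C)"
    unfolding divisor_degree_def set ..
  also have "\<dots> = (\<Sum>P\<in>?PF. multiplicity P F * hd P)"
    by (subst sum.reindex[OF inj]) (auto intro!: sum.cong simp: mult curve_degree_irreducible(1)[OF pf(1) hd])
  also have "\<dots> = m"
  proof -
    let ?\<Pi> = "\<Prod>P\<in>?PF. P ^ multiplicity P F"
    have h: "homogeneous (\<Sum>P\<in>?PF. multiplicity P F * hd P) ?\<Pi>"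
      by (intro homogeneous_prod homogeneous_power hd fin)
    have "?\<Pi> = prod_mset (prime_factorization F)"
      unfolding prod_mset_multiplicity by (intro prod.cong refl) (simp add: count_prime_factorization_prime[OF in_prime_factors_imp_prime])
    then have as: "normalize ?\<Pi> = normalize F" using prod_mset_prime_factorization_weak[OF F(2)] by simp
    have dv: "F dvd ?\<Pi>" "?\<Pi> dvd F" by (rule associatedD2[OF as] associatedD1[OF as])+
    then obtain H where H: "F = ?\<Pi> * H" by blast
    have "?\<Pi> \<noteq> 0" using F(2) H by auto
    moreover have "?\<Pi> * H dvd ?\<Pi> * 1" using dv(1) H by simp
    ultimately have Hu: "H dvd 1" by (simp only: dvd_mult_cancel_left simp_thms)
    have HF: "H dvd F" using H dvd_triv_right by metis
    obtain l where l: "homogeneous l H" by (rule homogeneous_factor[OF F HF])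
    have "l = 0" by (rule unit_homogeneous[OF l Hu])
    then have "homogeneous (\<Sum>P\<in>?PF. multiplicity P F * hd P) F" 
      using homogeneous_mult[OF h l] unfolding H[symmetric] \<open>l = 0\<close> by simp
    then show ?thesis using homogeneous_unique[OF _ F(1) F(2)] by blast
  qed
  finally show ?thesis .
qed

section \<open>Entire functions of polynomial growth\<close>

definition bigness :: "complex \<times> complex \<Rightarrow> real" where
  "bigness z = max 1 (max (cmod (fst z)) (cmod (snd z)))"

lemma bigness_ge: "bigness z \<ge> 1" "cmod (fst z) \<le> bigness z" "cmod (snd z) \<le> bigness z"
  by (auto simp: bigness_def)

lemma holo2_pd1_funpow: "holo2 g U \<Longrightarrow> holo2 ((pd1 ^^ k) g) U"
  by (induction k) (auto intro: holo2_pd1)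

lemma higher_deriv_slice: "(deriv ^^ k) (\<lambda>x. g (x, y)) = (\<lambda>x. ((pd1 ^^ k) g) (x, y))"
  by (induction k) (auto simp: pd1_def)

lemma holo2_slice1_holomorphic: "holo2 g UNIV \<Longrightarrow> (\<lambda>x. g (x, y)) holomorphic_on S"
  using holo2_line[of g 0 1 y 0 S] by simp

lemma holo2_slice2_holomorphic: "holo2 g UNIV \<Longrightarrow> (\<lambda>y. g (x, y)) holomorphic_on S"
  using holo2_line[of g x 0 0 1 S] by simp

text \<open>Liouville's theorem in the first variable, then Cauchy's inequality for the Taylor coefficients,
  which therefore satisfy a growth condition in the second variable. The bound on the total degree
  matters: it is the degree of the homogeneous polynomial obtained below.\<close>

theorem polynomial_of_growth:
  assumes g: "holo2 g UNIV" and C: "\<And>z. cmod (g z) \<le> C * bigness z ^ N"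
  obtains c where "\<And>z. g z = (\<Sum>k\<le>N. \<Sum>l\<le>N - k. c k l * fst z ^ k * snd z ^ l)"
proof -
  define a where "a k y = ((pd1 ^^ k) g) (0, y) / fact k" for k y
  have C0: "C \<ge> 0" using C[of "(0,0)"] norm_ge_zero[of "g (0, 0)"] by (simp add: bigness_def del: norm_ge_zero)
  have exp1: "g (x, y) = (\<Sum>k\<le>N. a k y * x ^ k)" for x y
  proof -
    have "g (x, y) = (\<Sum>k\<le>N. (deriv ^^ k) (\<lambda>x. g (x, y)) 0 / fact k * x ^ k)"
    proof (rule Liouville_polynomial[OF holo2_slice1_holomorphic[OF g], where A = "max 1 (cmod y)" and B = C])
      fix t assume "max 1 (cmod y) \<le> cmod t"
      then have "bigness (t, y) = cmod t" by (simp add: bigness_def)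
      then show "cmod (g (t, y)) \<le> C * cmod t ^ N" using C[of "(t, y)"] by simp
    qed
    then show ?thesis by (simp add: higher_deriv_slice a_def)
  qed
  have bound: "cmod (a k y) \<le> C * (max 1 (cmod y)) ^ (N - k)" if "k \<le> N" for k y
  proof -
    let ?R = "max 1 (cmod y)"
    have "cmod ((deriv ^^ k) (\<lambda>x. g (x, y)) 0) \<le> fact k * (C * ?R ^ N) / ?R ^ k"
    proof (rule Cauchy_inequality)
      show "(\<lambda>x. g (x, y)) holomorphic_on ball 0 ?R" by (rule holo2_slice1_holomorphic[OF g])
      show "continuous_on (cball 0 ?R) (\<lambda>x. g (x, y))"
        by (rule holomorphic_on_imp_continuous_on[OF holo2_slice1_holomorphic[OF g]])
      fix x assume "cmod (0 - x) = ?R"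
      then have "bigness (x, y) = ?R" by (auto simp: bigness_def)
      then show "cmod (g (x, y)) \<le> C * ?R ^ N" using C[of "(x, y)"] by simp
    qed auto
    then have "cmod (a k y) \<le> C * ?R ^ N / ?R ^ k"
      by (simp add: a_def higher_deriv_slice norm_divide field_simps)
    also have "\<dots> = C * ?R ^ (N - k)" using that by (simp add: power_diff)
    finally show ?thesis .
  qed
  have hol: "a k holomorphic_on UNIV" for k
    unfolding a_def by (intro holomorphic_intros holo2_slice2_holomorphic holo2_pd1_funpow g) auto
  define c where "c k l = (deriv ^^ l) (a k) 0 / fact l" for k l
  have exp2: "a k y = (\<Sum>l\<le>N - k. c k l * y ^ l)" if "k \<le> N" for k y
    unfolding c_def
  proof (rule Liouville_polynomial[OF hol, where A = 1 and B = C])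
    fix t assume "1 \<le> cmod t"
    then have "max 1 (cmod t) = cmod t" by simp
    then show "cmod (a k t) \<le> C * cmod t ^ (N - k)" using bound[OF that, of t] by simp
  qed
  show thesis
  proof (rule that)
    fix z
    show "g z = (\<Sum>k\<le>N. \<Sum>l\<le>N - k. c k l * fst z ^ k * snd z ^ l)"
      using exp1[of "fst z" "snd z"] exp2 by (simp add: sum_distrib_left sum_distrib_right mult_ac)
  qed
qed

lemma poly2_of_growth:
  assumes "holo2 g UNIV" "\<And>z. cmod (g z) \<le> C * bigness z ^ N"
  obtains p where "\<And>z. g z = eval2 p z"
proof -
  obtain c where c: "\<And>z. g z = (\<Sum>k\<le>N. \<Sum>l\<le>N - k. c k l * fst z ^ k * snd z ^ l)"
    by (rule polynomial_of_growth[OF assms]) blast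
  show thesis
    by (rule that[of "\<Sum>k\<le>N. \<Sum>l\<le>N - k. monom (monom (c k l) k) l"]) (simp add: c eval2_sum eval2_monom)
qed

lemma homogeneous_of_growth:
  assumes "holo2 g UNIV" "\<And>z. cmod (g z) \<le> C * bigness z ^ N"
  obtains F where "homogeneous N F" "\<And>z. g z = eval3 F (lift 3 z)"
proof -
  obtain c where c: "\<And>z. g z = (\<Sum>k\<le>N. \<Sum>l\<le>N - k. c k l * fst z ^ k * snd z ^ l)"
    by (rule polynomial_of_growth[OF assms]) blast
  show thesis
  proof (rule that[of "\<Sum>k\<le>N. \<Sum>l\<le>N - k. mon3 (c k l) k l (N - k - l)"])
    show "homogeneous N (\<Sum>k\<le>N. \<Sum>l\<le>N - k. mon3 (c k l) k l (N - k - l))"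
      by (intro homogeneous_sum homogeneous_mon3) auto
  qed (simp add: c eval3_sum eval3_mon3)
qed

section \<open>Sections of line bundles on the projective plane\<close>

definition unit_bidisc :: "(complex \<times> complex) set" where
  "unit_bidisc = cball 0 1 \<times> cball 0 1"

text \<open>The three closed unit bidiscs cover the projective plane. For a point of the chart \<open>3\<close> outside its
  bidisc, the coordinate by which one divides has modulus \<open>bigness z\<close>.\<close>

lemma chart_cover:
  "z \<in> unit_bidisc \<and> bigness z = 1 \<or>
   (\<exists>j\<in>{1, 2}. z \<in> chart_dom 3 j \<and> trans_map 3 j z \<in> unit_bidisc \<and> cmod (lift 3 z $ j) = bigness z)"
proof -
  consider "cmod (fst z) \<le> 1 \<and> cmod (snd z) \<le> 1" | "cmod (fst z) > 1 \<and> cmod (snd z) \<le> cmod (fst z)"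
    | "cmod (snd z) > 1 \<and> cmod (fst z) \<le> cmod (snd z)" by linarith
  then show ?thesis
  proof cases
    case 1 then show ?thesis by (auto simp: unit_bidisc_def bigness_def mem_Times_iff)
  next
    case 2
    then have "fst z \<noteq> 0" by auto
    then have "z \<in> chart_dom 3 1 \<and> trans_map 3 1 z \<in> unit_bidisc \<and> cmod (lift 3 z $ 1) = bigness z"
      using 2 by (auto simp: chart_dom_def trans_map_def coords_def unit_bidisc_def bigness_def norm_divide divide_le_eq_1)
    then show ?thesis by blast
  next
    case 3
    then have "snd z \<noteq> 0" by auto
    then have "z \<in> chart_dom 3 2 \<and> trans_map 3 2 z \<in> unit_bidisc \<and> cmod (lift 3 z $ 2) = bigness z"
      using 3 by (auto simp: chart_dom_def trans_map_def coords_def unit_bidisc_def bigness_def norm_divide divide_le_eq_1)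
    then show ?thesis by blast
  qed
qed

lemma bounded_on_bidisc:
  assumes "holo2 f UNIV" obtains M where "M \<ge> 0" "\<And>z. z \<in> unit_bidisc \<Longrightarrow> cmod (f z) \<le> M"
proof -
  have "compact unit_bidisc" unfolding unit_bidisc_def by (intro compact_Times compact_cball)
  then have "compact (f ` unit_bidisc)"
    by (intro compact_continuous_image continuous_on_subset[OF holo2_cont[OF assms]]) auto
  then have "bounded (f ` unit_bidisc)" by (rule compact_imp_bounded)
  then obtain M where "\<And>y. y \<in> f ` unit_bidisc \<Longrightarrow> cmod y \<le> M"
    unfolding bounded_iff by blast
  then show thesis using that[of "max 0 M"] by fastforce
qed

text \<open>A section is bounded on the three compact bidiscs, and the transition function has modulus
  \<open>bigness z powi D\<close>.\<close>

lemma section_growth: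
  assumes E: "\<And>i. holo2 (E i) UNIV"
    and tr: "\<And>j z. j \<noteq> 3 \<Longrightarrow> z \<in> chart_dom 3 j \<Longrightarrow> E 3 z = (lift 3 z $ j) powi D * E j (trans_map 3 j z)"
  obtains C where "C \<ge> 0" "\<And>z. cmod (E 3 z) \<le> C * bigness z powi D"
proof -
  have "\<exists>M\<ge>0. \<forall>z\<in>unit_bidisc. cmod (E i z) \<le> M" for i
    using bounded_on_bidisc[OF E, of i] by metis
  then obtain M where M: "\<And>i. M i \<ge> 0" "\<And>i z. z \<in> unit_bidisc \<Longrightarrow> cmod (E i z) \<le> M i" by metis
  let ?C = "M 1 + M 2 + M 3"
  show thesis
  proof (rule that[of ?C])
    show "?C \<ge> 0" using M(1) by (simp add: add_nonneg_nonneg)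
    fix z
    have MC: "M i \<le> ?C" for i using exhaust_3[of i] M(1)[of 1] M(1)[of 2] M(1)[of 3] by auto
    from chart_cover[of z] show "cmod (E 3 z) \<le> ?C * bigness z powi D"
    proof
      assume "z \<in> unit_bidisc \<and> bigness z = 1"
      then show ?thesis using M(2)[of z 3] MC[of 3] by simp
    next
      assume "\<exists>j\<in>{1, 2}. z \<in> chart_dom 3 j \<and> trans_map 3 j z \<in> unit_bidisc \<and> cmod (lift 3 z $ j) = bigness z"
      then obtain j where j0: "j \<in> {1, 2}" and j': "z \<in> chart_dom 3 j" "trans_map 3 j z \<in> unit_bidisc" "cmod (lift 3 z $ j) = bigness z" by blast
      have "j \<noteq> 3" using j0 by auto
      note j = this j'
      have "cmod (E 3 z) = bigness z powi D * cmod (E j (trans_map 3 j z))"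
        using tr[OF j(1,2)] j(4) by (simp add: norm_mult norm_power_int)
      also have "\<dots> \<le> bigness z powi D * ?C"
        using M(2)[OF j(3), of j] MC[of j] bigness_ge(1)[of z] by (intro mult_left_mono) auto
      finally show ?thesis by (simp add: mult.commute)
    qed
  qed
qed

text \<open>For negative \<open>D\<close> the growth estimate makes the section constant in the chart \<open>3\<close> and decaying at
  infinity, hence zero. The other charts follow from the chart \<open>3\<close> by the identity theorem.\<close>

theorem section_is_homogeneous:
  assumes E: "\<And>i. holo2 (E i) UNIV"
    and tr: "\<And>j z. j \<noteq> 3 \<Longrightarrow> z \<in> chart_dom 3 j \<Longrightarrow> E 3 z = (lift 3 z $ j) powi D * E j (trans_map 3 j z)"
    and nz: "E i0 z0 \<noteq> 0"
  obtains F where "D \<ge> 0" "homogeneous (nat D) F" "F \<noteq> 0" "\<And>i z. E i z = eval3 F (lift i z)"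
proof -
  have tr': "E j w = inverse (lift 3 (trans_map j 3 w) $ j powi D) * E 3 (trans_map j 3 w)"
    if "j \<noteq> 3" "w \<in> chart_dom j 3" for j w
  proof -
    have z: "trans_map j 3 w \<in> chart_dom 3 j" by (rule trans_chart_dom[OF that(2)])
    have w: "trans_map 3 j (trans_map j 3 w) = w" using that(2) by (simp add: trans_map_inverse chart_dom_def)
    have "lift 3 (trans_map j 3 w) $ j powi D \<noteq> 0" using z by (simp add: chart_dom_def)
    then show ?thesis using tr[OF that(1) z] w by simp
  qed
  have lift3: "\<exists>w. lift j w $ 3 \<noteq> 0" for j
    using exhaust_3[of j] by (auto intro!: exI[of _ "(1, 1)"] simp del: split_paired_Ex)
  have E3: "\<exists>z. E 3 z \<noteq> 0"
  proof (rule ccontr)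
    assume "\<not> ?thesis"
    then have 0: "E 3 z = 0" for z by blast
    then have i: "i0 \<noteq> 3" using nz 0[of z0] by blast
    obtain w0 where w0: "lift i0 w0 $ 3 \<noteq> 0" using lift3 by blast
    have "E i0 z0 = 0"
    proof (rule eq_of_eq_dense[OF E holo2_const holo2_lift[OF open_UNIV] w0])
      fix w assume "lift i0 w $ 3 \<noteq> 0"
      then show "E i0 w = 0" using tr'[OF i, of w] 0 by (simp add: chart_dom_def)
    qed simp
    then show False using nz by simp
  qed
  then obtain z1 where z1: "E 3 z1 \<noteq> 0" by blast
  obtain C where C: "C \<ge> 0" "\<And>z. cmod (E 3 z) \<le> C * bigness z powi D" by (rule section_growth[OF E tr]) auto
  have D: "D \<ge> 0"
  proof (rule ccontr)
    assume "\<not> D \<ge> 0"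
    then have D: "D \<le> - 1" by simp
    have le: "bigness z powi D \<le> inverse (bigness z)" for z
    proof -
      have "bigness z powi D \<le> bigness z powi (- 1)" using D bigness_ge(1) by (intro power_int_increasing) auto
      then show ?thesis by (simp add: power_int_minus)
    qed
    have b0: "cmod (E 3 z) \<le> C * bigness z ^ 0" for z
    proof -
      have "bigness z powi D \<le> 1" using le[of z] bigness_ge(1)[of z] by (simp add: inverse_le_1_iff order.trans)
      then have "C * bigness z powi D \<le> C * 1" using C(1) by (intro mult_left_mono)
      then show ?thesis using C(2)[of z] by simp
    qed
    obtain c where c: "\<And>z. E 3 z = (\<Sum>k\<le>0. \<Sum>l\<le>0 - k. c k l * fst z ^ k * snd z ^ l)"
      by (rule polynomial_of_growth[OF E b0]) blast
    have const: "E 3 z = c 0 0" for z using c[of z] by simp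
    have "cmod (c 0 0) \<le> C * inverse t" if "t \<ge> 1" for t
    proof -
      have "cmod (c 0 0) \<le> C * bigness (of_real t, 0) powi D" using C(2)[of "(of_real t, 0)"] const by simp
      also have "\<dots> \<le> C * inverse (bigness (of_real t, 0))" using le C(1) by (intro mult_left_mono)
      also have "bigness (of_real t, 0) = t" using that by (simp add: bigness_def)
      finally show ?thesis .
    qed
    then have lim: "cmod (c 0 0) \<le> C * inverse t" if "t \<ge> 1" for t using that by blast
    have "((\<lambda>t. C * inverse t) \<longlongrightarrow> C * 0) at_top" by (intro tendsto_mult tendsto_const tendsto_inverse_0_at_top filterlim_ident)
    then have "cmod (c 0 0) \<le> C * 0"
      by (rule tendsto_lowerbound) (use lim in \<open>auto simp: eventually_at_top_linorder\<close>)
    then show False using z1 const by simp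
  qed
  then obtain N where N: "D = int N" by (metis nat_eq_iff2)
  obtain F where F: "homogeneous N F" "\<And>z. E 3 z = eval3 F (lift 3 z)"
    by (rule homogeneous_of_growth[OF E, of 3 C N]) (use C(2) N in \<open>auto simp: power_int_def\<close>)
  have F0: "F \<noteq> 0" using F(2)[of z1] z1 by auto
  have "E i z = eval3 F (lift i z)" for i z
  proof (cases "i = 3")
    case True then show ?thesis using F(2) by simp
  next
    case False
    obtain w0 where w0: "lift i w0 $ 3 \<noteq> 0" using lift3 by blast
    show ?thesis
    proof (rule eq_of_eq_dense[OF E holo2_eval3_lift[OF open_UNIV] holo2_lift[OF open_UNIV] w0])
      fix w assume w: "lift i w $ 3 \<noteq> 0"
      then have wd: "w \<in> chart_dom i 3" by (simp add: chart_dom_def)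
      let ?z = "trans_map i 3 w"
      have zd: "lift 3 ?z $ i \<noteq> 0" using trans_chart_dom[OF wd] by (simp add: chart_dom_def)
      have "trans_map 3 i ?z = w" using w by (rule trans_map_inverse)
      then have "lift i w = inverse (lift 3 ?z $ i) *s lift 3 ?z"
        using lift_trans[OF zd] unfolding Finite_Cartesian_Product.vec_eq_iff by (simp add: divide_inverse mult.commute)
      then have "eval3 F (lift i w) = inverse (lift 3 ?z $ i) ^ N * eval3 F (lift 3 ?z)"
        by (simp add: eval3_homogeneous_scale[OF F(1)])
      then show "E i w = eval3 F (lift i w)" using tr'[OF False wd] F(2) N by (simp add: power_inverse)
    qed
  qed
  then show thesis using that[of F] D F(1) F0 N by simp
qed

section \<open>The coefficients of a web are polynomials\<close>

text \<open>Cauchy's inequality on the unit circle bounds the coefficients of a form by its values.\<close>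

lemma coeff_bound:
  assumes B: "\<And>t. cmod t = 1 \<Longrightarrow> cmod (bform d a (t, 1)) \<le> B" and l: "l \<le> d"
  shows "cmod (a l) \<le> B"
proof -
  let ?f = "\<lambda>t. \<Sum>j\<le>d. a j * t ^ j"
  have fb: "bform d a (t, 1) = ?f t" for t by (simp add: bform_def)
  have hol: "?f holomorphic_on S" for S by (intro holomorphic_intros)
  have gr: "cmod (?f t) \<le> (\<Sum>j\<le>d. cmod (a j)) * cmod t ^ d" if "1 \<le> cmod t" for t
  proof -
    have "cmod (?f t) \<le> (\<Sum>j\<le>d. cmod (a j * t ^ j))" by (rule norm_sum)
    also have "\<dots> \<le> (\<Sum>j\<le>d. cmod (a j) * cmod t ^ d)"
      by (intro sum_mono) (auto simp: norm_mult norm_power intro!: mult_left_mono power_increasing that)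
    finally show ?thesis by (simp add: sum_distrib_right)
  qed
  have lp: "?f t = (\<Sum>k\<le>d. (deriv ^^ k) ?f 0 / fact k * t ^ k)" for t
    by (rule Liouville_polynomial[OF hol gr])
  have "poly (form_poly d a) t = poly (form_poly d (\<lambda>k. (deriv ^^ k) ?f 0 / fact k)) t" for t
    using lp[of t] by (simp only: form_poly_def poly_sum poly_monom)
  then have "form_poly d a = form_poly d (\<lambda>k. (deriv ^^ k) ?f 0 / fact k)"
    by (simp add: poly_eq_poly_eq_iff[symmetric] fun_eq_iff)
  then have "coeff (form_poly d a) l = coeff (form_poly d (\<lambda>k. (deriv ^^ k) ?f 0 / fact k)) l" by simp
  then have al: "a l = (deriv ^^ l) ?f 0 / fact l" using l by (simp add: coeff_form_poly)
  have "cmod ((deriv ^^ l) ?f 0) \<le> fact l * B / 1 ^ l"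
    by (rule Cauchy_inequality[OF hol holomorphic_on_imp_continuous_on[OF hol]]) (use B fb in auto)
  then show ?thesis by (simp add: al norm_divide field_simps)
qed

lemma bform_bound:
  assumes "\<And>l. l \<le> d \<Longrightarrow> cmod (a l) \<le> M" "cmod (fst \<eta>) \<le> R" "cmod (snd \<eta>) \<le> R" "M \<ge> 0"
  shows "cmod (bform d a \<eta>) \<le> real (Suc d) * M * R ^ d"
proof -
  have R: "R \<ge> 0" using assms(2) norm_ge_zero order_trans by blast
  have "cmod (bform d a \<eta>) \<le> (\<Sum>j\<le>d. cmod (a j * fst \<eta> ^ j * snd \<eta> ^ (d - j)))"
    unfolding bform_def by (rule norm_sum)
  also have "\<dots> \<le> (\<Sum>j\<le>d. M * R ^ d)"
  proof (rule sum_mono)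
    fix j assume j: "j \<in> {..d}"
    have "cmod (fst \<eta>) ^ j * cmod (snd \<eta>) ^ (d - j) \<le> R ^ j * R ^ (d - j)"
      using assms(2,3) R by (intro mult_mono power_mono) auto
    also have "\<dots> = R ^ d" using j by (simp flip: power_add)
    finally show "cmod (a j * fst \<eta> ^ j * snd \<eta> ^ (d - j)) \<le> M * R ^ d"
      using assms(1)[of j] assms(4) R j by (simp add: norm_mult norm_power mult.assoc) (intro mult_mono, auto)
  qed
  finally show ?thesis by (simp add: mult.assoc)
qed

text \<open>The entries of the Jacobian matrix have at most a double pole along the line at infinity.\<close>

lemma trans_to_3_bound:
  assumes j: "j \<noteq> 3" and w: "w \<in> chart_dom j 3" "w \<in> unit_bidisc"
    and \<xi>: "cmod (fst \<xi>) \<le> 1" "cmod (snd \<xi>) \<le> 1"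
  defines "R \<equiv> 2 * cmod (inverse (lift j w $ 3)) ^ 2"
  shows "cmod (fst (pullback (trans_map j 3) w \<xi>)) \<le> R \<and> cmod (snd (pullback (trans_map j 3) w \<xi>)) \<le> R"
proof -
  define X where "X = inverse (lift j w $ 3)"
  have l3: "lift j w $ 3 = snd w" using j exhaust_3[of j] by auto
  have sw: "snd w \<noteq> 0" using w(1) l3 by (simp add: chart_dom_def)
  have wb: "cmod (fst w) \<le> 1" "cmod (snd w) \<le> 1" using w(2) by (auto simp: unit_bidisc_def mem_Times_iff)
  have X1: "cmod X \<ge> 1" using wb(2) sw by (simp add: X_def l3 norm_inverse one_le_inverse)
  have y: "has_cd (\<lambda>z. inverse (snd z)) 0 (- X\<^sup>2) w"
    using has_cd_inverse[OF has_cd_snd sw] by (simp add: X_def l3)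
  have xy: "has_cd (\<lambda>z. fst z * inverse (snd z)) X (fst w * - X\<^sup>2) w"
    using has_cd_mult[OF has_cd_fst y] by (simp add: X_def l3)
  have b1: "cmod (X * t) \<le> cmod X ^ 2" if "cmod t \<le> 1" for t
    using mult_mono[of "cmod X" "cmod X" "cmod t" "cmod X"] that X1 by (simp add: norm_mult power2_eq_square)
  have b2: "cmod (X\<^sup>2 * t) \<le> cmod X ^ 2" if "cmod t \<le> 1" for t
    using that by (simp add: norm_mult norm_power mult_left_le)
  have b3: "cmod (fst w * X\<^sup>2 * t) \<le> cmod X ^ 2" if "cmod t \<le> 1" for t
  proof -
    have "cmod (fst w * t) \<le> 1" using wb(1) that by (simp add: norm_mult mult_le_one)
    from b2[OF this] show ?thesis by (simp add: mult_ac)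
  qed
  have tri: "cmod (p + q) \<le> 2 * cmod X ^ 2" "cmod (p - q) \<le> 2 * cmod X ^ 2" "cmod (- p - q) \<le> 2 * cmod X ^ 2" "cmod p \<le> 2 * cmod X ^ 2"
    if "cmod p \<le> cmod X ^ 2" "cmod q \<le> cmod X ^ 2" for p q
    using that zero_le_power2[of "cmod X"] norm_triangle_ineq[of p q] norm_triangle_ineq4[of p q] norm_triangle_ineq4[of "- p" q]
    unfolding norm_minus_cancel by linarith+
  have "j = 1 \<or> j = 2" using j exhaust_3[of j] by auto
  then show ?thesis
  proof
    assume j1: "j = 1"
    have f: "fst \<circ> trans_map j 3 = (\<lambda>z. inverse (snd z))" "snd \<circ> trans_map j 3 = (\<lambda>z. fst z * inverse (snd z))"
      by (simp_all add: fun_eq_iff trans_map_def coords_def j1 divide_inverse del: split_paired_All)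
    show ?thesis
      unfolding pullback_def f has_cd_pd[OF y] has_cd_pd[OF xy] R_def X_def[symmetric]
      using tri(4)[OF b1[OF \<xi>(2)] b1[OF \<xi>(2)]] tri(3)[OF b2[OF \<xi>(1)] b3[OF \<xi>(2)]] by (simp add: mult.assoc)
  next
    assume j2: "j = 2"
    have f: "fst \<circ> trans_map j 3 = (\<lambda>z. fst z * inverse (snd z))" "snd \<circ> trans_map j 3 = (\<lambda>z. inverse (snd z))"
      by (simp_all add: fun_eq_iff trans_map_def coords_def j2 divide_inverse del: split_paired_All)
    show ?thesis
      unfolding pullback_def f has_cd_pd[OF y] has_cd_pd[OF xy] R_def X_def[symmetric]
      using tri(4)[OF b1[OF \<xi>(1)] b1[OF \<xi>(1)]] tri(3)[OF b3[OF \<xi>(1)] b2[OF \<xi>(2)]] by (simp add: mult.assoc)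
  qed
qed

text \<open>The coefficients are bounded on the bidiscs; the twist and the \<open>d\<close>-fold pullback of
  covectors multiply the bound by powers of \<open>bigness z\<close>, so that Liouville's theorem applies.\<close>

theorem web_coefficients_polynomial:
  assumes v: "sym_section d m v" and l: "l \<le> d"
  obtains p where "\<And>z. v 3 z l = eval2 p z"
proof -
  have h: "holo2 (\<lambda>z. v i z k) UNIV" if "k \<le> d" for i k using v that unfolding sym_section_def by blast
  have tr: "bform d (v i z) (pullback (trans_map i j) z \<xi>) = (lift i z $ j) powi m * bform d (v j (trans_map i j z)) \<xi>"
    if "z \<in> chart_dom i j" for i j z \<xi>
    using v that unfolding sym_section_def chart_dom_def by blast
  have "\<exists>M\<ge>0. \<forall>z\<in>unit_bidisc. cmod (v i z k) \<le> M" if "k \<le> d" for i k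
    using bounded_on_bidisc[OF h[OF that], of i] by metis
  then have "\<forall>i k. \<exists>M. k \<le> d \<longrightarrow> M \<ge> 0 \<and> (\<forall>z\<in>unit_bidisc. cmod (v i z k) \<le> M)" by blast
  then obtain M where M': "\<forall>i k. k \<le> d \<longrightarrow> M i k \<ge> 0 \<and> (\<forall>z\<in>unit_bidisc. cmod (v i z k) \<le> M i k)"
    by metis
  have M: "\<And>i k. k \<le> d \<Longrightarrow> M i k \<ge> 0" "\<And>i k z. k \<le> d \<Longrightarrow> z \<in> unit_bidisc \<Longrightarrow> cmod (v i z k) \<le> M i k"
    using M' by blast+
  define B where "B = (\<Sum>k\<le>d. M 1 k + M 2 k + M 3 k)"
  have MB: "M i k \<le> B" if "k \<le> d" for i k
  proof -
    have "M i k \<le> M 1 k + M 2 k + M 3 k" using exhaust_3[of i] M(1)[OF that, of 1] M(1)[OF that, of 2] M(1)[OF that, of 3] by auto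
    also have "\<dots> \<le> B" unfolding B_def by (rule member_le_sum) (use that M(1) in \<open>auto simp: add_nonneg_nonneg\<close>)
    finally show ?thesis .
  qed
  have B0: "B \<ge> 0" unfolding B_def using M(1) by (intro sum_nonneg) (auto simp: add_nonneg_nonneg)
  have vB: "cmod (v i z k) \<le> B" if "k \<le> d" "z \<in> unit_bidisc" for i z k using M(2)[OF that, of i] MB[OF that(1), of i] by linarith
  let ?N = "nat \<bar>m\<bar> + 2 * d" and ?C = "real (Suc d) * B * 2 ^ d"
  have B1: "B \<le> ?C"
  proof -
    have "1 * B * 1 \<le> real (Suc d) * B * 2 ^ d" using B0 by (intro mult_mono) auto
    then show ?thesis by simp
  qed
  have "cmod (v 3 z l) \<le> ?C * bigness z ^ ?N" for z
    using chart_cover[of z]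
  proof
    assume "z \<in> unit_bidisc \<and> bigness z = 1"
    then show ?thesis using vB[OF l, of z 3] B1 by simp
  next
    assume "\<exists>j\<in>{1, 2}. z \<in> chart_dom 3 j \<and> trans_map 3 j z \<in> unit_bidisc \<and> cmod (lift 3 z $ j) = bigness z"
    then obtain j where j0: "j \<in> {1, 2}" and j': "z \<in> chart_dom 3 j" "trans_map 3 j z \<in> unit_bidisc" "cmod (lift 3 z $ j) = bigness z" by blast
    have "j \<noteq> 3" using j0 by auto
    note j = this j'
    let ?w = "trans_map 3 j z" and ?b = "bigness z"
    have wd: "?w \<in> chart_dom j 3" by (rule trans_chart_dom[OF j(2)])
    have wz: "trans_map j 3 ?w = z" using j(2) by (simp add: trans_map_inverse chart_dom_def)
    have L: "lift j ?w $ 3 = inverse (lift 3 z $ j)" by (rule lift_trans_inverse[OF j(2)])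
    have Lz: "lift 3 z $ j \<noteq> 0" using j(2) by (simp add: chart_dom_def)
    show ?thesis
    proof (rule coeff_bound[OF _ l])
      fix t :: complex assume t: "cmod t = 1"
      let ?\<eta> = "pullback (trans_map j 3) ?w (t, 1)"
      have \<eta>: "cmod (fst ?\<eta>) \<le> 2 * ?b\<^sup>2 \<and> cmod (snd ?\<eta>) \<le> 2 * ?b\<^sup>2"
        using trans_to_3_bound[OF j(1) wd j(3), of "(t, 1)"] t L j(4) by simp
      have "bform d (v j ?w) ?\<eta> = (lift j ?w $ 3) powi m * bform d (v 3 z) (t, 1)"
        using tr[OF wd, of "(t, 1)"] wz by simp
      then have "bform d (v 3 z) (t, 1) = (lift 3 z $ j) powi m * bform d (v j ?w) ?\<eta>"
        using Lz unfolding L by (simp add: power_int_inverse)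
      then have "cmod (bform d (v 3 z) (t, 1)) = ?b powi m * cmod (bform d (v j ?w) ?\<eta>)"
        using j(4) by (simp add: norm_mult norm_power_int)
      also have "\<dots> \<le> ?b ^ nat \<bar>m\<bar> * (real (Suc d) * B * (2 * ?b\<^sup>2) ^ d)"
      proof (rule mult_mono)
        have "?b powi m \<le> ?b powi \<bar>m\<bar>" using bigness_ge(1)[of z] by (intro power_int_increasing) auto
        then show "?b powi m \<le> ?b ^ nat \<bar>m\<bar>" by (simp add: power_int_def)
        show "cmod (bform d (v j ?w) ?\<eta>) \<le> real (Suc d) * B * (2 * ?b\<^sup>2) ^ d"
          by (rule bform_bound) (use \<eta> vB j(3) B0 in auto)
      qed (use bigness_ge(1)[of z] in auto)
      also have "\<dots> = ?C * ?b ^ ?N"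
      proof -
        have "?b ^ (2 * d) = (?b\<^sup>2) ^ d" by (rule power_mult)
        then show ?thesis unfolding power_add power_mult_distrib by (simp only: mult_ac)
      qed
      finally show "cmod (bform d (v 3 z) (t, 1)) \<le> ?C * ?b ^ ?N" .
    qed
  qed
  then show thesis using poly2_of_growth[OF h[OF l], of 3 ?C ?N] that by metis
qed

section \<open>Vanishing Wronskians and first integrals\<close>

lemma zero_product_on_open:
  fixes f :: "'b \<Rightarrow> 'a :: topological_space \<Rightarrow> complex"
  assumes "open U" "U \<noteq> {}" "\<And>x. x \<in> set xs \<Longrightarrow> continuous_on U (f x)"
    "\<And>z. z \<in> U \<Longrightarrow> (\<Prod>x\<leftarrow>xs. f x z) = 0"
  obtains x V where "x \<in> set xs" "open V" "V \<noteq> {}" "V \<subseteq> U" "\<And>z. z \<in> V \<Longrightarrow> f x z = 0"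
  using assms
proof (induction xs arbitrary: U thesis)
  case Nil then show ?case by auto
next
  case (Cons y ys)
  show ?case
  proof (cases "\<forall>z\<in>U. f y z = 0")
    case True then show ?thesis using Cons.prems by (meson list.set_intros(1) order_refl)
  next
    case False
    let ?V = "{z \<in> U. f y z \<in> - {0}}"
    have op: "open ?V" using continuous_open_preimage[of U "f y" "- {0}"] Cons.prems(2,4)
      by (auto simp: vimage_def Int_def)
    have ne: "?V \<noteq> {}" using False by auto
    have c: "continuous_on ?V (f x)" if "x \<in> set ys" for x
      by (rule continuous_on_subset[OF Cons.prems(4)]) (use that in auto)
    have z: "(\<Prod>x\<leftarrow>ys. f x z) = 0" if "z \<in> ?V" for z using Cons.prems(5)[of z] that by auto
    show ?thesis
    proof (rule Cons.IH[OF _ op ne c z])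
      fix x V assume "x \<in> set ys" "open V" "V \<noteq> {}" "V \<subseteq> ?V" "\<And>z. z \<in> V \<Longrightarrow> f x z = 0"
      then show thesis using Cons.prems(1)[of x V] by auto
    qed
  qed
qed

lemma kernel_trivial:
  fixes M :: "nat \<Rightarrow> nat \<Rightarrow> complex"
  assumes det: "det (mat q q (\<lambda>(i,j). M i j)) \<noteq> 0" and x: "\<And>i. i < q \<Longrightarrow> (\<Sum>j<q. M i j * x j) = 0" and j: "j < q"
  shows "x j = 0"
proof -
  let ?A = "mat q q (\<lambda>(i,j). M i j)" and ?x = "Matrix.vec q x"
  have "?A *\<^sub>v ?x = 0\<^sub>v q"
    by (rule eq_vecI) (auto simp: scalar_prod_def x atLeast0LessThan)
  moreover have "?A \<in> carrier_mat q q" "?x \<in> carrier_vec q" by auto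
  ultimately have "?x = 0\<^sub>v q" using det det_0_iff_vec_prod_zero[of ?A q] by blast
  then have "vec_index ?x j = vec_index (0\<^sub>v q) j" by simp
  then show ?thesis using j by simp
qed

text \<open>A vector in the kernel of the large matrix has nonzero last entry because the small matrix is
  invertible. The coefficients are written with the adjugate matrix (Cramer's rule) in order to be
  holomorphic in parameters.\<close>

lemma last_column_combination:
  fixes M :: "nat \<Rightarrow> nat \<Rightarrow> complex"
  assumes det0: "det (mat (Suc q) (Suc q) (\<lambda>(i,j). M i j)) = 0" and det: "det (mat q q (\<lambda>(i,j). M i j)) \<noteq> 0"
    and i: "i \<le> q"
  shows "M i q = (\<Sum>j<q. (\<Sum>l<q. adj_mat (mat q q (\<lambda>(i,j). M i j)) $$ (j, l) * M l q) / det (mat q q (\<lambda>(i,j). M i j)) * M i j)"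
proof -
  let ?B = "mat (Suc q) (Suc q) (\<lambda>(i,j). M i j)" and ?A = "mat q q (\<lambda>(i,j). M i j)"
  obtain x where x: "x \<in> carrier_vec (Suc q)" "x \<noteq> 0\<^sub>v (Suc q)" "?B *\<^sub>v x = 0\<^sub>v (Suc q)"
    using det0 det_0_iff_vec_prod_zero[of ?B "Suc q"] by auto
  define y where "y j = vec_index x j" for j
  have row: "(\<Sum>j<q. M i j * y j) + M i q * y q = 0" if "i \<le> q" for i
  proof -
    have "vec_index (?B *\<^sub>v x) i = 0" using x(3) that by simp
    then have "(\<Sum>j = 0..<Suc q. M i j * y j) = 0" using that x(1) by (simp add: scalar_prod_def y_def del: sum.atLeast0_lessThan_Suc)
    then show ?thesis by (simp add: atLeast0LessThan)
  qed
  have yq: "y q \<noteq> 0"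
  proof
    assume y0: "y q = 0"
    have "y j = 0" if "j < q" for j
      by (rule kernel_trivial[OF det _ that]) (use row y0 in auto)
    then have "x = 0\<^sub>v (Suc q)" using x(1) y0 by (intro eq_vecI) (auto simp: y_def less_Suc_eq)
    then show False using x(2) by simp
  qed
  define \<tau> where "\<tau> j = - y j / y q" for j
  have col: "M i q = (\<Sum>j<q. M i j * \<tau> j)" if "i \<le> q" for i
  proof -
    have "M i q * y q = - (\<Sum>j<q. M i j * y j)" using row[OF that] by (simp add: add_eq_0_iff2 add.commute)
    then have "M i q = - (\<Sum>j<q. M i j * y j) / y q" using yq by (simp add: field_simps)
    then show ?thesis by (simp add: \<tau>_def sum_negf sum_divide_distrib)
  qed
  have "(\<Sum>l<q. adj_mat ?A $$ (j, l) * M l q) = det ?A * \<tau> j" if j: "j < q" for j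
  proof -
    have "(\<Sum>l<q. adj_mat ?A $$ (j, l) * M l q) = (\<Sum>l<q. \<Sum>k<q. adj_mat ?A $$ (j, l) * M l k * \<tau> k)"
      by (rule sum.cong) (auto simp: col sum_distrib_left mult.assoc)
    also have "\<dots> = (\<Sum>k<q. (\<Sum>l<q. adj_mat ?A $$ (j, l) * M l k) * \<tau> k)"
      by (subst sum.swap) (simp add: sum_distrib_right)
    also have "\<dots> = (\<Sum>k<q. (if k = j then det ?A else 0) * \<tau> k)"
    proof (rule sum.cong)
      fix k assume k: "k \<in> {..<q}"
      have "(adj_mat ?A * ?A) $$ (j, k) = (det ?A \<cdot>\<^sub>m 1\<^sub>m q) $$ (j, k)"
        by (subst adj_mat(3)[of ?A q]) auto
      moreover have "(adj_mat ?A * ?A) $$ (j, k) = (\<Sum>l<q. adj_mat ?A $$ (j, l) * M l k)"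
        using j k adj_mat(1)[of ?A q] by (simp add: scalar_prod_def atLeast0LessThan)
      ultimately show "(\<Sum>l<q. adj_mat ?A $$ (j, l) * M l k) * \<tau> k = (if k = j then det ?A else 0) * \<tau> k"
        using j k by auto
    qed simp
    also have "\<dots> = (\<Sum>k<q. if k = j then det ?A * \<tau> j else 0)" by (rule sum.cong) auto
    also have "\<dots> = det ?A * \<tau> j" using j by simp
    finally show ?thesis .
  qed
  then have "(\<Sum>l<q. adj_mat ?A $$ (j, l) * M l q) / det ?A = \<tau> j" if "j < q" for j
    using that det by simp
  then show ?thesis using col[OF i] by (simp add: mult.commute)
qed

lemma holo2_adj_mat:
  assumes "open U" "\<And>i j. i < q \<Longrightarrow> j < q \<Longrightarrow> holo2 (f i j) U" "j < q" "l < q"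
  shows "holo2 (\<lambda>z. adj_mat (mat q q (\<lambda>(i,j). f i j z)) $$ (j, l)) U"
proof -
  have e: "adj_mat (mat q q (\<lambda>(i,j). f i j z)) $$ (j, l) = (- 1) ^ (l + j) *
     det (mat (q - 1) (q - 1) (\<lambda>(i',j'). f (if i' < l then i' else Suc i') (if j' < j then j' else Suc j') z))" for z
  proof -
    have "mat_delete (mat q q (\<lambda>(i,j). f i j z)) l j =
      mat (q - 1) (q - 1) (\<lambda>(i',j'). f (if i' < l then i' else Suc i') (if j' < j then j' else Suc j') z)"
      unfolding mat_delete_def by (rule eq_matI) auto
    then show ?thesis using assms(3,4) by (simp add: adj_mat_def cofactor_def)
  qed
  show ?thesis unfolding e
    by (intro holo2_mult holo2_const holo2_det assms(1,2)) auto
qed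

text \<open>Take the least \<open>q\<close> for which the Wronskian of \<open>s 0, \<dots>, s q\<close> vanishes on some open set. Near a point
  where the Wronskian of \<open>s 0, \<dots>, s (q - 1)\<close> is nonzero, the first \<open>q + 1\<close> rows give
  \<open>u\<^sup>i(s q) = \<Sum> \<theta>\<^sub>j u\<^sup>i(s j)\<close> for \<open>i \<le> q\<close>. Deriving the relation for \<open>i < q\<close> and subtracting the one for \<open>i + 1\<close> leaves
  \<open>\<Sum> u(\<theta>\<^sub>j) u\<^sup>i(s j) = 0\<close>, a homogeneous system with nonzero determinant.\<close>

theorem wronskian_first_integrals:
  assumes V: "open V" "V \<noteq> {}" and u: "holo_vfield u V" and s: "\<And>j. j < N \<Longrightarrow> holo2 (s j) V"
    and W0: "\<And>z. z \<in> V \<Longrightarrow> det (mat N N (\<lambda>(i,j). (lie u ^^ i) (s j) z)) = 0"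
  obtains V' q \<theta> where "open V'" "V' \<noteq> {}" "V' \<subseteq> V" "q < N" "\<And>j. j < q \<Longrightarrow> holo2 (\<theta> j) V'"
    "\<And>z. z \<in> V' \<Longrightarrow> s q z = (\<Sum>j<q. \<theta> j z * s j z)"
    "\<And>j z. j < q \<Longrightarrow> z \<in> V' \<Longrightarrow> lie u (\<theta> j) z = 0"
proof -
  define W where "W q z = det (mat q q (\<lambda>(i,j). (lie u ^^ i) (s j) z))" for q z
  \<comment> \<open>The empty Wronskian is \<open>1\<close>, so the predicate is stated for the successor of \<open>q\<close>.\<close>
  let ?P = "\<lambda>q. \<exists>V1. open V1 \<and> V1 \<noteq> {} \<and> V1 \<subseteq> V \<and> (\<forall>z\<in>V1. W (Suc q) z = 0)"
  have Wz: "W 0 z = 1" for z unfolding W_def by (subst det_def'[of _ 0]) (auto simp: sign_def)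
  obtain z00 where "z00 \<in> V" using V by blast
  then have "W N z00 = 0" using W0 by (simp add: W_def)
  then have N: "N \<noteq> 0" using Wz by (metis zero_neq_one)
  then obtain N' where N': "N = Suc N'" by (cases N) auto
  have "?P N'" using V W0 unfolding N' W_def by blast
  define q where "q = (LEAST q. ?P q)"
  have Pq: "?P q" unfolding q_def by (rule LeastI[of ?P, OF \<open>?P N'\<close>])
  have qN: "q < N" using Least_le[of ?P, OF \<open>?P N'\<close>] N' by (simp add: q_def)
  have min: "\<not> ?P k" if "k < q" for k using not_less_Least[of k ?P] that by (simp add: q_def)
  obtain V1 where V1: "open V1" "V1 \<noteq> {}" "V1 \<subseteq> V" "\<And>z. z \<in> V1 \<Longrightarrow> W (Suc q) z = 0" using Pq by blast
  have u1: "holo_vfield u V1" using u V1 unfolding holo_vfield_def by (auto intro: holo2_subset)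
  have L: "holo2 ((lie u ^^ i) (s j)) V1" if "j < N" for i j
    by (rule holo2_lie_funpow[OF u1 holo2_subset[OF s[OF that] V1(1,3)]])
  have hW: "holo2 (W q) V1" unfolding W_def[abs_def] by (rule holo2_det[OF V1(1)]) (use L qN in auto)
  have "\<exists>z\<in>V1. W q z \<noteq> 0"
  proof (cases q)
    case 0 then show ?thesis using Wz V1(2) by auto
  next
    case (Suc k)
    then have "\<not> ?P k" using min by simp
    then show ?thesis using V1 Suc by blast
  qed
  define V2 where "V2 = {z \<in> V1. W q z \<noteq> 0}"
  have V2: "open V2" "V2 \<noteq> {}" "V2 \<subseteq> V1"
    unfolding V2_def using open_nonzero_set[OF V1(1) holo2_cont[OF hW]] \<open>\<exists>z\<in>V1. W q z \<noteq> 0\<close> by auto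
  have u2: "holo_vfield u V2" using u1 V2 unfolding holo_vfield_def by (auto intro: holo2_subset)
  have L2: "holo2 ((lie u ^^ i) (s j)) V2" if "j < N" for i j
    by (rule holo2_subset[OF L[OF that] V2(1,3)])
  define \<theta> where "\<theta> j z = (\<Sum>l<q. adj_mat (mat q q (\<lambda>(i,j). (lie u ^^ i) (s j) z)) $$ (j, l) * (lie u ^^ l) (s q) z) / W q z" for j z
  have h\<theta>: "holo2 (\<theta> j) V2" if "j < q" for j
    unfolding \<theta>_def
  proof (intro holo2_divide holo2_sum holo2_mult)
    show "holo2 (\<lambda>z. adj_mat (mat q q (\<lambda>(i,j). (lie u ^^ i) (s j) z)) $$ (j, l)) V2" if "l \<in> {..<q}" for l
      by (rule holo2_adj_mat[OF V2(1) L2]) (use \<open>j < q\<close> that qN in auto)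
    show "holo2 (W q) V2" by (rule holo2_subset[OF hW V2(1,3)])
  qed (use L2 qN V2 in \<open>auto simp: V2_def\<close>)
  have comb: "(lie u ^^ i) (s q) z = (\<Sum>j<q. \<theta> j z * (lie u ^^ i) (s j) z)" if "i \<le> q" "z \<in> V2" for i z
    unfolding \<theta>_def W_def
    by (rule last_column_combination[of q "\<lambda>i j. (lie u ^^ i) (s j) z", OF _ _ that(1)])
       (use that(2) V1(4) V2(3) in \<open>auto simp: W_def[symmetric] V2_def\<close>)
  have "lie u (\<theta> j) z = 0" if j: "j < q" and z: "z \<in> V2" for j z
  proof (rule kernel_trivial[of q "\<lambda>i j. (lie u ^^ i) (s j) z" "\<lambda>j. lie u (\<theta> j) z", OF _ _ j])
    show "det (mat q q (\<lambda>(i,j). (lie u ^^ i) (s j) z)) \<noteq> 0" using z by (simp add: V2_def W_def)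
    fix i assume i: "i < q"
    have "(lie u ^^ Suc i) (s q) z = lie u (\<lambda>z. \<Sum>j<q. \<theta> j z * (lie u ^^ i) (s j) z) z"
      unfolding funpow.simps comp_def
      by (rule lie_cong[of _ V2]) (use z h\<theta> L2 qN comb i V2 in \<open>auto intro!: holo2_sum holo2_mult\<close>)
    also have "\<dots> = (\<Sum>j<q. lie u (\<lambda>z. \<theta> j z * (lie u ^^ i) (s j) z) z)"
      by (rule lie_sum[where U = V2]) (use z h\<theta> L2 qN V2 in \<open>auto intro!: holo2_mult\<close>)
    also have "\<dots> = (\<Sum>j<q. lie u (\<theta> j) z * (lie u ^^ i) (s j) z + \<theta> j z * (lie u ^^ Suc i) (s j) z)"
      by (rule sum.cong) (use qN in \<open>auto simp: lie_mult[OF h\<theta> L2 z]\<close>)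
    also have "\<dots> = (\<Sum>j<q. lie u (\<theta> j) z * (lie u ^^ i) (s j) z) + (lie u ^^ Suc i) (s q) z"
      unfolding sum.distrib using comb[of "Suc i" z] i z by simp
    finally show "(\<Sum>j<q. (lie u ^^ i) (s j) z * lie u (\<theta> j) z) = 0" by (simp add: mult.commute)
  qed
  then show thesis using that[of V2 q \<theta>] V2 V1(3) qN h\<theta> comb[of 0] by auto
qed

section \<open>Affine parts of plane curves\<close>

definition dehom :: "poly3 \<Rightarrow> complex poly poly" where
  "dehom F = poly F [:[:1:]:]"

lemma eval2_dehom: "eval2 (dehom F) z = eval3 F (lift 3 z)"
  by (simp add: dehom_def eval3_eval2)

lemma eval2_expand: "eval2 p z = (\<Sum>b\<le>degree p. \<Sum>a\<le>degree (coeff p b). coeff (coeff p b) a * fst z ^ a * snd z ^ b)"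
proof -
  have "p = (\<Sum>b\<le>degree p. monom (\<Sum>a\<le>degree (coeff p b). monom (coeff (coeff p b) a) a) b)" by (simp add: poly_as_monoms)
  then have "eval2 p z = eval2 (\<Sum>b\<le>degree p. monom (\<Sum>a\<le>degree (coeff p b). monom (coeff (coeff p b) a) a) b) z" by simp
  then show ?thesis by (simp add: monom_sum eval2_sum eval2_monom)
qed

text \<open>The equation for \<open>F X\<close> is stated off the line at infinity, where it can be compared with quotients.\<close>

lemma homogenization:
  obtains N F where "homogeneous N F" "dehom F = p" "\<And>X. X $ 3 \<noteq> 0 \<Longrightarrow> eval3 F X = X $ 3 ^ N * eval2 p (X $ 1 / X $ 3, X $ 2 / X $ 3)"
proof -
  define N where "N = Max (insert 0 (\<Union>b\<in>{..degree p}. (\<lambda>a. a + b) ` {..degree (coeff p b)}))"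
  have N: "a + b \<le> N" if "b \<le> degree p" "a \<le> degree (coeff p b)" for a b
    unfolding N_def using that by (intro Max_ge) auto
  define F where "F = (\<Sum>b\<le>degree p. \<Sum>a\<le>degree (coeff p b). mon3 (coeff (coeff p b) a) a b (N - (a + b)))"
  have h: "homogeneous N F"
    unfolding F_def by (intro homogeneous_sum homogeneous_mon3) (use N in auto)
  have "eval2 (dehom F - p) z = 0" for z
    unfolding eval2_simps eval2_dehom by (simp add: F_def eval3_sum eval3_mon3 eval2_expand)
  then have d: "dehom F = p" using eval2_zero by (metis eq_iff_diff_eq_0)
  have "eval3 F X = X $ 3 ^ N * eval2 p (X $ 1 / X $ 3, X $ 2 / X $ 3)" if X: "X $ 3 \<noteq> 0" for X :: "complex ^ 3"
  proof -
    have "eval3 F (lift 3 (coords 3 X)) = inverse (X $ 3) ^ N * eval3 F X" by (rule eval3_lift_coords[OF h X])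
    moreover have "eval3 F (lift 3 (coords 3 X)) = eval2 p (X $ 1 / X $ 3, X $ 2 / X $ 3)"
      unfolding eval2_dehom[symmetric] d by (simp add: coords_def)
    ultimately show ?thesis using X by (simp add: power_inverse)
  qed
  then show thesis using that[OF h d] by blast
qed

lemma dehom_simps: "dehom (F * G) = dehom F * dehom G" by (simp add: dehom_def)

text \<open>Products of polynomials in the plane homogenise up to powers of the third coordinate, and \<open>P\<close> does
  not divide that coordinate because the curve has the finite point \<open>z0\<close>.\<close>

lemma dehom_prime:
  assumes P: "prime_elem P" "homogeneous m P" and z0: "eval3 P (lift 3 z0) = 0"
  shows "prime_elem (dehom P)"
proof (rule prime_elemI)
  have P0: "P \<noteq> 0" using P by auto
  show "dehom P \<noteq> 0" using eval3_lift_nonzero[OF P(2) P0, of 3] by (auto simp: eval2_dehom[symmetric])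
  show "\<not> is_unit (dehom P)"
  proof
    assume "is_unit (dehom P)"
    then obtain k where "1 = dehom P * k" by blast
    then have "eval2 1 z0 = eval2 (dehom P) z0 * eval2 k z0" by (metis eval2_simps(3))
    then show False using z0 by (simp add: eval2_dehom)
  qed
  fix a b assume "dehom P dvd a * b"
  then obtain c where c: "a * b = dehom P * c" by blast
  obtain Na A where A: "homogeneous Na A" "dehom A = a" "\<And>X. X $ 3 \<noteq> 0 \<Longrightarrow> eval3 A X = X $ 3 ^ Na * eval2 a (X $ 1 / X $ 3, X $ 2 / X $ 3)"
    using homogenization[of a] by blast
  obtain Nb B where B: "homogeneous Nb B" "dehom B = b" "\<And>X. X $ 3 \<noteq> 0 \<Longrightarrow> eval3 B X = X $ 3 ^ Nb * eval2 b (X $ 1 / X $ 3, X $ 2 / X $ 3)"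
    using homogenization[of b] by blast
  obtain Nc C where C: "homogeneous Nc C" "dehom C = c" "\<And>X. X $ 3 \<noteq> 0 \<Longrightarrow> eval3 C X = X $ 3 ^ Nc * eval2 c (X $ 1 / X $ 3, X $ 2 / X $ 3)"
    using homogenization[of c] by blast
  have Pe: "eval3 P X = X $ 3 ^ m * eval2 (dehom P) (X $ 1 / X $ 3, X $ 2 / X $ 3)" if X: "X $ 3 \<noteq> 0" for X :: "complex ^ 3"
  proof -
    have "eval2 (dehom P) (X $ 1 / X $ 3, X $ 2 / X $ 3) = inverse (X $ 3) ^ m * eval3 P X"
      using eval3_lift_coords[OF P(2) X] by (simp add: eval2_dehom coords_def)
    then show ?thesis using X by (simp add: power_inverse)
  qed
  \<comment> \<open>The third coordinate as a polynomial. The extra factor \<open>Tp\<close> in the next identity accounts for the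
     line at infinity, where the values of the homogenisations are not prescribed.\<close>
  define Tp where "Tp = mon3 1 0 0 1"
  have Te: "eval3 Tp X = X $ 3" for X by (simp add: eval3_mon3 Tp_def)
  have "Tp * (Tp ^ (m + Nc) * A * B - Tp ^ (Na + Nb) * P * C) = 0"
  proof (rule eval3_zero)
    fix X
    show "eval3 (Tp * (Tp ^ (m + Nc) * A * B - Tp ^ (Na + Nb) * P * C)) X = 0"
    proof (cases "X $ 3 = 0")
      case False
      have "eval2 a w * eval2 b w = eval2 (dehom P) w * eval2 c w" for w using c by (metis eval2_simps(3))
      then show ?thesis using False by (simp add: Te A(3) B(3) C(3) Pe power_add algebra_simps)
    qed (simp add: Te)
  qed
  moreover have "Tp \<noteq> 0" by (simp add: Tp_def mon3_def)
  ultimately have "Tp ^ (m + Nc) * A * B = P * (Tp ^ (Na + Nb) * C)" by (simp add: mult_ac)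
  then have "P dvd Tp ^ (m + Nc) * A * B" by (metis dvdI)
  moreover have "\<not> P dvd Tp ^ (m + Nc)"
  proof
    assume "P dvd Tp ^ (m + Nc)"
    then have "eval3 (Tp ^ (m + Nc)) (lift 3 z0) = 0" using z0 by (rule eval3_dvd)
    then show False by (simp add: Te)
  qed
  ultimately have "P dvd A \<or> P dvd B" using prime_elem_dvd_multD[OF P(1)] by blast
  then show "dehom P dvd a \<or> dehom P dvd b"
    unfolding A(2)[symmetric] B(2)[symmetric] by (metis dehom_simps dvdE dvdI)
qed

definition dx :: "complex poly poly \<Rightarrow> complex poly poly" where
  "dx p = map_poly pderiv p"

lemma dx_pCons: "dx (pCons f p) = pCons (pderiv f) (dx p)"
proof -
  have "pderiv (0 :: complex poly) = 0" by (simp add: pderiv_eq_0_iff)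
  then show ?thesis by (intro poly_eqI) (simp add: dx_def coeff_map_poly coeff_pCons split: nat.split)
qed

lemma has_cd_eval2: "has_cd (eval2 p) (eval2 (dx p) z) (eval2 (pderiv p) z) z"
proof (induction p)
  case 0
  then show ?case using has_cd_const[of 0 z] by (simp add: dx_def eval2_def[abs_def])
next
  case (pCons f p)
  have f: "has_cd (\<lambda>z. poly f (fst z)) (poly (pderiv f) (fst z)) 0 z"
    using has_cd_field_compose[OF has_cd_fst poly_DERIV, of f z] by simp
  have e: "eval2 (pCons f p) = (\<lambda>z. poly f (fst z) + snd z * eval2 p z)" by (simp add: eval2_def fun_eq_iff)
  have dxp: "dx (pCons f p) = pCons (pderiv f) (dx p)" by (rule dx_pCons)
  show ?case unfolding e
    using has_cd_add[OF f has_cd_mult[OF has_cd_snd pCons(2)]]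
    by (simp add: dxp pderiv_pCons eval2_def add.commute mult.commute)
qed

text \<open>Derivatives have smaller degree, so both would vanish and \<open>p\<close> would be constant.\<close>

lemma prime_not_dvd_derivatives:
  assumes p: "prime_elem p" shows "\<not> (p dvd dx p \<and> p dvd pderiv p)"
proof
  assume d: "p dvd dx p \<and> p dvd pderiv p"
  have p0: "p \<noteq> 0" using p by auto
  have "pderiv p = 0"
  proof (rule ccontr)
    assume n: "pderiv p \<noteq> 0"
    then have "degree p \<le> degree (pderiv p)" using d by (intro dvd_imp_degree_le) auto
    then show False using n by (simp add: degree_pderiv pderiv_eq_0_iff)
  qed
  then obtain f where f: "p = [:f:]" by (auto simp: pderiv_eq_0_iff elim: degree_eq_zeroE)
  have "dx p = [:pderiv f:]" unfolding f dx_pCons by (simp add: dx_def)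
  then have fd: "f dvd pderiv f" using d f by simp
  have "pderiv f = 0"
  proof (rule ccontr)
    assume n: "pderiv f \<noteq> 0"
    then have "degree f \<le> degree (pderiv f)" using fd by (intro dvd_imp_degree_le) auto
    then show False using n by (simp add: degree_pderiv pderiv_eq_0_iff)
  qed
  then obtain k where k: "f = [:k:]" by (auto simp: pderiv_eq_0_iff elim: degree_eq_zeroE)
  then have "k \<noteq> 0" using p0 f by auto
  then have "p * [:[:inverse k:]:] = 1" by (simp add: f k one_pCons)
  then have "p dvd 1" by (metis dvdI)
  then show False using p by (simp add: prime_elem_def)
qed

section \<open>Invariant curves through a common leaf\<close>

lemma tangent_map_nonzero:
  assumes ij: "i \<noteq> j" and z: "z \<in> chart_dom i j" and u: "u \<noteq> 0"
  shows "tangent_map i j z u \<noteq> 0"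
proof
  assume 0: "tangent_map i j z u = 0"
  have L: "lift i z $ j \<noteq> 0" using z by (simp add: chart_dom_def)
  have "jac i j z \<noteq> 0" using jac_square[OF ij z] L by auto
  moreover have "pairing u (perp (1, 0)) \<noteq> 0 \<or> pairing u (perp (0, 1)) \<noteq> 0"
    using u by (auto simp: pairing_perp prod_eq_iff)
  ultimately obtain w where "jac i j z * pairing u (perp w) \<noteq> 0" by auto
  then have "pairing (tangent_map i j z u) (perp (tangent_map i j z w)) \<noteq> 0" by (simp add: pairing_tangent_map)
  then show False unfolding 0 by (simp add: pairing_def)
qed

text \<open>The condition on a point of \<open>F = 0\<close> in the definition of an invariant curve: the curve is smooth
  there and its tangent is a direction of the web.\<close>

definition tangent_to_web :: "nat \<Rightarrow> sym_tensor \<Rightarrow> poly3 \<Rightarrow> 3 \<Rightarrow> complex \<times> complex \<Rightarrow> bool" where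
  "tangent_to_web d v F i z \<longleftrightarrow> (\<exists>u. tangent_to (eval3 F \<circ> lift i) z u \<and> web_direction d (v i z) u)"

text \<open>Tangency does not depend on the chart: the equation changes by a nonvanishing function, tangent
  vectors by the derivative of the change of charts, and the web by a nonzero number.\<close>

lemma tangent_to_web_trans:
  assumes d: "d \<ge> 1" and v: "sym_section d m v" and F: "homogeneous k F"
    and ij: "i \<noteq> j" and z: "z \<in> chart_dom i j" and F0: "eval3 F (lift i z) = 0"
    and good: "tangent_to_web d v F i z"
  shows "tangent_to_web d v F j (trans_map i j z)"
proof -
  let ?w = "trans_map i j z" and ?L = "\<lambda>z. lift i z $ j"
  let ?fi = "eval3 F \<circ> lift i" and ?fj = "eval3 F \<circ> lift j"
  obtain u us where u: "tangent_to ?fi z u" "u \<noteq> 0" "is_factorization d (v i z) us" "u \<in> set us"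
    using good unfolding tangent_to_web_def web_direction_def by blast
  have L: "?L z \<noteq> 0" using z by (simp add: chart_dom_def)
  have hi: "holo2 ?fi UNIV" "holo2 ?fj UNIV" by (simp_all add: comp_def holo2_eval3_lift)
  have rel: "?fi w = ?L w ^ k * ?fj (trans_map i j w)" if "w \<in> chart_dom i j" for w
  proof -
    have Lw: "?L w \<noteq> 0" using that by (simp add: chart_dom_def)
    have "lift i w = ?L w *s lift j (trans_map i j w)"
      using lift_trans[OF Lw] Lw unfolding Finite_Cartesian_Product.vec_eq_iff by simp
    then have "eval3 F (lift i w) = eval3 F (?L w *s lift j (trans_map i j w))" by (rule arg_cong)
    then show ?thesis by (simp add: eval3_homogeneous_scale[OF F])
  qed
  define p where "p = pd1 ?fj ?w" define q where "q = pd2 ?fj ?w"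
  have fw: "?fj ?w = 0" using rel[OF z] F0 L by simp
  have cdc: "has_cd (\<lambda>w. ?fj (trans_map i j w))
      (p * pd1 (fst \<circ> trans_map i j) z + q * pd1 (snd \<circ> trans_map i j) z)
      (p * pd2 (fst \<circ> trans_map i j) z + q * pd2 (snd \<circ> trans_map i j) z) z"
    unfolding p_def q_def
    by (rule has_cd_compose[OF holo2_has_cd[OF holo2_trans(1)[OF ij] z] holo2_has_cd[OF holo2_trans(2)[OF ij] z]
          holo2_has_cd[OF hi(2) UNIV_I]])
  have "holo2 (\<lambda>w. ?L w ^ k) UNIV" by (intro holo2_power holo2_lift) simp
  from has_cd_mult[OF holo2_has_cd[OF this UNIV_I] cdc]
  have cdm: "has_cd (\<lambda>w. ?L w ^ k * ?fj (trans_map i j w))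
      (?L z ^ k * (p * pd1 (fst \<circ> trans_map i j) z + q * pd1 (snd \<circ> trans_map i j) z))
      (?L z ^ k * (p * pd2 (fst \<circ> trans_map i j) z + q * pd2 (snd \<circ> trans_map i j) z)) z"
    using fw by simp
  have cdi: "has_cd ?fi
      (?L z ^ k * (p * pd1 (fst \<circ> trans_map i j) z + q * pd1 (snd \<circ> trans_map i j) z))
      (?L z ^ k * (p * pd2 (fst \<circ> trans_map i j) z + q * pd2 (snd \<circ> trans_map i j) z)) z"
    by (rule has_cd_cong_open[OF cdm open_chart_dom z]) (simp only: rel)
  have pq: "(p, q) \<noteq> 0"
  proof
    assume "(p, q) = 0"
    then have "pd1 ?fi z = 0" "pd2 ?fi z = 0" using has_cd_pd[OF cdi] by (auto simp: prod_eq_iff)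
    then show False using u(1) by (simp add: tangent_to_def zero_prod_def)
  qed
  have "fst u * pd1 ?fi z + snd u * pd2 ?fi z = 0" using u(1) by (simp add: tangent_to_def)
  then have "?L z ^ k * (fst (tangent_map i j z u) * p + snd (tangent_map i j z u) * q) = 0"
    unfolding has_cd_pd[OF cdi] by (simp add: tangent_map_def algebra_simps)
  then have tan: "fst (tangent_map i j z u) * p + snd (tangent_map i j z u) * q = 0" using L by simp
  \<comment> \<open>A scalar in front of the web is distributed evenly over its \<open>d\<close> factors; this keeps \<open>u\<close> among
     them up to a multiple.\<close>
  obtain c where c: "c ^ d = inverse (?L z powi m)" by (rule exists_complex_root[of d "inverse (?L z powi m)"]) (use d in auto)
  have Lm: "?L z powi m \<noteq> 0" using L by simp
  have c0: "c \<noteq> 0"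
  proof
    assume "c = 0"
    then have "c ^ d = 0" using d by simp
    then show False using c Lm by simp
  qed
  let ?u = "(c * fst (tangent_map i j z u), c * snd (tangent_map i j z u))"
  let ?us = "map (\<lambda>u. (c * fst (tangent_map i j z u), c * snd (tangent_map i j z u))) us"
  have tm0: "tangent_map i j z u \<noteq> 0" by (rule tangent_map_nonzero[OF ij z u(2)])
  have u0: "?u \<noteq> 0" using tm0 c0 by (auto simp: prod_eq_iff)
  have "is_factorization d (v j ?w) ?us"
    unfolding is_factorization_def
  proof (intro conjI allI)
    show len: "length ?us = d" using u(3) by (simp add: is_factorization_def)
    fix \<xi>
    have tr: "bform d (v i z) (pullback (trans_map i j) z \<xi>) = ?L z powi m * bform d (v j ?w) \<xi>"
      using v z unfolding sym_section_def chart_dom_def by blast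
    have "(\<Prod>u\<leftarrow>?us. pairing u \<xi>) = c ^ length us * (\<Prod>u\<leftarrow>us. pairing (tangent_map i j z u) \<xi>)"
      by (induction us) (auto simp: pairing_def algebra_simps)
    also have "(\<Prod>u\<leftarrow>us. pairing (tangent_map i j z u) \<xi>) = bform d (v i z) (pullback (trans_map i j) z \<xi>)"
      using u(3) by (simp add: is_factorization_def pairing_pullback[symmetric] del: split_paired_All)
    also have "length us = d" using u(3) by (simp add: is_factorization_def)
    finally show "bform d (v j ?w) \<xi> = (\<Prod>u\<leftarrow>?us. pairing u \<xi>)" unfolding tr c using Lm by simp
  qed
  moreover have "?u \<in> set ?us" using u(4) by auto
  ultimately have wd: "web_direction d (v j ?w) ?u" unfolding web_direction_def using u0 by blast
  have "c * (fst (tangent_map i j z u) * p + snd (tangent_map i j z u) * q) = 0" using tan by simp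
  then have "tangent_to ?fj ?w ?u"
    unfolding tangent_to_def p_def[symmetric] q_def[symmetric] using u0 pq by (simp add: algebra_simps)
  then show ?thesis unfolding tangent_to_web_def using wd by blast
qed

text \<open>If \<open>F\<close> vanished on the line at infinity, the irreducible \<open>F\<close> would be the third coordinate up to a
  constant, which is nonzero at the finite point \<open>z0\<close>.\<close>

lemma points_at_infinity_finite:
  assumes F: "irreducible F" "homogeneous k F" and z0: "eval3 F (lift 3 z0) = 0" and i: "i \<noteq> 3"
  shows "finite {z. eval3 F (lift i z) = 0 \<and> lift i z $ 3 = 0}"
proof -
  let ?F0 = "poly F 0"
  have F0: "eval2 ?F0 w = eval3 F (vector [fst w, snd w, 0])" for w by (simp add: eval3_eval2)
  have nz: "?F0 \<noteq> 0"
  proof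
    assume "?F0 = 0"
    then have "[:- 0, 1:] dvd F" by (simp only: poly_eq_0_iff_dvd[symmetric])
    then obtain G where G: "F = [:0, 1:] * G" by auto
    have e: "eval3 [:0, 1:] X = X $ 3" for X by (simp add: eval3_def)
    have "\<not> [:0, 1:] dvd (1 :: poly3)"
    proof
      assume "[:0, 1:] dvd (1 :: poly3)"
      from eval3_dvd[OF this, of 0] show False by (simp add: e)
    qed
    then have "G dvd 1" using irreducibleD[OF F(1) G] by blast
    moreover have "eval3 G (lift 3 z0) = 0" using z0 unfolding G eval3_simps e by simp
    ultimately have "eval3 1 (lift 3 z0) = 0" by (rule eval3_dvd)
    then show False by simp
  qed
  have sc: "eval3 F (vector [t * a, t * b, 0]) = t ^ k * eval3 F (vector [a, b, 0])" for t a b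
  proof -
    have "vector [t * a, t * b, 0] = t *s (vector [a, b, 0] :: complex ^ 3)"
      by (simp add: Finite_Cartesian_Product.vec_eq_iff forall_3)
    then show ?thesis by (simp add: eval3_homogeneous_scale[OF F(2)])
  qed
  have "i = 1 \<or> i = 2" using i exhaust_3[of i] by auto
  then show ?thesis
  proof
    assume i1: "i = 1"
    let ?g = "map_poly (\<lambda>r. poly r 1) ?F0"
    have g: "poly ?g x = eval3 F (vector [1, x, 0])" for x
      using poly_of_evaluation[of "\<lambda>r. poly r (1::complex)" "\<lambda>t. [:t:]" ?F0 x] F0[of "(1, x)"] by (simp add: eval2_def)
    have g0: "?g \<noteq> 0"
    proof
      assume "?g = 0"
      then have h: "eval3 F (vector [1, x, 0]) = 0" for x using g[of x] by simp
      have "?F0 * [:[:0, 1:]:] = 0"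
      proof (rule eval2_zero)
        fix w :: "complex \<times> complex"
        show "eval2 (?F0 * [:[:0, 1:]:]) w = 0" unfolding eval2_simps(3)
          using sc[of "fst w" 1 "snd w / fst w"] h[of "snd w / fst w"] F0[of w] by (cases "fst w = 0") (simp_all add: eval2_def)
      qed
      then show False using nz by simp
    qed
    have "{z. eval3 F (lift i z) = 0 \<and> lift i z $ 3 = 0} \<subseteq> (\<lambda>x. (x, 0)) ` {x. poly ?g x = 0}"
      unfolding i1 g by (auto simp: lift_def)
    then show ?thesis by (rule finite_subset) (intro finite_imageI poly_roots_finite g0)
  next
    assume i2: "i = 2"
    let ?g = "poly ?F0 1"
    have g: "poly ?g x = eval3 F (vector [x, 1, 0])" for x
      using F0[of "(x, 1)"] by (simp add: eval2_def one_pCons)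
    have g0: "?g \<noteq> 0"
    proof
      assume "?g = 0"
      then have h: "eval3 F (vector [x, 1, 0]) = 0" for x using g[of x] by simp
      have "?F0 * [:0, 1:] = 0"
      proof (rule eval2_zero)
        fix w :: "complex \<times> complex"
        show "eval2 (?F0 * [:0, 1:]) w = 0"
          using sc[of "snd w" "fst w / snd w" 1] h[of "fst w / snd w"] F0[of w]
          by (cases "snd w = 0") (simp_all add: eval2_def)
      qed
      then show False using nz by simp
    qed
    have "{z. eval3 F (lift i z) = 0 \<and> lift i z $ 3 = 0} \<subseteq> (\<lambda>x. (x, 0)) ` {x. poly ?g x = 0}"
      unfolding i2 g by (auto simp: lift_def)
    then show ?thesis by (rule finite_subset) (intro finite_imageI poly_roots_finite g0)
  qed
qed

text \<open>A polynomial that vanishes on the arc is divisible by the equation \<open>p\<close> of the curve, since its zeros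
  on the curve are infinite in number. This applies to the value of the web at the differential of \<open>p\<close>,
  a polynomial as the coefficients of the web are. So at every finite point of the curve the
  differential of \<open>p\<close> is a zero of the web, and a factor of the web is tangent unless the point is singular or
  a zero of the web. There are finitely many singular points because \<open>p\<close>
  does not divide both of its derivatives. If the web had infinitely many zeros on the curve, \<open>p\<close> would divide all
  its coefficients and the web would vanish along the arc, against the isolation of its zeros. The chart \<open>3\<close>
  misses only finitely many points of the curve.\<close>

lemma irreducible_curve_through_arc:
  assumes d: "d \<ge> 1" and v: "sym_section d m v" and iso: "isolated_zeros d v"
    and F: "irreducible F" "homogeneous k F"
    and T: "open T" "T \<noteq> {}" and \<gamma>: "\<And>t. t \<in> T \<Longrightarrow> (\<gamma>1 has_field_derivative \<gamma>1' t) (at t)"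
      "\<And>t. t \<in> T \<Longrightarrow> (\<gamma>2 has_field_derivative \<gamma>2' t) (at t)"
    and inj: "inj_on (\<lambda>t. (\<gamma>1 t, \<gamma>2 t)) T"
    and van: "\<And>t. t \<in> T \<Longrightarrow> eval3 F (lift 3 (\<gamma>1 t, \<gamma>2 t)) = 0"
    and dir: "\<And>t \<omega>. t \<in> T \<Longrightarrow> pairing (\<gamma>1' t, \<gamma>2' t) \<omega> = 0 \<Longrightarrow> bform d (v 3 (\<gamma>1 t, \<gamma>2 t)) \<omega> = 0"
  shows "finite {z. eval3 F (lift i z) = 0 \<and> \<not> tangent_to_web d v F i z}"
proof -
  let ?\<gamma> = "\<lambda>t. (\<gamma>1 t, \<gamma>2 t)"
  let ?p = "dehom F"
  obtain t0 where t0: "t0 \<in> T" using T by blast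
  have pp: "prime_elem ?p" by (rule dehom_prime[OF irreducible_prime3[OF F(1)] F(2) van[OF t0]])
  have pe: "eval2 ?p z = eval3 F (lift 3 z)" for z by (rule eval2_dehom)
  have infT: "infinite T" using T finite_imp_not_open by blast
  then have infZ: "infinite (?\<gamma> ` T)" using inj by (simp add: finite_image_iff)
  have Zp: "?\<gamma> ` T \<subseteq> {z. eval2 ?p z = 0}" using van pe by auto
  have dvdI: "?p dvd q" if "\<And>t. t \<in> T \<Longrightarrow> eval2 q (?\<gamma> t) = 0" for q
  proof (rule ccontr)
    assume "\<not> ?p dvd q"
    then have "finite {z. eval2 ?p z = 0 \<and> eval2 q z = 0}" by (rule prime_common_zeros_finite[OF pp])
    moreover have "?\<gamma> ` T \<subseteq> {z. eval2 ?p z = 0 \<and> eval2 q z = 0}" using that Zp by auto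
    ultimately show False using infZ finite_subset by blast
  qed
  have dvdD: "eval2 q z = 0" if "?p dvd q" "eval2 ?p z = 0" for q z using that by (auto elim!: dvdE)
  have "\<forall>l. \<exists>V. l \<le> d \<longrightarrow> (\<forall>z. v 3 z l = eval2 V z)"
  proof
    fix l show "\<exists>V. l \<le> d \<longrightarrow> (\<forall>z. v 3 z l = eval2 V z)"
      by (cases "l \<le> d") (use web_coefficients_polynomial[OF v, of l] in metis, simp)
  qed
  then obtain V where V: "\<And>l z. l \<le> d \<Longrightarrow> v 3 z l = eval2 (V l) z" by metis
  let ?dp = "\<lambda>z. (eval2 (dx ?p) z, eval2 (pderiv ?p) z)"
  define H where "H = (\<Sum>l\<le>d. V l * dx ?p ^ l * pderiv ?p ^ (d - l))"
  have He: "eval2 H z = bform d (v 3 z) (?dp z)" for z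
    unfolding H_def bform_def eval2_sum by (rule sum.cong) (auto simp: V)
  have "?p dvd H"
  proof (rule dvdI)
    fix t assume t: "t \<in> T"
    have "((\<lambda>t. eval2 ?p (?\<gamma> t)) has_field_derivative (eval2 (dx ?p) (?\<gamma> t) * \<gamma>1' t + eval2 (pderiv ?p) (?\<gamma> t) * \<gamma>2' t)) (at t)"
      by (rule has_cd_curve[OF \<gamma>(1)[OF t] \<gamma>(2)[OF t] has_cd_eval2])
    moreover have "((\<lambda>t. eval2 ?p (?\<gamma> t)) has_field_derivative 0) (at t)"
      by (rule has_field_derivative_transform_within_open[OF DERIV_const[of 0] T(1) t]) (simp add: pe van)
    ultimately have "eval2 (dx ?p) (?\<gamma> t) * \<gamma>1' t + eval2 (pderiv ?p) (?\<gamma> t) * \<gamma>2' t = 0" by (rule DERIV_unique)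
    then have "pairing (\<gamma>1' t, \<gamma>2' t) (?dp (?\<gamma> t)) = 0" by (simp add: pairing_def mult.commute)
    then show "eval2 H (?\<gamma> t) = 0" unfolding He by (rule dir[OF t])
  qed
  then have H0: "bform d (v 3 z) (?dp z) = 0" if "eval2 ?p z = 0" for z using dvdD[OF _ that] He by metis
  have sing: "finite {z. eval2 ?p z = 0 \<and> ?dp z = 0}"
  proof -
    consider "\<not> ?p dvd dx ?p" | "\<not> ?p dvd pderiv ?p" using prime_not_dvd_derivatives[OF pp] by blast
    then show ?thesis
    proof cases
      case 1 then show ?thesis
        by (intro finite_subset[OF _ prime_common_zeros_finite[OF pp 1]]) (auto simp: zero_prod_def)
    next
      case 2 then show ?thesis
        by (intro finite_subset[OF _ prime_common_zeros_finite[OF pp 2]]) (auto simp: zero_prod_def)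
    qed
  qed
  have vz: "finite {z. eval2 ?p z = 0 \<and> (\<forall>l\<le>d. v 3 z l = 0)}" (is "finite ?VZ")
  proof (rule ccontr)
    assume inf: "\<not> finite ?VZ"
    have "?p dvd V l" if l: "l \<le> d" for l
    proof (rule ccontr)
      assume "\<not> ?p dvd V l"
      from prime_common_zeros_finite[OF pp this] have "finite ?VZ"
        by (rule finite_subset[rotated]) (use V l in auto)
      then show False using inf by blast
    qed
    then have vg: "\<forall>l\<le>d. v 3 (?\<gamma> t) l = 0" if "t \<in> T" for t
      using dvdD[of _ "?\<gamma> t"] V van[OF that] by (simp add: pe)
    let ?S = "{z. \<forall>l\<le>d. v 3 z l = 0}"
    have "?\<gamma> t0 \<in> ?S" using vg[OF t0] by simp
    then have "?\<gamma> t0 isolated_in ?S" using iso unfolding isolated_zeros_def by blast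
    then obtain W where W: "open W" "W \<inter> ?S = {?\<gamma> t0}" unfolding isolated_in_def by blast
    have c\<gamma>: "continuous_on T ?\<gamma>"
      using \<gamma> by (intro continuous_on_Pair continuous_at_imp_continuous_on ballI) (auto dest: DERIV_isCont)
    have "open (T \<inter> ?\<gamma> -` W)" by (rule continuous_open_preimage[OF c\<gamma> T(1) W(1)])
    moreover have "t0 \<in> T \<inter> ?\<gamma> -` W" using t0 W by blast
    ultimately have "T \<inter> ?\<gamma> -` W \<noteq> {t0}" "t0 \<in> T \<inter> ?\<gamma> -` W" using not_open_singleton[of t0] by auto
    then obtain t1 where t1: "t1 \<in> T \<inter> ?\<gamma> -` W" "t1 \<noteq> t0" by blast
    then have "?\<gamma> t1 \<in> W \<inter> ?S" using vg by auto
    then have "?\<gamma> t1 = ?\<gamma> t0" using W(2) by blast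
    then show False using inj t1 t0 by (auto dest: inj_onD)
  qed
  have bad3: "finite {z. eval3 F (lift 3 z) = 0 \<and> \<not> tangent_to_web d v F 3 z}"
  proof (rule finite_subset)
    show "finite ({z. eval2 ?p z = 0 \<and> ?dp z = 0} \<union> ?VZ)" using sing vz by blast
    show "{z. eval3 F (lift 3 z) = 0 \<and> \<not> tangent_to_web d v F 3 z} \<subseteq> {z. eval2 ?p z = 0 \<and> ?dp z = 0} \<union> ?VZ"
    proof (rule ccontr)
      assume "\<not> ?thesis"
      then obtain z where z: "eval2 ?p z = 0" "\<not> tangent_to_web d v F 3 z" "?dp z \<noteq> 0" "\<not> (\<forall>l\<le>d. v 3 z l = 0)"
        unfolding pe[symmetric] by blast
      obtain us where us: "is_factorization d (v 3 z) us" by (rule factorization_exists[OF d])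
      have F0: "bform d (v 3 z) \<xi> = (\<Prod>u\<leftarrow>us. pairing u \<xi>)" for \<xi> using us unfolding is_factorization_def by blast
      have "(\<Prod>u\<leftarrow>us. pairing u (?dp z)) = 0" using H0[OF z(1)] F0 by simp
      then obtain u where u: "u \<in> set us" "pairing u (?dp z) = 0" by (auto simp: prod_list_zero_iff)
      have "u \<noteq> 0"
      proof
        assume "u = 0"
        then have "bform d (v 3 z) \<xi> = bform d (\<lambda>_. 0) \<xi>" for \<xi>
          unfolding F0 using u(1) by (force simp: bform_def prod_list_zero_iff pairing_def)
        then have "v 3 z l = 0" if "l \<le> d" for l by (rule bform_inject[OF _ that])
        then show False using z(4) by blast
      qed
      have fe: "eval3 F \<circ> lift 3 = eval2 ?p" by (rule ext) (simp add: pe)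
      have pd: "pd1 (eval2 ?p) z = eval2 (dx ?p) z" "pd2 (eval2 ?p) z = eval2 (pderiv ?p) z"
        using has_cd_pd[OF has_cd_eval2] by auto
      have "tangent_to (eval3 F \<circ> lift 3) z u"
        unfolding tangent_to_def fe pd using z(3) u(2) \<open>u \<noteq> 0\<close> by (simp add: pairing_def)
      moreover have "web_direction d (v 3 z) u" unfolding web_direction_def using us u(1) \<open>u \<noteq> 0\<close> by blast
      ultimately show False using z(2) unfolding tangent_to_web_def by blast
    qed
  qed
  show ?thesis
  proof (cases "i = 3")
    case True then show ?thesis using bad3 by simp
  next
    case i: False
    let ?B = "{z. eval3 F (lift 3 z) = 0 \<and> \<not> tangent_to_web d v F 3 z}"
    have fin: "finite ({z. eval3 F (lift i z) = 0 \<and> lift i z $ 3 = 0} \<union> trans_map 3 i ` ?B)"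
      using points_at_infinity_finite[OF F van[OF t0] i] bad3 by blast
    show ?thesis
    proof (rule finite_subset[OF _ fin], rule subsetI)
      fix z assume z: "z \<in> {z. eval3 F (lift i z) = 0 \<and> \<not> tangent_to_web d v F i z}"
      show "z \<in> {z. eval3 F (lift i z) = 0 \<and> lift i z $ 3 = 0} \<union> trans_map 3 i ` ?B"
      proof (cases "lift i z $ 3 = 0")
        case False
        then have zd: "z \<in> chart_dom i 3" by (simp add: chart_dom_def)
        let ?w = "trans_map i 3 z"
        have wd: "?w \<in> chart_dom 3 i" by (rule trans_chart_dom[OF zd])
        have wz: "trans_map 3 i ?w = z" by (rule trans_map_inverse[OF False])
        have "lift 3 ?w = inverse (lift i z $ 3) *s lift i z"
          using lift_trans[OF False] unfolding Finite_Cartesian_Product.vec_eq_iff by (simp add: divide_inverse mult.commute)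
        then have Fw: "eval3 F (lift 3 ?w) = 0" using z by (simp add: eval3_homogeneous_scale[OF F(2)])
        have "\<not> tangent_to_web d v F 3 ?w"
          using tangent_to_web_trans[OF d v F(2) i[symmetric] wd Fw] z wz by auto
        then show ?thesis using Fw wz by (metis (mono_tags, lifting) UnI2 imageI mem_Collect_eq)
      qed (use z in blast)
    qed
  qed
qed

section \<open>The extactic section is nonzero\<close>

text \<open>The exponents of the first two coordinates in the list \<open>monomials n i\<close>.\<close>

definition exponents :: "nat \<Rightarrow> (nat \<times> nat) list" where
  "exponents n = concat (map (\<lambda>a. map (\<lambda>b. (a, b)) [0..<n + 1 - a]) [0..<n + 1])"

lemma monomials_exponents:
  "monomials n i = map (\<lambda>ab z. (lift i z $ 1) ^ fst ab * (lift i z $ 2) ^ snd ab * (lift i z $ 3) ^ (n - fst ab - snd ab)) (exponents n)"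
  by (simp add: monomials_def exponents_def map_concat comp_def)

lemma distinct_concat_blocks:
  assumes "distinct xs" and f: "\<And>x. distinct (f x)" "\<And>x y. x \<noteq> y \<Longrightarrow> set (f x) \<inter> set (f y) = {}"
  shows "distinct (concat (map f xs))"
  using assms(1)
proof (induction xs)
  case (Cons a xs)
  then have "set (f a) \<inter> set (f x) = {}" if "x \<in> set xs" for x using that by (intro f(2)) auto
  then show ?case using Cons f(1) by auto
qed simp

lemma distinct_exponents: "distinct (exponents n)"
  unfolding exponents_def by (rule distinct_concat_blocks) (auto simp: distinct_map inj_on_def)

lemma exponents_bound: "ab \<in> set (exponents n) \<Longrightarrow> fst ab + snd ab \<le> n"
  unfolding exponents_def by (auto simp del: upt_Suc)

text \<open>A vanishing extactic section provides first integrals of a field of the web, and through them an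
  invariant algebraic curve of degree at most \<open>n\<close> through each general point of an open set; finitely many curves do not suffice.\<close>

theorem extactic_nonzero:
  assumes d: "d \<ge> 1" and w: "web d r v"
    and fin: "finite {C. (\<exists>m\<le>n. curve_of_degree m C) \<and> invariant_curve d v C}"
  shows "\<exists>i z. nth_extactic_section n d v i z \<noteq> 0"
proof (rule ccontr)
  assume "\<not> ?thesis"
  then have E0: "nth_extactic_section n d v 3 z = 0" for z by blast
  let ?m = "int r - int d"
  have v: "sym_section d ?m v" and iso: "isolated_zeros d v" and disc: "\<exists>i z. bdisc d (v i z) \<noteq> 0"
    using w by (auto simp: web_def)
  let ?S = "monomials n 3"
  obtain z0 where z0: "bdisc d (v 3 z0) \<noteq> 0" using bdisc_nonzero[OF d v disc] by blast
  obtain U vs where U: "open U" "z0 \<in> U" "\<And>u. u \<in> set vs \<Longrightarrow> holo_vfield u U"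
      "\<And>z. z \<in> U \<Longrightarrow> is_factorization d (v 3 z) (map (\<lambda>u. u z) vs)" "\<And>z. z \<in> U \<Longrightarrow> bdisc d (v 3 z) \<noteq> 0"
    using v_local[OF d v disc z0 open_UNIV UNIV_I] by blast
  have hs: "holo2 (sigma ?S u) U" if "u \<in> set vs" for u
    unfolding sigma_def[abs_def]
    by (rule holo2_det[OF U(1)]) (use U(3)[OF that] U(1) in \<open>intro holo2_lie_funpow holo2_monomials[OF nth_mem]\<close>)
  have "(\<Prod>u\<leftarrow>vs. sigma ?S u z) = 0" if z: "z \<in> U" for z
    using extactic_formula[OF d v disc U(1,3,4,5) z, of n] E0[of z] U(5)[OF z] by simp
  then obtain u V where u: "u \<in> set vs" and V: "open V" "V \<noteq> {}" "V \<subseteq> U" and su: "\<And>z. z \<in> V \<Longrightarrow> sigma ?S u z = 0"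
    using zero_product_on_open[of U vs "sigma ?S"] U(1,2) holo2_cont[OF hs] by (metis empty_iff)
  have uV: "holo_vfield u V" using U(3)[OF u] V unfolding holo_vfield_def by (auto intro: holo2_subset)
  have fac: "bform d (v 3 z) \<xi> = (\<Prod>w\<leftarrow>map (\<lambda>w. w z) vs. pairing w \<xi>)" if "z \<in> V" for z \<xi>
    using U(4)[of z] that V(3) unfolding is_factorization_def by blast
  have bzero: "bform d (v 3 z) \<xi> = 0" if "z \<in> V" "pairing (u z) \<xi> = 0" for z \<xi>
    unfolding fac[OF that(1)] using u that(2) by (auto simp: prod_list_zero_iff image_iff intro!: bexI[of _ u])
  have "\<exists>z\<in>V. u z \<noteq> 0"
  proof (rule ccontr)
    assume "\<not> ?thesis"
    then have uz: "u z = 0" if "z \<in> V" for z using that by blast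
    have "v 3 z l = 0" if "z \<in> V" "l \<le> d" for z l
      by (rule bform_inject[OF _ that(2), of _ "\<lambda>_. 0"]) (use bzero[OF that(1)] uz[OF that(1)] in \<open>simp add: pairing_def bform_def\<close>)
    then have sub: "V \<subseteq> {z. \<forall>l\<le>d. v 3 z l = 0}" by blast
    obtain z1 where z1: "z1 \<in> V" using V by blast
    then have "z1 isolated_in {z. \<forall>l\<le>d. v 3 z l = 0}" using iso sub unfolding isolated_zeros_def by blast
    then obtain W where W: "open W" "W \<inter> {z. \<forall>l\<le>d. v 3 z l = 0} = {z1}" unfolding isolated_in_def by blast
    then have "W \<inter> V = {z1}" using sub z1 by blast
    then have "open {z1}" using open_Int[OF W(1) V(1)] by simp
    then show False using not_open_singleton by blast
  qed
  define V0 where "V0 = {z \<in> V. fst (u z) \<noteq> 0} \<union> {z \<in> V. snd (u z) \<noteq> 0}"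
  have V0: "open V0" "V0 \<noteq> {}" "V0 \<subseteq> V" and u0: "\<And>z. z \<in> V0 \<Longrightarrow> u z \<noteq> 0"
  proof -
    have "continuous_on V (\<lambda>z. fst (u z))" "continuous_on V (\<lambda>z. snd (u z))"
      using uV unfolding holo_vfield_def comp_def by (auto intro: holo2_cont)
    then show "open V0" unfolding V0_def by (intro open_Un open_nonzero_set V(1))
    show "V0 \<noteq> {}" using \<open>\<exists>z\<in>V. u z \<noteq> 0\<close> by (auto simp: V0_def prod_eq_iff)
    show "V0 \<subseteq> V" by (auto simp: V0_def)
    show "\<And>z. z \<in> V0 \<Longrightarrow> u z \<noteq> 0" by (auto simp: V0_def)
  qed
  have uV0: "holo_vfield u V0" using uV V0 unfolding holo_vfield_def by (auto intro: holo2_subset)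
  define s where "s j = ?S ! j" for j
  let ?N = "length ?S"
  obtain V1 q \<theta> where V1: "open V1" "V1 \<noteq> {}" "V1 \<subseteq> V0" and q: "q < ?N" and h\<theta>: "\<And>j. j < q \<Longrightarrow> holo2 (\<theta> j) V1"
    and comb: "\<And>z. z \<in> V1 \<Longrightarrow> s q z = (\<Sum>j<q. \<theta> j z * s j z)" and fi: "\<And>j z. j < q \<Longrightarrow> z \<in> V1 \<Longrightarrow> lie u (\<theta> j) z = 0"
  proof (rule wronskian_first_integrals[OF V0(1,2) uV0, of ?N s])
    show "holo2 (s j) V0" if "j < ?N" for j unfolding s_def by (rule holo2_monomials[OF nth_mem[OF that] V0(1)])
    show "det (mat ?N ?N (\<lambda>(i,j). (lie u ^^ i) (s j) z)) = 0" if "z \<in> V0" for z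
      using su[of z] that V0(3) unfolding sigma_def s_def by blast
  qed blast
  define ex where "ex j = exponents n ! j" for j
  have len: "?N = length (exponents n)" by (simp add: monomials_exponents)
  have sj: "s j z = fst z ^ fst (ex j) * snd z ^ snd (ex j)" if "j < ?N" for j z
    using that by (simp add: s_def ex_def monomials_exponents)
  have exb: "fst (ex j) + snd (ex j) \<le> n" if "j < ?N" for j
    using that by (intro exponents_bound) (simp add: ex_def len)
  have exinj: "ex j \<noteq> ex q" if "j < q" for j
    using that q distinct_exponents[of n] by (simp add: ex_def len nth_eq_iff_index_eq)
  define Mo where "Mo j = mon3 1 (fst (ex j)) (snd (ex j)) (n - (fst (ex j) + snd (ex j)))" for j
  \<comment> \<open>The relation between the monomials with the coefficients frozen at \<open>w\<close>; it vanishes at \<open>w\<close>, and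
     along the leaf through \<open>w\<close>, on which the \<open>\<theta> j\<close> are constant.\<close>
  define F where "F w = Mo q - (\<Sum>j<q. mon3 (\<theta> j w) (fst (ex j)) (snd (ex j)) (n - (fst (ex j) + snd (ex j))))" for w
  have Fh: "homogeneous n (F w)" for w
  proof -
    have "homogeneous n (mon3 k (fst (ex j)) (snd (ex j)) (n - (fst (ex j) + snd (ex j))))" if "j < ?N" for j k
      using exb[OF that] by (intro homogeneous_mon3) simp
    moreover have "homogeneous n (A - B)" if "homogeneous n A" "homogeneous n B" for A B
      using that by (intro homogeneousI_eval) (simp add: eval3_homogeneous_scale[OF that(1)] eval3_homogeneous_scale[OF that(2)] algebra_simps)
    ultimately show ?thesis unfolding F_def Mo_def using q by (meson homogeneous_sum lessThan_iff less_trans)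
  qed
  have Fe: "eval3 (F w) (lift 3 z) = s q z - (\<Sum>j<q. \<theta> j w * s j z)" for w z
    unfolding F_def Mo_def using q by (simp add: eval3_sum eval3_mon3 sj mult.assoc)
  have F0: "F w \<noteq> 0" for w
  proof
    assume "F w = 0"
    then have "cf (F w) (fst (ex q)) (snd (ex q)) (n - (fst (ex q) + snd (ex q))) = 0" by simp
    moreover have "cf (mon3 k (fst (ex j)) (snd (ex j)) (n - (fst (ex j) + snd (ex j)))) (fst (ex q)) (snd (ex q)) (n - (fst (ex q) + snd (ex q))) = 0"
      if "j < q" for j k using exinj[OF that] unfolding cf_mon3 by (auto simp: prod_eq_iff)
    ultimately show False unfolding F_def Mo_def by (simp add: coeff_sum cf_mon3)
  qed
  have Fz: "eval3 (F z) (lift 3 z) = 0" if "z \<in> V1" for z using comb[OF that] by (simp add: Fe)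
  obtain zb where zb: "zb \<in> V1" using V1 by blast
  obtain \<rho> where \<rho>: "\<rho> > 0" "ball zb \<rho> \<subseteq> V1" using V1(1) zb open_contains_ball by blast
  \<comment> \<open>If all \<open>\<theta> j\<close> were constant, the monomials would be linearly dependent.\<close>
  have "\<exists>j<q. \<exists>z\<in>V1. pd1 (\<theta> j) z \<noteq> 0 \<or> pd2 (\<theta> j) z \<noteq> 0"
  proof (rule ccontr)
    assume "\<not> ?thesis"
    then have pz: "pd1 (\<theta> j) z = 0" "pd2 (\<theta> j) z = 0" if "j < q" "z \<in> V1" for j z using that by blast+
    have const: "\<theta> j z = \<theta> j zb" if j: "j < q" and z: "z \<in> ball zb \<rho>" for j z
    proof -
      have "(\<theta> j has_derivative (\<lambda>h. 0)) (at y within ball zb \<rho>)" if y: "y \<in> ball zb \<rho>" for y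
      proof -
        have "has_cd (\<theta> j) (pd1 (\<theta> j) y) (pd2 (\<theta> j) y) y" by (rule holo2_has_cd[OF h\<theta>[OF j]]) (use y \<rho> in blast)
        moreover have "pd1 (\<theta> j) y = 0" "pd2 (\<theta> j) y = 0" using pz[OF j, of y] y \<rho> by blast+
        ultimately show ?thesis by (simp add: has_cd_def has_derivative_at_withinI)
      qed
      from has_derivative_zero_constant[OF convex_ball this] obtain c where "\<And>x. x \<in> ball zb \<rho> \<Longrightarrow> \<theta> j x = c" by blast
      then show ?thesis using z \<rho>(1) by simp
    qed
    have "eval3 (F zb) (lift 3 z) = 0" if z: "z \<in> ball zb \<rho>" for z
    proof -
      have "eval3 (F zb) (lift 3 z) = eval3 (F z) (lift 3 z)" unfolding Fe using const[OF _ z] by simp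
      then show ?thesis using Fz[of z] z \<rho> by auto
    qed
    moreover have entF: "holo2 (\<lambda>z. eval3 (F zb) (lift 3 z)) UNIV" by (rule holo2_eval3_lift[OF open_UNIV])
    ultimately have "eval3 (F zb) (lift 3 z) = 0" for z
      using holo2_entire_identity[OF entF open_ball[of zb \<rho>]] \<rho> centre_in_ball by blast
    then show False using eval3_lift_nonzero[OF Fh F0] by blast
  qed
  then obtain j0 zs where j0: "j0 < q" and zs: "zs \<in> V1" "pd1 (\<theta> j0) zs \<noteq> 0 \<or> pd2 (\<theta> j0) zs \<noteq> 0" by blast
  define V2 where "V2 = {z \<in> V1. pd1 (\<theta> j0) z \<noteq> 0} \<union> {z \<in> V1. pd2 (\<theta> j0) z \<noteq> 0}"
  have V2: "open V2" "zs \<in> V2" "V2 \<subseteq> V1"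
    using zs open_nonzero_set[OF V1(1) continuous_pd1[OF h\<theta>[OF j0]]] open_nonzero_set[OF V1(1) continuous_pd2[OF h\<theta>[OF j0]]]
    by (auto simp: V2_def)
  let ?\<C> = "{C. (\<exists>m\<le>n. curve_of_degree m C) \<and> invariant_curve d v C}"
  have "\<forall>C. \<exists>G m. C \<in> ?\<C> \<longrightarrow> homogeneous m G \<and> squarefree G \<and> C = zero_locus G"
    unfolding curve_of_degree_def by blast
  then obtain G deg where G: "\<And>C. C \<in> ?\<C> \<Longrightarrow> homogeneous (deg C) (G C) \<and> squarefree (G C) \<and> C = zero_locus (G C)"
    unfolding choice_iff by blast
  \<comment> \<open>An equation of the union of all invariant curves of degree at most \<open>n\<close>; the base point of the leaf is chosen outside it.\<close>
  define \<Psi> where "\<Psi> = (\<Prod>C\<in>?\<C>. G C)"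
  have \<Psi>: "homogeneous (\<Sum>C\<in>?\<C>. deg C) \<Psi>" unfolding \<Psi>_def by (rule homogeneous_prod[OF fin]) (use G in blast)
  have "G C \<noteq> 0" if "C \<in> ?\<C>" for C using G[OF that] by auto
  then have \<Psi>0: "\<Psi> \<noteq> 0" unfolding \<Psi>_def using fin by (simp add: prod_zero_iff)
  obtain zp where zp: "eval3 \<Psi> (lift 3 zp) \<noteq> 0" using eval3_lift_nonzero[OF \<Psi> \<Psi>0] by blast
  have h\<Psi>: "holo2 (\<lambda>z. eval3 \<Psi> (lift 3 z)) Om" if "open Om" for Om by (rule holo2_eval3_lift[OF that])
  obtain z1 where z1: "z1 \<in> V2" "eval3 \<Psi> (lift 3 z1) \<noteq> 0"
    by (rule holo2_entire_nonzero_dense[OF h\<Psi>[OF open_UNIV] zp V2(1)]) (use V2(2) in blast)+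
  define V3 where "V3 = {z \<in> V2. eval3 \<Psi> (lift 3 z) \<noteq> 0}"
  have V3: "open V3" "z1 \<in> V3" "V3 \<subseteq> V1"
    unfolding V3_def using open_nonzero_set[OF V2(1) holo2_cont[OF h\<Psi>[OF V2(1)]]] z1 V2 by auto
  have nz3: "pd1 (\<theta> j0) z \<noteq> 0 \<or> pd2 (\<theta> j0) z \<noteq> 0" if "z \<in> V3" for z using that by (auto simp: V3_def V2_def)
  have h3: "holo2 (\<theta> j) V3" if "j < q" for j by (rule holo2_subset[OF h\<theta>[OF that] V3(1,3)])
  obtain T \<gamma>1 \<gamma>2 \<gamma>1' \<gamma>2' where T: "open T" "0 \<in> T" "connected T"
    and g1: "\<And>t. t \<in> T \<Longrightarrow> (\<gamma>1 has_field_derivative \<gamma>1' t) (at t)"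
    and g2: "\<And>t. t \<in> T \<Longrightarrow> (\<gamma>2 has_field_derivative \<gamma>2' t) (at t)"
    and gV: "\<And>t. t \<in> T \<Longrightarrow> (\<gamma>1 t, \<gamma>2 t) \<in> V3 \<and> \<theta> j0 (\<gamma>1 t, \<gamma>2 t) = \<theta> j0 z1 \<and> (\<gamma>1' t, \<gamma>2' t) \<noteq> 0"
    and g0: "(\<gamma>1 0, \<gamma>2 0) = z1" and ginj: "inj_on (\<lambda>t. (\<gamma>1 t, \<gamma>2 t)) T"
    by (rule level_curve[OF h3[OF j0] V3(2) nz3[OF V3(2)]], rule that)
  let ?\<gamma> = "\<lambda>t. (\<gamma>1 t, \<gamma>2 t)"
  have der: "((\<lambda>t. \<theta> j (?\<gamma> t)) has_field_derivative (pd1 (\<theta> j) (?\<gamma> t) * \<gamma>1' t + pd2 (\<theta> j) (?\<gamma> t) * \<gamma>2' t)) (at t)"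
    if "j < q" "t \<in> T" for j t
    by (rule has_cd_curve[OF g1[OF that(2)] g2[OF that(2)] holo2_has_cd[OF h3[OF that(1)]]]) (use gV[OF that(2)] in blast)
  have par: "fst (u (?\<gamma> t)) * \<gamma>2' t = snd (u (?\<gamma> t)) * \<gamma>1' t" if t: "t \<in> T" for t
  proof -
    let ?a = "pd1 (\<theta> j0) (?\<gamma> t)" and ?b = "pd2 (\<theta> j0) (?\<gamma> t)" and ?p = "fst (u (?\<gamma> t))" and ?q = "snd (u (?\<gamma> t))"
    have "((\<lambda>t. \<theta> j0 (?\<gamma> t)) has_field_derivative 0) (at t)"
      by (rule has_field_derivative_transform_within_open[OF DERIV_const[of "\<theta> j0 z1"] T(1) t]) (use gV in simp)
    then have 1: "?a * \<gamma>1' t + ?b * \<gamma>2' t = 0" using der[OF j0 t] DERIV_unique by blast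
    have 2: "?p * ?a + ?q * ?b = 0" using fi[OF j0, of "?\<gamma> t"] gV[OF t] V3(3) unfolding lie_def by blast
    have nz: "?a \<noteq> 0 \<or> ?b \<noteq> 0" using nz3 gV[OF t] by blast
    have "?a * (?p * \<gamma>2' t - ?q * \<gamma>1' t) = (?p * ?a + ?q * ?b) * \<gamma>2' t - ?q * (?a * \<gamma>1' t + ?b * \<gamma>2' t)"
      "?b * (?p * \<gamma>2' t - ?q * \<gamma>1' t) = ?p * (?a * \<gamma>1' t + ?b * \<gamma>2' t) - (?p * ?a + ?q * ?b) * \<gamma>1' t"
      by (simp_all add: algebra_simps)
    then have "?a * (?p * \<gamma>2' t - ?q * \<gamma>1' t) = 0" "?b * (?p * \<gamma>2' t - ?q * \<gamma>1' t) = 0" unfolding 1 2 by simp_all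
    then show ?thesis using nz by auto
  qed
  have un: "u (?\<gamma> t) \<noteq> 0" if "t \<in> T" for t using u0 gV[OF that] V3(3) V1(3) by blast
  have par0: "a * \<gamma>1' t + b * \<gamma>2' t = 0" if t: "t \<in> T" and ab: "a * fst (u (?\<gamma> t)) + b * snd (u (?\<gamma> t)) = 0" for a b t
  proof -
    let ?p = "fst (u (?\<gamma> t))" and ?q = "snd (u (?\<gamma> t))"
    have "?p * (a * \<gamma>1' t + b * \<gamma>2' t) = (a * ?p + b * ?q) * \<gamma>1' t + b * (?p * \<gamma>2' t - ?q * \<gamma>1' t)"
      "?q * (a * \<gamma>1' t + b * \<gamma>2' t) = (a * ?p + b * ?q) * \<gamma>2' t - a * (?p * \<gamma>2' t - ?q * \<gamma>1' t)"
      by (simp_all add: algebra_simps)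
    then have "?p * (a * \<gamma>1' t + b * \<gamma>2' t) = 0" "?q * (a * \<gamma>1' t + b * \<gamma>2' t) = 0"
      unfolding ab par[OF t] by simp_all
    moreover have "?p \<noteq> 0 \<or> ?q \<noteq> 0" using un[OF t] by (auto simp: prod_eq_iff)
    ultimately show ?thesis by auto
  qed
  have \<theta>const: "\<theta> j (?\<gamma> t) = \<theta> j z1" if j: "j < q" and t: "t \<in> T" for j t
  proof -
    have z: "((\<lambda>t. \<theta> j (?\<gamma> t)) has_field_derivative 0) (at t)" if t: "t \<in> T" for t
    proof -
      have "pd1 (\<theta> j) (?\<gamma> t) * fst (u (?\<gamma> t)) + pd2 (\<theta> j) (?\<gamma> t) * snd (u (?\<gamma> t)) = 0"
        using fi[OF j, of "?\<gamma> t"] gV[OF t] V3(3) unfolding lie_def by (auto simp: mult.commute)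
      from par0[OF t this] show ?thesis using der[OF j t] by simp
    qed
    have "(\<lambda>t. \<theta> j (?\<gamma> t)) constant_on T"
      by (rule has_field_derivative_0_imp_constant_on[OF z T(3,1)])
    then have "\<exists>c. \<forall>t\<in>T. \<theta> j (?\<gamma> t) = c" by (simp add: constant_on_def)
    then show ?thesis using T(2) t g0 by metis
  qed
  have Fleaf: "eval3 (F z1) (lift 3 (?\<gamma> t)) = 0" if t: "t \<in> T" for t
  proof -
    have "eval3 (F z1) (lift 3 (?\<gamma> t)) = eval3 (F (?\<gamma> t)) (lift 3 (?\<gamma> t))" unfolding Fe using \<theta>const[OF _ t] by simp
    then show ?thesis using Fz[of "?\<gamma> t"] gV[OF t] V3(3) by auto
  qed
  obtain Ps where Ps: "mset Ps = prime_factorization (F z1)" using ex_mset by blast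
  have c\<gamma>: "continuous_on T ?\<gamma>"
    using g1 g2 by (intro continuous_on_Pair continuous_at_imp_continuous_on ballI) (auto dest: DERIV_isCont)
  have dvd: "F z1 dvd prod_list Ps"
  proof -
    have "normalize (prod_mset (prime_factorization (F z1))) = normalize (F z1)" by (rule prod_mset_prime_factorization_weak[OF F0])
    then show ?thesis unfolding Ps[symmetric] prod_mset_prod_list by (metis associatedD2)
  qed
  have evl: "eval3 (prod_list Ps) X = (\<Prod>P\<leftarrow>Ps. eval3 P X)" for X by (induction Ps) auto
  \<comment> \<open>The leaf lies on the curve \<open>F z1 = 0\<close>, hence an arc of it lies on one irreducible component.\<close>
  obtain P T' where P: "P \<in> set Ps" and T': "open T'" "T' \<noteq> {}" "T' \<subseteq> T" and PT: "\<And>t. t \<in> T' \<Longrightarrow> eval3 P (lift 3 (?\<gamma> t)) = 0"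
  proof (rule zero_product_on_open[of T Ps "\<lambda>P t. eval3 P (lift 3 (?\<gamma> t))"])
    show "T \<noteq> {}" using T(2) by blast
    show "continuous_on T (\<lambda>t. eval3 P (lift 3 (?\<gamma> t)))" for P
      by (rule continuous_on_compose2[OF holo2_cont[OF holo2_eval3_lift[OF open_UNIV]] c\<gamma>]) simp
    show "(\<Prod>P\<leftarrow>Ps. eval3 P (lift 3 (?\<gamma> t))) = 0" if "t \<in> T" for t
      using eval3_dvd[OF dvd Fleaf[OF that]] evl by simp
  qed (use T(1) in blast)+
  have PF: "P \<in># prime_factorization (F z1)" using P Ps by (metis set_mset_mset)
  then have Pp: "prime P" and PdF: "P dvd F z1" by auto
  have Pi: "irreducible P" using Pp by (simp add: prime_elem_imp_irreducible prime_imp_prime_elem)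
  obtain k where k: "homogeneous k P" by (rule homogeneous_factor[OF Fh F0 PdF])
  have kn: "k \<le> n"
  proof -
    obtain Q where Q: "F z1 = P * Q" using PdF by blast
    then have "Q dvd F z1" by simp
    then obtain l where "homogeneous l Q" by (rule homogeneous_factor[OF Fh F0])
    then have "homogeneous (k + l) (F z1)" using homogeneous_mult[OF k] Q by simp
    then have "k + l = n" using homogeneous_unique[OF _ Fh F0] by blast
    then show ?thesis by simp
  qed
  have inv: "invariant_curve d v (zero_locus P)"
    unfolding invariant_curve_def tangent_to_web_def[symmetric]
  proof (intro allI impI)
    fix Q C' i assume Q: "irreducible_equation Q C' \<and> C' \<subseteq> zero_locus P"
    then obtain l where Qi: "irreducible Q" "homogeneous l Q" "zero_locus Q \<subseteq> zero_locus P"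
      unfolding irreducible_equation_def by blast
    have "Q dvd P"
      by (rule nullstellensatz_projective[OF irreducible_prime3[OF Qi(1)]])
         (use zero_locus_subset_iff[OF Qi(2) k] Qi(3) in blast)
    then have PQ: "P dvd Q" using Pi Qi(1) by (meson irreducibleD' irreducible_not_unit)
    show "finite {z. eval3 Q (lift i z) = 0 \<and> \<not> tangent_to_web d v Q i z}"
    proof (rule irreducible_curve_through_arc[OF d v iso Qi(1,2) T'(1,2), of \<gamma>1 \<gamma>1' \<gamma>2 \<gamma>2'])
      fix t assume t: "t \<in> T'"
      then have tT: "t \<in> T" using T' by blast
      show "(\<gamma>1 has_field_derivative \<gamma>1' t) (at t)" "(\<gamma>2 has_field_derivative \<gamma>2' t) (at t)" using g1 g2 tT by blast+
      show "eval3 Q (lift 3 (?\<gamma> t)) = 0" by (rule eval3_dvd[OF PQ PT[OF t]])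
      fix \<omega> assume \<omega>: "pairing (\<gamma>1' t, \<gamma>2' t) \<omega> = 0"
      have "pairing (u (?\<gamma> t)) \<omega> = 0"
      proof -
        let ?p = "fst (u (?\<gamma> t))" and ?q = "snd (u (?\<gamma> t))"
        have w0: "\<gamma>1' t * fst \<omega> + \<gamma>2' t * snd \<omega> = 0" using \<omega> by (simp add: pairing_def)
        have "\<gamma>1' t * (?p * fst \<omega> + ?q * snd \<omega>) = ?p * (\<gamma>1' t * fst \<omega> + \<gamma>2' t * snd \<omega>) - snd \<omega> * (?p * \<gamma>2' t - ?q * \<gamma>1' t)"
          "\<gamma>2' t * (?p * fst \<omega> + ?q * snd \<omega>) = ?q * (\<gamma>1' t * fst \<omega> + \<gamma>2' t * snd \<omega>) + fst \<omega> * (?p * \<gamma>2' t - ?q * \<gamma>1' t)"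
          by (simp_all add: algebra_simps)
        then have "\<gamma>1' t * (?p * fst \<omega> + ?q * snd \<omega>) = 0" "\<gamma>2' t * (?p * fst \<omega> + ?q * snd \<omega>) = 0"
          unfolding w0 par[OF tT] by simp_all
        moreover have "\<gamma>1' t \<noteq> 0 \<or> \<gamma>2' t \<noteq> 0" using gV[OF tT] by (auto simp: zero_prod_def)
        ultimately show ?thesis by (auto simp: pairing_def)
      qed
      moreover have "?\<gamma> t \<in> V" using gV[OF tT] V3(3) V1(3) V0(3) by blast
      ultimately show "bform d (v 3 (?\<gamma> t)) \<omega> = 0" by (intro bzero)
    next
      show "inj_on ?\<gamma> T'" by (rule inj_on_subset[OF ginj T'(3)])
    qed
  qed
  have "curve_of_degree k (zero_locus P)" by (rule curve_degree_irreducible(2)[OF Pi k])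
  then have PC: "zero_locus P \<in> ?\<C>" using kn inv by blast
  obtain t where t: "t \<in> T'" using T'(2) by blast
  then have tT: "t \<in> T" using T'(3) by blast
  let ?X = "lift 3 (?\<gamma> t)"
  have "?X $ 3 = 1" by simp
  then have X0: "?X \<noteq> 0" by (metis zero_index zero_neq_one)
  have GP: "homogeneous (deg (zero_locus P)) (G (zero_locus P))" "zero_locus P = zero_locus (G (zero_locus P))"
    using G[OF PC] by blast+
  have "proj_point ?X \<in> zero_locus P" using proj_point_in_zero_locus[OF k X0] PT[OF t] by blast
  then have "eval3 (G (zero_locus P)) ?X = 0" using proj_point_in_zero_locus[OF GP(1) X0] GP(2) by blast
  moreover have "G (zero_locus P) dvd \<Psi>" unfolding \<Psi>_def by (rule dvd_prodI[OF fin PC])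
  ultimately have "eval3 \<Psi> ?X = 0" using eval3_dvd by blast
  then show False using gV[OF tT] by (auto simp: V3_def)
qed

text \<open>The three summands of \<open>ext_degree\<close> with \<open>m = r - d\<close>, rewritten in terms of \<open>n\<close>.\<close>

lemma extactic_degree_arithmetic:
  fixes n d r k :: real
  assumes k: "k = n * (n + 3) / 2"
  shows "n * (k + 1) * d + (r - d) * ((k + 1) * k / 2)
      + (3 * (d * (d - 1)) + 2 * (r - d) * (d - 1)) * (k * (k - 1) / 2)
    = n / 8 * ((n + 1) * (n + 2) * (4 * d + (n + 3) * (r - d))
      + (n + 3) * (n\<^sup>2 + 3 * n - 2) * (d - 1) * (d + 2 * r))"
proof -
  define m where "m = 2 * k"
  have m: "m = n * (n + 3)" using k m_def by simp
  have "8 * (n * (k + 1) * d + (r - d) * ((k + 1) * k / 2)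
      + (3 * (d * (d - 1)) + 2 * (r - d) * (d - 1)) * (k * (k - 1) / 2))
    = 4 * n * (m + 2) * d + (r - d) * (m + 2) * m + (d - 1) * (d + 2 * r) * (m * (m - 2))"
    unfolding m_def by (simp add: field_simps)
  moreover have "4 * n * (m + 2) * d + (r - d) * (m + 2) * m + (d - 1) * (d + 2 * r) * (m * (m - 2))
    = n * ((n + 1) * (n + 2) * (4 * d + (n + 3) * (r - d))
      + (n + 3) * (n\<^sup>2 + 3 * n - 2) * (d - 1) * (d + 2 * r))"
  proof -
    have "m + 2 = (n + 1) * (n + 2)" "m - 2 = n\<^sup>2 + 3 * n - 2" by (simp_all add: m power2_eq_square algebra_simps)
    moreover have "4 * n * A * d + (r - d) * A * (n * B) + (d - 1) * (d + 2 * r) * (n * B * q)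
      = n * (A * (4 * d + B * (r - d)) + B * q * (d - 1) * (d + 2 * r))" for A B q
      by (simp add: algebra_simps)
    ultimately show ?thesis unfolding m by metis
  qed
  ultimately show ?thesis by simp
qed

theorem theorem1:
  fixes n d r :: nat and v :: sym_tensor
  assumes "n \<ge> 1" and "d \<ge> 1" and "web d r v"
    and "finite {C. (\<exists>m\<le>n. curve_of_degree m C) \<and> invariant_curve d v C}"
  shows "(\<exists>i z. nth_extactic_section n d v i z \<noteq> 0) \<and>
    real (divisor_degree (nth_extactic_divisor n d v)) =
      real n / 8 *
        ((real n + 1) * (real n + 2) * (4 * real d + (real n + 3) * (real r - real d))
         + (real n + 3) * ((real n)\<^sup>2 + 3 * real n - 2) * (real d - 1) * (real d + 2 * real r))"
proof
  show nz: "\<exists>i z. nth_extactic_section n d v i z \<noteq> 0" by (rule extactic_nonzero[OF assms(2-4)])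
  let ?m = "int r - int d" and ?E = "nth_extactic_section n d v"
  have v: "sym_section d ?m v" and disc: "\<exists>i z. bdisc d (v i z) \<noteq> 0" using assms(3) by (auto simp: web_def)
  let ?D = "ext_degree d ?m n"
  obtain i0 z0 where i0: "?E i0 z0 \<noteq> 0" using nz by blast
  obtain F where F: "?D \<ge> 0" "homogeneous (nat ?D) F" "F \<noteq> 0" "\<And>i z. ?E i z = eval3 F (lift i z)"
  proof (rule section_is_homogeneous[of ?E ?D i0 z0])
    show "holo2 (?E i) UNIV" for i by (rule holo2_extactic[OF assms(2) v disc])
    show "?E 3 z = (lift 3 z $ j) powi ?D * ?E j (trans_map 3 j z)" if "j \<noteq> 3" "z \<in> chart_dom 3 j" for j z
      by (rule extactic_trans[OF assms(2) v disc that(1)[symmetric] that(2)])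
  qed (use i0 in blast)+
  have "divisor_degree (nth_extactic_divisor n d v) = nat ?D"
    unfolding nth_extactic_divisor_def by (rule divisor_degree_homogeneous[OF F(2,3,4)])
  then have "real (divisor_degree (nth_extactic_divisor n d v)) = of_int ?D" using F(1) by simp
  also have "\<dots> = real n / 8 *
        ((real n + 1) * (real n + 2) * (4 * real d + (real n + 3) * (real r - real d))
         + (real n + 3) * ((real n)\<^sup>2 + 3 * real n - 2) * (real d - 1) * (real d + 2 * real r))"
  proof -
    define k where "k = n * (n + 3) div 2"
    have "even (n * (n + 3))" by simp
    then have k2: "real k = real n * (real n + 3) / 2" unfolding k_def by (simp add: real_of_nat_div)
    have k1: "k \<ge> 1" using assms(1) unfolding k_def by (cases n) auto
    have a: "real (Suc k * k div 2) = (real k + 1) * real k / 2" by (simp add: real_of_nat_div algebra_simps)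
    have "even (k * (k - 1))" by (cases k) auto
    then have b: "real (k * (k - 1) div 2) = real k * (real k - 1) / 2" using k1 by (simp add: real_of_nat_div of_nat_diff)
    have "of_int ?D = real (n * Suc k * d) + (real r - real d) * real (Suc k * k div 2)
       + (3 * (real d * (real d - 1)) + 2 * (real r - real d) * (real d - 1)) * real (k * (k - 1) div 2)"
      unfolding ext_degree_def[OF assms(2) v disc] Let_def k_def[symmetric] by simp
    also have "\<dots> = real n * (real k + 1) * real d + (real r - real d) * ((real k + 1) * real k / 2)
       + (3 * (real d * (real d - 1)) + 2 * (real r - real d) * (real d - 1)) * (real k * (real k - 1) / 2)"
      unfolding a b by (simp add: algebra_simps)
    also have "\<dots> = real n / 8 *
        ((real n + 1) * (real n + 2) * (4 * real d + (real n + 3) * (real r - real d))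
         + (real n + 3) * ((real n)\<^sup>2 + 3 * real n - 2) * (real d - 1) * (real d + 2 * real r))"
      by (rule extactic_degree_arithmetic[OF k2])
    finally show ?thesis .
  qed
  finally show "real (divisor_degree (nth_extactic_divisor n d v)) = real n / 8 *
        ((real n + 1) * (real n + 2) * (4 * real d + (real n + 3) * (real r - real d))
         + (real n + 3) * ((real n)\<^sup>2 + 3 * real n - 2) * (real d - 1) * (real d + 2 * real r))" .
qed

end
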